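(* Every finitary Lie algebra has a Levi component.
   Context: Ground field $\mathbb C$; all Lie algebras are of at most countable dimension. A Lie algebra is locally finite if every finite subset lies in a finite-dimensional subalgebra. A representation $W$ of a locally finite Lie algebra is finitary if $W$ has a basis in which every element acts by a finite matrix (finitely many nonzero entries); a locally finite Lie algebra is finitary if it has a faithful finitary representation (equivalently, it is isomorphic to a subalgebra of $\mathfrak{gl}_\infty=\mathfrak{gl}(V,V_* )$). The locally solvable radical $\mathfrak r$ of a locally finite Lie algebra $\mathfrak g$ is its largest locally solvable ideal (locally solvable: every finite subset lies in a solvable finite-dimensional subalgebra). A subalgebra $\mathfrak l\subset\mathfrak g$ is a Levi component of $\mathfrak g$ if $[\mathfrak g,\mathfrak g]=(\mathfrak r\cap[\mathfrak g,\mathfrak g])\rtimes\mathfrak l$, i.e. $[\mathfrak g,\mathfrak g]$ is the vector space direct sum of the ideal $\mathfrak r\cap[\mathfrak g,\mathfrak g]$ and the subalgebra $\mathfrak l$. *)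

theory Defs
  imports Complex_Main "HOL-Library.Countable_Set"
begin

definition lie_algebra :: "(complex \<Rightarrow> 'g::ab_group_add \<Rightarrow> 'g) \<Rightarrow> ('g \<Rightarrow> 'g \<Rightarrow> 'g) \<Rightarrow> bool" where
  "lie_algebra sc br \<longleftrightarrow> vector_space sc
     \<and> (\<forall>a x y z. br (sc a x + y) z = sc a (br x z) + br y z)
     \<and> (\<forall>a x y z. br z (sc a x + y) = sc a (br z x) + br z y)
     \<and> (\<forall>x. br x x = 0)
     \<and> (\<forall>x y z. br x (br y z) + br y (br z x) + br z (br x y) = 0)"

definition countable_dim :: "(complex \<Rightarrow> 'g::ab_group_add \<Rightarrow> 'g) \<Rightarrow> bool" where
  "countable_dim sc \<longleftrightarrow> (\<exists>B. countable B \<and> \<not> module.dependent sc B \<and> module.span sc B = UNIV)"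

definition lie_subalgebra :: "(complex \<Rightarrow> 'g::ab_group_add \<Rightarrow> 'g) \<Rightarrow> ('g \<Rightarrow> 'g \<Rightarrow> 'g) \<Rightarrow> 'g set \<Rightarrow> bool" where
  "lie_subalgebra sc br S \<longleftrightarrow> module.subspace sc S \<and> (\<forall>x\<in>S. \<forall>y\<in>S. br x y \<in> S)"

definition lie_ideal :: "(complex \<Rightarrow> 'g::ab_group_add \<Rightarrow> 'g) \<Rightarrow> ('g \<Rightarrow> 'g \<Rightarrow> 'g) \<Rightarrow> 'g set \<Rightarrow> bool" where
  "lie_ideal sc br I \<longleftrightarrow> module.subspace sc I \<and> (\<forall>x. \<forall>y\<in>I. br x y \<in> I)"

definition bracket_span :: "(complex \<Rightarrow> 'g::ab_group_add \<Rightarrow> 'g) \<Rightarrow> ('g \<Rightarrow> 'g \<Rightarrow> 'g) \<Rightarrow> 'g set \<Rightarrow> 'g set \<Rightarrow> 'g set" where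
  "bracket_span sc br A B = module.span sc {br a b | a b. a \<in> A \<and> b \<in> B}"

primrec derived_series :: "(complex \<Rightarrow> 'g::ab_group_add \<Rightarrow> 'g) \<Rightarrow> ('g \<Rightarrow> 'g \<Rightarrow> 'g) \<Rightarrow> 'g set \<Rightarrow> nat \<Rightarrow> 'g set" where
  "derived_series sc br S 0 = S"
| "derived_series sc br S (Suc n) = bracket_span sc br (derived_series sc br S n) (derived_series sc br S n)"

definition solvable_lie :: "(complex \<Rightarrow> 'g::ab_group_add \<Rightarrow> 'g) \<Rightarrow> ('g \<Rightarrow> 'g \<Rightarrow> 'g) \<Rightarrow> 'g set \<Rightarrow> bool" where
  "solvable_lie sc br S \<longleftrightarrow> (\<exists>n. derived_series sc br S n = {0})"

definition fin_dim :: "(complex \<Rightarrow> 'g::ab_group_add \<Rightarrow> 'g) \<Rightarrow> 'g set \<Rightarrow> bool" where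
  "fin_dim sc S \<longleftrightarrow> (\<exists>B. finite B \<and> module.span sc B = S)"

definition locally_finite_lie :: "(complex \<Rightarrow> 'g::ab_group_add \<Rightarrow> 'g) \<Rightarrow> ('g \<Rightarrow> 'g \<Rightarrow> 'g) \<Rightarrow> bool" where
  "locally_finite_lie sc br \<longleftrightarrow>
     (\<forall>F. finite F \<longrightarrow> (\<exists>S. lie_subalgebra sc br S \<and> fin_dim sc S \<and> F \<subseteq> S))"

definition locally_solvable :: "(complex \<Rightarrow> 'g::ab_group_add \<Rightarrow> 'g) \<Rightarrow> ('g \<Rightarrow> 'g \<Rightarrow> 'g) \<Rightarrow> 'g set \<Rightarrow> bool" where
  "locally_solvable sc br A \<longleftrightarrow>
     (\<forall>F. finite F \<and> F \<subseteq> A \<longrightarrow>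
        (\<exists>S. lie_subalgebra sc br S \<and> S \<subseteq> A \<and> fin_dim sc S \<and> solvable_lie sc br S \<and> F \<subseteq> S))"

definition locally_solvable_radical :: "(complex \<Rightarrow> 'g::ab_group_add \<Rightarrow> 'g) \<Rightarrow> ('g \<Rightarrow> 'g \<Rightarrow> 'g) \<Rightarrow> 'g set \<Rightarrow> bool" where
  "locally_solvable_radical sc br r \<longleftrightarrow>
     lie_ideal sc br r \<and> locally_solvable sc br r \<and>
     (\<forall>I. lie_ideal sc br I \<and> locally_solvable sc br I \<longrightarrow> I \<subseteq> r)"

definition levi_component :: "(complex \<Rightarrow> 'g::ab_group_add \<Rightarrow> 'g) \<Rightarrow> ('g \<Rightarrow> 'g \<Rightarrow> 'g) \<Rightarrow> 'g set \<Rightarrow> bool" where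
  "levi_component sc br l \<longleftrightarrow> lie_subalgebra sc br l \<and>
     (\<exists>r. locally_solvable_radical sc br r \<and>
        (let D = bracket_span sc br UNIV UNIV in
           l \<subseteq> D \<and> D = {a + b | a b. a \<in> r \<inter> D \<and> b \<in> l} \<and> (r \<inter> D) \<inter> l = {0}))"

definition finite_matrix :: "(nat \<Rightarrow> nat \<Rightarrow> complex) \<Rightarrow> bool" where
  "finite_matrix A \<longleftrightarrow> finite {(i, j). A i j \<noteq> 0}"

definition mat_mult :: "(nat \<Rightarrow> nat \<Rightarrow> complex) \<Rightarrow> (nat \<Rightarrow> nat \<Rightarrow> complex) \<Rightarrow> (nat \<Rightarrow> nat \<Rightarrow> complex)" where
  "mat_mult A B = (\<lambda>i k. \<Sum>j\<in>{j. A i j \<noteq> 0}. A i j * B j k)"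

text \<open>Finitary: there is a faithful representation on a space with a countable basis
(indexed by nat) in which every element acts by a finite matrix.\<close>
definition finitary_lie :: "(complex \<Rightarrow> 'g::ab_group_add \<Rightarrow> 'g) \<Rightarrow> ('g \<Rightarrow> 'g \<Rightarrow> 'g) \<Rightarrow> bool" where
  "finitary_lie sc br \<longleftrightarrow>
     (\<exists>\<rho> :: 'g \<Rightarrow> nat \<Rightarrow> nat \<Rightarrow> complex.
        (\<forall>x. finite_matrix (\<rho> x)) \<and> inj \<rho> \<and>
        (\<forall>a x y. \<rho> (sc a x + y) = (\<lambda>i j. a * \<rho> x i j + \<rho> y i j)) \<and>
        (\<forall>x y. \<rho> (br x y) = (\<lambda>i j. mat_mult (\<rho> x) (\<rho> y) i j - mat_mult (\<rho> y) (\<rho> x) i j)))"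

end

theory Submission
  imports Defs "HOL-Computational_Algebra.Computational_Algebra"
    "HOL-Computational_Algebra.Field_as_Ring" "HOL-Library.Function_Algebras"
begin

text \<open>Realize the Lie algebra as a Lie algebra \<open>g\<close> of finite rank operators, put \<open>D = [g, g]\<close> and let \<open>N\<close> be the
radical of the trace form \<open>tr (x * y)\<close> on \<open>D\<close>. By Cartan's criterion, and because a solvable ideal of a
finite-dimensional \<open>h\<close> is orthogonal to \<open>[h, h]\<close>, the locally solvable radical is \<open>{x. [x, g] \<subseteq> N}\<close>, and it meets
\<open>D\<close> in \<open>N\<close>; so \<open>N\<close> has to be complemented in \<open>D\<close>. In finite dimensions a semisimple subalgebra extends to a
Levi subalgebra. Hence it suffices that every finite subset of \<open>D\<close> lies in a subalgebra \<open>h\<close> that contains \<open>N\<close>,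
is finite-dimensional and perfect modulo \<open>N\<close>, and whose trace form has radical \<open>N\<close>: Levi subalgebras of an
increasing sequence of such \<open>h\<close> can be chosen increasing, and their union is the complement.

For a finite set, finitely many irreducible subquotients of the module matter, and they are dealt with one
by one. If an ideal \<open>J\<close> acts on an irreducible subquotient \<open>W\<close> by an infinite-dimensional algebra, then the
associative algebra generated by \<open>g\<close> contains operators \<open>v \<otimes> f\<close> of rank one, and commutators with elements of \<open>J\<close>
that live far away from a given finite set show that \<open>J\<close> itself contains all \<open>v \<otimes> f\<close> with \<open>f v = 0\<close>, or, when
\<open>W\<close> carries an invariant form, all \<open>v \<otimes> w \<mp> w \<otimes> v\<close> with \<open>v\<close> orthogonal to \<open>w\<close>. The elements of \<open>J\<close> that are
supported on a large finite-dimensional subspace therefore form a perfect algebra with nondegenerate trace form.\<close>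

section \<open>Complex vector spaces and their endomorphism rings\<close>

text \<open>Everything rests on the trace form of the given module, for which Cartan's criterion,
  the Casimir argument and Levi's theorem are proved. Levi subalgebras of arbitrary
  finite-dimensional subalgebras cannot be glued: the radical of such a subalgebra need not lie in
  \<open>N\<close>, and then its Levi subalgebra can miss elements that the complement must contain.
  Requiring that the trace form of \<open>h\<close> has radical exactly \<open>N\<close> removes
  this obstacle. As \<open>N\<close> may be infinite-dimensional, Levi's theorem is applied to a
  finite-dimensional part of \<open>h\<close> that spans \<open>h\<close> together with
  \<open>N\<close>. Quotients are never formed: statements about \<open>h / N\<close> are
  congruences modulo \<open>N\<close>, and modules are represented by projections in one operator
  ring. The simple algebras are not classified either; it only matters whether an irreducible module
  has an invariant form, that is, whether \<open>x \<mapsto> - x\<close> extends to an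
  anti-involution of the associative algebra, and infinite dimension leaves room for all
  constructions.\<close>

class cvec = ab_group_add +
 fixes scC :: "complex => 'a => 'a"  (infixr "*\<^sub>C" 75)
 assumes scC_add_right: "a *\<^sub>C (x + y) = a *\<^sub>C x + a *\<^sub>C y"
  and scC_add_left: "(a + b) *\<^sub>C x = a *\<^sub>C x + b *\<^sub>C x"
  and scC_scC: "a *\<^sub>C b *\<^sub>C x = (a * b) *\<^sub>C x"
  and scC_one: "1 *\<^sub>C x = x"

global_interpretation cv: vector_space "scC :: complex => 'a::cvec => 'a"
 by standard (auto simp: scC_add_right scC_add_left scC_scC scC_one)

global_interpretation cvp: vector_space_pair
 "scC :: complex => 'a::cvec => 'a" "scC :: complex => 'b::cvec => 'b"
 by standard

abbreviation clinear :: "('a::cvec => 'b::cvec) => bool"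
 where "clinear \<equiv> Vector_Spaces.linear scC scC"

lemma clinearI:
 assumes "\<And>x y. f (x + y) = f x + f y" "\<And>c x. f (c *\<^sub>C x) = c *\<^sub>C f x"
 shows "clinear f"
 using assms by (simp add: Vector_Spaces.linear_iff cv.vector_space_axioms)

lemma clinear_add: "clinear f ==> f (x + y) = f x + f y"
 and clinear_scC: "clinear f ==> f (c *\<^sub>C x) = c *\<^sub>C f x"
 by (simp_all add: Vector_Spaces.linear_iff)

lemma clinear_0: "clinear f ==> f 0 = 0"
 using clinear_scC[of f 0 0] by simp

lemma clinear_neg: "clinear f ==> f (- x) = - f x"
 using clinear_scC[of f "-1" x] by simp

lemma clinear_diff: "clinear f ==> f (x - y) = f x - f y"
 using clinear_add[of f x "- y"] by (simp add: clinear_neg)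

lemma clinear_sum: "clinear f ==> f (sum g A) = (\<Sum>x\<in>A. f (g x))"
 by (induction A rule: infinite_finite_induct) (auto simp: clinear_0 clinear_add)

lemmas clinear_rules = clinear_0 clinear_add clinear_scC
lemmas subspace_rules = cv.subspace_0 cv.subspace_add cv.subspace_scale
lemmas span_rules = cv.span_zero cv.span_add cv.span_scale

lemma subspace_sum_set:
 assumes "cv.subspace A" "cv.subspace B" shows "cv.subspace {x. \<exists>a\<in>A. x - a \<in> B}"
proof -
 have "{x. \<exists>a\<in>A. x - a \<in> B} = {a + b | a b. a \<in> A \<and> b \<in> B}"
 proof (intro set_eqI iffI)
  fix x assume "x \<in> {x. \<exists>a\<in>A. x - a \<in> B}"
  then obtain a where "a \<in> A" "x - a \<in> B" "x = a + (x - a)" by auto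
  then show "x \<in> {a + b | a b. a \<in> A \<and> b \<in> B}" by blast
 next
  fix x assume "x \<in> {a + b | a b. a \<in> A \<and> b \<in> B}"
  then obtain a b where "a \<in> A" "b \<in> B" "x = a + b" by blast
  then show "x \<in> {x. \<exists>a\<in>A. x - a \<in> B}" by (intro CollectI bexI[of _ a]) simp_all
 qed
 then show ?thesis using cv.subspace_sums[OF assms] by simp
qed

instantiation complex :: cvec
begin
definition scC_complex :: "complex => complex => complex" where [simp]: "scC_complex a x = a * x"
instance by standard (auto simp: algebra_simps)
end

instantiation "fun" :: (type, cvec) cvec
begin
definition scC_fun :: "complex => ('a => 'b) => 'a => 'b" where "scC_fun a f = (\<lambda>x. a *\<^sub>C f x)"
instance by standard (auto simp: scC_fun_def fun_eq_iff scC_add_right scC_add_left scC_scC scC_one)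
end

text \<open>A type constructor from complex vector spaces to complex vector spaces can be iterated:
  operators, the operators \<open>ad x\<close> on them, and the operators \<open>actm prj x\<close>
  on linear maps between operators all obey the same lemmas.\<close>

typedef (overloaded) 'v endo = "{f :: 'v::cvec => 'v. clinear f}"
 morphisms app Abs_endo
 by (rule exI[of _ "\<lambda>x. 0"]) (auto intro!: clinearI)

setup_lifting type_definition_endo

notation app (infixr "\<cdot>" 76)

lemma clinear_app: "clinear (app T)"
 using app[of T] by simp

lemma endo_eqI: "(\<And>x. S \<cdot> x = T \<cdot> x) ==> S = T"
 by (metis app_inject ext)

instantiation endo :: (cvec) "{ring, monoid_mult, cvec}"
begin
lift_definition zero_endo :: "'a endo" is "\<lambda>x. 0" by (auto intro: clinearI)
lift_definition one_endo :: "'a endo" is "\<lambda>x. x" by (auto intro: clinearI)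
lift_definition plus_endo :: "'a endo => 'a endo => 'a endo" is "\<lambda>f g x. f x + g x"
 by (auto intro!: clinearI simp: clinear_add clinear_scC cv.scale_right_distrib)
lift_definition minus_endo :: "'a endo => 'a endo => 'a endo" is "\<lambda>f g x. f x - g x"
 by (auto intro!: clinearI simp: clinear_add clinear_scC cv.scale_right_diff_distrib)
lift_definition uminus_endo :: "'a endo => 'a endo" is "\<lambda>f x. - f x"
 by (auto intro!: clinearI simp: clinear_add clinear_scC)
lift_definition times_endo :: "'a endo => 'a endo => 'a endo" is "\<lambda>f g x. f (g x)"
 by (auto intro!: clinearI simp: clinear_add clinear_scC)
lift_definition scC_endo :: "complex => 'a endo => 'a endo" is "\<lambda>a f x. a *\<^sub>C f x"
 by (auto intro!: clinearI simp: clinear_add clinear_scC cv.scale_right_distrib cv.scale_left_commute)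
instance
 by standard
  (transfer; auto simp: fun_eq_iff add_ac clinear_add clinear_diff
   scC_add_right scC_add_left scC_scC scC_one)+
end

lemma app_simps [simp]:
 "(0 :: 'a::cvec endo) \<cdot> x = 0" "(1 :: 'a endo) \<cdot> x = x"
 "(S + T) \<cdot> x = S \<cdot> x + T \<cdot> x" "(S - T) \<cdot> x = S \<cdot> x - T \<cdot> x" "(- S) \<cdot> x = - (S \<cdot> x)"
 "(S * T) \<cdot> x = S \<cdot> T \<cdot> x" "(c *\<^sub>C S) \<cdot> x = c *\<^sub>C (S \<cdot> x)"
 by (transfer; simp)+

lemma app_lin [simp]:
 "T \<cdot> (0 :: 'a::cvec) = 0" "T \<cdot> (x + y) = T \<cdot> x + T \<cdot> y" "T \<cdot> (x - y) = T \<cdot> x - T \<cdot> y"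
 "T \<cdot> (- x) = - (T \<cdot> x)" "T \<cdot> (c *\<^sub>C x) = c *\<^sub>C (T \<cdot> x)"
 using clinear_app[of T]
 by (auto simp: clinear_0 clinear_add clinear_diff clinear_neg clinear_scC)

lemma app_sum: "T \<cdot> (\<Sum>i\<in>A. f i) = (\<Sum>i\<in>A. T \<cdot> f i)"
 by (simp add: clinear_sum clinear_app)

lemma sum_app: "(\<Sum>i\<in>A. f i) \<cdot> x = (\<Sum>i\<in>A. f i \<cdot> x)"
 by (induction A rule: infinite_finite_induct) auto

lemma scC_mult_left [simp]: "(c *\<^sub>C S) * T = c *\<^sub>C (S * (T :: 'a::cvec endo))"
 and scC_mult_right [simp]: "S * (c *\<^sub>C T) = c *\<^sub>C (S * (T :: 'a::cvec endo))"
 by (auto intro!: endo_eqI)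

lift_definition endo_of :: "('v::cvec => 'v) => 'v endo" is "\<lambda>f. if clinear f then f else (\<lambda>x. 0)"
 by (auto intro: clinearI)

lemma app_endo_of [simp]: "clinear f ==> endo_of f \<cdot> x = f x"
 by transfer simp

section \<open>Finite-dimensional subsets and subspaces of finite codimension\<close>

text \<open>Meant for arbitrary sets, not only for subspaces, so that images, ranges and corners can
  be bounded without first being closed under addition.\<close>

definition fd :: "'a::cvec set => bool" where "fd S \<longleftrightarrow> (\<exists>B. finite B \<and> S \<subseteq> cv.span B)"

lemma fd_subset: "fd T ==> S \<subseteq> T ==> fd S"
 unfolding fd_def by blast

lemma fd_span: "finite B ==> fd (cv.span B)"
 unfolding fd_def by blast

lemma fd_span_iff [simp]: "fd (cv.span S) \<longleftrightarrow> fd S"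
proof
 show "fd S" if "fd (cv.span S)" using fd_subset[OF that cv.span_superset] .
 show "fd (cv.span S)" if "fd S"
  using that cv.span_minimal[OF _ cv.subspace_span] unfolding fd_def by blast
qed

lemma fd_finite: "finite B ==> fd B"
 unfolding fd_def using cv.span_superset by blast

lemma fd_Un: "fd S ==> fd T ==> fd (S \<union> T)"
proof -
 assume "fd S" "fd T"
 then obtain A B where "finite A" "S \<subseteq> cv.span A" "finite B" "T \<subseteq> cv.span B" unfolding fd_def by auto
 moreover have "cv.span A \<subseteq> cv.span (A \<union> B)" "cv.span B \<subseteq> cv.span (A \<union> B)" by (auto intro: cv.span_mono[THEN subsetD])
 ultimately show "fd (S \<union> T)" unfolding fd_def by (intro exI[of _ "A \<union> B"]) auto
qed

lemma fd_UN: "finite I ==> (\<And>i. i \<in> I ==> fd (S i)) ==> fd (\<Union>i\<in>I. S i)"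
 by (induction I rule: finite_induct) (auto intro: fd_Un fd_finite)

lemma fd_image: "clinear f ==> fd S ==> fd (f ` S)"
proof -
 assume f: "clinear f" and "fd S"
 then obtain A where "finite A" "S \<subseteq> cv.span A" unfolding fd_def by auto
 then have "finite (f ` A)" "f ` S \<subseteq> f ` cv.span A" by blast+
 then show ?thesis unfolding fd_def cvp.linear_span_image[OF f, symmetric] by blast
qed

lemma fd_basis:
 assumes "cv.subspace S" "fd S"
 obtains B where "finite B" "B \<subseteq> S" "\<not> cv.dependent B" "cv.span B = S" "card B = cv.dim S"
proof -
 obtain B where B: "B \<subseteq> S" "\<not> cv.dependent B" "S \<subseteq> cv.span B" "card B = cv.dim S"
  using cv.basis_exists[of S] by blast
 obtain A where A: "finite A" "S \<subseteq> cv.span A" using assms(2) unfolding fd_def by auto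
 have "finite B" using cv.independent_span_bound[OF A(1) B(2)] A(2) B(1) by blast
 moreover have "cv.span B = S" using B assms(1) by (simp add: cv.span_subspace)
 ultimately show ?thesis using that B by auto
qed

lemma fd_dim_mono:
 assumes "fd T" "S \<subseteq> T" shows "cv.dim S \<le> cv.dim T"
proof -
 have "fd (cv.span T)" using assms(1) by simp
 then obtain B where B: "finite B" "cv.span B = cv.span T" "card B = cv.dim (cv.span T)"
  using fd_basis[OF cv.subspace_span] by metis
 have "S \<subseteq> cv.span B" unfolding B(2) using assms(2) cv.span_superset by (rule subset_trans)
 then have "cv.dim S \<le> card B" using B(1) by (rule cv.dim_le_card)
 then show ?thesis unfolding B(3) cv.dim_span .
qed

lemma fd_dim_eq:
 assumes "fd T" "S \<subseteq> T" "cv.subspace S" "cv.subspace T" "cv.dim T \<le> cv.dim S" shows "S = T"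
proof (rule ccontr)
 assume "S \<noteq> T"
 then obtain t where t: "t \<in> T" "t \<notin> S" using assms(2) by blast
 obtain B where B: "finite B" "B \<subseteq> S" "\<not> cv.dependent B" "cv.span B = S" "card B = cv.dim S"
  using fd_basis[OF assms(3) fd_subset[OF assms(1,2)]] .
 have i: "\<not> cv.dependent (insert t B)" using B(3) t(2) B(4) by (intro cv.independent_insertI) simp_all
 obtain C where C: "finite C" "C \<subseteq> T" "\<not> cv.dependent C" "cv.span C = T" "card C = cv.dim T"
  using fd_basis[OF assms(4,1)] .
 have "insert t B \<subseteq> cv.span C" unfolding C(4) using t(1) B(2) assms(2) by blast
 from cv.independent_span_bound[OF C(1) i this] have "card (insert t B) \<le> card C" by simp
 moreover have "t \<notin> B" using t(2) B(2) by blast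
 ultimately show False using B(1,5) C(5) assms(5) by simp
qed

lemma fd_dim_less:
 assumes "fd T" "S \<subset> T" "cv.subspace S" "cv.subspace T" shows "cv.dim S < cv.dim T"
proof (rule ccontr)
 assume "\<not> cv.dim S < cv.dim T"
 then have "S = T" using assms(2) by (intro fd_dim_eq[OF assms(1) _ assms(3,4)]) auto
 then show False using assms(2) by simp
qed

lemma projection_exists:
 assumes S: "cv.subspace S" and Q: "cv.subspace Q" and SQ: "S \<inter> Q \<subseteq> {0}"
 obtains p :: "'v::cvec endo" where "\<And>x. p \<cdot> x \<in> S" "\<And>x. x \<in> S ==> p \<cdot> x = x" "\<And>x. x \<in> Q ==> p \<cdot> x = 0"
proof -
 obtain A where A: "A \<subseteq> Q" "\<not> cv.dependent A" "Q \<subseteq> cv.span A" "card A = cv.dim Q"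
  by (rule cv.basis_exists)
 have sA: "cv.span A = Q" using A(1,3) Q by (rule cv.span_subspace)
 obtain B where B: "B \<subseteq> S" "\<not> cv.dependent B" "S \<subseteq> cv.span B" "card B = cv.dim S"
  by (rule cv.basis_exists)
 have sB: "cv.span B = S" using B(1,3) S by (rule cv.span_subspace)
 have disj: "A \<inter> B = {}"
 proof -
  have "0 \<notin> A" using A cv.dependent_zero by blast
  then show ?thesis using A(1) B(1) SQ by blast
 qed
 have ind: "\<not> cv.dependent (A \<union> B)"
 proof
  assume "cv.dependent (A \<union> B)"
  then obtain t u where t: "finite t" "t \<subseteq> A \<union> B" "(\<Sum>v\<in>t. u v *\<^sub>C v) = 0" "\<exists>v\<in>t. u v \<noteq> 0"
   unfolding cv.dependent_explicit by blast
  have "(\<Sum>v\<in>(t \<inter> A) \<union> (t \<inter> B). u v *\<^sub>C v)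
    = (\<Sum>v\<in>t\<inter>A. u v *\<^sub>C v) + (\<Sum>v\<in>t\<inter>B. u v *\<^sub>C v)"
   by (rule sum.union_disjoint) (use t(1) disj in auto)
  moreover have "(t \<inter> A) \<union> (t \<inter> B) = t" using t(2) by auto
  ultimately have "(\<Sum>v\<in>t. u v *\<^sub>C v) = (\<Sum>v\<in>t\<inter>A. u v *\<^sub>C v) + (\<Sum>v\<in>t\<inter>B. u v *\<^sub>C v)"
   by simp
  then have e: "(\<Sum>v\<in>t\<inter>A. u v *\<^sub>C v) = - (\<Sum>v\<in>t\<inter>B. u v *\<^sub>C v)"
   using t(3) by (simp add: eq_neg_iff_add_eq_0)
  have a: "(\<Sum>v\<in>t\<inter>A. u v *\<^sub>C v) \<in> Q"
   by (intro cv.subspace_sum[OF Q] cv.subspace_scale[OF Q]) (use A(1) in auto)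
  have b: "(\<Sum>v\<in>t\<inter>B. u v *\<^sub>C v) \<in> S"
   by (intro cv.subspace_sum[OF S] cv.subspace_scale[OF S]) (use B(1) in auto)
  have "(\<Sum>v\<in>t\<inter>A. u v *\<^sub>C v) \<in> S" using e cv.subspace_neg[OF S b] by simp
  with a SQ have a0: "(\<Sum>v\<in>t\<inter>A. u v *\<^sub>C v) = 0" by auto
  then have b0: "(\<Sum>v\<in>t\<inter>B. u v *\<^sub>C v) = 0" using e by simp
  have "\<forall>v\<in>t\<inter>A. u v = 0" using cv.independentD[OF A(2) _ _ a0] t(1) by auto
  moreover have "\<forall>v\<in>t\<inter>B. u v = 0" using cv.independentD[OF B(2) _ _ b0] t(1) by auto
  ultimately show False using t(2,4) by auto
 qed
 \<comment> \<open>Extending with control of the range keeps the image inside \<open>S\<close>,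
   although \<open>A \<union> B\<close> need not span the whole space.\<close>
 obtain f where f: "clinear f" "\<forall>x\<in>A \<union> B. f x = (if x \<in> B then x else 0)" "range f \<subseteq> cv.span ((\<lambda>x. if x \<in> B then x else 0) ` (A \<union> B))"
  using cvp.linear_independent_extend_subspace[OF ind, of "\<lambda>x. if x \<in> B then x else 0"] by auto
 show ?thesis
 proof (rule that[of "endo_of f"])
  fix x
  have "(\<lambda>x. if x \<in> B then x else 0) ` (A \<union> B) \<subseteq> S" using B cv.subspace_0[OF S] by auto
  then have "range f \<subseteq> S" using f(3) cv.span_minimal[OF _ S] by blast
  then show "endo_of f \<cdot> x \<in> S" using f(1) by auto
 next
  fix x assume "x \<in> S"
  then have "x \<in> cv.span B" using sB by simp
  then show "endo_of f \<cdot> x = x"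
   using f(1,2) by (induction rule: cv.span_induct_alt) (auto simp: clinear_add clinear_scC clinear_0)
 next
  fix x assume "x \<in> Q"
  then have "x \<in> cv.span A" using sA by simp
  then show "endo_of f \<cdot> x = 0"
  proof (induction rule: cv.span_induct_alt)
   case (step c x y)
   then have "x \<notin> B" "f x = 0" using disj f(2) by auto
   then show ?case using step f(1) by (auto simp: clinear_add clinear_scC clinear_0)
  qed auto
 qed
qed

lemma subspace_image: "cv.subspace S ==> clinear f ==> cv.subspace (f ` S)"
 by (rule cvp.linear_subspace_image)

text \<open>There are two uses: \<open>H = N\<close> expresses that a subalgebra is
  finite-dimensional modulo \<open>N\<close>, and \<open>H \<subseteq> J\<close> expresses that
  \<open>H\<close> is cut out of \<open>J\<close> by finitely many linear conditions.\<close>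

definition fcod :: "'a::cvec set => 'a set => bool" where
 "fcod H J \<longleftrightarrow> (\<exists>B. finite B \<and> B \<subseteq> J \<and> (\<forall>x\<in>J. \<exists>b\<in>cv.span B. x - b \<in> H))"

lemma fcod_mono: "fcod H J ==> H \<subseteq> H' ==> fcod H' J"
 unfolding fcod_def by (meson subsetD)

text \<open>Because \<open>J\<close> modulo the kernel is the image. Subspaces of elements that are
  invisible to a given finite-dimensional piece always arise in this way.\<close>

lemma fcod_ker:
 assumes J: "cv.subspace J" and f: "clinear f" and i: "fd (f ` J)"
 shows "fcod {x \<in> J. f x = 0} J"
proof -
 have sub: "cv.subspace (f ` J)"
  using J f by (rule subspace_image)
 obtain B where B: "finite B" "B \<subseteq> f ` J" "\<not> cv.dependent B" "cv.span B = f ` J"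
  "card B = cv.dim (f ` J)" using fd_basis[OF sub i] .
 obtain A where A: "A \<subseteq> J" "finite A" "B = f ` A" using B by (meson finite_subset_image)
 have "\<exists>b\<in>cv.span A. x - b \<in> {x \<in> J. f x = 0}" if x: "x \<in> J" for x
 proof -
  have "f x \<in> f ` cv.span A" using B(2,4) A(3) x cvp.linear_span_image[OF f, of A] by auto
  then obtain a where a: "a \<in> cv.span A" "f x = f a" by auto
  have "a \<in> J" using a(1) cv.span_minimal[OF A(1) J] by blast
  then have "x - a \<in> {x \<in> J. f x = 0}"
   using a(2) x J f by (auto simp: clinear_diff cv.subspace_diff)
  then show ?thesis using a(1) by blast
 qed
 then show ?thesis unfolding fcod_def using A by blast
qed

lemma fcod_trans:
 assumes "fcod K H" "fcod H J" "H \<subseteq> J" shows "fcod K J"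
proof -
 obtain A where A: "finite A" "A \<subseteq> H" "\<And>x. x \<in> H ==> \<exists>b\<in>cv.span A. x - b \<in> K" using assms(1) unfolding fcod_def by auto
 obtain B where B: "finite B" "B \<subseteq> J" "\<And>x. x \<in> J ==> \<exists>b\<in>cv.span B. x - b \<in> H" using assms(2) unfolding fcod_def by auto
 have "\<exists>b\<in>cv.span (A \<union> B). x - b \<in> K" if x: "x \<in> J" for x
 proof -
  obtain b where b: "b \<in> cv.span B" "x - b \<in> H" using B x by auto
  obtain a where a: "a \<in> cv.span A" "x - b - a \<in> K" using A b by blast
  have "a \<in> cv.span (A \<union> B)" "b \<in> cv.span (A \<union> B)"
   using a(1) b(1) cv.span_mono[of A "A \<union> B"] cv.span_mono[of B "A \<union> B"] by auto
  then have "b + a \<in> cv.span (A \<union> B)" by (intro cv.span_add)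
  moreover have "x - (b + a) \<in> K" using a(2) by (simp add: diff_diff_eq)
  ultimately show ?thesis by blast
 qed
 then show ?thesis unfolding fcod_def using A B assms(3) by (intro exI[of _ "A \<union> B"]) auto
qed

lemma fcod_Int:
 assumes H: "cv.subspace H1" "cv.subspace H2" "H1 \<subseteq> J" "H2 \<subseteq> J" "fcod H1 J" "fcod H2 J"
 shows "fcod (H1 \<inter> H2) J"
proof -
 obtain p where p: "\<And>x. p \<cdot> x \<in> H2" "\<And>x. x \<in> H2 ==> p \<cdot> x = x"
  using projection_exists[OF H(2), of "{0}"] by auto
 obtain B where B: "finite B" "B \<subseteq> J" "\<And>x. x \<in> J ==> \<exists>b\<in>cv.span B. x - b \<in> H2" using H(6) unfolding fcod_def by auto
 \<comment> \<open>The operator \<open>1 - p\<close> has kernel \<open>H2\<close>, so its values on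
   \<open>H1\<close> are already attained on the span of the representatives of \<open>J\<close>
   modulo \<open>H2\<close>.\<close>
 have "app (1 - p) ` H1 \<subseteq> app (1 - p) ` cv.span B"
 proof
  fix y assume "y \<in> app (1 - p) ` H1"
  then obtain x where x: "x \<in> H1" "y = (1 - p) \<cdot> x" by auto
  then obtain b where b: "b \<in> cv.span B" "x - b \<in> H2" using B H by blast
  have "(1 - p) \<cdot> (x - b) = 0" using p(2)[OF b(2)] by (simp del: app_lin)
  then have "y = (1 - p) \<cdot> b" using x by simp
  then show "y \<in> app (1 - p) ` cv.span B" using b by blast
 qed
 then have "fd (app (1 - p) ` H1)" by (rule fd_subset[OF fd_image[OF clinear_app fd_span[OF B(1)]]])
 from fcod_ker[OF H(1) clinear_app this] have "fcod {x \<in> H1. (1 - p) \<cdot> x = 0} H1" .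
 moreover have "{x \<in> H1. (1 - p) \<cdot> x = 0} \<subseteq> H1 \<inter> H2" using p(1) by auto (metis)
 ultimately have "fcod (H1 \<inter> H2) H1" by (rule fcod_mono)
 then show ?thesis using H(5,3) by (rule fcod_trans)
qed

lemma fcod_zero_fd: "fcod {0} J ==> fd J"
proof -
 assume "fcod {0} J"
 then obtain B where B: "finite B" "\<And>x. x \<in> J ==> \<exists>b\<in>cv.span B. x - b \<in> {0}" unfolding fcod_def by auto
 have "J \<subseteq> cv.span B"
 proof
  fix x assume "x \<in> J"
  then obtain b where "b \<in> cv.span B" "x - b \<in> {0}" using B(2) by blast
  then show "x \<in> cv.span B" by simp
 qed
 then show "fd J" using B(1) unfolding fd_def by blast
qed

lemma fcod_INT:
 assumes "finite I" "cv.subspace J" "\<And>i. i \<in> I ==> cv.subspace (H i) \<and> H i \<subseteq> J \<and> fcod (H i) J"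
 shows "fcod (J \<inter> (\<Inter>i\<in>I. H i)) J"
 using assms(1,3)
proof (induction I rule: finite_induct)
 case empty
 show ?case unfolding fcod_def by (intro exI[of _ "{}"]) auto
next
 case (insert i I)
 have "cv.subspace (J \<inter> (\<Inter>i\<in>I. H i))"
  using insert by (intro cv.subspace_inter assms(2) cv.subspace_Int) auto
 moreover have "fcod (J \<inter> (\<Inter>i\<in>I. H i)) J" using insert by auto
 ultimately have "fcod (H i \<inter> (J \<inter> (\<Inter>i\<in>I. H i))) J"
  using insert.prems[of i] \<open>cv.subspace (J \<inter> (\<Inter>i\<in>I. H i))\<close> fcod_Int[of "H i" "J \<inter> (\<Inter>i\<in>I. H i)" J] by blast
 then show ?case by (rule fcod_mono) auto
qed

section \<open>Operators of finite rank and their trace\<close>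

text \<open>The rank one operator that the overview writes as \<open>v \<otimes> f\<close>.\<close>

definition rk :: "'v::cvec => ('v => complex) => 'v endo" where
 "rk v f = endo_of (\<lambda>x. f x *\<^sub>C v)"

lemma rk_app [simp]: "clinear f ==> rk v f \<cdot> x = f x *\<^sub>C v"
 unfolding rk_def
 by (subst app_endo_of) (auto intro!: clinearI simp: clinear_add clinear_scC cv.scale_left_distrib)

lemma clinear_comp_app [simp]: "clinear f ==> clinear (\<lambda>x. f (a \<cdot> x))"
 by (auto intro!: clinearI simp: clinear_add clinear_scC)

lemma mult_rk: "clinear f ==> a * rk v f = rk (a \<cdot> v) f"
 by (rule endo_eqI) simp

lemma rk_mult: "clinear f ==> rk v f * a = rk v (\<lambda>x. f (a \<cdot> x))"
 by (rule endo_eqI) simp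

lemma rk_rk: "clinear f ==> clinear g ==> rk v f * rk w g = f w *\<^sub>C rk v g"
 by (rule endo_eqI) (simp add: clinear_scC)

definition fr :: "'v::cvec endo set" where "fr = cv.span {rk v f | v f. clinear f}"

lemma fr_subspace: "cv.subspace fr" unfolding fr_def by (rule cv.subspace_span)

lemmas fr_add = cv.subspace_add[OF fr_subspace]
 and fr_scC = cv.subspace_scale[OF fr_subspace]
 and fr_diff = cv.subspace_diff[OF fr_subspace]
 and fr_neg = cv.subspace_neg[OF fr_subspace]
 and fr_0 = cv.subspace_0[OF fr_subspace]
 and fr_sum = cv.subspace_sum[OF fr_subspace]

lemma rk_fr: "clinear f ==> rk v f \<in> fr"
 unfolding fr_def by (intro cv.span_base) blast

lemma fr_induct [consumes 1, case_names rk zero add]: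
 assumes "x \<in> fr" "\<And>v f. clinear f ==> P (rk v f)" "P 0"
  "\<And>x y. x \<in> fr ==> y \<in> fr ==> P x ==> P y ==> P (x + y)"
 shows "P x"
proof -
 have "x \<in> cv.span {rk v f | v f. clinear f}" using assms(1) unfolding fr_def .
 then have "x \<in> fr \<and> P x"
 proof (induction rule: cv.span_induct_alt)
  case base
  show ?case using fr_0 assms(3) by simp
 next
  case (step c x y)
  then obtain v f where f: "clinear f" "x = rk v f" by auto
  have "c *\<^sub>C rk v f = rk (c *\<^sub>C v) f" by (rule endo_eqI) (simp add: f(1) mult.commute)
  have "c *\<^sub>C x + y \<in> fr" using step.IH f(2) rk_fr[OF f(1)] by (auto intro!: fr_add fr_scC)
  moreover have "P (c *\<^sub>C x + y)"
   unfolding f(2) \<open>c *\<^sub>C rk v f = rk (c *\<^sub>C v) f\<close>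
   using step.IH f(1) by (intro assms(4) rk_fr assms(2)) auto
  ultimately show ?case by simp
 qed
 then show ?thesis by simp
qed

lemma fr_mult_left: "x \<in> fr ==> a * x \<in> fr"
 by (induction rule: fr_induct) (auto simp: mult_rk rk_fr fr_0 distrib_left fr_add)

lemma fr_mult_right: "x \<in> fr ==> x * a \<in> fr"
 by (induction rule: fr_induct) (auto simp: rk_mult rk_fr fr_0 distrib_right fr_add)

lemma fd_range: "x \<in> fr ==> fd (range (app x))"
proof (induction rule: fr_induct)
 case (rk v f)
 have "range (app (rk v f)) \<subseteq> cv.span {v}"
  using rk cv.span_scale[OF cv.span_base[of v "{v}"]] by auto
 then show ?case by (rule fd_subset[OF fd_span, rotated]) simp
next
 case zero
 have "range (app (0::'a endo)) \<subseteq> cv.span {}" by auto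
 then show ?case by (rule fd_subset[OF fd_span, rotated]) simp
next
 case (add x y)
 have "range (app (x + y)) \<subseteq> cv.span (range (app x) \<union> range (app y))"
  by (auto intro!: cv.span_add intro: cv.span_base)
 moreover have "fd (cv.span (range (app x) \<union> range (app y)))" using fd_Un[OF add.IH] by simp
 ultimately show ?case by (rule fd_subset[rotated])
qed

lemma subspace_range: "cv.subspace (range (app x))"
 by (rule subspace_image[OF cv.subspace_UNIV clinear_app])

text \<open>A basis of the range together with its coordinate functionals composed with
  \<open>x\<close>. The last clause evaluates these functionals at preimages of basis vectors, which
  gives the diagonal entries for the trace of an idempotent.\<close>

lemma fr_expand:
 assumes "fd (range (app x))"
 shows "\<exists>B f. finite B \<and> card B = cv.dim (range (app x)) \<and> B \<subseteq> range (app x) \<and> (\<forall>b. clinear (f b)) \<and>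
  x = (\<Sum>b\<in>B. rk b (f b)) \<and>
  (\<forall>b\<in>B. \<forall>c\<in>B. \<forall>y. x \<cdot> y = b --> f c y = (if c = b then 1 else 0))"
proof -
 obtain B where B: "finite B" "B \<subseteq> range (app x)" "\<not> cv.dependent B" "cv.span B = range (app x)"
  "card B = cv.dim (range (app x))"
  using fd_basis[OF subspace_range assms] .
 define f where "f b y = cv.representation B (x \<cdot> y) b" for b y
 have in_span: "x \<cdot> y \<in> cv.span B" for y using B(4) by auto
 have lin: "clinear (f b)" for b
  unfolding f_def
  by (intro clinearI) (simp_all add: cv.representation_add[OF B(3) in_span in_span] cv.representation_scale[OF B(3) in_span])
 have "x = (\<Sum>b\<in>B. rk b (f b))"
 proof (rule endo_eqI)
  fix y
  have "x \<cdot> y = (\<Sum>b\<in>B. cv.representation B (x \<cdot> y) b *\<^sub>C b)"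
   by (rule cv.sum_representation_eq[OF B(3) in_span B(1), symmetric]) simp
  then show "x \<cdot> y = (\<Sum>b\<in>B. rk b (f b)) \<cdot> y" by (simp add: sum_app lin f_def)
 qed
 moreover have "f c y = (if c = b then 1 else 0)" if "b \<in> B" "c \<in> B" "x \<cdot> y = b" for b c y
  unfolding f_def that(3) cv.representation_basis[OF B(3) that(1)] by simp
 ultimately show ?thesis using B(1,5,2) lin by (intro exI[of _ B] exI[of _ f]) simp
qed

lemma fr_iff: "x \<in> fr \<longleftrightarrow> fd (range (app x))"
proof
 assume "fd (range (app x))"
 from fr_expand[OF this] show "x \<in> fr"
 proof (elim exE conjE)
  fix B f assume "\<forall>b. clinear (f b)" "x = (\<Sum>b\<in>B. rk b (f b))"
  then show "x \<in> fr" by (simp add: fr_sum rk_fr)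
 qed
qed (rule fd_range)

lemma fr_range: "fd U ==> (\<And>v. x \<cdot> v \<in> U) ==> x \<in> fr"
 unfolding fr_iff by (rule fd_subset) auto

text \<open>Between two rank one operators the full operator ring shrinks to a line, because
  \<open>(v \<otimes> f) y (w \<otimes> g)\<close> is \<open>f (y w)\<close> times
  \<open>v \<otimes> g\<close>. Most finiteness statements below are obtained by writing elements as
  \<open>a * y * b\<close> with \<open>a\<close> and \<open>b\<close> fixed.\<close>

lemma fd_corner:
 assumes "a \<in> fr" "b \<in> fr" shows "fd {a * y * b | y. True}"
 using assms(1)
proof (induction rule: fr_induct)
 case (rk v f)
 note f = rk
 from assms(2) show ?case
 proof (induction rule: fr_induct)
  case (rk w g)
  have "rk v f * y * rk w g = f (y \<cdot> w) *\<^sub>C rk v g" for y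
   by (rule endo_eqI) (simp add: rk f clinear_scC mult.commute)
  then have "{rk v f * y * rk w g | y. True} \<subseteq> cv.span {rk v g}"
   using cv.span_scale[OF cv.span_base[of "rk v g" "{rk v g}"]] by auto
  then show ?case by (rule fd_subset[OF fd_span, rotated]) simp
 next
  case zero
  then show ?case by (rule fd_subset[OF fd_finite[of "{0}"]]) auto
 next
  case (add x y)
  have "{rk v f * z * (x + y) | z. True} \<subseteq> cv.span ({rk v f * z * x | z. True} \<union> {rk v f * z * y | z. True})"
   by (auto simp: distrib_left intro!: cv.span_add intro: cv.span_base)
  moreover have "fd (cv.span ({rk v f * z * x | z. True} \<union> {rk v f * z * y | z. True}))"
   using fd_Un[OF add.IH] by simp
  ultimately show ?case by (rule fd_subset[rotated])
 qed
next
 case zero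
 then show ?case by (rule fd_subset[OF fd_finite[of "{0}"]]) auto
next
 case (add x y)
 have "{(x + y) * z * b | z. True} \<subseteq> cv.span ({x * z * b | z. True} \<union> {y * z * b | z. True})"
  by (auto simp: distrib_right intro!: cv.span_add intro: cv.span_base)
 moreover have "fd (cv.span ({x * z * b | z. True} \<union> {y * z * b | z. True}))"
  using fd_Un[OF add.IH] by simp
 ultimately show ?case by (rule fd_subset[rotated])
qed

section \<open>The trace of an operator of finite rank\<close>

definition Bas :: "'v::cvec set" where "Bas = cv.extend_basis {}"

lemma Bas: "\<not> cv.dependent Bas" "cv.span Bas = UNIV"
 unfolding Bas_def using cv.independent_extend_basis[OF cv.independent_empty] cv.span_extend_basis[OF cv.independent_empty]
 by auto

definition crd :: "'v::cvec => 'v => complex" where "crd b v = cv.representation Bas v b"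

lemma crd_linear: "clinear (crd b)"
 unfolding crd_def by (intro clinearI) (simp_all add: cv.representation_add[OF Bas(1)] cv.representation_scale[OF Bas(1)] Bas(2))

text \<open>The diagonal sum in a fixed Hamel basis. For finite rank only finitely many diagonal
  entries are nonzero (\<open>tr0_support\<close>), and by \<open>tr0_rk\<close> the choice of the
  basis does not affect the value.\<close>

definition tr0 :: "'v::cvec endo => complex" where
 "tr0 x = (\<Sum>b | b \<in> Bas \<and> crd b (x \<cdot> b) \<noteq> 0. crd b (x \<cdot> b))"

lemma tr0_support:
 assumes "x \<in> fr" shows "finite {b \<in> Bas. crd b (x \<cdot> b) \<noteq> 0}"
 using assms
proof (induction rule: fr_induct)
 case (rk v f)
 have "{b \<in> Bas. crd b (rk v f \<cdot> b) \<noteq> 0} \<subseteq> {b. crd b v \<noteq> 0}"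
  using rk by (auto simp: clinear_scC[OF crd_linear])
 moreover have "finite {b. crd b v \<noteq> 0}" unfolding crd_def by (rule cv.finite_representation)
 ultimately show ?case by (rule finite_subset)
next
 case zero
 then show ?case by (simp add: clinear_0[OF crd_linear])
next
 case (add x y)
 have "{b \<in> Bas. crd b ((x + y) \<cdot> b) \<noteq> 0} \<subseteq> {b \<in> Bas. crd b (x \<cdot> b) \<noteq> 0} \<union> {b \<in> Bas. crd b (y \<cdot> b) \<noteq> 0}"
  by (auto simp: clinear_add[OF crd_linear])
 then show ?case using add.IH finite_subset by blast
qed

lemma tr0_eq:
 assumes "finite C" "C \<subseteq> Bas" "{b \<in> Bas. crd b (x \<cdot> b) \<noteq> 0} \<subseteq> C"
 shows "tr0 x = (\<Sum>b\<in>C. crd b (x \<cdot> b))"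
 unfolding tr0_def by (rule sum.mono_neutral_left) (use assms in auto)

lemma tr0_add: "x \<in> fr ==> y \<in> fr ==> tr0 (x + y) = tr0 x + tr0 y"
proof -
 assume xy: "x \<in> fr" "y \<in> fr"
 define C where "C = {b \<in> Bas. crd b (x \<cdot> b) \<noteq> 0} \<union> {b \<in> Bas. crd b (y \<cdot> b) \<noteq> 0}"
 have C: "finite C" "C \<subseteq> Bas" using tr0_support xy by (auto simp: C_def)
 have "tr0 (x + y) = (\<Sum>b\<in>C. crd b ((x + y) \<cdot> b))"
  by (rule tr0_eq[OF C]) (auto simp: C_def clinear_add[OF crd_linear])
 also have "\<dots> = (\<Sum>b\<in>C. crd b (x \<cdot> b)) + (\<Sum>b\<in>C. crd b (y \<cdot> b))"
  by (simp add: clinear_add[OF crd_linear] sum.distrib)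
 also have "(\<Sum>b\<in>C. crd b (x \<cdot> b)) = tr0 x" by (rule tr0_eq[OF C, symmetric]) (auto simp: C_def)
 also have "(\<Sum>b\<in>C. crd b (y \<cdot> b)) = tr0 y" by (rule tr0_eq[OF C, symmetric]) (auto simp: C_def)
 finally show ?thesis .
qed

lemma tr0_scC: "x \<in> fr ==> tr0 (c *\<^sub>C x) = c * tr0 x"
proof -
 assume x: "x \<in> fr"
 define C where "C = {b \<in> Bas. crd b (x \<cdot> b) \<noteq> 0}"
 have C: "finite C" "C \<subseteq> Bas" using tr0_support x by (auto simp: C_def)
 have "tr0 (c *\<^sub>C x) = (\<Sum>b\<in>C. crd b ((c *\<^sub>C x) \<cdot> b))"
  by (rule tr0_eq[OF C]) (auto simp: C_def clinear_scC[OF crd_linear])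
 also have "\<dots> = c * (\<Sum>b\<in>C. crd b (x \<cdot> b))"
  by (simp add: clinear_scC[OF crd_linear] sum_distrib_left)
 also have "(\<Sum>b\<in>C. crd b (x \<cdot> b)) = tr0 x" by (rule tr0_eq[OF C, symmetric]) (auto simp: C_def)
 finally show ?thesis .
qed

lemma tr0_rk: assumes f: "clinear f" shows "tr0 (rk v f) = f v"
proof -
 define C where "C = {b. cv.representation Bas v b \<noteq> 0}"
 have v: "v \<in> cv.span Bas" by (simp add: Bas)
 have C: "finite C" "C \<subseteq> Bas"
  using cv.finite_representation[of Bas v] cv.representation_ne_zero[of Bas v] by (auto simp: C_def)
 have "tr0 (rk v f) = (\<Sum>b\<in>C. crd b (rk v f \<cdot> b))"
  by (rule tr0_eq[OF C]) (auto simp: C_def f clinear_scC[OF crd_linear] crd_def[symmetric])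
 also have "\<dots> = (\<Sum>b\<in>C. f (crd b v *\<^sub>C b))"
  by (intro sum.cong refl) (simp add: f clinear_scC[OF crd_linear] clinear_scC[OF f] mult.commute)
 also have "\<dots> = f (\<Sum>b\<in>C. crd b v *\<^sub>C b)" by (rule clinear_sum[OF f, symmetric])
 also have "(\<Sum>b\<in>C. crd b v *\<^sub>C b) = v"
  unfolding crd_def C_def by (rule cv.sum_nonzero_representation_eq[OF Bas(1) v])
 finally show ?thesis .
qed

text \<open>Composing with a projection onto \<open>fr\<close> makes the trace linear on all operators;
 its values outside \<open>fr\<close> are meaningless.\<close>

definition fr_proj :: "'v::cvec endo endo" where
 "fr_proj = (SOME p. (\<forall>x. p \<cdot> x \<in> fr) \<and> (\<forall>x\<in>fr. p \<cdot> x = x))"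

lemma fr_proj: "fr_proj \<cdot> x \<in> fr" "x \<in> fr ==> fr_proj \<cdot> x = x"
proof -
 have "\<exists>p :: 'a endo endo. (\<forall>x. p \<cdot> x \<in> fr) \<and> (\<forall>x\<in>fr. p \<cdot> x = x)"
  by (rule projection_exists[OF fr_subspace cv.subspace_single_0]) (auto)
 from someI_ex[OF this] show "fr_proj \<cdot> x \<in> fr" "x \<in> fr ==> fr_proj \<cdot> x = x"
  unfolding fr_proj_def[symmetric] by auto
qed

definition tr :: "'v::cvec endo => complex" where "tr x = tr0 (fr_proj \<cdot> x)"

lemma tr_linear: "clinear tr"
 unfolding tr_def by (intro clinearI) (simp_all add: tr0_add tr0_scC fr_proj(1))

lemma tr_simps [simp]: "tr 0 = 0" "tr (x + y) = tr x + tr y" "tr (x - y) = tr x - tr y"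
 "tr (- x) = - tr x" "tr (c *\<^sub>C x) = c * tr x"
 by (simp_all add: clinear_0[OF tr_linear] clinear_add[OF tr_linear] clinear_diff[OF tr_linear]
   clinear_neg[OF tr_linear] clinear_scC[OF tr_linear])

lemma tr_sum: "tr (\<Sum>i\<in>A. f i) = (\<Sum>i\<in>A. tr (f i))"
 by (rule clinear_sum[OF tr_linear])

lemma tr_rk: "clinear f ==> tr (rk v f) = f v"
 by (simp add: tr_def fr_proj(2) rk_fr tr0_rk)

text \<open>For \<open>x = v \<otimes> f\<close> both sides are \<open>f (y v)\<close>. The other
  factor may be any operator, for instance a projection of infinite rank.\<close>

lemma tr_comm: "x \<in> fr ==> tr (x * y) = tr (y * x)"
 by (induction rule: fr_induct) (simp_all add: rk_mult mult_rk tr_rk distrib_left distrib_right)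

text \<open>Characteristic zero enters through this integer: a nonzero idempotent of finite rank has
  nonzero trace.\<close>

lemma tr_idem:
 assumes p: "p \<in> fr" "p * p = p" shows "tr p = of_nat (cv.dim (range (app p)))"
proof -
 obtain B f where B: "finite B" "card B = cv.dim (range (app p))" "B \<subseteq> range (app p)"
  "\<And>b. clinear (f b)" "p = (\<Sum>b\<in>B. rk b (f b))"
  "\<And>b c y. b \<in> B ==> c \<in> B ==> p \<cdot> y = b ==> f c y = (if c = b then 1 else 0)"
  using fr_expand[OF fd_range[OF p(1)]] by auto
 have "p \<cdot> b = b" if "b \<in> B" for b
 proof -
  have "b \<in> range (app p)" using that B(3) by (rule subsetD[rotated])
  then obtain y where "b = p \<cdot> y" by (rule rangeE)
  then show ?thesis using p(2) by (metis app_simps(6))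
 qed
 then have "f b b = 1" if "b \<in> B" for b using B(6)[of b b b] that by simp
 then have "tr p = (\<Sum>b\<in>B. 1)" unfolding B(5) tr_sum by (intro sum.cong) (auto simp: tr_rk B(4))
 then show ?thesis using B(2) by simp
qed

lemma dim_eq_0_fd: assumes "fd S" "cv.dim S = 0" shows "S \<subseteq> {0}"
proof -
 have "cv.span S = {0}"
 proof (rule fd_dim_eq[symmetric])
  show "fd (cv.span S)" using assms by simp
  show "{0} \<subseteq> cv.span S" using cv.span_zero by blast
  show "cv.dim (cv.span S) \<le> cv.dim {0::'a}" using assms by simp
 qed auto
 then show ?thesis using cv.span_superset by blast
qed

lemma tr_idem_nonzero: "p \<in> fr ==> p * p = p ==> p \<noteq> 0 ==> tr p \<noteq> 0"
proof
 assume p: "p \<in> fr" "p * p = p" "p \<noteq> 0" "tr p = 0"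
 then have "cv.dim (range (app p)) = 0" by (simp add: tr_idem)
 then have "range (app p) \<subseteq> {0}" by (rule dim_eq_0_fd[OF fd_range[OF p(1)]])
 then have "p = 0" by (intro endo_eqI) auto
 with p show False by simp
qed

text \<open>With \<open>p\<close> a projection onto the range of \<open>x\<close>, the operator
  \<open>x * p\<close> has the same trace as \<open>p * x = x\<close>, and its exponent of
  nilpotency is smaller by one.\<close>

lemma tr_nilpotent: "x \<in> fr ==> x ^ m = 0 ==> tr x = 0"
proof (induction m arbitrary: x)
 case 0
 then have "x = 0" by (metis mult_1 mult_zero_left power_0)
 then show ?case by simp
next
 case (Suc m)
 show ?case
 proof (cases m)
  case 0
  then show ?thesis using Suc.prems by simp
 next
  case m: (Suc k)
  obtain p where p: "\<And>v. p \<cdot> v \<in> range (app x)" "\<And>v. v \<in> range (app x) ==> p \<cdot> v = v"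
   using projection_exists[OF subspace_range cv.subspace_single_0] by (metis inf_le2)
  have px: "p * x = x" by (rule endo_eqI) (simp add: p(2))
  have pow: "(x * p) ^ Suc k = x ^ Suc k * p" for k
  proof (induction k)
   case (Suc k)
   have "(x * p) ^ Suc (Suc k) = (x * p) * (x ^ Suc k * p)" using Suc by simp
   also have "\<dots> = x * (p * x) * x ^ k * p" by (simp add: mult.assoc)
   finally show ?case by (simp add: px mult.assoc)
  qed simp
  have "x ^ Suc k * p = 0"
  proof (rule endo_eqI)
   fix v
   obtain w where w: "p \<cdot> v = x \<cdot> w" using p(1)[of v] by auto
   have "x ^ Suc k \<cdot> x \<cdot> w = x ^ Suc m \<cdot> w" unfolding m by (simp add: power_Suc2 del: power_Suc)
   then show "(x ^ Suc k * p) \<cdot> v = 0 \<cdot> v" using w \<open>x ^ Suc m = 0\<close> by (simp del: power_Suc)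
  qed
  then have "(x * p) ^ m = 0" using pow[of k] m by simp
  then have "tr (x * p) = 0" using Suc.IH Suc.prems(1) fr_mult_right by blast
  then show ?thesis using tr_comm[OF Suc.prems(1), of p] px by simp
 qed
qed

section \<open>Spectral projections\<close>

text \<open>Horner's scheme for the value of a polynomial at an operator; the constant term acts as
  a multiple of the identity.\<close>

definition pe :: "complex poly => 'v::cvec endo => 'v endo" where
 "pe p x = fold_coeffs (\<lambda>a y. a *\<^sub>C 1 + x * y) p 0"

lemma pe_0 [simp]: "pe 0 x = 0" by (simp add: pe_def)

lemma pe_pCons [simp]: "pe (pCons a p) x = a *\<^sub>C 1 + x * pe p x"
 by (cases "a = 0 \<and> p = 0") (auto simp: pe_def)

lemma pe_add [simp]: "pe (p + q) x = pe p x + pe q x"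
 by (induction p q rule: poly_induct2) (auto simp: cv.scale_left_distrib distrib_left)

lemma pe_smult [simp]: "pe (smult c p) x = c *\<^sub>C pe p x"
 by (induction p) (auto simp: cv.scale_right_distrib)

lemma pe_minus [simp]: "pe (- p) x = - pe p x"
 using pe_smult[of "-1" p x] by simp

lemma pe_diff [simp]: "pe (p - q) x = pe p x - pe q x"
 using pe_add[of p "- q" x] by simp

lemma pe_1 [simp]: "pe 1 x = 1"
 by (simp add: one_pCons)

lemma pe_commute: "y * x = x * y ==> y * pe p x = pe p x * y"
proof (induction p)
 case (pCons a p)
 have "y * (x * pe p x) = x * (y * pe p x)" using pCons.prems by (simp add: mult.assoc[symmetric])
 then show ?case using pCons by (simp add: distrib_left distrib_right mult.assoc)
qed simp

lemma pe_mult [simp]: "pe (p * q) x = pe p x * pe q x"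
 by (induction p) (auto simp: distrib_right mult.assoc)

lemma pe_sum: "pe (\<Sum>i\<in>A. f i) x = (\<Sum>i\<in>A. pe (f i) x)"
 by (induction A rule: infinite_finite_induct) auto

lemma pe_power [simp]: "pe (p ^ n) x = pe p x ^ n"
 by (induction n) auto

lemma pe_X: "pe [:0, 1:] x = x" by simp

lemma pe_stable:
 assumes "cv.subspace U" "\<And>u. u \<in> U ==> x \<cdot> u \<in> U" "u \<in> U" shows "pe p x \<cdot> u \<in> U"
 using assms(1,2,3) by (induction p) (auto simp: cv.subspace_0 intro!: cv.subspace_add cv.subspace_scale)

text \<open>Powers of \<open>x\<close> from the second on lie in the corner of all
  \<open>x * y * x\<close>, which is finite-dimensional although the operator ring is not. So the
  increasing spaces \<open>W n\<close> of values of multiples of \<open>X^2\<close> become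
  stationary, and a stationary step is a polynomial relation.\<close>

lemma annihilating_poly:
 assumes x: "x \<in> fr" obtains P where "P \<noteq> 0" "pe P x = 0"
proof -
 define W where "W n = {pe ([:0,1:]^2 * q) x | q. degree q \<le> n}" for n
 have Wsub: "W n \<subseteq> {x * y * x | y. True}" for n
  proof
   fix z assume "z \<in> W n"
   then obtain q where "z = pe ([:0,1:]^2 * q) x" unfolding W_def by blast
   then have "z = x * (x * pe q x)" by (simp add: power2_eq_square mult.assoc)
   then have "z = x * (pe q x * x)" by (simp only: pe_commute[of x x q, OF refl])
   then have "z = x * pe q x * x" by (simp only: mult.assoc)
   then show "z \<in> {x * y * x | y. True}" by blast
  qed
 have fdW: "fd (W n)" for n
  by (rule fd_subset[OF fd_corner[OF x x] Wsub])
 have sub: "cv.subspace (W n)" for n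
 proof (rule cv.subspaceI)
  show "0 \<in> W n" unfolding W_def by (rule CollectI, rule exI[of _ 0]) simp
  show "a + b \<in> W n" if ab: "a \<in> W n" "b \<in> W n" for a b
  proof -
   obtain q r where q: "degree q \<le> n" "a = pe ([:0,1:]^2 * q) x" "degree r \<le> n" "b = pe ([:0,1:]^2 * r) x"
    using ab unfolding W_def by blast
   have "a + b = pe ([:0,1:]^2 * (q + r)) x" unfolding q distrib_left pe_add ..
   moreover have "degree (q + r) \<le> n" using q degree_add_le by blast
   ultimately show ?thesis unfolding W_def by blast
  qed
  show "c *\<^sub>C a \<in> W n" if ab: "a \<in> W n" for c a
  proof -
   obtain q where q: "degree q \<le> n" "a = pe ([:0,1:]^2 * q) x" using ab unfolding W_def by blast
   have "c *\<^sub>C a = pe ([:0,1:]^2 * smult c q) x" unfolding q mult_smult_right pe_smult ..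
   moreover have "degree (smult c q) \<le> n" using q degree_smult_le le_trans by blast
   ultimately show ?thesis unfolding W_def by blast
  qed
 qed
 have mono: "W n \<subseteq> W (Suc n)" for n unfolding W_def by auto
 have "\<exists>n. W n = W (Suc n)"
 proof (rule ccontr)
  assume "\<nexists>n. W n = W (Suc n)"
  then have lt: "cv.dim (W n) < cv.dim (W (Suc n))" for n
   using fd_dim_less[OF fdW _ sub sub, of n "Suc n"] mono[of n] by blast
  have ge: "n \<le> cv.dim (W n)" for n
  proof (induction n)
   case (Suc n)
   then show ?case using lt[of n] by simp
  qed simp
  have bound: "cv.dim (W n) \<le> cv.dim {x * y * x | y. True}" for n
   by (rule fd_dim_mono[OF fd_corner[OF x x] Wsub])
  show False using ge[of "Suc (cv.dim {x * y * x | y. True})"] bound[of "Suc (cv.dim {x * y * x | y. True})"] by simp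
 qed
 then obtain n where n: "W n = W (Suc n)" by blast
 have "pe ([:0,1:]^2 * [:0,1:] ^ Suc n) x \<in> W (Suc n)"
  unfolding W_def by (rule CollectI, rule exI[of _ "[:0,1:] ^ Suc n"]) (simp add: degree_power_eq del: power_Suc)
 then have "pe ([:0,1:]^2 * [:0,1:] ^ Suc n) x \<in> W n" unfolding n .
 then obtain q where q: "degree q \<le> n" "pe ([:0,1:]^2 * [:0,1:] ^ Suc n) x = pe ([:0,1:]^2 * q) x"
  unfolding W_def by blast
 have "degree ([:0,1::complex:] ^ Suc n) = Suc n" by (simp add: degree_power_eq del: power_Suc)
 then have "[:0,1:] ^ Suc n \<noteq> q" using q(1) by auto
 moreover have "[:0,1::complex:]^2 \<noteq> 0" by (simp only: power_eq_0_iff) simp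
 ultimately have "[:0,1:]^2 * ([:0,1:] ^ Suc n - q) \<noteq> 0" by (simp only: mult_eq_0_iff right_minus_eq) simp
 moreover have "pe ([:0,1:]^2 * ([:0,1:] ^ Suc n - q)) x = 0"
  unfolding right_diff_distrib pe_diff using q(2) by simp
 ultimately show ?thesis using that by blast
qed

lemma coprime_linear: "a \<noteq> b ==> coprime [:-a, 1:] [:-b, 1 :: complex:]"
proof (rule coprimeI)
 fix d assume "a \<noteq> b" "d dvd [:-a, 1:]" "d dvd [:-b, 1:]"
 then have "d dvd [:-a, 1:] - [:-b, 1:]" by (intro dvd_diff)
 moreover have "is_unit ([:-a, 1:] - [:-b, 1:])" using \<open>a \<noteq> b\<close> by (simp add: is_unit_const_poly_iff dvd_field_iff)
 ultimately show "is_unit d" using dvd_trans by blast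
qed

lemma prod_coprime_dvd:
 assumes "finite S" "\<And>i. i \<in> S ==> f i dvd (c :: complex poly)"
  "\<And>i j. i \<in> S ==> j \<in> S ==> i \<noteq> j ==> coprime (f i) (f j)"
 shows "prod f S dvd c"
 using assms
proof (induction S rule: finite_induct)
 case (insert i S)
 have "coprime (f i) (f j)" if "j \<in> S" for j
  using insert.hyps(2) that by (intro insert.prems(2)) auto
 then have "coprime (f i) (prod f S)" by (rule prod_coprime_right)
 then show ?case using insert by (simp add: divides_mult)
qed simp

lemma primary_decomposition:
 assumes x: "x \<in> fr"
 obtains S :: "complex set" and K and q where "finite S" "0 \<in> S" "K > 0"
  "\<And>l. l \<in> S ==> (x - l *\<^sub>C 1) ^ K * pe (q l) x = 0"
  "(\<Sum>l\<in>S. pe (q l) x) = 1"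
  "\<And>l m. l \<in> S ==> m \<in> S ==> l \<noteq> m ==> pe (q l) x * pe (q m) x = 0"
proof -
 obtain P where P: "P \<noteq> 0" "pe P x = 0" using annihilating_poly[OF x] .
 \<comment> \<open>The value 0 is always listed, possibly with projection zero, because its part is
   the only one that may have infinite rank and is treated separately.\<close>
 define S where "S = insert 0 {z. poly P z = 0}"
 define K where "K = Suc (degree P)"
 define L where "L l = [:-l, 1:] ^ K" for l :: complex
 define M where "M l = (\<Prod>m\<in>S - {l}. L m)" for l
 have S: "finite S" "0 \<in> S" unfolding S_def using poly_roots_finite[OF P(1)] by auto
 have cop: "coprime (L l) (L m)" if "l \<noteq> m" for l m
  unfolding L_def using coprime_linear[OF that] by (intro coprime_power_left_iff[THEN iffD2] coprime_power_right_iff[THEN iffD2] disjI1)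
 have "P dvd (\<Prod>m\<in>S. L m)"
 proof -
  have "(\<Prod>z | poly P z = 0. [:-z, 1:] ^ order z P) dvd (\<Prod>z | poly P z = 0. L z)"
  proof (rule prod_dvd_prod)
   fix z
   have "order z P \<le> K" unfolding K_def using order_degree[OF P(1), of z] by simp
   then show "[:-z, 1:] ^ order z P dvd L z" unfolding L_def by (rule le_imp_power_dvd)
  qed
  moreover have "(\<Prod>z | poly P z = 0. L z) dvd (\<Prod>m\<in>S. L m)"
   by (rule prod_dvd_prod_subset[OF S(1)]) (auto simp: S_def)
  ultimately have "smult (lead_coeff P) (\<Prod>z | poly P z = 0. [:-z, 1:] ^ order z P) dvd (\<Prod>m\<in>S. L m)"
   using P(1) by (intro smult_dvd) (auto intro: dvd_trans)
  then show ?thesis unfolding complex_poly_decompose .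
 qed
 then obtain k where "(\<Prod>m\<in>S. L m) = P * k" by (elim dvdE)
 then have M0: "pe (\<Prod>m\<in>S. L m) x = 0" using P(2) by simp
 have MS: "(\<Prod>m\<in>S. L m) = L l * M l" if "l \<in> S" for l
  unfolding M_def using S(1) that by (rule prod.remove)
 have "\<exists>u v. u * M l + v * L l = 1" for l
 proof -
  have "coprime (M l) (L l)" unfolding M_def using cop by (intro prod_coprime_left) auto
  then have "gcd (M l) (L l) = 1" by (simp add: coprime_iff_gcd_eq_1)
  then show ?thesis using bezout_coefficients_fst_snd[of "M l" "L l"] by auto
 qed
 then obtain u v where uv: "\<And>l. u l * M l + v l * L l = 1" by metis
 \<comment> \<open>The idempotents of the Chinese remainder theorem: \<open>q l\<close> is 1 modulo
   \<open>L l\<close> and 0 modulo \<open>L m\<close> for every other \<open>m\<close>.\<close>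
 define q where "q l = u l * M l" for l
 have dvdM: "L m dvd M l" if "m \<in> S" "l \<noteq> m" for l m
  unfolding M_def using S(1) that by (intro dvd_prodI) auto
 show ?thesis
 proof (rule that[of S K q])
  show "K > 0" by (simp add: K_def)
  show "(x - l *\<^sub>C 1) ^ K * pe (q l) x = 0" if "l \<in> S" for l
  proof -
   have "L l * q l = u l * (\<Prod>m\<in>S. L m)" unfolding q_def MS[OF that] by (simp add: ac_simps)
   then have "pe (L l * q l) x = 0" using M0 by simp
   moreover have "pe (L l) x = (x - l *\<^sub>C 1) ^ K" unfolding L_def by (simp add: algebra_simps)
   ultimately show ?thesis by simp
  qed
  show "pe (q l) x * pe (q m) x = 0" if "l \<in> S" "m \<in> S" "l \<noteq> m" for l m
  proof -
   have "L l dvd M m" using dvdM[of l m] that by simp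
   then obtain k where "M m = L l * k" by (elim dvdE)
   then have "q l * q m = u l * u m * k * (\<Prod>m\<in>S. L m)" unfolding q_def MS[OF that(1)] by (simp add: ac_simps)
   then have "pe (q l * q m) x = 0" using M0 by simp
   then show ?thesis by simp
  qed
  have "(\<Prod>m\<in>S. L m) dvd ((\<Sum>l\<in>S. q l) - 1)"
  proof (rule prod_coprime_dvd[OF S(1)])
   fix l assume l: "l \<in> S"
   have "(\<Sum>l\<in>S. q l) - 1 = (\<Sum>m\<in>S-{l}. q m) - v l * L l"
    using uv[of l] sum.remove[OF S(1) l, of q] unfolding q_def by (simp add: algebra_simps)
   moreover have "L l dvd (\<Sum>m\<in>S-{l}. q m)"
    unfolding q_def using dvdM l by (intro dvd_sum dvd_mult) auto
   ultimately show "L l dvd (\<Sum>l\<in>S. q l) - 1" by simp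
  qed (use cop in auto)
  then obtain k where "(\<Sum>l\<in>S. q l) - 1 = (\<Prod>m\<in>S. L m) * k" by (elim dvdE)
  then have "pe ((\<Sum>l\<in>S. q l) - 1) x = pe (\<Prod>m\<in>S. L m) x * pe k x" by (simp only: pe_mult)
  then have "pe ((\<Sum>l\<in>S. q l) - 1) x = 0" using M0 by (simp del: pe_diff)
  then show "(\<Sum>l\<in>S. pe (q l) x) = 1" by (simp add: pe_sum)
 qed (use S in auto)
qed

lemma power_mult_commute:
 fixes a b :: "'a::monoid_mult"
 assumes "a * b = b * a" shows "(a * b) ^ n = a ^ n * b ^ n"
proof (induction n)
 case (Suc n)
 have "b * a ^ n = a ^ n * b" using power_commuting_commutes[OF assms, of n] by simp
 then have "a * b * (a ^ n * b ^ n) = a * (a ^ n * b) * b ^ n" by (simp add: mult.assoc[symmetric]) (simp add: mult.assoc)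
 then show ?case using Suc by (simp add: mult.assoc)
qed simp

text \<open>Vandermonde: replacing \<open>d l\<close> by \<open>d l * (l - a)\<close> combines the
  relations for \<open>m\<close> and \<open>Suc m\<close> and removes the node \<open>a\<close>. The
  relations start at \<open>m = 1\<close>, so a node 0 would stay invisible.\<close>

lemma zero_times_power_sum:
 fixes d :: "complex => complex"
 assumes "finite S" "0 \<notin> S" "\<And>m. m \<ge> 1 ==> (\<Sum>l\<in>S. d l * l ^ m) = 0" "l \<in> S"
 shows "d l = 0"
 using assms
proof (induction S arbitrary: d l rule: finite_induct)
 case (insert a S)
 have *: "d l = 0" if "l \<in> S" for l
 proof -
  have "(\<Sum>l\<in>S. (d l * (l - a)) * l ^ m) = 0" if "m \<ge> 1" for m
  proof -
   have "(\<Sum>l\<in>S. (d l * (l - a)) * l ^ m) = (\<Sum>l\<in>insert a S. (d l * (l - a)) * l ^ m)"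
    using insert.hyps by simp
   also have "\<dots> = (\<Sum>l\<in>insert a S. d l * l ^ Suc m - a * (d l * l ^ m))"
    by (intro sum.cong refl) (simp add: algebra_simps)
   also have "\<dots> = (\<Sum>l\<in>insert a S. d l * l ^ Suc m) - a * (\<Sum>l\<in>insert a S. d l * l ^ m)"
    by (simp only: sum_subtractf sum_distrib_left)
   finally show ?thesis using insert.prems(2)[of m] insert.prems(2)[of "Suc m"] that by simp
  qed
  then have "d l * (l - a) = 0" using insert.IH[of "\<lambda>l. d l * (l - a)" l] insert.prems(1) that by simp
  then show ?thesis using insert.hyps(2) that by auto
 qed
 have "d a * a ^ 1 = 0" using insert.prems(2)[of 1] insert.hyps * by simp
 then have "d a = 0" using insert.prems(1) by auto
 then show ?case using * insert.prems(3) by auto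
qed simp

text \<open>The \<open>p l\<close> are polynomials in \<open>x\<close>, which gives commutation and
  the stability of invariant subspaces. On the part for \<open>l\<close> the operator
  \<open>x - l\<close> is nilpotent, so \<open>x ^ m\<close> has the same trace there as
  \<open>l ^ m\<close>. The part for 0 may have infinite rank and gets its own trace
  formula.\<close>

lemma spectral:
 assumes x: "x \<in> fr"
 obtains S K p where "finite S" "0 \<in> S" "K > 0" "(\<Sum>l\<in>S. p l) = 1"
  "\<And>l. l \<in> S ==> (x - l *\<^sub>C 1) ^ K * p l = 0" "\<And>l y. y * x = x * y ==> y * p l = p l * y"
  "\<And>l. l \<in> S ==> p l * p l = p l" "\<And>l. l \<in> S ==> l \<noteq> 0 ==> p l \<in> fr"
  "\<And>l m. l \<in> S ==> l \<noteq> 0 ==> tr (x ^ m * p l) = l ^ m * tr (p l)"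
  "\<And>m. m \<ge> 1 ==> tr (x ^ m * p 0) = 0" "\<And>l U. cv.subspace U ==> \<forall>u\<in>U. x \<cdot> u \<in> U ==> \<forall>u\<in>U. p l \<cdot> u \<in> U"
proof -
 obtain S K q where S: "finite S" "0 \<in> S" "K > 0"
  "\<And>l. l \<in> S ==> (x - l *\<^sub>C 1) ^ K * pe (q l) x = 0"
  "(\<Sum>l\<in>S. pe (q l) x) = 1"
  "\<And>l m. l \<in> S ==> m \<in> S ==> l \<noteq> m ==> pe (q l) x * pe (q m) x = 0"
  by (rule primary_decomposition[OF x]) (rule that)
 define p where "p l = pe (q l) x" for l
 have comm: "y * p l = p l * y" if "y * x = x * y" for l y unfolding p_def by (rule pe_commute[OF that])
 have comm_pe: "pe f x * p l = p l * pe f x" for f l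
  by (intro comm pe_commute[symmetric]) simp
 have idem: "p l * p l = p l" if l: "l \<in> S" for l
 proof -
  have "p l = p l * (\<Sum>m\<in>S. p m)" using S(5) by (simp add: p_def)
  also have "\<dots> = p l * p l + (\<Sum>m\<in>S-{l}. p l * p m)"
   unfolding sum_distrib_left by (rule sum.remove[OF S(1) l])
  also have "(\<Sum>m\<in>S-{l}. p l * p m) = 0" unfolding p_def using S(6) l by (intro sum.neutral) auto
  finally show ?thesis by simp
 qed
 have ppow: "p l ^ K = p l" if "l \<in> S" for l
 proof -
  have "p l ^ Suc n = p l" for n by (induction n) (use idem[OF that] in auto)
  from this[of "K - 1"] show ?thesis using S(3) by simp
 qed
 have nil: "(x - l *\<^sub>C 1) ^ K * p l = 0" if "l \<in> S" for l using S(4)[OF that] by (simp add: p_def)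
 have lin: "pe [:-l, 1:] x = x - l *\<^sub>C 1" for l by (simp add: algebra_simps)
 have pfr: "p l \<in> fr" if l: "l \<in> S" "l \<noteq> 0" for l
 proof -
  \<comment> \<open>The constant coefficient of \<open>(X - l)^K\<close> is nonzero, so the relation
    \<open>(x - l)^K * p l = 0\<close> expresses \<open>p l\<close> as \<open>x\<close> times an
    operator.\<close>
  obtain a r where ar: "[:-l, 1:] ^ K = pCons a r" by (cases "[:-l, 1:] ^ K")
  have "a = poly ([:-l, 1:] ^ K) 0" unfolding ar by simp
  then have a: "a \<noteq> 0" using l by simp
  have "pe (pCons a r) x * p l = 0" unfolding ar[symmetric] pe_power lin using nil[OF l(1)] .
  then have "a *\<^sub>C p l = - (x * (pe r x * p l))" by (simp add: distrib_right mult.assoc eq_neg_iff_add_eq_0)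
  then have "p l = inverse a *\<^sub>C (- (x * (pe r x * p l)))" using a by (metis (no_types) cv.scale_scale cv.scale_one left_inverse)
  moreover have "inverse a *\<^sub>C (- (x * (pe r x * p l))) \<in> fr" by (intro fr_scC fr_neg fr_mult_right x)
  ultimately show ?thesis by simp
 qed
 have trp: "tr (x ^ m * p l) = l ^ m * tr (p l)" if l: "l \<in> S" "l \<noteq> 0" for l m
 proof -
  have "poly ([:0,1:] ^ m - [:l ^ m:]) l = 0" by simp
  then obtain r where r: "[:0,1:] ^ m - [:l ^ m:] = [:-l, 1:] * r" unfolding poly_eq_0_iff_dvd by (elim dvdE)
  have "x ^ m - l ^ m *\<^sub>C 1 = pe ([:0,1:] ^ m - [:l ^ m:]) x" by simp
  also have "\<dots> = (x - l *\<^sub>C 1) * pe r x" unfolding r pe_mult lin ..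
  finally have "(x ^ m - l ^ m *\<^sub>C 1) * p l = (x - l *\<^sub>C 1) * (pe r x * p l)" by (simp only: mult.assoc)
  then have e: "x ^ m * p l - l ^ m *\<^sub>C p l = (x - l *\<^sub>C 1) * (pe r x * p l)" by (simp add: left_diff_distrib)
  have c: "(x - l *\<^sub>C 1) * (pe r x * p l) = (pe r x * p l) * (x - l *\<^sub>C 1)"
  proof -
   have "pe [:-l, 1:] x * (pe r x * p l) = pe (r * [:-l, 1:]) x * p l"
    unfolding mult.commute[of r] pe_mult mult.assoc ..
   also have "\<dots> = pe r x * (pe [:-l, 1:] x * p l)" unfolding pe_mult mult.assoc ..
   also have "\<dots> = (pe r x * p l) * pe [:-l, 1:] x" unfolding comm_pe[of "[:-l, 1:]"] mult.assoc ..
   finally show ?thesis unfolding lin .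
  qed
  have "((x - l *\<^sub>C 1) * (pe r x * p l)) ^ K = (pe r x * p l) ^ K * (x - l *\<^sub>C 1) ^ K"
   unfolding c by (rule power_mult_commute[OF c[symmetric]])
  also have "\<dots> = pe r x ^ K * ((x - l *\<^sub>C 1) ^ K * p l)"
   using comm_pe[of "[:-l,1:] ^ K" l]
   unfolding power_mult_commute[OF comm_pe[of r l], of K] ppow[OF l(1)] pe_power lin mult.assoc by (simp only:)
  also have "\<dots> = 0" using nil[OF l(1)] by simp
  finally have "tr ((x - l *\<^sub>C 1) * (pe r x * p l)) = 0"
   by (intro tr_nilpotent[rotated] fr_mult_left pfr l)
  then show ?thesis unfolding e[symmetric] by simp
 qed
 have tr0: "tr (x ^ m * p 0) = 0" if m: "m \<ge> 1" for m
 proof -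
  have "(x ^ m * p 0) ^ K = (x ^ m) ^ K * p 0"
   using power_mult_commute[OF comm_pe[of "[:0,1:] ^ m" 0], of K] ppow[OF S(2)] by simp
  also have "(x ^ m) ^ K = x ^ (m * K - K) * x ^ K"
   using m by (simp add: power_mult[symmetric] power_add[symmetric])
  also have "\<dots> * p 0 = 0" using nil[OF S(2)] by (simp add: mult.assoc)
  finally show ?thesis
  proof (rule tr_nilpotent[rotated])
   have "x ^ m = x * x ^ (m - 1)" using m by (cases m) auto
   then show "x ^ m * p 0 \<in> fr" using x by (simp add: fr_mult_right mult.assoc)
  qed
 qed
 have stab: "\<forall>u\<in>U. p l \<cdot> u \<in> U" if "cv.subspace U" "\<forall>u\<in>U. x \<cdot> u \<in> U" for l U
  unfolding p_def using that by (auto intro: pe_stable)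
 show ?thesis
  by (rule that[OF S(1,2,3) S(5)[folded p_def] nil comm idem pfr trp tr0 stab])
qed

text \<open>The traces of the powers are power sums of the nonzero eigenvalues, weighted by the
  traces of their projections. So all these weights vanish, and an idempotent of finite rank and
  trace zero is zero.\<close>

lemma nilpotent_if_traces:
 assumes x: "x \<in> fr" and t: "\<And>m. m \<ge> 1 ==> tr (x ^ m) = 0" shows "\<exists>K. x ^ K = 0"
proof -
 obtain S K p where S: "finite S" "0 \<in> S" "K > 0" "(\<Sum>l\<in>S. p l) = 1"
  and n: "\<And>l. l \<in> S ==> (x - l *\<^sub>C 1) ^ K * p l = 0"
  and p: "\<And>l. l \<in> S ==> p l * p l = p l" "\<And>l. l \<in> S ==> l \<noteq> 0 ==> p l \<in> fr"
  and tp: "\<And>l m. l \<in> S ==> l \<noteq> 0 ==> tr (x ^ m * p l) = l ^ m * tr (p l)"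
  and t0: "\<And>m. m \<ge> 1 ==> tr (x ^ m * p 0) = 0"
  by (rule spectral[OF x]) (rule that)
 have "(\<Sum>l\<in>S - {0}. tr (p l) * l ^ m) = 0" if m: "m \<ge> 1" for m
 proof -
  have "0 = tr (x ^ m * (\<Sum>l\<in>S. p l))" using S(4) t[OF m] by simp
  also have "\<dots> = (\<Sum>l\<in>S. tr (x ^ m * p l))" by (simp add: sum_distrib_left tr_sum)
  also have "\<dots> = (\<Sum>l\<in>S-{0}. tr (x ^ m * p l))" using t0[OF m] S(1,2) by (simp add: sum.remove[of S 0])
  also have "\<dots> = (\<Sum>l\<in>S-{0}. tr (p l) * l ^ m)" using tp by (intro sum.cong refl) (simp add: mult.commute)
  finally show ?thesis by simp
 qed
 then have "tr (p l) = 0" if "l \<in> S - {0}" for l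
  using zero_times_power_sum[of "S - {0}" "\<lambda>l. tr (p l)" l] S(1) that by simp
 then have "p l = 0" if "l \<in> S - {0}" for l using tr_idem_nonzero[OF p(2) p(1), of l] that by blast
 then have "p 0 = 1" using S(1,2,4) by (simp add: sum.remove[of S 0])
 then have "x ^ K = 0" using n[OF S(2)] by simp
 then show ?thesis by blast
qed

lemma eigenvector_from_nilpotent:
 assumes "(x - l *\<^sub>C 1) ^ K \<cdot> w = 0" "w \<noteq> 0"
 shows "\<exists>k. (x - l *\<^sub>C 1) ^ k \<cdot> w \<noteq> 0 \<and> x \<cdot> ((x - l *\<^sub>C 1) ^ k \<cdot> w) = l *\<^sub>C ((x - l *\<^sub>C 1) ^ k \<cdot> w)"
 using assms
proof (induction K)
 case (Suc K)
 show ?case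
 proof (cases "(x - l *\<^sub>C 1) ^ K \<cdot> w = 0")
  case False
  then show ?thesis using Suc.prems(1) by (intro exI[of _ K]) simp
 qed (use Suc in blast)
qed simp

lemma eigenvector_exists:
 assumes U: "cv.subspace U" "fd U" "\<And>u. u \<in> U ==> T \<cdot> u \<in> U" and u: "u \<in> U" "u \<noteq> 0"
 obtains l e where "e \<in> U" "e \<noteq> 0" "T \<cdot> e = l *\<^sub>C e"
proof -
 obtain pr where pr: "\<And>v. pr \<cdot> v \<in> U" "\<And>v. v \<in> U ==> pr \<cdot> v = v"
  by (rule projection_exists[OF U(1) cv.subspace_single_0 inf_le2]) (rule that)
 define x where "x = T * pr"
 have x: "x \<in> fr" unfolding x_def by (intro fr_mult_left fr_range[OF U(2) pr(1)])
 have xT: "x \<cdot> v = T \<cdot> v" if "v \<in> U" for v using pr(2)[OF that] by (simp add: x_def)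
 obtain S K p where S: "finite S" "(\<Sum>l\<in>S. p l) = 1"
  and n: "\<And>l. l \<in> S ==> (x - l *\<^sub>C 1) ^ K * p l = 0"
  and st: "\<And>l U. cv.subspace U ==> \<forall>u\<in>U. x \<cdot> u \<in> U ==> \<forall>u\<in>U. p l \<cdot> u \<in> U"
  by (rule spectral[OF x]) (rule that)
 have xU: "x \<cdot> v \<in> U" if "v \<in> U" for v using xT that U(3) by simp
 have "(\<Sum>l\<in>S. p l \<cdot> u) = u" unfolding sum_app[symmetric] S(2) by simp
 then have "\<exists>l\<in>S. p l \<cdot> u \<noteq> 0"
  using sum.neutral[of S "\<lambda>l. p l \<cdot> u"] u(2) by metis
 then obtain l where l: "l \<in> S" "p l \<cdot> u \<noteq> 0" by blast
 have "((x - l *\<^sub>C 1) ^ K * p l) \<cdot> u = 0" using n[OF l(1)] by simp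
 then have "(x - l *\<^sub>C 1) ^ K \<cdot> (p l \<cdot> u) = 0" by simp
 from eigenvector_from_nilpotent[OF this l(2)] obtain k where
  k: "(x - l *\<^sub>C 1) ^ k \<cdot> (p l \<cdot> u) \<noteq> 0" "x \<cdot> ((x - l *\<^sub>C 1) ^ k \<cdot> (p l \<cdot> u)) = l *\<^sub>C ((x - l *\<^sub>C 1) ^ k \<cdot> (p l \<cdot> u))" by blast
 have eU: "(x - l *\<^sub>C 1) ^ k \<cdot> (p l \<cdot> u) \<in> U"
 proof (induction k)
  case 0
  then show ?case using st[OF U(1)] xU u(1) by simp
 next
  case (Suc k)
  then show ?case using xU U(1) by (simp add: cv.subspace_diff cv.subspace_scale)
 qed
 show ?thesis by (rule that[OF eU k(1) k(2)[unfolded xT[OF eU]]])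
qed

lemma nonzero_eigenvalue:
 assumes x: "x \<in> fr" and t: "tr x \<noteq> 0"
 obtains l e where "l \<noteq> 0" "e \<noteq> 0" "x \<cdot> e = l *\<^sub>C e"
proof -
 obtain S K p where S: "finite S" "0 \<in> S" "(\<Sum>l\<in>S. p l) = 1"
  and n: "\<And>l. l \<in> S ==> (x - l *\<^sub>C 1) ^ K * p l = 0"
  by (rule spectral[OF x]) (rule that)
 have "\<exists>l\<in>S - {0}. p l \<noteq> 0"
 proof (rule ccontr)
  assume "\<not> (\<exists>l\<in>S - {0}. p l \<noteq> 0)"
  then have "p 0 = 1" using S by (simp add: sum.remove[of S 0])
  then have "x ^ K = 0" using n[OF S(2)] by simp
  then show False using tr_nilpotent[OF x] t by blast
 qed
 then obtain l where l: "l \<in> S" "l \<noteq> 0" "p l \<noteq> 0" by blast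
 then obtain v where v: "p l \<cdot> v \<noteq> 0" using endo_eqI[of "p l" 0] by auto
 have "((x - l *\<^sub>C 1) ^ K * p l) \<cdot> v = 0" using n[OF l(1)] by simp
 then have "(x - l *\<^sub>C 1) ^ K \<cdot> (p l \<cdot> v) = 0" by simp
 from eigenvector_from_nilpotent[OF this v] show ?thesis using that l(2) by blast
qed

section \<open>Lie algebras of operators: the theorems of Engel and Cartan\<close>

definition lb :: "'v::cvec endo => 'v endo => 'v endo" where "lb x y = x * y - y * x"

abbreviation subalg :: "'v::cvec endo set => bool" where "subalg \<equiv> lie_subalgebra scC lb"
abbreviation lbs :: "'v::cvec endo set => 'v endo set => 'v endo set" where "lbs \<equiv> bracket_span scC lb"
abbreviation dser :: "'v::cvec endo set => nat => 'v endo set" where "dser \<equiv> derived_series scC lb"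

lemma lb_simps [simp]: "lb (x + y) z = lb x z + lb y z" "lb x (y + z) = lb x y + lb x z"
 "lb (x - y) z = lb x z - lb y z" "lb x (y - z) = lb x y - lb x z"
 "lb (c *\<^sub>C x) z = c *\<^sub>C lb x z" "lb x (c *\<^sub>C z) = c *\<^sub>C lb x z" "lb 0 x = 0" "lb x 0 = 0"
 "lb (- x) z = - lb x z" "lb x (- z) = - lb x z" "lb x x = 0"
 by (simp_all add: lb_def algebra_simps cv.scale_right_diff_distrib)

lemma lb_swap: "lb x y = - lb y x" by (simp add: lb_def)

lemma lb_jacobi: "lb x (lb y z) = lb (lb x y) z + lb y (lb x z)"
 by (simp add: lb_def algebra_simps)

lemma lb_fr: "x \<in> fr ==> lb x y \<in> fr" "y \<in> fr ==> lb x y \<in> fr"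
 by (simp_all add: lb_def fr_diff fr_mult_left fr_mult_right)

lemma tr_lb: "x \<in> fr ==> tr (lb x y) = 0" "y \<in> fr ==> tr (lb x y) = 0"
 by (simp_all add: lb_def tr_comm[of x y] tr_comm[of y x])

text \<open>Invariance of the trace form. The hypotheses say that at least two of the three
  operators have finite rank; the third may be a zeroth power, for example.\<close>

lemma tr_lb_assoc:
 assumes "a \<in> fr \<or> b \<in> fr" "b \<in> fr \<or> c \<in> fr" "a \<in> fr \<or> c \<in> fr"
 shows "tr (lb a b * c) = tr (a * lb b c)"
proof -
 have "tr (b * a * c) = tr (a * c * b)"
 proof (cases "b \<in> fr")
  case True
  then show ?thesis using tr_comm[OF True, of "a * c"] by (simp add: mult.assoc)
 next
  case False
  then have "a * c \<in> fr" using assms by (simp add: fr_mult_left)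
  then show ?thesis using tr_comm[of "a * c" b] by (simp add: mult.assoc)
 qed
 then show ?thesis by (simp add: lb_def algebra_simps)
qed

lemma clinear_lb: "clinear (lb x)" by (auto intro!: clinearI)

lemma subalg_D: "subalg h ==> cv.subspace h" "subalg h ==> x \<in> h ==> y \<in> h ==> lb x y \<in> h"
 by (auto simp: lie_subalgebra_def)

lemma lbs_mem: "a \<in> A ==> b \<in> B ==> lb a b \<in> lbs A B"
 unfolding bracket_span_def by (intro cv.span_base) blast

lemma lbs_subspace: "cv.subspace (lbs A B)"
 unfolding bracket_span_def by (rule cv.subspace_span)

lemma lbs_subset: "cv.subspace T ==> (\<And>a b. a \<in> A ==> b \<in> B ==> lb a b \<in> T) ==> lbs A B \<subseteq> T"
 unfolding bracket_span_def by (rule cv.span_minimal) auto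

lemma lbs_mono: "A \<subseteq> A' ==> B \<subseteq> B' ==> lbs A B \<subseteq> lbs A' B'"
 by (rule lbs_subset[OF lbs_subspace]) (auto intro: lbs_mem)

lemma lbs_induct [consumes 1, case_names lb zero add scC]:
 assumes "x \<in> lbs A B" "\<And>a b. a \<in> A ==> b \<in> B ==> P (lb a b)" "P 0"
  "\<And>x y. P x ==> P y ==> P (x + y)" "\<And>c x. P x ==> P (c *\<^sub>C x)"
 shows "P x"
proof -
 have "cv.subspace {x. P x}" using assms(3-5) by (auto intro: cv.subspaceI)
 then have "lbs A B \<subseteq> {x. P x}" by (rule lbs_subset) (use assms(2) in auto)
 then show ?thesis using assms(1) by auto
qed

lemma lbs_subalg: "subalg h ==> lbs h h \<subseteq> h"
 by (rule lbs_subset) (auto dest: subalg_D)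

lemma subalg_lbs: "subalg h ==> subalg (lbs h h)"
 using lbs_subalg[of h] unfolding lie_subalgebra_def[of _ _ "lbs h h"] by (auto simp: lbs_subspace intro!: lbs_mem)

lemma subalg_dser: "subalg h ==> subalg (dser h n)"
 by (induction n) (auto intro: subalg_lbs)

lemma dser_decreasing: "subalg h ==> dser h (Suc n) \<subseteq> dser h n"
 using lbs_subalg[OF subalg_dser] by simp

lemma dser_subset: "subalg h ==> dser h n \<subseteq> h"
proof (induction n)
 case (Suc n)
 then show ?case using dser_decreasing[of h n] by blast
qed simp

lemma dser_mono: "h \<subseteq> k ==> dser h n \<subseteq> dser k n"
 by (induction n) (simp_all add: lbs_mono)

lemma dser_add: "dser h (m + n) = dser (dser h m) n"
 by (induction n) simp_all

lemma dser_stable: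
 assumes h: "subalg h" "fd h" obtains n where "dser h (Suc n) = dser h n"
proof -
 have "\<exists>n. dser h (Suc n) = dser h n"
 proof (rule ccontr)
  assume *: "\<nexists>n. dser h (Suc n) = dser h n"
  have lt: "cv.dim (dser h (Suc n)) < cv.dim (dser h n)" for n
  proof (rule fd_dim_less)
   show "fd (dser h n)" using fd_subset[OF h(2) dser_subset[OF h(1)]] .
   show "dser h (Suc n) \<subset> dser h n" using dser_decreasing[OF h(1)] * by blast
  qed (use subalg_D(1)[OF subalg_dser[OF h(1)]] in blast)+
  have "cv.dim (dser h n) + n \<le> cv.dim h" for n
  proof (induction n)
   case (Suc n)
   then show ?case using lt[of n] by linarith
  qed simp
  from this[of "Suc (cv.dim h)"] show False by simp
 qed
 then show ?thesis using that by blast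
qed

section \<open>Engel's theorem for operators\<close>

definition nilp :: "'v::cvec endo set => nat => bool" where
 "nilp h n \<longleftrightarrow> (\<forall>xs. length xs = n --> set xs \<subseteq> h --> prod_list xs = 0)"

lemma nilp_ge:
 assumes "nilp h n" "n \<le> length xs" "set xs \<subseteq> h" shows "prod_list xs = 0"
proof -
 have "prod_list (take n xs) = 0" using assms set_take_subset[of n xs] unfolding nilp_def by auto
 moreover have "prod_list xs = prod_list (take n xs) * prod_list (drop n xs)"
  by (metis append_take_drop_id prod_list.append)
 ultimately show ?thesis by simp
qed

lemma span_mult:
 assumes "a \<in> cv.span A" "b \<in> cv.span B" shows "a * b \<in> cv.span {x * y | x y. x \<in> A \<and> y \<in> (B :: 'v::cvec endo set)}"
 using assms(1)
proof (induction rule: cv.span_induct_alt)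
 case (step c x y)
 have "x * b \<in> cv.span {x * y | x y. x \<in> A \<and> y \<in> B}"
  using assms(2)
 proof (induction rule: cv.span_induct_alt)
  case (step d z w)
  have "x * z \<in> cv.span {x * y | x y. x \<in> A \<and> y \<in> B}" using step(1) \<open>x \<in> A\<close> by (intro cv.span_base) blast
  then show ?case using step by (simp add: distrib_left cv.span_add cv.span_scale)
 qed (simp add: cv.span_zero)
 then show ?case using step by (simp add: distrib_right cv.span_add cv.span_scale)
qed (simp add: cv.span_zero)

lemma prod_list_span:
 assumes "set xs \<subseteq> cv.span S"
 shows "prod_list xs \<in> cv.span {prod_list ys | ys. length ys = length xs \<and> set ys \<subseteq> (S :: 'v::cvec endo set)}"
 using assms
proof (induction xs)
 case Nil
 then show ?case by (intro cv.span_base) simp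
next
 case (Cons x xs)
 let ?P = "{prod_list ys | ys. length ys = length xs \<and> set ys \<subseteq> S}"
 have "x * prod_list xs \<in> cv.span {x * y | x y. x \<in> S \<and> y \<in> ?P}"
  using Cons by (intro span_mult) auto
 moreover have "{x * y | x y. x \<in> S \<and> y \<in> ?P} \<subseteq> {prod_list ys | ys. length ys = length (x # xs) \<and> set ys \<subseteq> S}"
 proof
  fix z assume "z \<in> {x * y | x y. x \<in> S \<and> y \<in> ?P}"
  then obtain a ys where "z = a * prod_list ys" "a \<in> S" "length ys = length xs" "set ys \<subseteq> S" by blast
  then have "z = prod_list (a # ys)" "length (a # ys) = length (x # xs)" "set (a # ys) \<subseteq> S" by auto
  then show "z \<in> {prod_list ys | ys. length ys = length (x # xs) \<and> set ys \<subseteq> S}" by blast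
 qed
 ultimately have "x * prod_list xs \<in> cv.span {prod_list ys | ys. length ys = length (x # xs) \<and> set ys \<subseteq> S}"
  by (meson cv.span_mono subsetD)
 then show ?case by simp
qed

lemma nilp_span: "nilp S n ==> nilp (cv.span S) n"
 unfolding nilp_def
proof (intro allI impI)
 fix xs :: "'a endo list" assume S: "\<forall>xs. length xs = n --> set xs \<subseteq> S --> prod_list xs = 0" and xs: "length xs = n" "set xs \<subseteq> cv.span S"
 have "{prod_list ys | ys. length ys = length xs \<and> set ys \<subseteq> S} \<subseteq> {0}" using S xs(1) by auto
 then have "cv.span {prod_list ys | ys. length ys = length xs \<and> set ys \<subseteq> S} \<subseteq> {0}"
  by (rule cv.span_minimal) simp
 then show "prod_list xs = 0" using prod_list_span[OF xs(2)] by auto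
qed

lemma foldr_lb_span:
 assumes "set xs \<subseteq> m"
 shows "foldr lb xs v \<in> cv.span {prod_list as * v * prod_list bs | as bs. length as + length bs = length xs \<and> set as \<subseteq> m \<and> set bs \<subseteq> m}"
 using assms
proof (induction xs)
 case Nil
 have "v = prod_list [] * v * prod_list []" by simp
 then show ?case by (intro cv.span_base) force
next
 case (Cons x xs)
 let ?W = "\<lambda>n. {prod_list as * v * prod_list bs | as bs. length as + length bs = n \<and> set as \<subseteq> m \<and> set bs \<subseteq> m}"
 have "lb x y \<in> cv.span (?W (Suc (length xs)))" if "y \<in> cv.span (?W (length xs))" for y
  using that
 proof (induction rule: cv.span_induct_alt)
  case base
  then show ?case by (simp add: cv.span_zero)
 next
  case (step c z w)
  then obtain as bs where z: "z = prod_list as * v * prod_list bs" "length as + length bs = length xs" "set as \<subseteq> m" "set bs \<subseteq> m" by blast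
  have "x * z = prod_list (x # as) * v * prod_list bs" unfolding z(1) by (simp add: mult.assoc)
  moreover have "length (x # as) + length bs = Suc (length xs)" "set (x # as) \<subseteq> m" using z Cons.prems by auto
  ultimately have 1: "x * z \<in> ?W (Suc (length xs))" using z(4) by blast
  have "z * x = prod_list as * v * prod_list (bs @ [x])" unfolding z(1) by (simp add: mult.assoc)
  moreover have "length as + length (bs @ [x]) = Suc (length xs)" "set (bs @ [x]) \<subseteq> m" using z Cons.prems by auto
  ultimately have 2: "z * x \<in> ?W (Suc (length xs))" using z(3) by blast
  have "lb x z \<in> cv.span (?W (Suc (length xs)))"
   unfolding lb_def by (intro cv.span_diff cv.span_base 1 2)
  then show ?case using step by (simp add: cv.span_add cv.span_scale)
 qed
 then show ?case using Cons by simp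
qed

text \<open>An iterated bracket expands into words in which the letters from \<open>m\<close> are
  distributed to the two sides of \<open>v\<close>; among \<open>2 * n\<close> letters at least
  \<open>n\<close> stand on one side.\<close>

lemma foldr_lb_zero:
 assumes "nilp m n" "set xs \<subseteq> m" "length xs = 2 * n" shows "foldr lb xs v = 0"
proof -
 have "{prod_list as * v * prod_list bs | as bs. length as + length bs = length xs \<and> set as \<subseteq> m \<and> set bs \<subseteq> m} \<subseteq> {0}"
 proof
  fix z assume "z \<in> {prod_list as * v * prod_list bs | as bs. length as + length bs = length xs \<and> set as \<subseteq> m \<and> set bs \<subseteq> m}"
  then obtain as bs where z: "z = prod_list as * v * prod_list bs" "length as + length bs = length xs" "set as \<subseteq> m" "set bs \<subseteq> m" by blast
  then have "n \<le> length as \<or> n \<le> length bs" using assms(3) by linarith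
  then show "z \<in> {0}" using nilp_ge[OF assms(1)] z by auto
 qed
 then have "cv.span {prod_list as * v * prod_list bs | as bs. length as + length bs = length xs \<and> set as \<subseteq> m \<and> set bs \<subseteq> m} \<subseteq> {0}"
  by (rule cv.span_minimal) simp
 then show ?thesis using foldr_lb_span[OF assms(2), of v] by blast
qed

text \<open>Adjoining to an associatively nilpotent Lie algebra one nilpotent element that normalizes it:
 in a long word the letters outside \<open>m\<close> can be moved to the right without changing
 the number of letters from \<open>m\<close>.\<close>
lemma nilp_extend:
 assumes m: "cv.subspace m" "nilp m n" and x: "x ^ q = 0" "\<And>y. y \<in> m ==> lb x y \<in> m"
 shows "nilp (cv.span (insert x m)) (q * n)"
proof (rule nilp_span)
 define C where "C i = cv.span {prod_list as * x ^ j | as j. length as = i \<and> set as \<subseteq> m}" for i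
 have mC: "a * c \<in> C (Suc i)" if "a \<in> m" "c \<in> C i" for a c i
  using that(2) unfolding C_def
 proof (induction rule: cv.span_induct_alt)
  case (step d z w)
  then obtain as j where "z = prod_list as * x ^ j" "length as = i" "set as \<subseteq> m" by blast
  then have "a * z = prod_list (a # as) * x ^ j" "length (a # as) = Suc i" "set (a # as) \<subseteq> m"
   using that(1) by (auto simp: mult.assoc)
  then have "a * z \<in> cv.span {prod_list as * x ^ j | as j. length as = Suc i \<and> set as \<subseteq> m}"
   by (intro cv.span_base) blast
  then show ?case using step by (simp add: distrib_left cv.span_add cv.span_scale)
 qed (simp add: cv.span_zero)
 have xas: "x * (prod_list as * x ^ j) \<in> C (length as)" if "set as \<subseteq> m" for as j
  using that
 proof (induction as)
  case Nil
  have "x * (prod_list [] * x ^ j) = prod_list [] * x ^ Suc j" by simp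
  then have "x * (prod_list [] * x ^ j) \<in> {prod_list as * x ^ j | as j. length as = length [] \<and> set as \<subseteq> m}"
   by (intro CollectI exI[of _ "[]"] exI[of _ "Suc j"]) simp
  then show ?case unfolding C_def by (rule cv.span_base)
 next
  case (Cons a as)
  have "x * (prod_list (a # as) * x ^ j) = a * (x * (prod_list as * x ^ j)) + lb x a * (prod_list as * x ^ j)"
   by (simp add: lb_def algebra_simps mult.assoc)
  moreover have "a * (x * (prod_list as * x ^ j)) \<in> C (Suc (length as))"
   using Cons by (intro mC) auto
  moreover have "lb x a * (prod_list as * x ^ j) \<in> C (Suc (length as))"
  proof (intro mC x(2))
   show "prod_list as * x ^ j \<in> C (length as)" unfolding C_def using Cons.prems by (intro cv.span_base) auto
  qed (use Cons.prems in auto)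
  ultimately show ?case unfolding C_def by (simp add: cv.span_add)
 qed
 have xC: "x * c \<in> C i" if "c \<in> C i" for c i
  using that unfolding C_def
 proof (induction rule: cv.span_induct_alt)
  case (step d z w)
  then obtain as j where "z = prod_list as * x ^ j" "length as = i" "set as \<subseteq> m" by blast
  then have "x * z \<in> cv.span {prod_list as * x ^ j | as j. length as = i \<and> set as \<subseteq> m}"
   using xas[of as j] unfolding C_def by auto
  then show ?case using step by (simp add: distrib_left cv.span_add cv.span_scale)
 qed (simp add: cv.span_zero)
 have C0: "c = 0" if "c \<in> C i" "n \<le> i" for c i
 proof -
  have "{prod_list as * x ^ j | as j. length as = i \<and> set as \<subseteq> m} \<subseteq> {0}" using nilp_ge[OF m(2)] that(2) by auto
  then have "C i \<subseteq> {0}" unfolding C_def by (rule cv.span_minimal) simp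
  then show ?thesis using that(1) by auto
 qed
 have xtC: "x ^ t * c \<in> C i" if "c \<in> C i" for t c i
  by (induction t) (use that xC in \<open>auto simp: mult.assoc\<close>)
 \<comment> \<open>The word \<open>w\<close> is consumed from the right: a letter \<open>x\<close>
   raises \<open>t\<close>, a letter from \<open>m\<close> raises \<open>i\<close> and resets
   \<open>t\<close> to 0. As long as \<open>t < q\<close>, the quantity
   \<open>length w + t + q * i\<close> does not decrease; the product vanishes once
   \<open>t = q\<close> or \<open>i\<close> reaches \<open>n\<close>.\<close>
 have main: "prod_list w * (x ^ t * c) = 0"
  if "set w \<subseteq> insert x m" "q * n \<le> length w + t + q * i" "t \<le> q" "c \<in> C i" for w t i c
  using that
 proof (induction w arbitrary: t i c rule: rev_induct)
  case Nil
  show ?case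
  proof (cases "n \<le> i")
   case True
   then have "c = 0" by (rule C0[OF Nil.prems(4)])
   then show ?thesis by simp
  next
   case False
   then have "q * Suc i \<le> q * n" by (intro mult_le_mono2) simp
   then have "t = q" using Nil by simp
   then show ?thesis using x(1) by simp
  qed
 next
  case (snoc a w)
  show ?case
  proof (cases "t = q")
   case True
   then show ?thesis using x(1) by simp
  next
   case False
   have "prod_list w * (a * (x ^ t * c)) = 0"
   proof (cases "a = x")
    case True
    have "prod_list w * (x ^ Suc t * c) = 0" using snoc.prems False by (intro snoc.IH[of "Suc t" i]) auto
    then show ?thesis using True by (simp add: mult.assoc)
   next
    case a: False
    have "a * (x ^ t * c) \<in> C (Suc i)" using snoc.prems a by (intro mC xtC) auto
    then have "prod_list w * (x ^ 0 * (a * (x ^ t * c))) = 0"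
     using snoc.prems False by (intro snoc.IH[of 0 "Suc i"]) auto
    then show ?thesis by simp
   qed
   then show ?thesis by (simp add: mult.assoc)
  qed
 qed
 have "1 \<in> C 0" unfolding C_def by (intro cv.span_base) (auto intro!: exI[of _ 0])
 then show "nilp (insert x m) (q * n)" unfolding nilp_def using main[where t=0 and i=0 and c=1] by auto
qed

text \<open>Take a nilpotent subalgebra \<open>m\<close> of maximal dimension and some
  \<open>y\<close> outside. Long iterated brackets of elements of \<open>m\<close> with
  \<open>y\<close> vanish, so a last one outside \<open>m\<close> exists; it normalizes
  \<open>m\<close>, and \<open>nilp_extend\<close> enlarges \<open>m\<close>.\<close>

theorem Engel:
 assumes h: "subalg h" "fd h" and nil: "\<And>x. x \<in> h ==> \<exists>K. x ^ K = 0"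
 shows "\<exists>n. nilp h n"
proof -
 define Q where "Q m \<longleftrightarrow> subalg m \<and> m \<subseteq> h \<and> (\<exists>n. nilp m n)" for m
 have Q0: "Q {0}"
 proof -
  have "nilp {0::'a endo} 1" unfolding nilp_def
  proof (intro allI impI)
   fix xs :: "'a endo list" assume "length xs = 1" "set xs \<subseteq> {0}"
   then show "prod_list xs = 0" by (cases xs) auto
  qed
  then show ?thesis unfolding Q_def using cv.subspace_0[OF subalg_D(1)[OF h(1)]]
   by (auto simp: lie_subalgebra_def)
 qed
 have "\<exists>m. Q m \<and> (\<forall>m'. Q m' --> cv.dim m' \<le> cv.dim m)"
 proof -
  have "cv.dim m < Suc (cv.dim h)" if "Q m" for m using that fd_dim_mono[OF h(2)] unfolding Q_def by (simp add: le_imp_less_Suc)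
  then show ?thesis using ex_has_greatest_nat[of Q "{0}" cv.dim "Suc (cv.dim h)"] Q0 by blast
 qed
 then obtain m where m: "Q m" "\<And>m'. Q m' ==> cv.dim m' \<le> cv.dim m" by blast
 then obtain n where n: "nilp m n" and mh: "m \<subseteq> h" "subalg m" unfolding Q_def by blast
 note ms = subalg_D(1)[OF mh(2)]
 have "m = h"
 proof (rule ccontr)
  assume "m \<noteq> h"
  then obtain y where y: "y \<in> h" "y \<notin> m" using mh by blast
  have ex: "\<exists>k. \<forall>xs. set xs \<subseteq> m --> length xs = k --> foldr lb xs y \<in> m"
   using foldr_lb_zero[OF n, of _ y] cv.subspace_0[OF ms] by (intro exI[of _ "2 * n"]) auto
  define k where "k = (LEAST k. \<forall>xs. set xs \<subseteq> m --> length xs = k --> foldr lb xs y \<in> m)"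
  have k: "\<And>xs. set xs \<subseteq> m ==> length xs = k ==> foldr lb xs y \<in> m"
   using LeastI_ex[OF ex] unfolding k_def by blast
  have "k \<noteq> 0" using k[of "[]"] y(2) by auto
  then obtain j where j: "k = Suc j" by (cases k) auto
  have "\<not> (\<forall>xs. set xs \<subseteq> m --> length xs = j --> foldr lb xs y \<in> m)"
   using not_less_Least[of j "\<lambda>k. \<forall>xs. set xs \<subseteq> m --> length xs = k --> foldr lb xs y \<in> m"] j unfolding k_def by auto
  then obtain xs where xs: "set xs \<subseteq> m" "length xs = j" "foldr lb xs y \<notin> m" by blast
  define x where "x = foldr lb xs y"
  have xm: "lb z x \<in> m" if "z \<in> m" for z
   using k[of "z # xs"] xs j that by (simp add: x_def)
  then have xm': "lb x z \<in> m" if "z \<in> m" for z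
   using that cv.subspace_neg[OF ms] by (metis lb_swap)
  have "x \<in> h" unfolding x_def using xs(1)
  proof (induction xs)
   case (Cons a as)
   then show ?case using mh(1) by (auto intro: subalg_D(2)[OF h(1)])
  qed (use y in auto)
  then obtain q where q: "x ^ q = 0" using nil by blast
  define m' where "m' = cv.span (insert x m)"
  have sm: "cv.span m = m" using ms by simp
  have m'_iff: "z \<in> m' \<longleftrightarrow> (\<exists>c. z - c *\<^sub>C x \<in> m)" for z
   unfolding m'_def cv.span_breakdown_eq sm ..
  have "subalg m'"
  proof -
   have "lb a b \<in> m'" if ab: "a \<in> m'" "b \<in> m'" for a b
   proof -
    obtain c d where cd: "a - c *\<^sub>C x \<in> m" "b - d *\<^sub>C x \<in> m" using ab unfolding m'_iff by blast
    have "lb a b = lb (a - c *\<^sub>C x) (b - d *\<^sub>C x) + c *\<^sub>C lb x (b - d *\<^sub>C x) + d *\<^sub>C lb (a - c *\<^sub>C x) x"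
     by (simp add: algebra_simps cv.scale_right_diff_distrib)
    also have "\<dots> \<in> m"
     by (intro cv.subspace_add[OF ms] cv.subspace_scale[OF ms] subalg_D(2)[OF mh(2)] cd xm xm')
    finally show ?thesis unfolding m'_def by (simp add: cv.span_base)
   qed
   then show ?thesis unfolding lie_subalgebra_def m'_def by (simp add: cv.subspace_span)
  qed
  moreover have "m' \<subseteq> h" unfolding m'_def
   using \<open>x \<in> h\<close> mh(1) by (intro cv.span_minimal subalg_D(1)[OF h(1)]) auto
  moreover have "nilp m' (q * n)" unfolding m'_def by (rule nilp_extend[OF ms n q xm'])
  ultimately have "Q m'" unfolding Q_def by blast
  moreover have "m \<subset> m'" using xs(3) unfolding m'_def x_def[symmetric] using cv.span_superset[of "insert x m"] by blast
  then have "cv.dim m < cv.dim m'"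
   using fd_dim_less[OF fd_subset[OF h(2) \<open>m' \<subseteq> h\<close>] _ ms] unfolding m'_def by simp
  ultimately show False using m(2) by fastforce
 qed
 then show ?thesis using n by blast
qed

section \<open>Generalized eigenspaces and Cartan's criterion\<close>

lemma powers_commute:
 fixes a b :: "'a::monoid_mult"
 assumes "a * b = b * a" shows "a ^ m * b ^ n = b ^ n * a ^ m"
proof -
 have "b * a ^ m = a ^ m * b" by (rule power_commuting_commutes[OF assms, symmetric])
 then have "b ^ n * a ^ m = a ^ m * b ^ n" by (rule power_commuting_commutes)
 then show ?thesis by (rule sym)
qed

text \<open>Modulo the stable subspace \<open>h\<close> the vector \<open>z\<close> is an
  eigenvector for \<open>m\<close> and also a generalized one for \<open>v\<close>, hence zero. The
  induction passes from \<open>z\<close> to \<open>(T - v) z\<close>.\<close>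

lemma ker_power_invert:
 assumes h: "cv.subspace h" "\<And>z. z \<in> h ==> T \<cdot> z \<in> h"
  and "(T - v *\<^sub>C 1) ^ K \<cdot> z = 0" "T \<cdot> z - m *\<^sub>C z \<in> h" "m \<noteq> v"
 shows "z \<in> h"
 using assms(3,4)
proof (induction K arbitrary: z)
 case 0
 then show ?case using cv.subspace_0[OF h(1)] by simp
next
 case (Suc K)
 define z1 where "z1 = T \<cdot> z - v *\<^sub>C z"
 have "(T - v *\<^sub>C 1) ^ K \<cdot> z1 = 0"
  using Suc.prems(1) unfolding z1_def power_Suc2 by simp
 moreover have "T \<cdot> z1 - m *\<^sub>C z1 = T \<cdot> (T \<cdot> z - m *\<^sub>C z) - v *\<^sub>C (T \<cdot> z - m *\<^sub>C z)"
  by (simp add: z1_def cv.scale_right_diff_distrib cv.scale_left_commute)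
 then have "T \<cdot> z1 - m *\<^sub>C z1 \<in> h"
  using cv.subspace_diff[OF h(1) h(2)[OF Suc.prems(2)] cv.subspace_scale[OF h(1) Suc.prems(2), of v]] by (simp only:)
 ultimately have "z1 \<in> h" by (rule Suc.IH)
 then have "(T \<cdot> z - m *\<^sub>C z) - z1 \<in> h" by (rule cv.subspace_diff[OF h(1) Suc.prems(2)])
 moreover have "(T \<cdot> z - m *\<^sub>C z) - z1 = (v - m) *\<^sub>C z" by (simp add: z1_def cv.scale_left_diff_distrib)
 ultimately have "(v - m) *\<^sub>C z \<in> h" by simp
 then have "inverse (v - m) *\<^sub>C ((v - m) *\<^sub>C z) \<in> h" by (rule cv.subspace_scale[OF h(1)])
 moreover have "inverse (v - m) *\<^sub>C ((v - m) *\<^sub>C z) = z"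
  unfolding cv.scale_scale using assms(5) by simp
 ultimately show ?case by simp
qed

lemma ker_power_invert_power:
 assumes h: "cv.subspace h" "\<And>z. z \<in> h ==> T \<cdot> z \<in> h"
  and "(T - v *\<^sub>C 1) ^ K \<cdot> z = 0" "(T - m *\<^sub>C 1) ^ N \<cdot> z \<in> h" "m \<noteq> v"
 shows "z \<in> h"
 using assms(4)
proof (induction N)
 case (Suc N)
 have c: "(T - v *\<^sub>C 1) ^ K * (T - m *\<^sub>C 1) ^ N = (T - m *\<^sub>C 1) ^ N * (T - v *\<^sub>C 1) ^ K"
  by (rule powers_commute) (simp add: algebra_simps)
 have "(T - v *\<^sub>C 1) ^ K \<cdot> ((T - m *\<^sub>C 1) ^ N \<cdot> z) = ((T - m *\<^sub>C 1) ^ N * (T - v *\<^sub>C 1) ^ K) \<cdot> z"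
  unfolding c[symmetric] by simp
 also have "\<dots> = 0" using assms(3) by simp
 finally have 0: "(T - v *\<^sub>C 1) ^ K \<cdot> ((T - m *\<^sub>C 1) ^ N \<cdot> z) = 0" .
 have "T \<cdot> ((T - m *\<^sub>C 1) ^ N \<cdot> z) - m *\<^sub>C ((T - m *\<^sub>C 1) ^ N \<cdot> z) = (T - m *\<^sub>C 1) ^ Suc N \<cdot> z" by simp
 also have "\<dots> \<in> h" by (rule Suc.prems)
 finally have 1: "T \<cdot> ((T - m *\<^sub>C 1) ^ N \<cdot> z) - m *\<^sub>C ((T - m *\<^sub>C 1) ^ N \<cdot> z) \<in> h" .
 have "(T - m *\<^sub>C 1) ^ N \<cdot> z \<in> h"
 proof (rule ker_power_invert[where T = T and v = v and K = K and m = m])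
  show "cv.subspace h" by (rule h(1))
  show "T \<cdot> z \<in> h" if "z \<in> h" for z using that by (rule h(2))
 qed (rule 0, rule 1, rule assms(5))
 then show ?case by (rule Suc.IH)
qed simp

text \<open>A power of \<open>T - v0\<close> removes the component for \<open>v0\<close> and keeps
  the others in their generalized eigenspaces; \<open>ker_power_invert_power\<close> then undoes
  that power on each of them.\<close>

lemma generalized_eigencomponents:
 assumes h: "cv.subspace h" "\<And>z. z \<in> h ==> T \<cdot> z \<in> h" and "finite V"
  "\<And>v. v \<in> V ==> (T - v *\<^sub>C 1) ^ K \<cdot> z v = 0" "(\<Sum>v\<in>V. z v) \<in> h" "v \<in> V"
 shows "z v \<in> h"
 using assms(3-)
proof (induction V arbitrary: z v rule: finite_induct)
 case (insert v0 V)
 have c: "(T - v *\<^sub>C 1) ^ K * (T - m *\<^sub>C 1) ^ K = (T - m *\<^sub>C 1) ^ K * (T - v *\<^sub>C 1) ^ K" for v m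
  by (rule powers_commute) (simp add: algebra_simps)
 have pow_h: "(T - v0 *\<^sub>C 1) ^ n \<cdot> y \<in> h" if "y \<in> h" for n y
 proof (induction n)
  case (Suc n)
  then show ?case using cv.subspace_diff[OF h(1) h(2) cv.subspace_scale[OF h(1)], of "(T - v0 *\<^sub>C 1) ^ n \<cdot> y" "(T - v0 *\<^sub>C 1) ^ n \<cdot> y" v0] by simp
 qed (use that in simp)
 have IH: "(T - v0 *\<^sub>C 1) ^ K \<cdot> z v \<in> h" if "v \<in> V" for v
 proof (rule insert.IH[of "\<lambda>v. (T - v0 *\<^sub>C 1) ^ K \<cdot> z v"])
  fix w assume "w \<in> V"
  have "(T - w *\<^sub>C 1) ^ K \<cdot> (T - v0 *\<^sub>C 1) ^ K \<cdot> z w = ((T - v0 *\<^sub>C 1) ^ K * (T - w *\<^sub>C 1) ^ K) \<cdot> z w"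
   unfolding c[of w v0, symmetric] by simp
  also have "\<dots> = 0" using insert.prems(1)[of w] \<open>w \<in> V\<close> by simp
  finally show "(T - w *\<^sub>C 1) ^ K \<cdot> (T - v0 *\<^sub>C 1) ^ K \<cdot> z w = 0" .
 next
  have "(T - v0 *\<^sub>C 1) ^ K \<cdot> (\<Sum>v\<in>insert v0 V. z v) \<in> h" by (rule pow_h[OF insert.prems(2)])
  then show "(\<Sum>v\<in>V. (T - v0 *\<^sub>C 1) ^ K \<cdot> z v) \<in> h"
   using insert.hyps insert.prems(1)[of v0] by (simp add: app_sum)
 qed (rule that)
 have zV: "z v \<in> h" if "v \<in> V" for v
 proof (rule ker_power_invert_power[OF h _ IH[OF that]])
  show "(T - v *\<^sub>C 1) ^ K \<cdot> z v = 0" using insert.prems(1) that by simp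
  show "v0 \<noteq> v" using that insert.hyps(2) by blast
 qed
 have "z v0 = (\<Sum>v\<in>insert v0 V. z v) - (\<Sum>v\<in>V. z v)" using insert.hyps by simp
 also have "\<dots> \<in> h" using zV by (intro cv.subspace_diff[OF h(1)] insert.prems(2) cv.subspace_sum[OF h(1)]) auto
 finally show ?case using zV insert.prems(3) by auto
qed simp

text \<open>Different indices may carry the same eigenvalue \<open>e i\<close>, so the components
  are first grouped by eigenvalue. In the application the indices are pairs of eigenvalues,
  \<open>e\<close> is their difference and \<open>f\<close> is complex conjugation.\<close>

lemma function_of_eigencomponents:
 assumes h: "cv.subspace h" "\<And>z. z \<in> h ==> T \<cdot> z \<in> h" and I: "finite I"
  "\<And>i. i \<in> I ==> (T - e i *\<^sub>C 1) ^ K \<cdot> y i = 0" "(\<Sum>i\<in>I. y i) \<in> h"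
 shows "(\<Sum>i\<in>I. f (e i) *\<^sub>C y i) \<in> h"
proof -
 define z where "z v = (\<Sum>i | i \<in> I \<and> e i = v. y i)" for v
 have z: "z v \<in> h" if "v \<in> e ` I" for v
 proof (rule generalized_eigencomponents[OF h, of "e ` I" K z])
  show "(T - v *\<^sub>C 1) ^ K \<cdot> z v = 0" for v unfolding z_def app_sum by (rule sum.neutral) (use I(2) in auto)
  show "(\<Sum>v\<in>e ` I. z v) \<in> h" unfolding z_def using I(3) sum.image_gen[OF I(1), of y e] by simp
 qed (use I(1) that in auto)
 have "(\<Sum>i\<in>I. f (e i) *\<^sub>C y i) = (\<Sum>v\<in>e ` I. \<Sum>i | i \<in> I \<and> e i = v. f (e i) *\<^sub>C y i)"
  by (rule sum.image_gen[OF I(1)])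
 also have "\<dots> = (\<Sum>v\<in>e ` I. f v *\<^sub>C z v)"
  unfolding z_def by (intro sum.cong refl) (simp add: cv.scale_sum_right)
 also have "\<dots> \<in> h" using z h(1) by (intro cv.subspace_sum cv.subspace_scale) auto
 finally show ?thesis .
qed

text \<open>The binomial expansion: each term of degree \<open>a + b\<close> contains
  \<open>A\<close> at least \<open>a\<close> times or \<open>B\<close> at least \<open>b\<close>
  times.\<close>

lemma power_diff_zero:
 fixes A B :: "'w::cvec endo"
 assumes "A * B = B * A" "A ^ a \<cdot> z = 0" "B ^ b \<cdot> z = 0" shows "(A - B) ^ (a + b) \<cdot> z = 0"
 using assms(2,3)
proof (induction "a + b" arbitrary: a b z)
 case 0
 then show ?case by simp
next
 case (Suc n)
 show ?case
 proof (cases "a = 0 \<or> b = 0")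
  case True
  then have "z = 0" using Suc.prems by auto
  then show ?thesis by simp
 next
  case False
  then obtain a' b' where ab: "a = Suc a'" "b = Suc b'" by (metis not0_implies_Suc)
  have BA: "B ^ m * A = A * B ^ m" "A ^ m * B = B * A ^ m" for m
   using power_commuting_commutes[of A B m] power_commuting_commutes[of B A m] assms(1) by auto
  have Az: "A ^ a' \<cdot> (A \<cdot> z) = 0" using Suc.prems(1) unfolding ab power_Suc2 by simp
  have "B ^ b \<cdot> (A \<cdot> z) = (A * B ^ b) \<cdot> z" unfolding BA(1)[symmetric] by simp
  then have "B ^ b \<cdot> (A \<cdot> z) = 0" using Suc.prems(2) by simp
  then have 1: "(A - B) ^ (a' + b) \<cdot> (A \<cdot> z) = 0" using Suc.hyps(2) ab Az by (intro Suc.hyps(1)) simp_all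
  have Bz: "B ^ b' \<cdot> (B \<cdot> z) = 0" using Suc.prems(2) unfolding ab power_Suc2 by simp
  have "A ^ a \<cdot> (B \<cdot> z) = (B * A ^ a) \<cdot> z" unfolding BA(2)[symmetric] by simp
  then have "A ^ a \<cdot> (B \<cdot> z) = 0" using Suc.prems(1) by simp
  then have 2: "(A - B) ^ (a + b') \<cdot> (B \<cdot> z) = 0" using Suc.hyps(2) ab Bz by (intro Suc.hyps(1)) simp_all
  have e: "a + b = Suc (a' + b)" "a + b' = a' + b" using ab by auto
  have "(A - B) ^ (a + b) \<cdot> z = (A - B) ^ (a' + b) \<cdot> (A \<cdot> z) - (A - B) ^ (a' + b) \<cdot> (B \<cdot> z)"
   unfolding e(1) power_Suc2 by simp
  then show ?thesis using 1 2 unfolding e(2) by simp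
 qed
qed

definition LM :: "'v::cvec endo => 'v endo endo" where "LM a = endo_of (\<lambda>y. a * y)"
definition RM :: "'v::cvec endo => 'v endo endo" where "RM a = endo_of (\<lambda>y. y * a)"
definition ad :: "'v::cvec endo => 'v endo endo" where "ad x = endo_of (lb x)"

lemma LM_app [simp]: "LM a \<cdot> y = a * y" and RM_app [simp]: "RM a \<cdot> y = y * a" and ad_app [simp]: "ad x \<cdot> y = lb x y"
proof -
 have "clinear (\<lambda>y. a * y)" "clinear (\<lambda>y. y * a)" by (auto intro!: clinearI simp: distrib_left distrib_right)
 then show "LM a \<cdot> y = a * y" "RM a \<cdot> y = y * a" by (simp_all add: LM_def RM_def)
 show "ad x \<cdot> y = lb x y" by (simp add: ad_def clinear_lb)
qed

lemma LM_power [simp]: "LM a ^ n \<cdot> y = a ^ n * y"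
 by (induction n) (simp_all add: mult.assoc)

lemma RM_power [simp]: "RM a ^ n \<cdot> y = y * a ^ n"
proof (induction n)
 case (Suc n)
 then show ?case unfolding power_Suc2[of a] by (simp add: mult.assoc)
qed simp

lemma ad_generalized_eigenvector:
 assumes "(x - l *\<^sub>C 1) ^ K * z = 0" "z * (x - m *\<^sub>C 1) ^ K = 0"
 shows "(ad x - (l - m) *\<^sub>C 1) ^ (K + K) \<cdot> z = 0"
proof -
 have e: "ad x - (l - m) *\<^sub>C 1 = LM (x - l *\<^sub>C 1) - RM (x - m *\<^sub>C 1)"
  by (rule endo_eqI) (simp add: lb_def algebra_simps cv.scale_left_diff_distrib)
 have "LM (x - l *\<^sub>C 1) * RM (x - m *\<^sub>C 1) = RM (x - m *\<^sub>C 1) * LM (x - l *\<^sub>C 1)"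
  by (rule endo_eqI) (simp add: mult.assoc)
 then show ?thesis unfolding e using assms by (intro power_diff_zero) simp_all
qed

text \<open>The complex conjugate of the semisimple part of \<open>x\<close> acts on \<open>k\<close>, because it acts on the
 generalized eigenspaces of \<open>ad x\<close> by the conjugate eigenvalues.\<close>
lemma perfect_isotropic_nilpotent:
 assumes k: "subalg k" "k \<subseteq> fr" "k \<subseteq> lbs k k" and t: "\<And>a b. a \<in> k ==> b \<in> k ==> tr (a * b) = 0" and x: "x \<in> k"
 shows "\<exists>K. x ^ K = 0"
proof -
 have xfr: "x \<in> fr" using k(2) x by blast
 obtain S K p where S: "finite S" "0 \<in> S" "(\<Sum>l\<in>S. p l) = 1"
  and n: "\<And>l. l \<in> S ==> (x - l *\<^sub>C 1) ^ K * p l = 0"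
  and c: "\<And>l y. y * x = x * y ==> y * p l = p l * y"
  and p: "\<And>l. l \<in> S ==> p l * p l = p l" "\<And>l. l \<in> S ==> l \<noteq> 0 ==> p l \<in> fr"
  and tp: "\<And>l m. l \<in> S ==> l \<noteq> 0 ==> tr (x ^ m * p l) = l ^ m * tr (p l)"
  by (rule spectral[OF xfr]) (rule that)
 define s where "s = (\<Sum>l\<in>S. cnj l *\<^sub>C p l)"
 have sk: "lb s y \<in> k" if y: "y \<in> k" for y
 proof -
  let ?y = "\<lambda>(l, m). p l * y * p m" and ?e = "\<lambda>(l, m). l - m"
  have ysum: "y = (\<Sum>i\<in>S \<times> S. ?y i)"
  proof -
   have "y = (\<Sum>l\<in>S. p l) * y * (\<Sum>m\<in>S. p m)" using S(3) by simp
   also have "\<dots> = (\<Sum>l\<in>S. \<Sum>m\<in>S. p l * y * p m)" by (simp add: sum_distrib_left sum_distrib_right) (rule sum.swap)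
   finally show ?thesis by (simp add: sum.cartesian_product)
  qed
  have "(\<Sum>i\<in>S \<times> S. cnj (?e i) *\<^sub>C ?y i) \<in> k"
  proof (rule function_of_eigencomponents[where T = "ad x" and K = "K + K" and e = ?e and y = ?y and f = cnj])
   show "cv.subspace k" using k(1) by (rule subalg_D)
   show "ad x \<cdot> z \<in> k" if "z \<in> k" for z using subalg_D(2)[OF k(1) x that] by simp
   show "finite (S \<times> S)" using S(1) by simp
   show "(\<Sum>i\<in>S \<times> S. ?y i) \<in> k" using ysum y by simp
   fix i assume "i \<in> S \<times> S"
   then obtain l m where i: "i = (l, m)" "l \<in> S" "m \<in> S" by auto
   have "p m * (x - m *\<^sub>C 1) ^ K = (x - m *\<^sub>C 1) ^ K * p m"
    by (rule c[symmetric]) (rule power_commuting_commutes, simp add: algebra_simps)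
   then have "p l * y * p m * (x - m *\<^sub>C 1) ^ K = 0" using n[OF i(3)] by (simp add: mult.assoc)
   moreover have "(x - l *\<^sub>C 1) ^ K * (p l * y * p m) = 0" using n[OF i(2)] by (simp add: mult.assoc[symmetric])
   ultimately show "(ad x - ?e i *\<^sub>C 1) ^ (K + K) \<cdot> ?y i = 0" unfolding i(1) prod.case by (intro ad_generalized_eigenvector)
  qed
  also have "(\<Sum>i\<in>S \<times> S. cnj (?e i) *\<^sub>C ?y i) = lb s y"
  proof -
   have "(\<Sum>i\<in>S \<times> S. cnj (?e i) *\<^sub>C ?y i) = (\<Sum>l\<in>S. \<Sum>m\<in>S. cnj l *\<^sub>C (p l * y * p m) - cnj m *\<^sub>C (p l * y * p m))"
    unfolding sum.cartesian_product by (intro sum.cong refl) (auto simp: cv.scale_left_diff_distrib)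
   also have "\<dots> = (\<Sum>l\<in>S. \<Sum>m\<in>S. cnj l *\<^sub>C (p l * y * p m)) - (\<Sum>l\<in>S. \<Sum>m\<in>S. cnj m *\<^sub>C (p l * y * p m))"
    by (simp add: sum_subtractf)
   also have "(\<Sum>l\<in>S. \<Sum>m\<in>S. cnj l *\<^sub>C (p l * y * p m)) = (\<Sum>l\<in>S. cnj l *\<^sub>C p l) * y * (\<Sum>m\<in>S. p m)"
    by (simp add: sum_distrib_left sum_distrib_right) (rule sum.swap)
   also have "(\<Sum>l\<in>S. \<Sum>m\<in>S. cnj m *\<^sub>C (p l * y * p m)) = (\<Sum>l\<in>S. p l) * y * (\<Sum>m\<in>S. cnj m *\<^sub>C p m)"
    by (subst sum.swap) (simp add: sum_distrib_left sum_distrib_right cv.scale_sum_right)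
   finally show ?thesis using S(3) by (simp add: s_def lb_def)
  qed
  finally show ?thesis .
 qed
 have ts: "tr (z * s) = 0" if "z \<in> lbs k k" for z
  using that
 proof (induction rule: lbs_induct)
  case (lb a b)
  have "tr (lb a b * s) = tr (a * lb b s)" using lb k(2) by (intro tr_lb_assoc) auto
  also have "\<dots> = - tr (a * lb s b)" by (subst lb_swap) simp
  finally show ?case using t[OF lb(1) sk[OF lb(2)]] by simp
 qed (simp_all add: distrib_right)
 \<comment> \<open>Perfectness makes \<open>x\<close> a sum of brackets, so this trace vanishes. It
   equals the sum of \<open>|l|^2\<close> times the rank of \<open>p l\<close>, so no nonzero
   eigenvalue is left.\<close>
 have "0 = tr (x * s)" using ts x k(3) by auto
 also have "\<dots> = (\<Sum>l\<in>S. cnj l * tr (x ^ 1 * p l))" by (simp add: s_def sum_distrib_left tr_sum)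
 also have "\<dots> = (\<Sum>l\<in>S. of_real ((cmod l)\<^sup>2 * real (cv.dim (range (app (p l))))))"
 proof (intro sum.cong refl)
  fix l assume l: "l \<in> S"
  show "cnj l * tr (x ^ 1 * p l) = of_real ((cmod l)\<^sup>2 * real (cv.dim (range (app (p l)))))"
  proof (cases "l = 0")
   case False
   have "cnj l * tr (x ^ 1 * p l) = (l * cnj l) * tr (p l)" unfolding tp[OF l False] by simp
   then show ?thesis unfolding complex_norm_square[symmetric] tr_idem[OF p(2)[OF l False] p(1)[OF l]] by simp
  qed simp
 qed
 also have "\<dots> = of_real (\<Sum>l\<in>S. (cmod l)\<^sup>2 * real (cv.dim (range (app (p l)))))" by simp
 finally have "(\<Sum>l\<in>S. (cmod l)\<^sup>2 * real (cv.dim (range (app (p l))))) = 0" by (metis of_real_eq_0_iff)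
 then have z: "(cmod l)\<^sup>2 * real (cv.dim (range (app (p l)))) = 0" if "l \<in> S" for l
  using that S(1) by (subst (asm) sum_nonneg_eq_0_iff) auto
 have "p l = 0" if l: "l \<in> S" "l \<noteq> 0" for l
 proof -
  have "cv.dim (range (app (p l))) = 0" using z[OF l(1)] l(2) by simp
  then have "tr (p l) = 0" using tr_idem[OF p(2)[OF l] p(1)[OF l(1)]] by simp
  then show ?thesis using tr_idem_nonzero[OF p(2)[OF l] p(1)[OF l(1)]] by blast
 qed
 then have "p 0 = 1" using S by (simp add: sum.remove[of S 0])
 then have "x ^ K = 0" using n[OF S(2)] by simp
 then show ?thesis by blast
qed

text \<open>The stationary term \<open>k\<close> of the derived series is perfect and isotropic, so
  it consists of nilpotent operators, and by Engel long words in \<open>k\<close> vanish. But a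
  perfect \<open>k\<close> lies in the span of words of any prescribed length.\<close>

theorem Cartan_criterion:
 assumes h: "subalg h" "fd h" "h \<subseteq> fr" and t: "\<And>a b. a \<in> h ==> b \<in> h ==> tr (a * b) = 0"
 shows "solvable_lie scC lb h"
proof -
 obtain n where n: "dser h (Suc n) = dser h n" using dser_stable[OF h(1,2)] .
 define k where "k = dser h n"
 have k: "subalg k" "k \<subseteq> h" "k = lbs k k" using subalg_dser[OF h(1)] dser_subset[OF h(1)] n unfolding k_def by auto
 have "\<exists>K. x ^ K = 0" if "x \<in> k" for x
 proof (rule perfect_isotropic_nilpotent[OF k(1) _ _ _ that])
  show "k \<subseteq> lbs k k" using k(3) by simp
  show "k \<subseteq> fr" using k(2) h(3) by (rule subset_trans)
  show "tr (a * b) = 0" if "a \<in> k" "b \<in> k" for a b by (rule t) (use that k(2) in \<open>auto\<close>)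
 qed
 then obtain N where N: "nilp k N" using Engel[OF k(1) fd_subset[OF h(2) k(2)]] by blast
 have "k \<subseteq> cv.span {prod_list ys | ys. length ys = Suc j \<and> set ys \<subseteq> k}" for j
 proof (induction j)
  case 0
  have "x \<in> {prod_list ys | ys. length ys = Suc 0 \<and> set ys \<subseteq> k}" if "x \<in> k" for x
   using that by (intro CollectI exI[of _ "[x]"]) simp
  then show ?case by (auto intro: cv.span_base)
 next
  case (Suc j)
  let ?W = "\<lambda>n. {prod_list ys | ys. length ys = n \<and> set ys \<subseteq> k}"
  have prod: "a * b \<in> cv.span (?W (Suc (Suc j)))" if "a \<in> k" "b \<in> k" for a b
  proof -
   have "b \<in> cv.span (?W (Suc j))" using Suc that by blast
   then have "a * b \<in> cv.span {x * y | x y. x \<in> k \<and> y \<in> ?W (Suc j)}"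
    by (rule span_mult[OF cv.span_base[OF that(1)]])
   moreover have "{x * y | x y. x \<in> k \<and> y \<in> ?W (Suc j)} \<subseteq> ?W (Suc (Suc j))"
   proof
    fix z assume "z \<in> {x * y | x y. x \<in> k \<and> y \<in> ?W (Suc j)}"
    then obtain x ys where "z = x * prod_list ys" "x \<in> k" "length ys = Suc j" "set ys \<subseteq> k" by blast
    then have "z = prod_list (x # ys)" "length (x # ys) = Suc (Suc j)" "set (x # ys) \<subseteq> k" by auto
    then show "z \<in> ?W (Suc (Suc j))" by blast
   qed
   ultimately show ?thesis by (meson cv.span_mono subsetD)
  qed
  have "lbs k k \<subseteq> cv.span (?W (Suc (Suc j)))"
   by (rule lbs_subset) (auto simp: lb_def intro!: cv.span_diff prod)
  then show ?case using k(3) by simp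
 qed
 from this[of N] have "k \<subseteq> cv.span {prod_list ys | ys. length ys = Suc N \<and> set ys \<subseteq> k}" .
 moreover have "{prod_list ys | ys. length ys = Suc N \<and> set ys \<subseteq> k} \<subseteq> {0}"
  using nilp_ge[OF N] by auto
 then have "cv.span {prod_list ys | ys. length ys = Suc N \<and> set ys \<subseteq> k} \<subseteq> {0}" by (rule cv.span_minimal) simp
 ultimately have "k = {0}" using cv.subspace_0[OF subalg_D(1)[OF k(1)]] by blast
 then show ?thesis unfolding solvable_lie_def k_def by blast
qed

section \<open>Solvable ideals and the trace form\<close>

inductive_set alg1 :: "'v::cvec endo set => 'v endo set" for h where
 one: "1 \<in> alg1 h"
| mult: "x \<in> h ==> a \<in> alg1 h ==> x * a \<in> alg1 h"
| add: "a \<in> alg1 h ==> b \<in> alg1 h ==> a + b \<in> alg1 h"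
| scC: "a \<in> alg1 h ==> c *\<^sub>C a \<in> alg1 h"

lemma alg1_mult: "a \<in> alg1 h ==> b \<in> alg1 h ==> a * b \<in> alg1 h"
 by (induction rule: alg1.induct) (simp_all add: mult.assoc distrib_right alg1.mult alg1.add alg1.scC)

lemma alg1_base: "x \<in> h ==> x \<in> alg1 h"
 using alg1.mult[OF _ alg1.one, of x h] by simp

lemma alg1_power: "a \<in> alg1 h ==> a ^ n \<in> alg1 h"
 by (induction n) (simp_all add: alg1.one alg1_mult)

definition ideal_in :: "'v::cvec endo set => 'v endo set => bool" where
 "ideal_in n h \<longleftrightarrow> cv.subspace n \<and> n \<subseteq> h \<and> (\<forall>x\<in>h. \<forall>y\<in>n. lb x y \<in> n)"

lemma ideal_inD: "ideal_in n h ==> cv.subspace n" "ideal_in n h ==> x \<in> n ==> x \<in> h"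
 "ideal_in n h ==> x \<in> h ==> y \<in> n ==> lb x y \<in> n"
 "ideal_in n h ==> x \<in> h ==> y \<in> n ==> lb y x \<in> n"
 using cv.subspace_neg[of n "lb x y"] unfolding ideal_in_def lb_swap[of y x] by auto

lemma ideal_subalg: "ideal_in n h ==> subalg n"
 unfolding lie_subalgebra_def ideal_in_def by blast

lemma ideal_lbs: assumes "ideal_in n h" shows "ideal_in (lbs n n) h"
 unfolding ideal_in_def
proof (intro conjI ballI)
 show "cv.subspace (lbs n n)" by (rule lbs_subspace)
 show "lbs n n \<subseteq> h" using lbs_subalg[OF ideal_subalg[OF assms]] ideal_inD(2)[OF assms] by (meson subset_iff)
 fix x y assume x: "x \<in> h" and "y \<in> lbs n n"
 from this(2) show "lb x y \<in> lbs n n"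
 proof (induction rule: lbs_induct)
  case (lb a b)
  show ?case unfolding lb_jacobi[of x a b]
   by (intro cv.subspace_add[OF lbs_subspace] lbs_mem ideal_inD(3)[OF assms] x lb)
 qed (simp_all add: subspace_rules[OF lbs_subspace])
qed

lemma ideal_dser: "ideal_in n h ==> ideal_in (dser n k) h"
 by (induction k) (simp_all add: ideal_lbs)

text \<open>A substitute for the Jacobson radical of the associative algebra generated by
  \<open>h\<close>: it is stable under multiplication by \<open>alg1 h\<close> from both sides, and
  its elements that belong to \<open>alg1 h\<close> are nilpotent, since the traces of their powers
  vanish.\<close>

definition arad :: "'v::cvec endo set => 'v endo set" where
 "arad h = {w \<in> fr. \<forall>z\<in>alg1 h. tr (w * z) = 0}"

lemma arad_subspace: "cv.subspace (arad h)"
 unfolding arad_def by (rule cv.subspaceI) (simp_all add: fr_0 fr_add fr_scC distrib_right)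

lemma arad_right: "w \<in> arad h ==> a \<in> alg1 h ==> w * a \<in> arad h"
 unfolding arad_def by (simp add: fr_mult_right mult.assoc alg1_mult)

lemma arad_left:
 assumes w: "w \<in> arad h" and a: "a \<in> alg1 h" shows "a * w \<in> arad h"
proof -
 have "tr (a * w * z) = 0" if z: "z \<in> alg1 h" for z
 proof -
  have wf: "w \<in> fr" using w unfolding arad_def by simp
  have "tr (a * w * z) = tr (a * (w * z))" by (simp add: mult.assoc)
  also have "\<dots> = tr (w * (z * a))" using tr_comm[OF fr_mult_right[OF wf, of z], of a] by (simp add: mult.assoc)
  finally show ?thesis using w alg1_mult[OF z a] unfolding arad_def by simp
 qed
 then show ?thesis using w unfolding arad_def by (simp add: fr_mult_left)
qed

lemma arad_nilpotent: assumes w: "w \<in> arad h" "w \<in> alg1 h" shows "\<exists>K. w ^ K = 0"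
proof (rule nilpotent_if_traces)
 show "w \<in> fr" using w unfolding arad_def by simp
 fix m :: nat assume "m \<ge> 1"
 then have "w ^ m = w * w ^ (m - 1)" by (cases m) auto
 then show "tr (w ^ m) = 0" using w alg1_power[OF w(2)] unfolding arad_def by simp
qed

lemma lb_power_in:
 assumes R: "cv.subspace R" "\<And>w a. w \<in> R ==> a \<in> A ==> w * a \<in> R" "\<And>w a. w \<in> R ==> a \<in> A ==> a * w \<in> R"
  and A: "\<And>n. c ^ n \<in> A" and c: "lb y c \<in> R"
 shows "lb y (c ^ n) \<in> R"
proof (induction n)
 case 0
 show ?case using cv.subspace_0[OF R(1)] by (simp add: lb_def)
next
 case (Suc n)
 have "lb y (c ^ Suc n) = lb y c * c ^ n + c * lb y (c ^ n)" by (simp add: lb_def algebra_simps)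
 also have "\<dots> \<in> R" using R(2)[OF c A[of n]] R(3)[OF Suc A[of 1]] by (simp add: cv.subspace_add[OF R(1)])
 finally show ?case .
qed

text \<open>One step up the derived series of a solvable ideal, in place of Lie's theorem on common
  eigenvectors. Modulo \<open>arad h\<close> the hypothesis makes \<open>[n, n]\<close> central in
  \<open>alg1 h\<close>; this forces first \<open>[n, n]\<close> and then \<open>[n, h]\<close> into
  \<open>arad h\<close>.\<close>

lemma solvable_ideal_step:
 assumes h: "subalg h" "fd h" "h \<subseteq> fr" and n: "ideal_in n h"
  and IH: "\<And>x y. x \<in> lbs n n ==> y \<in> h ==> lb x y \<in> arad h" and xy: "x \<in> n" "y \<in> h"
 shows "lb x y \<in> arad h"
proof -
 note R = arad_subspace[of h] arad_right[of _ h] arad_left[of _ h]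
 have nh: "x \<in> h" if "x \<in> n" for x using ideal_inD(2)[OF n that] .
 have nA: "x \<in> alg1 h" if "x \<in> n" for x using alg1_base[OF nh[OF that]] .
 have lbR: "lb c z \<in> arad h" if "c \<in> lbs n n" "z \<in> alg1 h" for c z
  using that(2)
 proof (induction rule: alg1.induct)
  case one
  then show ?case using cv.subspace_0[OF R(1)] by (simp add: lb_def)
 next
  case (mult u a)
  have "c \<in> alg1 h" using ideal_inD(2)[OF ideal_lbs[OF n] that(1)] by (rule alg1_base)
  have "lb c (u * a) = lb c u * a + u * lb c a" by (simp add: lb_def algebra_simps)
  also have "\<dots> \<in> arad h" by (intro cv.subspace_add[OF R(1)] R(2,3) IH that mult alg1_base)
  finally show ?case .
 qed (simp_all add: cv.subspace_add[OF R(1)] cv.subspace_scale[OF R(1)])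
 have comm: "lb a b \<in> arad h" if ab: "a \<in> n" "b \<in> n" for a b
 proof -
  define c where "c = lb a b"
  have cn: "c \<in> lbs n n" unfolding c_def using ab by (rule lbs_mem)
  have cA: "c \<in> alg1 h" by (rule alg1_base[OF ideal_inD(2)[OF ideal_lbs[OF n] cn]])
  have cf: "c \<in> fr" using h(3) nh[OF ab(1)] unfolding c_def by (intro lb_fr) auto
  have lbc: "lb z (c ^ m) \<in> arad h" if "z \<in> alg1 h" for z m
  proof (rule lb_power_in[OF R])
   show "lb z c \<in> arad h" using cv.subspace_neg[OF R(1) lbR[OF cn that]] by (simp add: lb_swap[of z c])
  qed (use alg1_power[OF cA] in auto)
  \<comment> \<open>Since \<open>c = [a, b]\<close> commutes with \<open>b\<close> modulo
    \<open>arad h\<close>, invariance turns \<open>tr (c ^ m)\<close> into the trace of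
    \<open>a\<close> times an element of \<open>arad h\<close>.\<close>
  have "\<exists>K. c ^ K = 0"
  proof (rule nilpotent_if_traces[OF cf])
   fix m :: nat assume "m \<ge> 1"
   then have "tr (c ^ m) = tr (lb a b * c ^ (m - 1))" by (cases m) (simp_all add: c_def)
   also have "\<dots> = tr (a * lb b (c ^ (m - 1)))"
    using h(3) nh ab by (intro tr_lb_assoc) auto
   also have "\<dots> = tr (lb b (c ^ (m - 1)) * a)" using h(3) nh[OF ab(1)] by (intro tr_comm) auto
   also have "\<dots> = 0" using lbc[OF nA[OF ab(2)], of "m - 1"] nA[OF ab(1)] unfolding arad_def by simp
   finally show "tr (c ^ m) = 0" .
  qed
  then obtain K where K: "c ^ K = 0" by blast
  have "tr (c * z) = 0" if z: "z \<in> alg1 h" for z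
  proof -
   \<comment> \<open>As \<open>c\<close> is central modulo \<open>arad h\<close>, powers of
     \<open>c * z\<close> may be computed factorwise up to \<open>arad h\<close>. At the exponent
     \<open>K\<close> only an element of \<open>arad h\<close> is left, and it is nilpotent.\<close>
   have "(c * z) ^ m - c ^ m * z ^ m \<in> arad h" for m
   proof (induction m)
    case 0
    then show ?case using cv.subspace_0[OF R(1)] by simp
   next
    case (Suc m)
    have "(c * z) ^ Suc m - c ^ Suc m * z ^ Suc m
      = (c * z) * ((c * z) ^ m - c ^ m * z ^ m) + c * (lb z (c ^ m) * z ^ m)"
     by (simp add: lb_def algebra_simps power_commutes mult.assoc)
    also have "\<dots> \<in> arad h"
     by (intro cv.subspace_add[OF R(1)] R(2,3) Suc lbc z cA alg1_mult alg1_power)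
    finally show ?case .
   qed
   from this[of K] have "(c * z) ^ K \<in> arad h" using K by simp
   then obtain j where "((c * z) ^ K) ^ j = 0"
    using arad_nilpotent[OF _ alg1_power[OF alg1_mult[OF cA z]]] by blast
   then show ?thesis using tr_nilpotent[OF fr_mult_right[OF cf, of z]] by (simp add: power_mult[symmetric])
  qed
  then show ?thesis unfolding c_def[symmetric] arad_def using cf by simp
 qed
 \<comment> \<open>By now elements of \<open>n\<close> commute with each other modulo
   \<open>arad h\<close>. By invariance this makes every element of \<open>[n, h]\<close> nilpotent,
   so that Engel applies to this ideal.\<close>
 define b where "b = lbs n h"
 have bn: "w \<in> n" if "w \<in> b" for w
  using lbs_subset[OF ideal_inD(1)[OF n] ideal_inD(4)[OF n], of n h] that unfolding b_def by auto
 have bi: "ideal_in b h"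
  unfolding ideal_in_def
 proof (intro conjI ballI subsetI)
  show "cv.subspace b" unfolding b_def by (rule lbs_subspace)
  show "w \<in> h" if "w \<in> b" for w using nh[OF bn[OF that]] .
  show "lb u w \<in> b" if "u \<in> h" "w \<in> b" for u w
   using cv.subspace_neg[OF lbs_subspace lbs_mem[OF bn[OF that(2)] that(1)]] unfolding b_def lb_swap[of u w] .
 qed
 have nil: "\<exists>K. w ^ K = 0" if w: "w \<in> b" for w
 proof (rule nilpotent_if_traces)
  have wn: "w \<in> n" by (rule bn[OF w])
  show "w \<in> fr" using h(3) nh[OF wn] by auto
  fix m :: nat assume "m \<ge> 1"
  have "tr (w' * w ^ j) = 0" if "w' \<in> b" for w' j
   using that unfolding b_def
  proof (induction rule: lbs_induct)
   case (lb x y)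
   have fx: "x \<in> fr" "y \<in> fr" using h(3) nh[OF lb(1)] lb(2) by auto
   have "lb x (w ^ j) \<in> arad h"
    by (rule lb_power_in[OF R]) (use alg1_power[OF nA[OF wn]] comm[OF lb(1) wn] in auto)
   then have "tr (lb x (w ^ j) * y) = 0" using alg1_base[OF lb(2)] unfolding arad_def by simp
   moreover have "tr (lb y x * w ^ j) = tr (y * lb x (w ^ j))" using fx by (intro tr_lb_assoc) auto
   ultimately show ?case using tr_comm[OF fx(2), of "lb x (w ^ j)"] by (simp add: lb_swap[of x y])
  qed (simp_all add: distrib_right)
  from this[OF w, of "m - 1"] \<open>m \<ge> 1\<close> show "tr (w ^ m) = 0" by (cases m) auto
 qed
 obtain Q where Q: "nilp b Q"
  using Engel[OF ideal_subalg[OF bi] fd_subset[OF h(2)] nil] ideal_inD(2)[OF bi] by blast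
 \<comment> \<open>A filtration by the number of leading letters from the ideal \<open>b\<close>.
   Elements of \<open>h\<close> pass through these letters at the cost of brackets that lie in
   \<open>b\<close> again, so \<open>B i\<close> is stable under \<open>alg1 h\<close> and contains
   \<open>(w * z) ^ i\<close>.\<close>
 define B where "B i = cv.span {prod_list ws * z | ws z. length ws = i \<and> set ws \<subseteq> b \<and> z \<in> alg1 h}" for i
 have hB': "u * (prod_list ws * z) \<in> B (length ws)" if "u \<in> h" "set ws \<subseteq> b" "z \<in> alg1 h" for u ws z
  using that(2)
 proof (induction ws)
  case Nil
  have "u * (prod_list [] * z) = prod_list [] * (u * z)" by simp
  then have "u * (prod_list [] * z) \<in> {prod_list ws * z | ws z. length ws = length [] \<and> set ws \<subseteq> b \<and> z \<in> alg1 h}"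
   using alg1.mult[OF that(1,3)] by (intro CollectI exI[of _ "[]"] exI[of _ "u * z"]) simp
  then show ?case unfolding B_def by (rule cv.span_base)
 next
  case (Cons w ws)
  have w: "w * y \<in> B (Suc (length ws))" if "w \<in> b" "y \<in> B (length ws)" for w y
   using that(2) unfolding B_def
  proof (induction rule: cv.span_induct_alt)
   case (step d x y)
   then obtain vs z' where "x = prod_list vs * z'" "length vs = length ws" "set vs \<subseteq> b" "z' \<in> alg1 h" by blast
   then have "w * x = prod_list (w # vs) * z'" "length (w # vs) = Suc (length ws)" "set (w # vs) \<subseteq> b" "z' \<in> alg1 h"
    using that(1) by (auto simp: mult.assoc)
   then have "w * x \<in> cv.span {prod_list ws' * z | ws' z. length ws' = Suc (length ws) \<and> set ws' \<subseteq> b \<and> z \<in> alg1 h}"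
    by (intro cv.span_base) blast
   then show ?case using step by (simp add: distrib_left cv.span_add cv.span_scale)
  qed (simp add: cv.span_zero)
  have "u * (prod_list (w # ws) * z) = w * (u * (prod_list ws * z)) + lb u w * (prod_list ws * z)"
   by (simp add: lb_def algebra_simps mult.assoc)
  moreover have "w * (u * (prod_list ws * z)) \<in> B (Suc (length ws))"
   using Cons by (intro w) auto
  moreover have "lb u w * (prod_list ws * z) \<in> B (Suc (length ws))"
  proof (rule w)
   show "lb u w \<in> b" using Cons.prems by (intro ideal_inD(3)[OF bi that(1)]) auto
   have "prod_list ws * z \<in> {prod_list ws' * z | ws' z. length ws' = length ws \<and> set ws' \<subseteq> b \<and> z \<in> alg1 h}"
    using Cons.prems that(3) by (intro CollectI exI[of _ ws] exI[of _ z]) simp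
   then show "prod_list ws * z \<in> B (length ws)" unfolding B_def by (rule cv.span_base)
  qed
  ultimately show ?case unfolding B_def by (simp add: cv.span_add)
 qed
 have hB: "u * y \<in> B i" if "u \<in> h" "y \<in> B i" for u y i
  using that(2) unfolding B_def
 proof (induction rule: cv.span_induct_alt)
  case (step d x y)
  then obtain vs z' where "x = prod_list vs * z'" "length vs = i" "set vs \<subseteq> b" "z' \<in> alg1 h" by blast
  then have "u * x \<in> cv.span {prod_list ws' * z | ws' z. length ws' = i \<and> set ws' \<subseteq> b \<and> z \<in> alg1 h}"
   using hB'[OF that(1), of vs z'] unfolding B_def by simp
  then show ?case using step by (simp add: distrib_left cv.span_add cv.span_scale)
 qed (simp add: cv.span_zero)
 have aB: "a * y \<in> B i" if "a \<in> alg1 h" "y \<in> B i" for a y i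
  using that(1)
 proof (induction rule: alg1.induct)
  case (mult x a)
  then show ?case using hB by (simp add: mult.assoc)
 qed (use that(2) in \<open>simp_all add: distrib_right B_def cv.span_add cv.span_scale\<close>)
 have wB: "w * y \<in> B (Suc i)" if "w \<in> b" "y \<in> B i" for w y i
  using that(2) unfolding B_def
 proof (induction rule: cv.span_induct_alt)
  case (step d x y)
  then obtain vs z' where "x = prod_list vs * z'" "length vs = i" "set vs \<subseteq> b" "z' \<in> alg1 h" by blast
  then have "w * x = prod_list (w # vs) * z'" "length (w # vs) = Suc i" "set (w # vs) \<subseteq> b" "z' \<in> alg1 h"
   using that(1) by (auto simp: mult.assoc)
  then have "w * x \<in> cv.span {prod_list ws' * z | ws' z. length ws' = Suc i \<and> set ws' \<subseteq> b \<and> z \<in> alg1 h}"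
   by (intro cv.span_base) blast
  then show ?case using step by (simp add: distrib_left cv.span_add cv.span_scale)
 qed (simp add: cv.span_zero)
 have B0: "1 \<in> B 0"
 proof -
  have "(1::'a endo) \<in> {prod_list ws * z | ws z. length ws = 0 \<and> set ws \<subseteq> b \<and> z \<in> alg1 h}"
   by (intro CollectI exI[of _ "[]"] exI[of _ 1]) (simp add: alg1.one)
  then show ?thesis unfolding B_def by (rule cv.span_base)
 qed
 have BQ: "y = 0" if "y \<in> B Q" for y
 proof -
  have "{prod_list ws * z | ws z. length ws = Q \<and> set ws \<subseteq> b \<and> z \<in> alg1 h} \<subseteq> {0}"
   using nilp_ge[OF Q] by auto
  then have "B Q \<subseteq> {0}" unfolding B_def by (rule cv.span_minimal) simp
  then show ?thesis using that by auto
 qed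
 define w where "w = lb x y"
 have wb: "w \<in> b" unfolding w_def b_def using xy by (rule lbs_mem)
 have wf: "w \<in> fr" using h(3) nh[OF bn[OF wb]] by auto
 have "tr (w * z) = 0" if "z \<in> alg1 h" for z
 proof -
  have "(w * z) ^ i \<in> B i" for i
  proof (induction i)
   case (Suc i)
   then show ?case using wB[OF wb aB[OF that Suc]] by (simp add: mult.assoc)
  qed (use B0 in simp)
  then have "(w * z) ^ Q = 0" by (rule BQ)
  then show ?thesis by (rule tr_nilpotent[OF fr_mult_right[OF wf]])
 qed
 then show ?thesis unfolding w_def[symmetric] arad_def using wf by simp
qed

text \<open>Descending induction along the derived series of \<open>n\<close>, starting where it is
  zero.\<close>

lemma solvable_ideal_arad:
 assumes h: "subalg h" "fd h" "h \<subseteq> fr" and n: "ideal_in n h" "solvable_lie scC lb n" and xy: "x \<in> n" "y \<in> h"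
 shows "lb x y \<in> arad h"
proof -
 obtain k where k: "dser n k = {0}" using n(2) unfolding solvable_lie_def by blast
 have step: "\<forall>x\<in>dser n m. \<forall>y\<in>h. lb x y \<in> arad h" if IH: "\<forall>x\<in>dser n (Suc m). \<forall>y\<in>h. lb x y \<in> arad h" for m
 proof (intro ballI)
  fix x y assume x: "x \<in> dser n m" and y: "y \<in> h"
  show "lb x y \<in> arad h"
  proof (rule solvable_ideal_step[OF h ideal_dser[OF n(1)] _ x y])
   fix u v assume "u \<in> lbs (dser n m) (dser n m)" "v \<in> h"
   then show "lb u v \<in> arad h" using IH unfolding derived_series.simps(2) by blast
  qed
 qed
 have "\<forall>x\<in>dser n 0. \<forall>y\<in>h. lb x y \<in> arad h"
 proof (rule inc_induct[of 0 k "\<lambda>m. \<forall>x\<in>dser n m. \<forall>y\<in>h. lb x y \<in> arad h"])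
  show "\<forall>x\<in>dser n k. \<forall>y\<in>h. lb x y \<in> arad h" unfolding k using cv.subspace_0[OF arad_subspace[of h]] by simp
 qed (use step in auto)
 then show ?thesis using xy unfolding derived_series.simps(1) by blast
qed

lemma solvable_ideal_trace:
 assumes h: "subalg h" "fd h" "h \<subseteq> fr" and n: "ideal_in n h" "solvable_lie scC lb n" and xy: "x \<in> n" "y \<in> lbs h h"
 shows "tr (x * y) = 0"
 using xy(2)
proof (induction rule: lbs_induct)
 case (lb a b)
 have "tr (lb x a * b) = tr (x * lb a b)" using h(3) lb by (intro tr_lb_assoc) auto
 then show ?case using solvable_ideal_arad[OF h n xy(1) lb(1)] alg1_base[OF lb(2)] unfolding arad_def by simp
qed (simp_all add: distrib_left)

section \<open>Invariants of modules over a Lie algebra with nondegenerate trace form\<close>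

text \<open>The form may be degenerate: \<open>B\<close> is an orthonormal basis of a complement of
  the radical, and the last clause places the remainder in the radical. Polarization provides a
  vector with \<open>Bf a a \<noteq> 0\<close> unless the form is zero, and a complex square root
  normalizes it.\<close>

lemma orthonormal_basis:
 fixes Bf :: "'a::cvec => 'a => complex"
 assumes "cv.subspace k" "fd k" and lin: "\<And>x. clinear (Bf x)" "\<And>y. clinear (\<lambda>x. Bf x y)"
  and "\<And>x y. x \<in> k ==> y \<in> k ==> Bf x y = Bf y x"
 shows "\<exists>B. finite B \<and> B \<subseteq> k \<and> (\<forall>a\<in>B. \<forall>b\<in>B. Bf a b = (if a = b then 1 else 0)) \<and>
  (\<forall>x\<in>k. \<forall>y\<in>k. Bf (x - (\<Sum>b\<in>B. Bf x b *\<^sub>C b)) y = 0)"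
 using assms(1,2,5)
proof (induction "cv.dim k" arbitrary: k rule: less_induct)
 case less
 note k = less.prems(1) and sym = less.prems(3)
 have l1: "Bf (x + y) z = Bf x z + Bf y z" "Bf (x - y) z = Bf x z - Bf y z" "Bf (c *\<^sub>C x) z = c * Bf x z"
  "Bf z (x + y) = Bf z x + Bf z y" "Bf z (x - y) = Bf z x - Bf z y" "Bf z (c *\<^sub>C x) = c * Bf z x" "Bf 0 z = 0" for x y z c
  using clinear_add[OF lin(2), of x y z] clinear_diff[OF lin(2), of x y z] clinear_scC[OF lin(2), of c x z]
   clinear_add[OF lin(1)] clinear_diff[OF lin(1)] clinear_scC[OF lin(1)] clinear_0[OF lin(2), of z] by simp_all
 show ?case
 proof (cases "\<forall>x\<in>k. \<forall>y\<in>k. Bf x y = 0")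
  case True
  then show ?thesis by (intro exI[of _ "{}"]) simp
 next
  case False
  have "\<exists>a\<in>k. Bf a a \<noteq> 0"
  proof (rule ccontr)
   assume "\<not> (\<exists>a\<in>k. Bf a a \<noteq> 0)"
   then have z: "Bf a a = 0" if "a \<in> k" for a using that by auto
   have "Bf x y = 0" if xy: "x \<in> k" "y \<in> k" for x y
   proof -
    have "Bf (x + y) (x + y) = Bf x x + Bf x y + Bf y x + Bf y y" by (simp add: l1)
    then have "0 = Bf x y + Bf x y" using z[OF xy(1)] z[OF xy(2)] z[OF cv.subspace_add[OF k xy]] sym[OF xy] by simp
    then show ?thesis by simp
   qed
   then show False using False by blast
  qed
  then obtain a where a: "a \<in> k" "Bf a a \<noteq> 0" by blast
  define o1 where "o1 = inverse (csqrt (Bf a a)) *\<^sub>C a"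
  have o1k: "o1 \<in> k" unfolding o1_def by (rule cv.subspace_scale[OF k a(1)])
  have sq: "csqrt (Bf a a) * csqrt (Bf a a) = Bf a a" using power2_csqrt[of "Bf a a"] by (simp add: power2_eq_square)
  have o11: "Bf o1 o1 = 1" unfolding o1_def l1 using a(2) sq by (simp add: field_simps)
  define k' where "k' = {x \<in> k. Bf x o1 = 0}"
  have k's: "cv.subspace k'" unfolding k'_def
   by (rule cv.subspaceI) (simp_all add: l1 subspace_rules[OF k])
  have "o1 \<notin> k'" "k' \<subseteq> k" using o11 unfolding k'_def by auto
  then have k'k: "k' \<subset> k" using o1k by blast
  have "fd k'" by (rule fd_subset[OF less.prems(2)]) (use k'k in blast)
  moreover have "Bf x y = Bf y x" if "x \<in> k'" "y \<in> k'" for x y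
   using that by (intro sym) (simp_all add: k'_def)
  ultimately have "\<exists>B. finite B \<and> B \<subseteq> k' \<and> (\<forall>a\<in>B. \<forall>b\<in>B. Bf a b = (if a = b then 1 else 0)) \<and>
   (\<forall>x\<in>k'. \<forall>y\<in>k'. Bf (x - (\<Sum>b\<in>B. Bf x b *\<^sub>C b)) y = 0)"
   by (rule less.hyps[OF fd_dim_less[OF less.prems(2) k'k k's k] k's])
  then obtain B where B: "finite B" "B \<subseteq> k'" "\<forall>a\<in>B. \<forall>b\<in>B. Bf a b = (if a = b then 1 else 0)"
   "\<forall>x\<in>k'. \<forall>y\<in>k'. Bf (x - (\<Sum>b\<in>B. Bf x b *\<^sub>C b)) y = 0"
   by (elim exE conjE) (rule that)
  have Bo: "Bf b o1 = 0" "b \<in> k" if "b \<in> B" for b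
   using subsetD[OF B(2) that] unfolding k'_def by simp_all
  have Bo': "Bf o1 b = 0" if "b \<in> B" for b using Bo(1)[OF that] sym[OF Bo(2)[OF that] o1k] by simp
  have oB: "o1 \<notin> B" using Bo(1)[of o1] o11 by auto
  show ?thesis
  proof (intro exI[of _ "insert o1 B"] conjI ballI)
   show "finite (insert o1 B)" using B(1) by simp
   show "insert o1 B \<subseteq> k" using o1k Bo(2) by auto
   show "Bf a b = (if a = b then 1 else 0)" if "a \<in> insert o1 B" "b \<in> insert o1 B" for a b
   proof (cases "a = o1")
    case True
    then show ?thesis using that(2) Bo' oB o11 by auto
   next
    case a: False
    then have "a \<in> B" using that(1) by simp
    then show ?thesis using that(2) Bo(1) oB B(3) by (cases "b = o1") auto
   qed
  next
   fix x y assume x: "x \<in> k" and y: "y \<in> k"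
   define x' where "x' = x - Bf x o1 *\<^sub>C o1"
   have "x' \<in> k" unfolding x'_def by (rule cv.subspace_diff[OF k x cv.subspace_scale[OF k o1k]])
   moreover have "Bf x' o1 = 0" unfolding x'_def l1 o11 by simp
   ultimately have x': "x' \<in> k'" unfolding k'_def by simp
   have xb: "Bf x b = Bf x' b" if "b \<in> B" for b unfolding x'_def l1 Bo'[OF that] by simp
   have "(\<Sum>b\<in>B. Bf x b *\<^sub>C b) = (\<Sum>b\<in>B. Bf x' b *\<^sub>C b)" by (rule sum.cong[OF refl]) (simp only: xb)
   then have e: "x - (\<Sum>b\<in>insert o1 B. Bf x b *\<^sub>C b) = x' - (\<Sum>b\<in>B. Bf x' b *\<^sub>C b)"
    unfolding sum.insert[OF B(1) oB] by (simp only: diff_diff_eq[symmetric] x'_def)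
   define y' where "y' = y - Bf y o1 *\<^sub>C o1"
   have "y' \<in> k" unfolding y'_def by (rule cv.subspace_diff[OF k y cv.subspace_scale[OF k o1k]])
   moreover have "Bf y' o1 = 0" unfolding y'_def l1 o11 by simp
   ultimately have y': "y' \<in> k'" unfolding k'_def by simp
   have mem: "x' - (\<Sum>b\<in>B. Bf x' b *\<^sub>C b) \<in> k'"
    by (intro cv.subspace_diff[OF k's x'] cv.subspace_sum[OF k's] cv.subspace_scale[OF k's]) (rule subsetD[OF B(2)])
   have "Bf (x' - (\<Sum>b\<in>B. Bf x' b *\<^sub>C b)) y = Bf (x' - (\<Sum>b\<in>B. Bf x' b *\<^sub>C b)) y' + Bf y o1 * Bf (x' - (\<Sum>b\<in>B. Bf x' b *\<^sub>C b)) o1"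
    unfolding y'_def l1(5) l1(6) by simp
   also have "Bf (x' - (\<Sum>b\<in>B. Bf x' b *\<^sub>C b)) y' = 0" using B(4) x' y' by blast
   also have "Bf (x' - (\<Sum>b\<in>B. Bf x' b *\<^sub>C b)) o1 = 0" using mem unfolding k'_def by simp
   finally show "Bf (x - (\<Sum>b\<in>insert o1 B. Bf x b *\<^sub>C b)) y = 0" unfolding e by simp
  qed
 qed
qed

lemma orthonormal_residue:
 assumes B: "finite B" "\<forall>a\<in>B. \<forall>b\<in>B. tr (a * b) = (if a = b then 1 else 0)" and c: "c \<in> B"
 shows "tr ((x - (\<Sum>b\<in>B. tr (x * b) *\<^sub>C b)) * c) = 0"
proof -
 have "tr ((\<Sum>b\<in>B. tr (x * b) *\<^sub>C b) * c) = (\<Sum>b\<in>B. tr (x * b) * tr (b * c))" by (simp add: sum_distrib_right tr_sum)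
 also have "\<dots> = (\<Sum>b\<in>B. if b = c then tr (x * c) else 0)" using B(2) c by (intro sum.cong) auto
 also have "\<dots> = tr (x * c)" using B(1) c by simp
 finally show ?thesis by (simp add: left_diff_distrib)
qed

lemma tr_form_linear: "clinear (\<lambda>y. tr (x * y))" "clinear (\<lambda>x. tr (x * y))"
 by (auto intro!: clinearI simp: distrib_left distrib_right)

definition trad :: "'v::cvec endo set => 'v endo set" where
 "trad H = {x \<in> H. \<forall>y\<in>H. tr (x * y) = 0}"

lemma perp_subspace: "cv.subspace I ==> cv.subspace {x \<in> I. \<forall>y\<in>J. tr (x * y) = 0}"
 by (rule cv.subspaceI) (simp_all add: subspace_rules distrib_right)

lemma perp_ideal:
 assumes I: "ideal_in I g" and g: "g \<subseteq> fr" and J: "\<And>x y. x \<in> g ==> y \<in> J ==> lb x y \<in> J"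
 shows "ideal_in {x \<in> I. \<forall>y\<in>J. tr (x * y) = 0} g"
 unfolding ideal_in_def
proof (intro conjI ballI)
 show "cv.subspace {x \<in> I. \<forall>y\<in>J. tr (x * y) = 0}" by (rule perp_subspace[OF ideal_inD(1)[OF I]])
 show "{x \<in> I. \<forall>y\<in>J. tr (x * y) = 0} \<subseteq> g" using ideal_inD(2)[OF I] by blast
 fix a b assume a: "a \<in> g" and "b \<in> {x \<in> I. \<forall>y\<in>J. tr (x * y) = 0}"
 then have b: "b \<in> I" "\<And>y. y \<in> J ==> tr (b * y) = 0" by auto
 have "tr (lb a b * y) = 0" if y: "y \<in> J" for y
 proof -
  have "a \<in> fr" "b \<in> fr" using a g ideal_inD(2)[OF I b(1)] by auto
  then have "tr (lb b a * y) = tr (b * lb a y)" by (intro tr_lb_assoc) auto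
  also have "\<dots> = 0" by (rule b(2)[OF J[OF a y]])
  finally show ?thesis unfolding lb_swap[of a b] by simp
 qed
 then show "lb a b \<in> {x \<in> I. \<forall>y\<in>J. tr (x * y) = 0}" using ideal_inD(3)[OF I a b(1)] by blast
qed

lemma trad_ideal:
 assumes H: "subalg H" "H \<subseteq> fr" shows "ideal_in (trad H) H"
 unfolding trad_def
 by (rule perp_ideal) (use H subalg_D[OF H(1)] in \<open>simp_all add: ideal_in_def\<close>)

lemma trad_subspace: "subalg H ==> H \<subseteq> fr ==> cv.subspace (trad H)"
 using trad_ideal ideal_inD(1) by blast

text \<open>For the radical \<open>n\<close> of the trace form on \<open>H\<close>, this is what remains of semisimplicity of \<open>H / n\<close>.\<close>
definition tperfect :: "'v::cvec endo set => bool" where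
 "tperfect H \<longleftrightarrow> (\<forall>x\<in>H. \<exists>a\<in>lbs H H. x - a \<in> trad H)"

text \<open>The analogue of the perfectness of ideals in a semisimple algebra. \<open>H\<close> is
  the sum of \<open>K\<close> and its orthogonal \<open>Kp\<close>; the two commute modulo
  \<open>trad H\<close>, so brackets in \<open>H\<close> are brackets in \<open>K\<close> up to
  elements of \<open>Kp\<close>.\<close>

lemma ideal_tperfect:
 assumes H: "subalg H" "fd H" "H \<subseteq> fr" "tperfect H" and K: "ideal_in K H" "trad H \<subseteq> K" and x: "x \<in> K"
 shows "\<exists>a\<in>lbs K K. x - a \<in> trad H"
proof -
 have KH: "u \<in> H" if "u \<in> K" for u by (rule ideal_inD(2)[OF K(1) that])
 have Ks: "subalg K" by (rule ideal_subalg[OF K(1)])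
 have Kfr: "K \<subseteq> fr" using KH H(3) by auto
 note Hs = subalg_D(1)[OF H(1)] and Kv = ideal_inD(1)[OF K(1)]
 define q where "q = trad K"
 have qfd: "fd q" by (rule fd_subset[OF H(2)]) (use KH in \<open>auto simp: q_def trad_def\<close>)
 have qH: "ideal_in q H"
  unfolding ideal_in_def
 proof (intro conjI ballI)
  show "cv.subspace q" unfolding q_def by (rule trad_subspace[OF Ks Kfr])
  show "q \<subseteq> H" using KH unfolding q_def trad_def by auto
  fix u v assume u: "u \<in> H" and v: "v \<in> q"
  have vK: "v \<in> K" using v unfolding q_def trad_def by simp
  have "tr (lb u v * z) = 0" if z: "z \<in> K" for z
  proof -
   have "tr (lb v u * z) = tr (v * lb u z)" using H(3) u KH[OF vK] by (intro tr_lb_assoc) auto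
   also have "\<dots> = 0" using v ideal_inD(3)[OF K(1) u z] unfolding q_def trad_def by simp
   finally show ?thesis by (simp add: lb_swap[of u v])
  qed
  then show "lb u v \<in> q" using ideal_inD(3)[OF K(1) u vK] unfolding q_def trad_def by simp
 qed
 have qsol: "solvable_lie scC lb q"
  by (rule Cartan_criterion[OF ideal_subalg[OF qH] qfd]) (use Kfr in \<open>auto simp: q_def trad_def\<close>)
 \<comment> \<open>The radical \<open>q\<close> of the form on \<open>K\<close> is a solvable ideal
   by Cartan's criterion, hence orthogonal to \<open>[H, H]\<close>; as \<open>H\<close> is perfect
   modulo \<open>trad H\<close>, it is orthogonal to all of \<open>H\<close>.\<close>
 have qn: "v \<in> trad H" if v: "v \<in> q" for v
 proof -
  have vH: "v \<in> H" by (rule ideal_inD(2)[OF qH v])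
  have "tr (v * y) = 0" if y: "y \<in> H" for y
  proof -
   obtain a where a: "a \<in> lbs H H" "y - a \<in> trad H" using H(4) y unfolding tperfect_def by blast
   have "tr (v * a) = 0" by (rule solvable_ideal_trace[OF H(1-3) qH qsol v a(1)])
   moreover have "tr (v * (y - a)) = tr ((y - a) * v)" using H(3) vH by (intro tr_comm) auto
   moreover have "tr ((y - a) * v) = 0" using a(2) vH unfolding trad_def by simp
   ultimately show ?thesis by (simp add: right_diff_distrib)
  qed
  then show ?thesis using vH unfolding trad_def by simp
 qed
 have sym: "tr (a * b) = tr (b * a)" if "a \<in> H" for a b using H(3) that by (intro tr_comm) auto
 obtain B where B: "finite B" "B \<subseteq> K" "\<forall>a\<in>B. \<forall>b\<in>B. tr (a * b) = (if a = b then 1 else 0)"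
  "\<forall>x\<in>K. \<forall>y\<in>K. tr ((x - (\<Sum>b\<in>B. tr (x * b) *\<^sub>C b)) * y) = 0"
 proof -
  have "fd K" by (rule fd_subset[OF H(2)]) (rule subsetI, rule KH)
  moreover have "tr (a * b) = tr (b * a)" if "a \<in> K" "b \<in> K" for a b by (rule sym[OF KH[OF that(1)]])
  ultimately have "\<exists>B. finite B \<and> B \<subseteq> K \<and> (\<forall>a\<in>B. \<forall>b\<in>B. tr (a * b) = (if a = b then 1 else 0)) \<and>
   (\<forall>x\<in>K. \<forall>y\<in>K. tr ((x - (\<Sum>b\<in>B. tr (x * b) *\<^sub>C b)) * y) = 0)"
   by (rule orthonormal_basis[where Bf = "\<lambda>x y. tr (x * y)", OF Kv _ tr_form_linear])
  then show ?thesis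
   by (elim exE conjE) (rule that)
 qed
 define pr where "pr y = (\<Sum>b\<in>B. tr (y * b) *\<^sub>C b)" for y
 have prK: "pr y \<in> K" for y unfolding pr_def using B(2) by (intro cv.subspace_sum[OF Kv] cv.subspace_scale[OF Kv]) auto
 define Kp where "Kp = {y \<in> H. \<forall>z\<in>K. tr (y * z) = 0}"
 have Kpv: "cv.subspace Kp" unfolding Kp_def by (rule perp_subspace[OF Hs])
 have split: "y - pr y \<in> Kp" if y: "y \<in> H" for y
 proof -
  have yp: "y - pr y \<in> H" by (rule cv.subspace_diff[OF Hs y KH[OF prK]])
  have B0: "tr ((y - pr y) * b) = 0" if b: "b \<in> B" for b unfolding pr_def by (rule orthonormal_residue[OF B(1,3) b])
  have "tr ((y - pr y) * z) = 0" if z: "z \<in> K" for z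
  proof -
   have "z - pr z \<in> q" unfolding q_def trad_def using B(4) z cv.subspace_diff[OF Kv z prK] unfolding pr_def by simp
   then have "z - pr z \<in> trad H" by (rule qn)
   then have "tr ((z - pr z) * (y - pr y)) = 0" using yp unfolding trad_def by simp
   then have "tr ((y - pr y) * (z - pr z)) = 0" using sym[OF yp, of "z - pr z"] by simp
   moreover have "tr ((y - pr y) * pr z) = 0"
    unfolding pr_def[of z] by (simp add: sum_distrib_left tr_sum B0)
   ultimately show ?thesis by (simp add: right_diff_distrib)
  qed
  then show ?thesis using yp unfolding Kp_def by simp
 qed
 have KpK: "lb a b \<in> trad H" if a: "a \<in> K" and b: "b \<in> Kp" for a b
 proof -
  have bH: "b \<in> H" using b unfolding Kp_def by simp
  have "tr (lb b a * z) = 0" if z: "z \<in> H" for z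
  proof -
   have "tr (lb b a * z) = tr (b * lb a z)" using H(3) bH KH[OF a] by (intro tr_lb_assoc) auto
   also have "\<dots> = 0" using b ideal_inD(4)[OF K(1) z a] unfolding Kp_def by simp
   finally show ?thesis .
  qed
  then have "lb b a \<in> trad H" using subalg_D(2)[OF H(1) bH KH[OF a]] unfolding trad_def by simp
  then have "- lb b a \<in> trad H" by (rule cv.subspace_neg[OF trad_subspace[OF H(1,3)]])
  then show ?thesis by (simp add: lb_swap[of a b])
 qed
 note tv = trad_subspace[OF H(1,3)]
 have Kpb: "lb a b \<in> Kp" if a: "a \<in> Kp" and b: "b \<in> Kp" for a b
 proof -
  have ab: "a \<in> H" "b \<in> H" using a b unfolding Kp_def by auto
  have "tr (lb a b * z) = 0" if z: "z \<in> K" for z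
  proof -
   have "tr (lb a b * z) = tr (a * lb b z)" using H(3) ab by (intro tr_lb_assoc) auto
   then show ?thesis using a ideal_inD(3)[OF K(1) ab(2) z] unfolding Kp_def by simp
  qed
  then show ?thesis using subalg_D(2)[OF H(1) ab] unfolding Kp_def by simp
 qed
 have nKp: "v \<in> Kp" if "v \<in> trad H" for v
  using that KH unfolding Kp_def trad_def by auto
 have dec: "\<exists>a\<in>lbs K K. y - a \<in> Kp" if "y \<in> lbs H H" for y
  using that
 proof (induction rule: lbs_induct)
  case (lb a b)
  have "lb a b - lb (pr a) (pr b) = lb (pr a) (b - pr b) + (- lb (pr b) (a - pr a)) + lb (a - pr a) (b - pr b)"
   by (simp add: lb_swap[of "pr b"])
  also have "\<dots> \<in> Kp"
   by (intro cv.subspace_add[OF Kpv] cv.subspace_neg[OF Kpv] nKp[OF KpK] Kpb prK split lb)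
  finally show ?case using lbs_mem[OF prK prK] by blast
 next
  case zero
  then show ?case using cv.subspace_0[OF lbs_subspace] cv.subspace_0[OF Kpv] by (intro bexI[of _ 0]) auto
 next
  case (add u v)
  then obtain a b where ab: "a \<in> lbs K K" "b \<in> lbs K K" "u - a \<in> Kp" "v - b \<in> Kp" by blast
  have e: "u + v - (a + b) = (u - a) + (v - b)" by simp
  have "u + v - (a + b) \<in> Kp" unfolding e by (rule cv.subspace_add[OF Kpv ab(3,4)])
  then show ?case using cv.subspace_add[OF lbs_subspace ab(1,2)] by blast
 next
  case (scC c u)
  then obtain a where a: "a \<in> lbs K K" "u - a \<in> Kp" by blast
  have "c *\<^sub>C u - c *\<^sub>C a \<in> Kp" unfolding cv.scale_right_diff_distrib[symmetric] by (rule cv.subspace_scale[OF Kpv a(2)])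
  then show ?case using cv.subspace_scale[OF lbs_subspace a(1)] by blast
 qed
 obtain y where y: "y \<in> lbs H H" "x - y \<in> trad H" using H(4) KH[OF x] unfolding tperfect_def by blast
 obtain a where a: "a \<in> lbs K K" "y - a \<in> Kp" using dec[OF y(1)] by blast
 have aK: "a \<in> K" using lbs_subalg[OF Ks] a(1) by blast
 have e: "x - a = (x - y) + (y - a)" by simp
 have "x - a \<in> Kp" unfolding e by (rule cv.subspace_add[OF Kpv nKp[OF y(2)] a(2)])
 moreover have "x - a \<in> K" by (rule cv.subspace_diff[OF Kv x aK])
 ultimately have "x - a \<in> q" unfolding q_def Kp_def trad_def by simp
 then have "x - a \<in> trad H" by (rule qn)
 then show ?thesis using a(1) by blast
qed

text \<open>Vanishing of the first cohomology. The Casimir element of the trace form of the module commutes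
 with the action, and its nilpotent part is handled by induction; no irreducible modules are needed.\<close>
lemma invariant_vector:
 fixes T :: "'v::cvec endo => 'm::cvec endo" and e :: 'm
 assumes H: "subalg H" "fd H" "H \<subseteq> fr" "tperfect H"
  and T: "clinear T" "\<And>x. x \<in> H ==> T x \<in> fr" "\<And>x y. x \<in> H ==> y \<in> H ==> T (lb x y) = lb (T x) (T y)"
   "\<And>x. x \<in> trad H ==> T x = 0"
  and U: "cv.subspace U" "fd U" "\<And>x v. x \<in> H ==> T x \<cdot> v \<in> U"
 shows "\<exists>u\<in>U. \<forall>x\<in>H. T x \<cdot> (e - u) = 0"
 using T U
proof (induction "cv.dim U" arbitrary: U T rule: less_induct)
 case less
 note T = less.prems(1-4) and U = less.prems(5-7) and Hs = subalg_D(1)[OF H(1)]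
 note Tl [simp] = clinear_add[OF T(1)] clinear_diff[OF T(1)] clinear_scC[OF T(1)] clinear_0[OF T(1)] clinear_sum[OF T(1)]
 show ?case
 proof (cases "\<forall>x\<in>H. T x = 0")
  case True
  then show ?thesis using cv.subspace_0[OF U(1)] by (intro bexI[of _ 0]) auto
 next
  case False
  define Bf where "Bf x y = tr (T x * T y)" for x y
  have lin: "clinear (Bf x)" "clinear (\<lambda>x. Bf x y)" for x y
   unfolding Bf_def by (auto intro!: clinearI simp: distrib_left distrib_right)
  have sym: "Bf x y = Bf y x" if "x \<in> H" for x y unfolding Bf_def using T(2)[OF that] by (rule tr_comm)
  obtain B where B: "finite B" "B \<subseteq> H" "\<forall>a\<in>B. \<forall>b\<in>B. Bf a b = (if a = b then 1 else 0)"
   "\<forall>x\<in>H. \<forall>y\<in>H. Bf (x - (\<Sum>b\<in>B. Bf x b *\<^sub>C b)) y = 0"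
  proof -
   have "Bf a b = Bf b a" if "a \<in> H" "b \<in> H" for a b using that(1) by (rule sym)
   then have "\<exists>B. finite B \<and> B \<subseteq> H \<and> (\<forall>a\<in>B. \<forall>b\<in>B. Bf a b = (if a = b then 1 else 0)) \<and>
     (\<forall>x\<in>H. \<forall>y\<in>H. Bf (x - (\<Sum>b\<in>B. Bf x b *\<^sub>C b)) y = 0)"
    by (rule orthonormal_basis[where Bf = Bf, OF Hs H(2) lin])
   then show ?thesis by (elim exE conjE) (rule that)
  qed
  \<comment> \<open>This radical of the form of the representation acts as zero: its image is
    solvable by Cartan's criterion and perfect by \<open>ideal_tperfect\<close>. Hence the operators
    \<open>T b\<close> with \<open>b\<close> in \<open>B\<close> span the image of
    \<open>T\<close>.\<close>
  define K where "K = {x \<in> H. \<forall>y\<in>H. Bf x y = 0}"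
  have KH: "ideal_in K H"
   unfolding ideal_in_def
  proof (intro conjI ballI)
   show "cv.subspace K" unfolding K_def
    by (rule cv.subspaceI) (simp_all add: subspace_rules[OF Hs] clinear_rules[OF lin(2)])
   show "K \<subseteq> H" unfolding K_def by auto
   fix x y assume x: "x \<in> H" and y: "y \<in> K"
   have yH: "y \<in> H" using y unfolding K_def by simp
   have "Bf (lb x y) z = 0" if z: "z \<in> H" for z
   proof -
    have "Bf (lb x y) z = - tr (lb (T y) (T x) * T z)" unfolding Bf_def T(3)[OF x yH] by (simp add: lb_swap[of "T x"])
    also have "tr (lb (T y) (T x) * T z) = tr (T y * lb (T x) (T z))" using T(2) x yH by (intro tr_lb_assoc) auto
    also have "\<dots> = Bf y (lb x z)" unfolding Bf_def T(3)[OF x z] ..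
    also have "\<dots> = 0" using y subalg_D(2)[OF H(1) x z] unfolding K_def by simp
    finally show ?thesis by simp
   qed
   then show "lb x y \<in> K" using subalg_D(2)[OF H(1) x yH] unfolding K_def by simp
  qed
  have nK: "trad H \<subseteq> K" unfolding K_def Bf_def using T(4) by (auto simp: trad_def)
  have KT: "T x = 0" if x: "x \<in> K" for x
  proof -
   have KHx: "u \<in> H" if "u \<in> K" for u by (rule ideal_inD(2)[OF KH that])
   have "subalg (T ` K)"
    unfolding lie_subalgebra_def
   proof (intro conjI ballI)
    show "cv.subspace (T ` K)" by (rule subspace_image[OF ideal_inD(1)[OF KH] T(1)])
    fix a b assume "a \<in> T ` K" "b \<in> T ` K"
    then obtain u v where uv: "u \<in> K" "v \<in> K" "a = T u" "b = T v" by blast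
    show "lb a b \<in> T ` K" unfolding uv(3,4) T(3)[OF KHx[OF uv(1)] KHx[OF uv(2)], symmetric]
     by (rule imageI) (rule ideal_inD(3)[OF KH KHx[OF uv(1)] uv(2)])
   qed
   moreover have "fd (T ` K)" by (rule fd_image[OF T(1) fd_subset[OF H(2)]]) (use KHx in auto)
   moreover have "T ` K \<subseteq> fr" using T(2) KHx by auto
   moreover have "tr (a * b) = 0" if ab: "a \<in> T ` K" "b \<in> T ` K" for a b
   proof -
    obtain u v where uv: "u \<in> K" "v \<in> K" "a = T u" "b = T v" using ab by blast
    then show ?thesis using KHx[OF uv(2)] unfolding K_def Bf_def by simp
   qed
   ultimately have "solvable_lie scC lb (T ` K)" by (rule Cartan_criterion)
   then obtain m where m: "dser (T ` K) m = {0}" unfolding solvable_lie_def by blast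
   have "T y \<in> lbs (T ` K) (T ` K)" if y: "y \<in> K" for y
   proof -
    obtain a where a: "a \<in> lbs K K" "y - a \<in> trad H" using ideal_tperfect[OF H KH nK y] by blast
    have "T a \<in> lbs (T ` K) (T ` K)" using a(1)
    proof (induction rule: lbs_induct)
     case (lb u v)
     show ?case unfolding T(3)[OF KHx[OF lb(1)] KHx[OF lb(2)]] using lb by (intro lbs_mem imageI)
    qed (simp_all add: subspace_rules[OF lbs_subspace])
    moreover have "T y = T a" using T(4)[OF a(2)] by simp
    ultimately show ?thesis by simp
   qed
   then have perf: "T ` K \<subseteq> lbs (T ` K) (T ` K)" by blast
   have "T ` K \<subseteq> dser (T ` K) m"
   proof (induction m)
    case (Suc m)
    show ?case unfolding derived_series.simps(2) by (rule subset_trans[OF perf lbs_mono[OF Suc Suc]])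
   qed simp
   then show ?thesis unfolding m using x by blast
  qed
  have Brad: "T x = (\<Sum>b\<in>B. Bf x b *\<^sub>C T b)" if x: "x \<in> H" for x
  proof -
   have "x - (\<Sum>b\<in>B. Bf x b *\<^sub>C b) \<in> H"
    by (intro cv.subspace_diff[OF Hs x] cv.subspace_sum[OF Hs] cv.subspace_scale[OF Hs]) (rule subsetD[OF B(2)])
   then have "x - (\<Sum>b\<in>B. Bf x b *\<^sub>C b) \<in> K" unfolding K_def using B(4) x by blast
   then have "T (x - (\<Sum>b\<in>B. Bf x b *\<^sub>C b)) = 0" by (rule KT)
   then show ?thesis by simp
  qed
  \<comment> \<open>The Casimir element. Its trace is the number of elements of \<open>B\<close>,
    nonzero as the action is not trivial, and it maps everything into \<open>U\<close> because all
    \<open>T x\<close> do.\<close>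
  define c where "c = (\<Sum>b\<in>B. T b * T b)"
  have cfr: "c \<in> fr" unfolding c_def using B(2) T(2) by (intro fr_sum fr_mult_left) auto
  have cU: "c \<cdot> v \<in> U" for v unfolding c_def sum_app app_simps
   by (intro cv.subspace_sum[OF U(1)] U(3)) (rule subsetD[OF B(2)])
  have trc: "tr c \<noteq> 0"
  proof
   assume "tr c = 0"
   then have "(\<Sum>b\<in>B. Bf b b) = 0" by (simp add: c_def tr_sum Bf_def)
   moreover have "(\<Sum>b\<in>B. Bf b b) = (\<Sum>b\<in>B. 1)" using B(3) by (intro sum.cong) auto
   ultimately have "B = {}" using B(1) by simp
   then show False using Brad False by simp
  qed
  have comm: "T x * c = c * T x" if x: "x \<in> H" for x
  proof -
   have e: "lb (T x) (T b) = (\<Sum>a\<in>B. Bf (lb x b) a *\<^sub>C T a)" if "b \<in> B" for b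
    unfolding T(3)[OF x subsetD[OF B(2) that], symmetric] by (rule Brad[OF subalg_D(2)[OF H(1) x subsetD[OF B(2) that]]])
   have anti: "Bf (lb x b) a = - Bf (lb x a) b" if "a \<in> B" "b \<in> B" for a b
   proof -
    have ab: "a \<in> H" "b \<in> H" using B(2) that by auto
    have "Bf (lb x b) a = - tr (lb (T b) (T x) * T a)" unfolding Bf_def T(3)[OF x ab(2)] by (simp add: lb_swap[of "T x"])
    also have "tr (lb (T b) (T x) * T a) = tr (T b * lb (T x) (T a))" using T(2) x ab by (intro tr_lb_assoc) auto
    also have "\<dots> = Bf b (lb x a)" unfolding Bf_def T(3)[OF x ab(1)] ..
    finally show ?thesis using sym[OF ab(2)] by simp
   qed
   have "T x * c - c * T x = (\<Sum>b\<in>B. lb (T x) (T b) * T b + T b * lb (T x) (T b))"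
    unfolding c_def sum_distrib_left sum_distrib_right sum_subtractf[symmetric]
    by (intro sum.cong refl) (simp add: lb_def algebra_simps)
   also have "\<dots> = (\<Sum>b\<in>B. \<Sum>a\<in>B. Bf (lb x b) a *\<^sub>C (T a * T b)) + (\<Sum>b\<in>B. \<Sum>a\<in>B. Bf (lb x b) a *\<^sub>C (T b * T a))"
    unfolding sum.distrib[symmetric] by (intro sum.cong refl) (simp add: e sum_distrib_left sum_distrib_right sum.distrib)
   also have "(\<Sum>b\<in>B. \<Sum>a\<in>B. Bf (lb x b) a *\<^sub>C (T b * T a)) = (\<Sum>b\<in>B. \<Sum>a\<in>B. Bf (lb x a) b *\<^sub>C (T a * T b))"
    by (rule sum.swap)
   also have "\<dots> = (\<Sum>b\<in>B. \<Sum>a\<in>B. - (Bf (lb x b) a *\<^sub>C (T a * T b)))"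
   proof (intro sum.cong refl)
    fix b a assume ab: "b \<in> B" "a \<in> B"
    show "Bf (lb x a) b *\<^sub>C (T a * T b) = - (Bf (lb x b) a *\<^sub>C (T a * T b))" unfolding anti[OF ab] by simp
   qed
   finally show ?thesis by (simp add: sum_negf)
  qed
  obtain S N p where S: "finite S" "0 \<in> S" "(\<Sum>l\<in>S. p l) = 1"
   and n: "\<And>l. l \<in> S ==> (c - l *\<^sub>C 1) ^ N * p l = 0"
   and pc: "\<And>l y. y * c = c * y ==> y * p l = p l * y"
   and pid: "\<And>l. l \<in> S ==> p l * p l = p l"
   and stab: "\<And>l U. cv.subspace U ==> \<forall>u\<in>U. c \<cdot> u \<in> U ==> \<forall>u\<in>U. p l \<cdot> u \<in> U"
   by (rule spectral[OF cfr]) (rule that)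
  \<comment> \<open>The projection onto the part where \<open>c\<close> is invertible. Its image
    lies in \<open>U\<close>, so \<open>P \<cdot> e\<close> may be subtracted from \<open>e\<close>.
    On the part where \<open>c\<close> is nilpotent, \<open>U\<close> is replaced by the strictly
    smaller \<open>U'\<close> and the induction takes over.\<close>
  define P where "P = 1 - p 0"
  have PU: "P \<cdot> v \<in> U" for v
  proof -
   have s: "p 0 + (\<Sum>l\<in>S-{0}. p l) = 1" using S(3) unfolding sum.remove[OF S(1,2)] .
   have "P = (\<Sum>l\<in>S-{0}. p l)" unfolding P_def s[symmetric] by simp
   then have Pv: "P \<cdot> v = (\<Sum>l\<in>S-{0}. p l \<cdot> v)" by (simp add: sum_app)
   have plU: "p l \<cdot> v \<in> U" if l: "l \<in> S - {0}" for l
   proof (rule ker_power_invert_power[OF U(1), where T = c and v = l and K = N and m = 0 and N = 1])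
    show "(c - l *\<^sub>C 1) ^ N \<cdot> p l \<cdot> v = 0" using arg_cong[OF n[of l], of "\<lambda>a. a \<cdot> v"] l by simp
   qed (use l cU in auto)
   show ?thesis unfolding Pv by (rule cv.subspace_sum[OF U(1) plU])
  qed
  have p0U: "p 0 \<cdot> u \<in> U" if "u \<in> U" for u using stab[OF U(1), of 0] cU that by blast
  have pT: "T x * p 0 = p 0 * T x" if "x \<in> H" for x by (rule pc[OF comm[OF that]])
  define U' where "U' = app (p 0) ` U"
  have U's: "cv.subspace U'" unfolding U'_def by (rule subspace_image[OF U(1) clinear_app])
  have U'U: "U' \<subseteq> U" unfolding U'_def using p0U by auto
  have "P \<noteq> 0"
  proof
   assume "P = 0"
   then have "p 0 = 1" by (simp add: P_def)
   then have "c ^ N = 0" using n[OF S(2)] by simp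
   then show False using tr_nilpotent[OF cfr] trc by blast
  qed
  then obtain v where v: "P \<cdot> v \<noteq> 0" using endo_eqI[of P 0] by auto
  have p0P: "p 0 * P = 0" unfolding P_def using pid[OF S(2)] by (simp add: right_diff_distrib)
  have "P \<cdot> v \<notin> U'"
  proof
   assume "P \<cdot> v \<in> U'"
   then obtain u where u: "P \<cdot> v = p 0 \<cdot> u" unfolding U'_def by auto
   have "P \<cdot> v = (p 0 * p 0) \<cdot> u" unfolding u pid[OF S(2)] ..
   also have "\<dots> = (p 0 * P) \<cdot> v" by (simp add: u)
   finally show False using p0P v by simp
  qed
  then have "U' \<subset> U" using U'U PU[of v] by blast
  then have lt: "cv.dim U' < cv.dim U" by (rule fd_dim_less[OF U(2) _ U's U(1)])
  have "\<exists>u\<in>U'. \<forall>x\<in>H. (T x * p 0) \<cdot> (e - u) = 0"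
  proof (rule less.hyps[OF lt])
   show "clinear (\<lambda>x. T x * p 0)" by (auto intro!: clinearI simp: distrib_right)
   show "T x * p 0 \<in> fr" if "x \<in> H" for x using T(2)[OF that] by (rule fr_mult_right)
   show "T x * p 0 = 0" if "x \<in> trad H" for x using T(4)[OF that] by simp
   show "T (lb x y) * p 0 = lb (T x * p 0) (T y * p 0)" if xy: "x \<in> H" "y \<in> H" for x y
   proof -
    have "T a * p 0 * (T b * p 0) = T a * T b * p 0" if "a \<in> H" "b \<in> H" for a b
    proof -
     have "T a * p 0 * (T b * p 0) = T a * (p 0 * T b) * p 0" by (simp add: mult.assoc)
     also have "\<dots> = T a * T b * (p 0 * p 0)" unfolding pT[OF that(2), symmetric] by (simp add: mult.assoc)
     finally show ?thesis unfolding pid[OF S(2)] .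
    qed
    then show ?thesis using xy T(3)[OF xy] by (simp add: lb_def left_diff_distrib)
   qed
   show "cv.subspace U'" by (rule U's)
   show "fd U'" by (rule fd_subset[OF U(2) U'U])
   show "(T x * p 0) \<cdot> v \<in> U'" if "x \<in> H" for x v
    unfolding pT[OF that] U'_def using U(3)[OF that] by auto
  qed
  then obtain u where u: "u \<in> U'" "\<And>x. x \<in> H ==> (T x * p 0) \<cdot> (e - u) = 0" by blast
  define w where "w = P \<cdot> e + p 0 \<cdot> u"
  have "w \<in> U" unfolding w_def using PU p0U u(1) U'U by (intro cv.subspace_add[OF U(1)]) auto
  moreover have "e - w = p 0 \<cdot> (e - u)" by (simp add: w_def P_def)
  then have "T x \<cdot> (e - w) = 0" if "x \<in> H" for x using u(2)[OF that] by simp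
  ultimately show ?thesis by blast
 qed
qed

text \<open>The same for a quotient module \<open>M / P\<close>, realized on a complement of \<open>P\<close> in \<open>M\<close>.\<close>
lemma invariant_vector_quotient:
 fixes act :: "'v::cvec endo => 'm::cvec endo"
 assumes H: "subalg H" "fd H" "H \<subseteq> fr" "tperfect H"
  and M: "cv.subspace M" "fd M" "cv.subspace P" "P \<subseteq> N'" "N' \<subseteq> M" "cv.subspace N'"
  and act: "clinear act" "\<And>x m. x \<in> H ==> m \<in> M ==> act x \<cdot> m \<in> N'" "\<And>x m. x \<in> H ==> m \<in> P ==> act x \<cdot> m \<in> P"
   "\<And>x y m. x \<in> H ==> y \<in> H ==> m \<in> M ==> act (lb x y) \<cdot> m = act x \<cdot> act y \<cdot> m - act y \<cdot> act x \<cdot> m"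
   "\<And>x m. x \<in> trad H ==> m \<in> M ==> act x \<cdot> m \<in> P"
  and e: "e \<in> M"
 shows "\<exists>f\<in>M. f - e \<in> N' \<and> (\<forall>x\<in>H. act x \<cdot> f \<in> P)"
proof -
 obtain g where g: "\<And>x. g \<cdot> x \<in> P" "\<And>x. x \<in> P ==> g \<cdot> x = x"
  by (rule projection_exists[OF M(3) cv.subspace_single_0 inf_le2]) (rule that)
 define C where "C = {m \<in> M. g \<cdot> m = 0}"
 have PM: "P \<subseteq> M" using M(4,5) by simp
 have C: "cv.subspace C" unfolding C_def
  by (rule cv.subspaceI) (simp_all add: subspace_rules[OF M(1)])
 have CP: "C \<inter> P \<subseteq> {0}"
 proof
  fix x assume "x \<in> C \<inter> P"
  then have "g \<cdot> x = 0" "x \<in> P" unfolding C_def by simp_all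
  then show "x \<in> {0}" using g(2)[of x] by simp
 qed
 obtain p where p: "\<And>x. p \<cdot> x \<in> C" "\<And>x. x \<in> C ==> p \<cdot> x = x" "\<And>x. x \<in> P ==> p \<cdot> x = 0"
  by (rule projection_exists[OF C M(3) CP]) (rule that)
 have CM: "x \<in> M" if "x \<in> C" for x using that unfolding C_def by simp
 have pP: "p \<cdot> m - m \<in> P" if m: "m \<in> M" for m
 proof -
  have "m - g \<cdot> m \<in> M" by (rule cv.subspace_diff[OF M(1) m subsetD[OF PM g(1)]])
  moreover have "g \<cdot> (m - g \<cdot> m) = 0" using g(2)[OF g(1)[of m]] by simp
  ultimately have "m - g \<cdot> m \<in> C" unfolding C_def by simp
  then have "p \<cdot> (m - g \<cdot> m) = m - g \<cdot> m" by (rule p(2))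
  then have e: "p \<cdot> m - m = - (g \<cdot> m)" using p(3)[OF g(1)[of m]] by simp
  show ?thesis unfolding e by (rule cv.subspace_neg[OF M(3) g(1)])
 qed
 define T where "T x = p * act x * p" for x
 define U where "U = C \<inter> N'"
 have NM: "x \<in> M" if "x \<in> N'" for x using that M(5) by blast
 have pN: "p \<cdot> m \<in> N'" if m: "m \<in> N'" for m
  using cv.subspace_add[OF M(6) m subsetD[OF M(4) pP[OF NM[OF m]]]] by simp
 have sameP: "p \<cdot> a = p \<cdot> b" if "a - b \<in> P" for a b using p(3)[OF that] by simp
 have "\<exists>u\<in>U. \<forall>x\<in>H. T x \<cdot> (p \<cdot> e - u) = 0"
 proof (rule invariant_vector[OF H])
  show "clinear T" unfolding T_def
   by (auto intro!: clinearI simp: clinear_add[OF act(1)] clinear_scC[OF act(1)] distrib_left distrib_right)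
  show "T x \<in> fr" if "x \<in> H" for x
  proof -
   have "p \<in> fr" by (rule fr_range[OF fd_subset[OF M(2)] p(1)]) (rule subsetI, rule CM)
   then show ?thesis unfolding T_def by (intro fr_mult_right)
  qed
  show "T x = 0" if "x \<in> trad H" for x
   unfolding T_def by (rule endo_eqI) (simp add: p(3) act(5)[OF that CM[OF p(1)]])
  show "T (lb x y) = lb (T x) (T y)" if x: "x \<in> H" and y: "y \<in> H" for x y
  proof (rule endo_eqI)
   fix v
   define m where "m = p \<cdot> v"
   have m: "m \<in> M" "p \<cdot> m = m" unfolding m_def using p CM by auto
   have k: "p \<cdot> act a \<cdot> p \<cdot> act b \<cdot> m = p \<cdot> act a \<cdot> act b \<cdot> m" if ab: "a \<in> H" "b \<in> H" for a b
   proof (rule sameP)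
    have "act a \<cdot> (p \<cdot> act b \<cdot> m - act b \<cdot> m) \<in> P" by (rule act(3)[OF ab(1) pP[OF NM[OF act(2)[OF ab(2) m(1)]]]])
    then show "act a \<cdot> p \<cdot> act b \<cdot> m - act a \<cdot> act b \<cdot> m \<in> P" by simp
   qed
   have pp: "p \<cdot> p \<cdot> z = p \<cdot> z" for z by (rule p(2)[OF p(1)])
   have "T (lb x y) \<cdot> v = p \<cdot> (act x \<cdot> act y \<cdot> m - act y \<cdot> act x \<cdot> m)"
    unfolding T_def using act(4)[OF x y m(1)] by (simp add: m_def)
   also have "\<dots> = p \<cdot> act x \<cdot> p \<cdot> act y \<cdot> m - p \<cdot> act y \<cdot> p \<cdot> act x \<cdot> m"
    using k[OF x y] k[OF y x] by simp
   also have "\<dots> = lb (T x) (T y) \<cdot> v" unfolding T_def lb_def by (simp add: pp m_def)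
   finally show "T (lb x y) \<cdot> v = lb (T x) (T y) \<cdot> v" .
  qed
  show "cv.subspace U" unfolding U_def by (rule cv.subspace_inter[OF C M(6)])
  show "fd U" by (rule fd_subset[OF M(2)]) (use CM in \<open>auto simp: U_def\<close>)
  show "T x \<cdot> v \<in> U" if "x \<in> H" for x v
  proof -
   have "p \<cdot> act x \<cdot> p \<cdot> v \<in> N'" by (rule pN[OF act(2)[OF that CM[OF p(1)]]])
   then show ?thesis unfolding U_def T_def using p(1)[of "act x \<cdot> p \<cdot> v"] by simp
  qed
 qed
 then obtain u where u: "u \<in> U" "\<And>x. x \<in> H ==> T x \<cdot> (p \<cdot> e - u) = 0" by blast
 define f where "f = p \<cdot> e - u"
 have fC: "f \<in> C" unfolding f_def using u(1) by (intro cv.subspace_diff[OF C p(1)]) (simp add: U_def)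
 have fe: "f - e = (p \<cdot> e - e) - u" by (simp add: f_def)
 have "u \<in> N'" using u(1) by (simp add: U_def)
 then have "f - e \<in> N'" unfolding fe by (rule cv.subspace_diff[OF M(6) subsetD[OF M(4) pP[OF e]]])
 moreover have "act x \<cdot> f \<in> P" if x: "x \<in> H" for x
 proof -
  have aM: "act x \<cdot> f \<in> M" by (rule NM[OF act(2)[OF x CM[OF fC]]])
  have "T x \<cdot> f = 0" using u(2)[OF x] unfolding f_def .
  then have "p \<cdot> act x \<cdot> f = 0" unfolding T_def app_simps p(2)[OF fC] .
  then have "- (act x \<cdot> f) \<in> P" using pP[OF aM] by simp
  from cv.subspace_neg[OF M(3) this] show ?thesis by simp
 qed
 ultimately show ?thesis using CM[OF fC] by blast
qed

section \<open>Levi's theorem for finite-dimensional Lie algebras of operators\<close>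

lemma ad_linear: "ad (x + y) = ad x + ad y" "ad (c *\<^sub>C x) = c *\<^sub>C ad x"
 by (rule endo_eqI, simp)+

text \<open>The action of \<open>x\<close> on the linear maps that factor through the projection \<open>prj\<close> onto a subalgebra.\<close>
definition actm :: "'v::cvec endo endo => 'v endo => 'v endo endo endo" where
 "actm prj x = endo_of (\<lambda>F. (ad x * F - F * ad x) * prj)"

lemma actm_app: "actm prj x \<cdot> F = (ad x * F - F * ad x) * prj"
proof -
 have "clinear (\<lambda>F. (ad x * F - F * ad x) * prj)"
  by (rule clinearI) (simp_all add: distrib_left distrib_right left_diff_distrib cv.scale_right_diff_distrib)
 then show ?thesis unfolding actm_def by (rule app_endo_of)
qed

lemma actm_app2: "(actm prj x \<cdot> F) \<cdot> y = lb x (F \<cdot> prj \<cdot> y) - F \<cdot> lb x (prj \<cdot> y)"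
 unfolding actm_app by simp

lemma clinear_actm: "clinear (actm prj)"
 by (rule clinearI; rule endo_eqI)
  (simp_all add: actm_app ad_linear distrib_left distrib_right left_diff_distrib right_diff_distrib cv.scale_right_diff_distrib)

text \<open>The setting for splitting off \<open>r\<close> modulo an ideal \<open>K\<close>. A
  linear map from \<open>H\<close> to \<open>r\<close> is encoded as an operator \<open>F\<close>
  with \<open>F = F * prj\<close>. On \<open>r\<close> modulo \<open>K\<close> the maps in
  \<open>M\<close> are scalars and those in \<open>N'\<close> are zero; the maps in
  \<open>P0\<close> vanish modulo \<open>K\<close> on all of \<open>H\<close>. The action of
  \<open>H\<close> sends \<open>M\<close> into \<open>N'\<close>, so an invariant with scalar 1 can
  be sought: a projection onto \<open>r\<close>, modulo \<open>K\<close>, that commutes with the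
  action.\<close>

locale levi_split =
 fixes H r K :: "'v::cvec endo set" and prj :: "'v endo endo"
 assumes sub: "subalg H" "fd H" and r: "ideal_in r H" and Kid: "ideal_in K H" "K \<subseteq> r"
  and prj: "\<And>y. prj \<cdot> y \<in> H" "\<And>y. y \<in> H ==> prj \<cdot> y = y"
begin

definition M where "M = {F. (\<forall>y. F \<cdot> y = F \<cdot> prj \<cdot> y) \<and> (\<forall>y. F \<cdot> y \<in> r) \<and> (\<exists>l. \<forall>y\<in>r. F \<cdot> y - l *\<^sub>C y \<in> K)}"
definition N' where "N' = {F. (\<forall>y. F \<cdot> y = F \<cdot> prj \<cdot> y) \<and> (\<forall>y. F \<cdot> y \<in> r) \<and> (\<forall>y\<in>r. F \<cdot> y \<in> K)}"
definition P0 where "P0 = {F. (\<forall>y. F \<cdot> y = F \<cdot> prj \<cdot> y) \<and> (\<forall>y\<in>H. F \<cdot> y \<in> K)}"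

lemmas Hv = subalg_D(1)[OF sub(1)] and rv = ideal_inD(1)[OF r] and Kv = ideal_inD(1)[OF Kid(1)]
 and rH = ideal_inD(2)[OF r] and Kr = subsetD[OF Kid(2)]

lemma prj_prj: "prj \<cdot> prj \<cdot> y = prj \<cdot> y" by (rule prj(2)[OF prj(1)])

lemma M_subspace: "cv.subspace M"
proof (rule cv.subspaceI)
 show "0 \<in> M" unfolding M_def using cv.subspace_0[OF rv] cv.subspace_0[OF Kv] by (auto intro!: exI[of _ 0])
 fix F G assume F: "F \<in> M" and G: "G \<in> M"
 obtain l where l: "\<forall>y\<in>r. F \<cdot> y - l *\<^sub>C y \<in> K" using F unfolding M_def by blast
 obtain m where m: "\<forall>y\<in>r. G \<cdot> y - m *\<^sub>C y \<in> K" using G unfolding M_def by blast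
 have "(F + G) \<cdot> y - (l + m) *\<^sub>C y \<in> K" if "y \<in> r" for y
 proof -
  have e: "(F + G) \<cdot> y - (l + m) *\<^sub>C y = (F \<cdot> y - l *\<^sub>C y) + (G \<cdot> y - m *\<^sub>C y)" by (simp add: cv.scale_left_distrib)
  show ?thesis unfolding e using l m that by (intro cv.subspace_add[OF Kv]) auto
 qed
 moreover have "(F + G) \<cdot> y = (F + G) \<cdot> prj \<cdot> y" "(F + G) \<cdot> y \<in> r" for y
  using F G cv.subspace_add[OF rv, of "F \<cdot> y" "G \<cdot> y"] unfolding M_def by auto
 ultimately show "F + G \<in> M" unfolding M_def by blast
next
 fix c F assume F: "F \<in> M"
 obtain l where l: "\<forall>y\<in>r. F \<cdot> y - l *\<^sub>C y \<in> K" using F unfolding M_def by blast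
 have "(c *\<^sub>C F) \<cdot> y - (c * l) *\<^sub>C y \<in> K" if "y \<in> r" for y
 proof -
  have e: "(c *\<^sub>C F) \<cdot> y - (c * l) *\<^sub>C y = c *\<^sub>C (F \<cdot> y - l *\<^sub>C y)" by (simp add: cv.scale_right_diff_distrib)
  show ?thesis unfolding e using l that by (intro cv.subspace_scale[OF Kv]) auto
 qed
 moreover have "(c *\<^sub>C F) \<cdot> y = (c *\<^sub>C F) \<cdot> prj \<cdot> y" "(c *\<^sub>C F) \<cdot> y \<in> r" for y
  using F cv.subspace_scale[OF rv, of "F \<cdot> y" c] unfolding M_def by auto
 ultimately show "c *\<^sub>C F \<in> M" unfolding M_def by blast
qed

lemma N'_subspace: "cv.subspace N'"
 unfolding N'_def
 by (rule cv.subspaceI) (auto simp: cv.subspace_0[OF rv] cv.subspace_0[OF Kv] cv.subspace_add[OF rv] cv.subspace_add[OF Kv]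
   cv.subspace_scale[OF rv] cv.subspace_scale[OF Kv])

lemma P0_subspace: "cv.subspace P0"
 unfolding P0_def
 by (rule cv.subspaceI) (auto simp: subspace_rules[OF Kv])

lemma P0_N': "P0 \<subseteq> N'"
proof
 fix F assume "F \<in> P0"
 then have F: "\<And>y. F \<cdot> y = F \<cdot> prj \<cdot> y" "\<And>y. y \<in> H ==> F \<cdot> y \<in> K" unfolding P0_def by auto
 have "F \<cdot> y \<in> r" for y using Kr[OF F(2)[OF prj(1)]] F(1)[of y] by simp
 then show "F \<in> N'" unfolding N'_def using F rH by blast
qed

lemma N'_M: "N' \<subseteq> M"
proof
 fix F assume "F \<in> N'"
 then have "\<forall>y\<in>r. F \<cdot> y - 0 *\<^sub>C y \<in> K" "\<forall>y. F \<cdot> y = F \<cdot> prj \<cdot> y" "\<forall>y. F \<cdot> y \<in> r" unfolding N'_def by auto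
 then show "F \<in> M" unfolding M_def by blast
qed

lemma M_fd: "fd M"
proof -
 have "prj \<in> fr" by (rule fr_range[OF sub(2)]) (rule prj(1))
 then have "fd {prj * F * prj | F. True}" by (intro fd_corner)
 moreover have "M \<subseteq> {prj * F * prj | F. True}"
 proof
  fix F assume "F \<in> M"
  then have F: "F \<cdot> y = F \<cdot> prj \<cdot> y" "F \<cdot> y \<in> r" for y unfolding M_def by auto
  have "F = prj * F * prj"
  proof (rule endo_eqI)
   fix y
   show "F \<cdot> y = (prj * F * prj) \<cdot> y" using prj(2)[OF rH[OF F(2)[of "prj \<cdot> y"]]] F(1)[of y] by simp
  qed
  then show "F \<in> {prj * F * prj | F. True}" by blast
 qed
 ultimately show ?thesis by (rule fd_subset)
qed

text \<open>The scalar by which \<open>F\<close> acts on \<open>r\<close> cancels in the commutator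
  with \<open>ad x\<close>.\<close>

lemma act_N': assumes x: "x \<in> H" and F: "F \<in> M" shows "actm prj x \<cdot> F \<in> N'"
proof -
 obtain l where l: "\<forall>y\<in>r. F \<cdot> y - l *\<^sub>C y \<in> K" using F unfolding M_def by blast
 have Fr: "F \<cdot> y \<in> r" for y using F unfolding M_def by simp
 have "lb x (F \<cdot> y) - F \<cdot> lb x y \<in> K" if y: "y \<in> r" for y
 proof -
  have "lb x (F \<cdot> y) - F \<cdot> lb x y = lb x (F \<cdot> y - l *\<^sub>C y) - (F \<cdot> lb x y - l *\<^sub>C lb x y)" by simp
  also have "\<dots> \<in> K" by (rule cv.subspace_diff[OF Kv ideal_inD(3)[OF Kid(1) x bspec[OF l y]] bspec[OF l ideal_inD(3)[OF r x y]]])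
  finally show ?thesis .
 qed
 moreover have "lb x (F \<cdot> y) - F \<cdot> lb x y \<in> r" for y
  by (intro cv.subspace_diff[OF rv] ideal_inD(3)[OF r x] Fr)
 ultimately show ?thesis unfolding N'_def mem_Collect_eq actm_app2 using prj(2) rH prj_prj by simp
qed

lemma act_P0: assumes x: "x \<in> H" and F: "F \<in> P0" shows "actm prj x \<cdot> F \<in> P0"
proof -
 have FK: "F \<cdot> y \<in> K" if "y \<in> H" for y using F that unfolding P0_def by simp
 have "lb x (F \<cdot> y) - F \<cdot> lb x y \<in> K" if y: "y \<in> H" for y
  by (intro cv.subspace_diff[OF Kv] ideal_inD(3)[OF Kid(1) x] FK subalg_D(2)[OF sub(1) x] y)
 then show ?thesis unfolding P0_def mem_Collect_eq actm_app2 by (simp add: prj(2) prj_prj)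
qed

lemma act_lb:
 assumes x: "x \<in> H" and y: "y \<in> H"
 shows "actm prj (lb x y) \<cdot> F = actm prj x \<cdot> actm prj y \<cdot> F - actm prj y \<cdot> actm prj x \<cdot> F"
proof (rule endo_eqI)
 fix z
 define w where "w = prj \<cdot> z"
 have w: "w \<in> H" "prj \<cdot> w = w" unfolding w_def using prj prj_prj by auto
 have l: "prj \<cdot> lb a w = lb a w" if "a \<in> H" for a by (rule prj(2)[OF subalg_D(2)[OF sub(1) that w(1)]])
 have "(actm prj (lb x y) \<cdot> F) \<cdot> z = lb (lb x y) (F \<cdot> w) - F \<cdot> lb (lb x y) w"
  by (simp only: actm_app2 w_def)
 also have "\<dots> = (lb x (lb y (F \<cdot> w) - F \<cdot> lb y w) - (lb y (F \<cdot> lb x w) - F \<cdot> lb y (lb x w)))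
   - (lb y (lb x (F \<cdot> w) - F \<cdot> lb x w) - (lb x (F \<cdot> lb y w) - F \<cdot> lb x (lb y w)))"
  by (simp add: lb_jacobi[of x y "F \<cdot> w"] lb_jacobi[of x y w])
 also have "\<dots> = (actm prj x \<cdot> actm prj y \<cdot> F - actm prj y \<cdot> actm prj x \<cdot> F) \<cdot> z"
  by (simp add: actm_app2 w_def[symmetric] l[OF x] l[OF y] w(2))
 finally show "(actm prj (lb x y) \<cdot> F) \<cdot> z = (actm prj x \<cdot> actm prj y \<cdot> F - actm prj y \<cdot> actm prj x \<cdot> F) \<cdot> z" .
qed

lemma e_exists: obtains e where "e \<in> M" "\<And>y. y \<in> r ==> e \<cdot> y = y"
proof -
 obtain q where q: "\<And>y. q \<cdot> y \<in> r" "\<And>y. y \<in> r ==> q \<cdot> y = y"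
  by (rule projection_exists[OF rv cv.subspace_single_0 inf_le2]) (rule that)
 have e: "(q * prj) \<cdot> y = y" if "y \<in> r" for y using q(2)[OF that] prj(2)[OF rH[OF that]] by simp
 have "(q * prj) \<cdot> y - 1 *\<^sub>C y \<in> K" if "y \<in> r" for y unfolding e[OF that] using cv.subspace_0[OF Kv] by simp
 moreover have "(q * prj) \<cdot> y = (q * prj) \<cdot> prj \<cdot> y" "(q * prj) \<cdot> y \<in> r" for y using q(1) prj_prj by simp_all
 ultimately have "q * prj \<in> M" unfolding M_def by blast
 then show ?thesis using e by (rule that)
qed

lemma normalized:
 assumes "F - e \<in> N'" "\<And>y. y \<in> r ==> e \<cdot> y = y" "y \<in> r" shows "F \<cdot> y - y \<in> K"
 using assms unfolding N'_def by auto

end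

lemma proj_onto:
 assumes "cv.subspace H"
 obtains prj :: "'v::cvec endo" where "\<And>y. prj \<cdot> y \<in> H" "\<And>y. y \<in> H ==> prj \<cdot> y = y"
 by (rule projection_exists[OF assms cv.subspace_single_0 inf_le2]) (rule that)

text \<open>Here \<open>r = trad H\<close> is abelian modulo \<open>K\<close>, but it acts
  nontrivially on \<open>M\<close>. It acts by inner maps, so an invariant is first found modulo the
  space \<open>P\<close> of inner maps. The stabilizer \<open>H1\<close> of the final projection
  \<open>g\<close> modulo \<open>P0\<close> supplements \<open>r\<close>, and its elements in
  \<open>r\<close> are central modulo \<open>K\<close>.\<close>

lemma levi_abelian_step:
 fixes H :: "'v::cvec endo set"
 assumes H: "subalg H" "fd H" "H \<subseteq> fr" "tperfect H" and K: "ideal_in K H" "K \<subseteq> trad H" "lbs (trad H) (trad H) \<subseteq> K"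
  and l0: "subalg l0" "l0 \<subseteq> H" "tperfect l0" "trad l0 \<subseteq> {0}"
 shows "\<exists>H1. subalg H1 \<and> H1 \<subseteq> H \<and> l0 \<subseteq> H1 \<and> K \<subseteq> H1 \<and> (\<forall>x\<in>H. \<exists>p\<in>trad H. x + p \<in> H1) \<and>
  (\<forall>x\<in>trad H \<inter> H1. \<forall>y\<in>H. lb x y \<in> K)"
proof -
 define r where "r = trad H"
 obtain prj :: "'v endo endo" where prj: "\<And>y. prj \<cdot> y \<in> H" "\<And>y. y \<in> H ==> prj \<cdot> y = y"
  by (rule proj_onto[OF subalg_D(1)[OF H(1)]]) (rule that)
 interpret levi_split H r K prj
  by unfold_locales (use H(1,2) K prj trad_ideal[OF H(1,3)] in \<open>simp_all add: r_def\<close>)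
 have rrK: "lb a b \<in> K" if "a \<in> r" "b \<in> r" for a b
  using K(3) lbs_mem[OF that] unfolding r_def by blast
 define P where "P = {F. (\<forall>y. F \<cdot> y = F \<cdot> prj \<cdot> y) \<and> (\<exists>p\<in>r. \<forall>y\<in>H. F \<cdot> y - lb p y \<in> K)}"
 have Pv: "cv.subspace P"
 proof (rule cv.subspaceI)
  show "0 \<in> P" unfolding P_def using cv.subspace_0[OF rv] cv.subspace_0[OF Kv] by (auto intro!: bexI[of _ 0])
  fix F G assume F: "F \<in> P" and G: "G \<in> P"
  obtain p where p: "p \<in> r" "\<forall>y\<in>H. F \<cdot> y - lb p y \<in> K" using F unfolding P_def by blast
  obtain q where q: "q \<in> r" "\<forall>y\<in>H. G \<cdot> y - lb q y \<in> K" using G unfolding P_def by blast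
  have "(F + G) \<cdot> y - lb (p + q) y \<in> K" if "y \<in> H" for y
  proof -
   have e: "(F + G) \<cdot> y - lb (p + q) y = (F \<cdot> y - lb p y) + (G \<cdot> y - lb q y)" by simp
   show ?thesis unfolding e using p q that by (intro cv.subspace_add[OF Kv]) auto
  qed
  moreover have "p + q \<in> r" by (rule cv.subspace_add[OF rv p(1) q(1)])
  moreover have "(F + G) \<cdot> y = (F + G) \<cdot> prj \<cdot> y" for y using F G unfolding P_def by auto
  ultimately show "F + G \<in> P" unfolding P_def by blast
 next
  fix c F assume F: "F \<in> P"
  obtain p where p: "p \<in> r" "\<forall>y\<in>H. F \<cdot> y - lb p y \<in> K" using F unfolding P_def by blast
  have "(c *\<^sub>C F) \<cdot> y - lb (c *\<^sub>C p) y \<in> K" if "y \<in> H" for y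
  proof -
   have e: "(c *\<^sub>C F) \<cdot> y - lb (c *\<^sub>C p) y = c *\<^sub>C (F \<cdot> y - lb p y)" by (simp add: cv.scale_right_diff_distrib)
   show ?thesis unfolding e using p that by (intro cv.subspace_scale[OF Kv]) auto
  qed
  moreover have "c *\<^sub>C p \<in> r" by (rule cv.subspace_scale[OF rv p(1)])
  moreover have "(c *\<^sub>C F) \<cdot> y = (c *\<^sub>C F) \<cdot> prj \<cdot> y" for y using F unfolding P_def by auto
  ultimately show "c *\<^sub>C F \<in> P" unfolding P_def by blast
 qed
 have PN: "P \<subseteq> N'"
 proof
  fix F assume F: "F \<in> P"
  obtain p where p: "p \<in> r" "\<forall>y\<in>H. F \<cdot> y - lb p y \<in> K" using F unfolding P_def by blast
  have F_prj: "F \<cdot> y = F \<cdot> prj \<cdot> y" for y using F unfolding P_def by auto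
  have "F \<cdot> y \<in> K" if y: "y \<in> r" for y
   using cv.subspace_add[OF Kv bspec[OF p(2) rH[OF y]] rrK[OF p(1) y]] by simp
  moreover have "F \<cdot> y \<in> r" for y
   using cv.subspace_add[OF rv Kr[OF bspec[OF p(2) prj(1)[of y]]] ideal_inD(4)[OF r prj(1)[of y] p(1)]] F_prj[of y] by simp
  ultimately show "F \<in> N'" unfolding N'_def using F_prj by blast
 qed
 have P0P: "P0 \<subseteq> P" unfolding P0_def P_def using cv.subspace_0[OF rv] by (auto intro!: bexI[of _ 0])
 have act_P: "actm prj x \<cdot> F \<in> P" if x: "x \<in> H" and F: "F \<in> P" for x F
 proof -
  obtain p where p: "p \<in> r" "\<forall>y\<in>H. F \<cdot> y - lb p y \<in> K" using F unfolding P_def by blast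
  have "lb x (F \<cdot> y) - F \<cdot> lb x y - lb (lb x p) y \<in> K" if y: "y \<in> H" for y
  proof -
   have "lb x (F \<cdot> y) - F \<cdot> lb x y - lb (lb x p) y = lb x (F \<cdot> y - lb p y) - (F \<cdot> lb x y - lb p (lb x y))"
    unfolding lb_simps lb_jacobi[of x p y] by simp
   also have "\<dots> \<in> K" by (rule cv.subspace_diff[OF Kv ideal_inD(3)[OF K(1) x bspec[OF p(2) y]] bspec[OF p(2) subalg_D(2)[OF H(1) x y]]])
   finally show ?thesis .
  qed
  moreover have "lb x p \<in> r" by (rule ideal_inD(3)[OF r x p(1)])
  ultimately show ?thesis unfolding P_def mem_Collect_eq actm_app2 using prj(2) prj_prj by auto
 qed
 \<comment> \<open>For \<open>x\<close> in \<open>r\<close> and \<open>F\<close> with scalar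
   \<open>l\<close> the commutator is the inner map given by \<open>- l x\<close>; the remaining
   term is a bracket of elements of \<open>r\<close> and lies in \<open>K\<close>.\<close>
 have act_r: "actm prj x \<cdot> F \<in> P" if x: "x \<in> r" and F: "F \<in> M" for x F
 proof -
  obtain l where l: "\<forall>y\<in>r. F \<cdot> y - l *\<^sub>C y \<in> K" using F unfolding M_def by blast
  have Fr: "F \<cdot> y \<in> r" for y using F unfolding M_def by simp
  have "lb x (F \<cdot> y) - F \<cdot> lb x y - lb ((-l) *\<^sub>C x) y \<in> K" if y: "y \<in> H" for y
  proof -
   have "lb x (F \<cdot> y) - F \<cdot> lb x y - lb ((-l) *\<^sub>C x) y = lb x (F \<cdot> y) - (F \<cdot> lb x y - l *\<^sub>C lb x y)" by simp
   also have "\<dots> \<in> K" by (rule cv.subspace_diff[OF Kv rrK[OF x Fr] bspec[OF l ideal_inD(4)[OF r y x]]])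
   finally show ?thesis .
  qed
  moreover have "(-l) *\<^sub>C x \<in> r" by (rule cv.subspace_scale[OF rv x])
  ultimately show ?thesis unfolding P_def mem_Collect_eq actm_app2 using prj(2) prj_prj by (auto intro!: bexI[of _ "(-l) *\<^sub>C x"] simp del: cv.scale_minus_left)
 qed
 obtain e where e: "e \<in> M" "\<And>y. y \<in> r ==> e \<cdot> y = y" by (rule e_exists) (rule that)
 have "\<exists>f\<in>M. f - e \<in> N' \<and> (\<forall>x\<in>H. actm prj x \<cdot> f \<in> P)"
  by (rule invariant_vector_quotient[OF H M_subspace M_fd Pv PN N'_M N'_subspace clinear_actm act_N' act_P act_lb _ e(1)])
   (use act_r in \<open>simp_all add: r_def\<close>)
 then obtain f where f: "f \<in> M" "f - e \<in> N'" "\<And>x. x \<in> H ==> actm prj x \<cdot> f \<in> P" by blast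
 \<comment> \<open>A second application of the invariant vector, now for \<open>l0\<close> and
   modulo \<open>P0\<close>. The form of \<open>l0\<close> is nondegenerate, so its radical acts
   trivially on every module. The result is a projection \<open>g\<close> that is stabilized by
   \<open>l0\<close>.\<close>
 define M2 where "M2 = cv.span (insert f P)"
 have l0H: "x \<in> H" if "x \<in> l0" for x using l0(2) that by blast
 have PM: "P \<subseteq> M" using PN N'_M by blast
 have M2: "m \<in> M2 \<longleftrightarrow> (\<exists>c. m - c *\<^sub>C f \<in> P)" for m
  unfolding M2_def cv.span_breakdown_eq cv.span_eq_iff[THEN iffD2, OF Pv] ..
 have M2M: "M2 \<subseteq> M" unfolding M2_def by (rule cv.span_minimal[OF _ M_subspace]) (use f(1) PM in auto)
 have "\<exists>g\<in>M2. g - f \<in> P \<and> (\<forall>x\<in>l0. actm prj x \<cdot> g \<in> P0)"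
 proof (rule invariant_vector_quotient[OF l0(1) fd_subset[OF H(2) l0(2)] _ l0(3)])
  show "l0 \<subseteq> fr" using l0(2) H(3) by (rule subset_trans)
  show "cv.subspace M2" unfolding M2_def by (rule cv.subspace_span)
  show "fd M2" by (rule fd_subset[OF M_fd M2M])
  show "P \<subseteq> M2" unfolding M2_def using cv.span_superset by blast
  show "f \<in> M2" unfolding M2_def by (rule cv.span_base) simp
  show "actm prj x \<cdot> m \<in> P" if xm: "x \<in> l0" "m \<in> M2" for x m
  proof -
   obtain c where c: "m - c *\<^sub>C f \<in> P" using xm(2) unfolding M2 by blast
   have "actm prj x \<cdot> m = actm prj x \<cdot> (m - c *\<^sub>C f) + c *\<^sub>C (actm prj x \<cdot> f)" by simp
   also have "\<dots> \<in> P"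
    by (intro cv.subspace_add[OF Pv] cv.subspace_scale[OF Pv] act_P[OF l0H[OF xm(1)] c] f(3) l0H xm(1))
   finally show ?thesis .
  qed
  show "actm prj x \<cdot> m \<in> P0" if "x \<in> l0" "m \<in> P0" for x m by (rule act_P0[OF l0H[OF that(1)] that(2)])
  show "actm prj (lb x y) \<cdot> m = actm prj x \<cdot> actm prj y \<cdot> m - actm prj y \<cdot> actm prj x \<cdot> m" if "x \<in> l0" "y \<in> l0" for x y m
   by (rule act_lb[OF l0H[OF that(1)] l0H[OF that(2)]])
  show "actm prj x \<cdot> m \<in> P0" if "x \<in> trad l0" for x m
  proof -
   have "x = 0" using l0(4) that by blast
   then show ?thesis using clinear_0[OF clinear_actm, of prj] cv.subspace_0[OF P0_subspace] by simp
  qed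
 qed (rule P0_subspace, rule P0P, rule Pv, rule clinear_actm)
 then obtain g where g: "g \<in> M2" "g - f \<in> P" "\<And>x. x \<in> l0 ==> actm prj x \<cdot> g \<in> P0" by blast
 have gM: "g \<in> M" using g(1) M2M by blast
 have gr: "g \<cdot> y \<in> r" for y using gM unfolding M_def by simp
 have gP: "actm prj x \<cdot> g \<in> P" if x: "x \<in> H" for x
  using cv.subspace_add[OF Pv act_P[OF x g(2)] f(3)[OF x]] by simp
 have "g - e \<in> N'" using cv.subspace_add[OF N'_subspace subsetD[OF PN g(2)] f(2)] by simp
 then have gn: "g \<cdot> y - y \<in> K" if "y \<in> r" for y using normalized e(2) that by blast
 have gK: "g \<cdot> y \<in> K" if y: "y \<in> K" for y using cv.subspace_add[OF Kv gn[OF Kr[OF y]] y] by simp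
 have P0_iff: "actm prj x \<cdot> g \<in> P0 \<longleftrightarrow> (\<forall>y\<in>H. lb x (g \<cdot> y) - g \<cdot> lb x y \<in> K)" for x
  unfolding P0_def mem_Collect_eq actm_app2 using prj(2) prj_prj by auto
 define H1 where "H1 = {x \<in> H. actm prj x \<cdot> g \<in> P0}"
 have "subalg H1" unfolding lie_subalgebra_def
 proof (intro conjI ballI)
  show "cv.subspace H1" unfolding H1_def
   by (rule cv.subspaceI) (auto simp: subspace_rules[OF Hv]
    clinear_rules[OF clinear_actm]
    subspace_rules[OF P0_subspace])
  fix x y assume "x \<in> H1" "y \<in> H1"
  then have xy: "x \<in> H" "y \<in> H" "actm prj x \<cdot> g \<in> P0" "actm prj y \<cdot> g \<in> P0" unfolding H1_def by auto
  have "actm prj (lb x y) \<cdot> g \<in> P0" unfolding act_lb[OF xy(1,2)]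
   by (intro cv.subspace_diff[OF P0_subspace] act_P0 xy)
  then show "lb x y \<in> H1" using subalg_D(2)[OF H(1) xy(1,2)] unfolding H1_def by simp
 qed
 moreover have "H1 \<subseteq> H" unfolding H1_def by auto
 moreover have "l0 \<subseteq> H1" unfolding H1_def using g(3) l0H by auto
 moreover have "K \<subseteq> H1"
 proof
  fix x assume x: "x \<in> K"
  have "lb x (g \<cdot> y) - g \<cdot> lb x y \<in> K" if y: "y \<in> H" for y
   by (intro cv.subspace_diff[OF Kv] gK ideal_inD(4)[OF K(1)] rH gr x y)
  then show "x \<in> H1" unfolding H1_def P0_iff using rH[OF Kr[OF x]] by simp
 qed
 \<comment> \<open>Modulo \<open>K\<close> the element \<open>x\<close> moves \<open>g\<close> by
   the inner map of some \<open>p\<close> in \<open>r\<close>. Since \<open>g\<close> is the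
   identity on \<open>r\<close>, adding \<open>p\<close> to \<open>x\<close> compensates this
   motion.\<close>
 moreover have "\<exists>p\<in>r. x + p \<in> H1" if x: "x \<in> H" for x
 proof -
  obtain p where p: "p \<in> r" "\<forall>y\<in>H. (actm prj x \<cdot> g) \<cdot> y - lb p y \<in> K" using gP[OF x] unfolding P_def by blast
  have "lb (x + p) (g \<cdot> y) - g \<cdot> lb (x + p) y \<in> K" if y: "y \<in> H" for y
  proof -
   have "lb (x + p) (g \<cdot> y) - g \<cdot> lb (x + p) y
     = ((actm prj x \<cdot> g) \<cdot> y - lb p y) + lb p (g \<cdot> y) - (g \<cdot> lb p y - lb p y)"
    unfolding actm_app2 prj(2)[OF y] by simp
   also have "\<dots> \<in> K"
    by (intro cv.subspace_diff[OF Kv] cv.subspace_add[OF Kv] bspec[OF p(2) y] rrK p(1) gr gn ideal_inD(4)[OF r y p(1)])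
   finally show ?thesis .
  qed
  then have "x + p \<in> H1" unfolding H1_def P0_iff using cv.subspace_add[OF Hv x rH[OF p(1)]] by simp
  then show ?thesis using p(1) by blast
 qed
 moreover have "lb x y \<in> K" if x: "x \<in> r \<inter> H1" and y: "y \<in> H" for x y
 proof -
  have xr: "x \<in> r" using x by simp
  have "lb x (g \<cdot> y) - g \<cdot> lb x y \<in> K" using x y unfolding H1_def P0_iff by blast
  from cv.subspace_diff[OF Kv rrK[OF xr gr[of y]] this] have "g \<cdot> lb x y \<in> K" by simp
  from cv.subspace_diff[OF Kv this gn[OF ideal_inD(4)[OF r y xr]]] show ?thesis by simp
 qed
 ultimately show ?thesis unfolding r_def[symmetric] by blast
qed

text \<open>The projection \<open>f\<close> onto \<open>r\<close> commutes with the action, and the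
  action on \<open>r\<close> is trivial, both modulo \<open>K\<close>; so \<open>f\<close> maps
  \<open>[H, H]\<close> into \<open>K\<close>. As \<open>f\<close> is the identity on
  \<open>r\<close> modulo \<open>K\<close>, the intersection of \<open>[H, H]\<close> and
  \<open>r\<close> lies in \<open>K\<close>, and \<open>[H, H] + K\<close> is the desired
  supplement.\<close>

lemma levi_central_step:
 fixes H :: "'v::cvec endo set"
 assumes H: "subalg H" "fd H" "H \<subseteq> fr" "tperfect H" and K: "ideal_in K H" "K \<subseteq> trad H"
  and c: "\<And>x y. x \<in> trad H ==> y \<in> H ==> lb x y \<in> K"
 shows "\<exists>H2. subalg H2 \<and> H2 \<subseteq> H \<and> lbs H H \<subseteq> H2 \<and> K \<subseteq> H2 \<and> (\<forall>x\<in>H. \<exists>p\<in>trad H. x + p \<in> H2) \<and> trad H \<inter> H2 \<subseteq> K"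
proof -
 define r where "r = trad H"
 obtain prj :: "'v endo endo" where prj: "\<And>y. prj \<cdot> y \<in> H" "\<And>y. y \<in> H ==> prj \<cdot> y = y"
  by (rule proj_onto[OF subalg_D(1)[OF H(1)]]) (rule that)
 interpret levi_split H r K prj
  by unfold_locales (use H(1,2) K prj trad_ideal[OF H(1,3)] in \<open>simp_all add: r_def\<close>)
 have act_r: "actm prj x \<cdot> F \<in> P0" if x: "x \<in> r" and F: "F \<in> M" for x F
 proof -
  obtain l where l: "\<forall>y\<in>r. F \<cdot> y - l *\<^sub>C y \<in> K" using F unfolding M_def by blast
  have Fr: "F \<cdot> y \<in> r" for y using F unfolding M_def by simp
  have "lb x (F \<cdot> y) - F \<cdot> lb x y \<in> K" if y: "y \<in> H" for y
  proof -
   have xy: "lb x y \<in> K" using c x y unfolding r_def by blast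
   have "F \<cdot> lb x y \<in> K" using cv.subspace_add[OF Kv bspec[OF l Kr[OF xy]] cv.subspace_scale[OF Kv xy, of l]] by simp
   moreover have "lb x (F \<cdot> y) \<in> K" using c x rH[OF Fr] unfolding r_def by blast
   ultimately show ?thesis by (rule cv.subspace_diff[OF Kv, rotated])
  qed
  then show ?thesis unfolding P0_def mem_Collect_eq actm_app2 by (simp add: prj(2) prj_prj)
 qed
 obtain e where e: "e \<in> M" "\<And>y. y \<in> r ==> e \<cdot> y = y" by (rule e_exists) (rule that)
 have "\<exists>f\<in>M. f - e \<in> N' \<and> (\<forall>x\<in>H. actm prj x \<cdot> f \<in> P0)"
  by (rule invariant_vector_quotient[OF H M_subspace M_fd P0_subspace P0_N' N'_M N'_subspace clinear_actm act_N' act_P0 act_lb _ e(1)])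
   (use act_r in \<open>simp_all add: r_def\<close>)
 then obtain f where f: "f \<in> M" "f - e \<in> N'" "\<And>x. x \<in> H ==> actm prj x \<cdot> f \<in> P0" by blast
 have fn: "f \<cdot> y - y \<in> K" if "y \<in> r" for y using normalized[OF f(2) e(2) that] .
 have fr: "f \<cdot> y \<in> r" for y using f(1) unfolding M_def by simp
 have flb: "f \<cdot> lb x y \<in> K" if x: "x \<in> H" and y: "y \<in> H" for x y
 proof -
  have "lb x (f \<cdot> y) - f \<cdot> lb x y \<in> K" using f(3)[OF x] y prj(2)[OF y] unfolding P0_def mem_Collect_eq actm_app2 by force
  moreover have "lb (f \<cdot> y) x \<in> K" using c fr x unfolding r_def by blast
  then have "lb x (f \<cdot> y) \<in> K" using cv.subspace_neg[OF Kv] by (simp add: lb_swap[of x])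
  ultimately have "lb x (f \<cdot> y) - (lb x (f \<cdot> y) - f \<cdot> lb x y) \<in> K" by (rule cv.subspace_diff[OF Kv, rotated])
  then show ?thesis by simp
 qed
 have "cv.subspace {a. f \<cdot> a \<in> K}"
  by (rule cv.subspaceI) (simp_all add: subspace_rules[OF Kv])
 then have "lbs H H \<subseteq> {a. f \<cdot> a \<in> K}" by (rule lbs_subset) (simp add: flb)
 then have fl: "f \<cdot> a \<in> K" if "a \<in> lbs H H" for a using that by blast
 define H2 where "H2 = {x. \<exists>a\<in>lbs H H. x - a \<in> K}"
 have LH: "a \<in> H" if "a \<in> lbs H H" for a using lbs_subalg[OF H(1)] that by blast
 note Lv = lbs_subspace[of H H]
 have H2H: "x \<in> H" if "x \<in> H2" for x
 proof -
  obtain a where a: "a \<in> lbs H H" "x - a \<in> K" using \<open>x \<in> H2\<close> unfolding H2_def by blast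
  show ?thesis using cv.subspace_add[OF Hv rH[OF Kr[OF a(2)]] LH[OF a(1)]] by simp
 qed
 have LH2: "lbs H H \<subseteq> H2" unfolding H2_def using cv.subspace_0[OF Kv] by (auto intro!: bexI)
 have "subalg H2" unfolding lie_subalgebra_def
 proof (intro conjI ballI)
  show "cv.subspace H2" unfolding H2_def by (rule subspace_sum_set[OF Lv Kv])
  show "lb x y \<in> H2" if "x \<in> H2" "y \<in> H2" for x y
   using LH2 lbs_mem[OF H2H[OF that(1)] H2H[OF that(2)]] by blast
 qed
 moreover have "H2 \<subseteq> H" using H2H by blast
 moreover have "K \<subseteq> H2" unfolding H2_def using cv.subspace_0[OF Lv] by (auto intro!: bexI[of _ 0])
 moreover have "\<exists>p\<in>r. x + p \<in> H2" if x: "x \<in> H" for x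
 proof -
  obtain a where a: "a \<in> lbs H H" "x - a \<in> r" using H(4) x unfolding tperfect_def r_def by blast
  have "- (x - a) \<in> r" by (rule cv.subspace_neg[OF rv a(2)])
  moreover have "x + - (x - a) \<in> H2" using LH2 a(1) by auto
  ultimately show ?thesis by blast
 qed
 moreover have "x \<in> K" if x: "x \<in> r" "x \<in> H2" for x
 proof -
  obtain a where a: "a \<in> lbs H H" "x - a \<in> K" using x(2) unfolding H2_def by blast
  have "x - (x - a) \<in> r" by (rule cv.subspace_diff[OF rv x(1) Kr[OF a(2)]])
  then have ar: "a \<in> r" by simp
  have "f \<cdot> a - (f \<cdot> a - a) \<in> K" by (rule cv.subspace_diff[OF Kv fl[OF a(1)] fn[OF ar]])
  then have "a \<in> K" by simp
  from cv.subspace_add[OF Kv a(2) this] show ?thesis by simp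
 qed
 ultimately show ?thesis unfolding r_def[symmetric] using LH2 by blast
qed

text \<open>Elements of \<open>trad H\<close> do not contribute to traces of products within
  \<open>H\<close>, so the form on \<open>H1\<close> already decides orthogonality to
  \<open>H\<close>.\<close>

lemma supplement_trad:
 assumes H: "subalg H" "H \<subseteq> fr" and H1: "subalg H1" "H1 \<subseteq> H" "\<And>x. x \<in> H ==> \<exists>p\<in>trad H. x + p \<in> H1"
 shows "trad H1 = trad H \<inter> H1"
proof
 show "trad H \<inter> H1 \<subseteq> trad H1" using H1(2) unfolding trad_def by auto
 show "trad H1 \<subseteq> trad H \<inter> H1"
 proof
  fix x assume x: "x \<in> trad H1"
  have xH: "x \<in> H" "x \<in> H1" using x H1(2) unfolding trad_def by auto
  have "tr (x * y) = 0" if y: "y \<in> H" for y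
  proof -
   obtain p where p: "p \<in> trad H" "y + p \<in> H1" using H1(3)[OF y] by blast
   have "tr (x * p) = tr (p * x)" using H(2) xH by (intro tr_comm) auto
   also have "\<dots> = 0" using p(1) xH unfolding trad_def by simp
   finally have "tr (x * p) = 0" .
   moreover have "tr (x * (y + p)) = 0" using x p(2) unfolding trad_def by blast
   moreover have "x * y \<in> fr" "x * p \<in> fr" using H(2) xH by (auto intro: fr_mult_left fr_mult_right)
   ultimately show ?thesis by (simp add: distrib_left tr_simps)
  qed
  then show "x \<in> trad H \<inter> H1" using xH unfolding trad_def by simp
 qed
qed

lemma supplement_tperfect:
 assumes H: "subalg H" "H \<subseteq> fr" "tperfect H" and H1: "subalg H1" "H1 \<subseteq> H" "\<And>x. x \<in> H ==> \<exists>p\<in>trad H. x + p \<in> H1"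
 shows "tperfect H1"
proof -
 have t1: "trad H1 = trad H \<inter> H1" by (rule supplement_trad[OF H(1,2) H1])
 note ti = trad_ideal[OF H(1,2)]
 note tv = ideal_inD(1)[OF ti]
 have dec: "\<exists>b\<in>lbs H1 H1. a - b \<in> trad H" if "a \<in> lbs H H" for a
  using that
 proof (induction rule: lbs_induct)
  case (lb u v)
  obtain p where p: "p \<in> trad H" "u + p \<in> H1" using H1(3)[OF lb(1)] by blast
  obtain q where q: "q \<in> trad H" "v + q \<in> H1" using H1(3)[OF lb(2)] by blast
  have e: "lb u v - lb (u + p) (v + q) = - (lb u q + lb p v + lb p q)" by simp
  have "lb u v - lb (u + p) (v + q) \<in> trad H" unfolding e
   by (intro cv.subspace_neg[OF tv] cv.subspace_add[OF tv] ideal_inD(3)[OF ti lb(1) q(1)] ideal_inD(4)[OF ti lb(2) p(1)]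
     ideal_inD(3)[OF ti ideal_inD(2)[OF ti p(1)] q(1)])
  then show ?case using lbs_mem[OF p(2) q(2)] by blast
 next
  case zero
  then show ?case using cv.subspace_0[OF lbs_subspace] cv.subspace_0[OF tv] by (intro bexI[of _ 0]) simp_all
 next
  case (add u v)
  then obtain a b where ab: "a \<in> lbs H1 H1" "b \<in> lbs H1 H1" "u - a \<in> trad H" "v - b \<in> trad H" by blast
  have e: "u + v - (a + b) = (u - a) + (v - b)" by simp
  have "u + v - (a + b) \<in> trad H" unfolding e by (rule cv.subspace_add[OF tv ab(3,4)])
  then show ?case using cv.subspace_add[OF lbs_subspace ab(1,2)] by blast
 next
  case (scC c u)
  then obtain a where a: "a \<in> lbs H1 H1" "u - a \<in> trad H" by blast
  have "c *\<^sub>C u - c *\<^sub>C a \<in> trad H" unfolding cv.scale_right_diff_distrib[symmetric] by (rule cv.subspace_scale[OF tv a(2)])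
  then show ?case using cv.subspace_scale[OF lbs_subspace a(1)] by blast
 qed
 have "\<exists>a\<in>lbs H1 H1. x - a \<in> trad H1" if x: "x \<in> H1" for x
 proof -
 obtain a where a: "a \<in> lbs H H" "x - a \<in> trad H" using x H(3) H1(2) unfolding tperfect_def by blast
 obtain b where b: "b \<in> lbs H1 H1" "a - b \<in> trad H" using dec[OF a(1)] by blast
 have e: "x - b = (x - a) + (a - b)" by simp
 have "x - b \<in> trad H" unfolding e by (rule cv.subspace_add[OF tv a(2) b(2)])
 moreover have "x - b \<in> H1" using cv.subspace_diff[OF subalg_D(1)[OF H1(1)] x] lbs_subalg[OF H1(1)] b(1) by blast
 ultimately show ?thesis using b(1) unfolding t1 by blast
 qed
 then show ?thesis unfolding tperfect_def by blast
qed

lemma levi_step: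
 assumes H: "subalg H" "fd H" "H \<subseteq> fr" "tperfect H" and K: "ideal_in K H" "K \<subseteq> trad H" "lbs (trad H) (trad H) \<subseteq> K"
  and l0: "subalg l0" "l0 \<subseteq> H" "tperfect l0" "trad l0 \<subseteq> {0}"
 shows "\<exists>H2. subalg H2 \<and> H2 \<subseteq> H \<and> l0 \<subseteq> H2 \<and> K \<subseteq> H2 \<and> (\<forall>x\<in>H. \<exists>p\<in>trad H. x + p \<in> H2) \<and> trad H \<inter> H2 \<subseteq> K"
proof -
 obtain H1 where H1: "subalg H1" "H1 \<subseteq> H" "l0 \<subseteq> H1" "K \<subseteq> H1" "\<And>x. x \<in> H ==> \<exists>p\<in>trad H. x + p \<in> H1"
  "\<And>x y. x \<in> trad H \<inter> H1 ==> y \<in> H ==> lb x y \<in> K"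
  using levi_abelian_step[OF H K l0] by blast
 have t1: "trad H1 = trad H \<inter> H1" by (rule supplement_trad[OF H(1,3) H1(1,2,5)])
 have p1: "tperfect H1" by (rule supplement_tperfect[OF H(1,3,4) H1(1,2,5)])
 have f1: "fd H1" "H1 \<subseteq> fr" using fd_subset[OF H(2) H1(2)] H1(2) H(3) by auto
 have K1: "ideal_in K H1" using K(1) H1(2,4) unfolding ideal_in_def by blast
 have "\<exists>H2. subalg H2 \<and> H2 \<subseteq> H1 \<and> lbs H1 H1 \<subseteq> H2 \<and> K \<subseteq> H2 \<and> (\<forall>x\<in>H1. \<exists>p\<in>trad H1. x + p \<in> H2) \<and> trad H1 \<inter> H2 \<subseteq> K"
 proof (rule levi_central_step[OF H1(1) f1 p1 K1])
  show "K \<subseteq> trad H1" unfolding t1 using K(2) H1(4) by blast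
  show "lb x y \<in> K" if "x \<in> trad H1" "y \<in> H1" for x y using H1(6)[of x y] that H1(2) unfolding t1 by blast
 qed
 then obtain H2 where H2: "subalg H2" "H2 \<subseteq> H1" "lbs H1 H1 \<subseteq> H2" "K \<subseteq> H2" "\<And>x. x \<in> H1 ==> \<exists>p\<in>trad H1. x + p \<in> H2"
  "trad H1 \<inter> H2 \<subseteq> K" by blast
 \<comment> \<open>\<open>l0\<close> is perfect because its form has radical 0, so it lies in
   \<open>lbs H1 H1\<close>, which the central step preserves.\<close>
 have "l0 \<subseteq> H2"
 proof
  fix x assume "x \<in> l0"
  then obtain a where a: "a \<in> lbs l0 l0" "x - a \<in> trad l0" using l0(3) unfolding tperfect_def by blast
  then have "x = a" using l0(4) by auto
  then show "x \<in> H2" using a(1) lbs_mono[OF H1(3) H1(3)] H2(3) by blast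
 qed
 moreover have "\<exists>p\<in>trad H. x + p \<in> H2" if x: "x \<in> H" for x
 proof -
  obtain p where p: "p \<in> trad H" "x + p \<in> H1" using H1(5)[OF x] by blast
  obtain q where q: "q \<in> trad H1" "x + p + q \<in> H2" using H2(5)[OF p(2)] by blast
  have "p + q \<in> trad H" using q(1) unfolding t1 by (intro cv.subspace_add[OF trad_subspace[OF H(1,3)] p(1)]) simp
  then show ?thesis using q(2) by (auto simp: add.assoc)
 qed
 moreover have "trad H \<inter> H2 \<subseteq> K" using H2(2,6) unfolding t1 by blast
 ultimately show ?thesis using H2(1,2,4) H1(2) by blast
qed

text \<open>The derived series of the radical has abelian steps and ends at 0 by Cartan's criterion.
  Prescribing the subalgebra \<open>l0\<close> is what makes an increasing choice of Levi
  subalgebras possible later.\<close>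

theorem levi_finite_dimensional:
 assumes H: "subalg H" "fd H" "H \<subseteq> fr" "tperfect H"
  and l0: "subalg l0" "l0 \<subseteq> H" "tperfect l0" "trad l0 \<subseteq> {0}"
 shows "\<exists>l. subalg l \<and> l \<subseteq> H \<and> l0 \<subseteq> l \<and> (\<forall>x\<in>H. \<exists>p\<in>trad H. x + p \<in> l) \<and> trad H \<inter> l \<subseteq> {0}"
proof -
 define r where "r = trad H"
 have ri: "ideal_in r H" unfolding r_def by (rule trad_ideal[OF H(1,3)])
 have "\<exists>l. subalg l \<and> l \<subseteq> H \<and> l0 \<subseteq> l \<and> dser r m \<subseteq> l \<and> (\<forall>x\<in>H. \<exists>p\<in>r. x + p \<in> l) \<and> r \<inter> l \<subseteq> dser r m" for m
 proof (induction m)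
  case 0
  have "\<forall>x\<in>H. \<exists>p\<in>r. x + p \<in> H" using cv.subspace_0[OF ideal_inD(1)[OF ri]] by (auto intro!: bexI[of _ 0])
  moreover have "r \<subseteq> H" using ideal_inD(2)[OF ri] by blast
  ultimately show ?case using H(1) l0(2) by (intro exI[of _ H]) auto
 next
  case (Suc m)
  then obtain l where l: "subalg l" "l \<subseteq> H" "l0 \<subseteq> l" "dser r m \<subseteq> l" "\<And>x. x \<in> H ==> \<exists>p\<in>r. x + p \<in> l" "r \<inter> l \<subseteq> dser r m"
   by blast
  note l5 = l(5)[unfolded r_def]
  have dr: "dser r n \<subseteq> r" for n by (rule dser_subset[OF ideal_subalg[OF ri]])
  have tl: "trad l = dser r m" using supplement_trad[OF H(1,3) l(1,2) l5] l(4,6) dr[of m] unfolding r_def[symmetric] by blast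
  have pl: "tperfect l" by (rule supplement_tperfect[OF H(1,3,4) l(1,2) l5])
  have dS: "dser r (Suc m) \<subseteq> l" using dser_decreasing[OF ideal_subalg[OF ri], of m] l(4) by blast
  have Ki: "ideal_in (dser r (Suc m)) l"
   using ideal_dser[OF ri, of "Suc m"] dS l(2) unfolding ideal_in_def by blast
  have "l \<subseteq> fr" using l(2) H(3) by blast
  have "\<exists>H2. subalg H2 \<and> H2 \<subseteq> l \<and> l0 \<subseteq> H2 \<and> dser r (Suc m) \<subseteq> H2 \<and> (\<forall>x\<in>l. \<exists>p\<in>trad l. x + p \<in> H2) \<and> trad l \<inter> H2 \<subseteq> dser r (Suc m)"
  proof (rule levi_step[OF l(1) fd_subset[OF H(2) l(2)] \<open>l \<subseteq> fr\<close> pl Ki _ _ l0(1) l(3) l0(3,4)])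
   show "dser r (Suc m) \<subseteq> trad l" unfolding tl by (rule dser_decreasing[OF ideal_subalg[OF ri]])
   show "lbs (trad l) (trad l) \<subseteq> dser r (Suc m)" unfolding tl by simp
  qed
  then obtain H2 where H2: "subalg H2" "H2 \<subseteq> l" "l0 \<subseteq> H2" "dser r (Suc m) \<subseteq> H2" "\<And>x. x \<in> l ==> \<exists>p\<in>trad l. x + p \<in> H2"
   "trad l \<inter> H2 \<subseteq> dser r (Suc m)" by blast
  have "\<exists>p\<in>r. x + p \<in> H2" if x: "x \<in> H" for x
  proof -
   obtain p where p: "p \<in> r" "x + p \<in> l" using l(5)[OF x] by blast
   obtain q where q: "q \<in> trad l" "x + p + q \<in> H2" using H2(5)[OF p(2)] by blast
   have "p + q \<in> r" using q(1) dr[of m] unfolding tl by (intro cv.subspace_add[OF ideal_inD(1)[OF ri] p(1)]) blast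
   then show ?thesis using q(2) by (auto simp: add.assoc)
  qed
  moreover have "r \<inter> H2 \<subseteq> dser r (Suc m)" using H2(2,6) l(6) unfolding tl by blast
  ultimately show ?case using H2(1-4) l(2) by (intro exI[of _ H2]) blast
 qed
 moreover have "solvable_lie scC lb r"
 proof (rule Cartan_criterion[OF ideal_subalg[OF ri]])
  show "fd r" by (rule fd_subset[OF H(2)]) (use ideal_inD(2)[OF ri] in blast)
  show "r \<subseteq> fr" using ideal_inD(2)[OF ri] H(3) by blast
  show "tr (a * b) = 0" if "a \<in> r" "b \<in> r" for a b using that unfolding r_def trad_def by simp
 qed
 then obtain m where "dser r m = {0}" unfolding solvable_lie_def by blast
 ultimately show ?thesis unfolding r_def[symmetric] by metis
qed

section \<open>Irreducible Lie algebras of finite rank operators\<close>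

definition ops :: "'v::cvec set => ('v => complex) set => 'v endo set" where
 "ops W F = cv.span {rk w f | w f. w \<in> W \<and> f \<in> F}"

lemma ops_subspace: "cv.subspace (ops W F)" unfolding ops_def by (rule cv.subspace_span)

lemma ops_rk: "w \<in> W ==> f \<in> F ==> rk w f \<in> ops W F"
 unfolding ops_def by (rule cv.span_base) blast

lemma ops_induct [consumes 1, case_names rk zero add scC]:
 assumes x: "x \<in> ops W F" and "\<And>w f. w \<in> W ==> f \<in> F ==> P (rk w f)" "P 0"
  "\<And>x y. P x ==> P y ==> P (x + y)" "\<And>c x. P x ==> P (c *\<^sub>C x)"
 shows "P x"
proof (rule cv.span_induct[OF x[unfolded ops_def]])
 show "cv.subspace {x. P x}" by (rule cv.subspaceI) (use assms in auto)
 show "P y" if "y \<in> {rk w f | w f. w \<in> W \<and> f \<in> F}" for y using that assms(2) by blast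
qed

lemma rk_fun_simps:
 assumes "clinear f" "clinear h"
 shows "rk w (f + h) = rk w f + rk w h" "rk w (f - h) = rk w f - rk w h" "rk w (c *\<^sub>C f) = c *\<^sub>C rk w f"
proof -
 have "clinear (f + h)" "clinear (f - h)" "clinear (c *\<^sub>C f)"
  using assms by (auto intro!: clinearI simp: clinear_add clinear_scC scC_fun_def algebra_simps)
 then show "rk w (f + h) = rk w f + rk w h" "rk w (f - h) = rk w f - rk w h" "rk w (c *\<^sub>C f) = c *\<^sub>C rk w f"
  using assms by (auto intro!: endo_eqI simp: scC_fun_def cv.scale_left_distrib cv.scale_left_diff_distrib)
qed

lemma rk_vec_simps:
 assumes "clinear f"
 shows "rk (v + w) f = rk v f + rk w f" "rk (v - w) f = rk v f - rk w f" "rk (c *\<^sub>C w) f = c *\<^sub>C rk w f" "rk (- v) f = - rk v f"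
 using assms by (auto intro!: endo_eqI simp: cv.scale_right_distrib cv.scale_right_diff_distrib mult.commute)

text \<open>A dual pair. \<open>F\<close> may be much smaller than the full dual of
  \<open>W\<close>, as is typical for finitary Lie algebras.\<close>

locale pairing =
 fixes W :: "'v::cvec set" and F :: "('v => complex) set"
 assumes Wv: "cv.subspace W" and Fv: "cv.subspace F" and Fl: "\<And>f. f \<in> F ==> clinear f"
  and sep: "\<And>w. w \<in> W ==> w \<noteq> 0 ==> \<exists>f\<in>F. f w \<noteq> 0"
  and cosep: "\<And>f. f \<in> F ==> f \<noteq> 0 ==> \<exists>w\<in>W. f w \<noteq> 0"
begin

lemma ops_fr: "x \<in> ops W F ==> x \<in> fr"
 by (induction rule: ops_induct) (simp_all add: rk_fr Fl fr_0 fr_add fr_scC)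

lemma ops_app: "x \<in> ops W F ==> x \<cdot> v \<in> W"
 by (induction rule: ops_induct)
  (simp_all add: Fl subspace_rules[OF Wv])

lemma ops_comp: "x \<in> ops W F ==> clinear f ==> (\<lambda>v. f (x \<cdot> v)) \<in> F"
proof (induction rule: ops_induct)
 case (rk w h)
 have "(\<lambda>v. f (rk w h \<cdot> v)) = f w *\<^sub>C h" by (simp add: fun_eq_iff scC_fun_def Fl[OF rk(2)] clinear_scC[OF rk(3)] mult.commute)
 then show ?case using cv.subspace_scale[OF Fv rk(2)] by simp
next
 case zero
 have "(\<lambda>v. f (0 \<cdot> v)) = 0" by (simp add: fun_eq_iff clinear_0[OF zero])
 then show ?case using cv.subspace_0[OF Fv] by simp
next
 case (add x y)
 have "(\<lambda>v. f ((x + y) \<cdot> v)) = (\<lambda>v. f (x \<cdot> v)) + (\<lambda>v. f (y \<cdot> v))" by (simp add: fun_eq_iff clinear_add[OF add(3)])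
 then show ?case using cv.subspace_add[OF Fv add(1)[OF add(3)] add(2)[OF add(3)]] by simp
next
 case (scC c x)
 have "(\<lambda>v. f ((c *\<^sub>C x) \<cdot> v)) = c *\<^sub>C (\<lambda>v. f (x \<cdot> v))" by (simp add: fun_eq_iff clinear_scC[OF scC(2)] scC_fun_def)
 then show ?case using cv.subspace_scale[OF Fv scC(1)[OF scC(2)]] by simp
qed

lemma ops_left: "x \<in> ops W F ==> (\<And>w. w \<in> W ==> a \<cdot> w \<in> W) ==> a * x \<in> ops W F"
proof (induction rule: ops_induct)
 case (rk w f) then show ?case by (simp add: mult_rk Fl ops_rk)
qed (simp_all add: distrib_left subspace_rules[OF ops_subspace])

lemma ops_mult: "a \<in> ops W F ==> x \<in> ops W F ==> a * x \<in> ops W F"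
 using ops_left ops_app by blast

text \<open>In the manner of Gram and Schmidt: the correction \<open>rk v h'\<close> repairs the
  defect \<open>v = w - b w\<close> of the new vector and vanishes on the vectors already fixed,
  because \<open>h'\<close> is \<open>h\<close> composed with \<open>1 - b\<close>.\<close>

lemma vector_unit: "finite G ==> G \<subseteq> W ==> \<exists>b\<in>ops W F. \<forall>w\<in>G. b \<cdot> w = w"
proof (induction rule: finite_induct)
 case empty then show ?case using cv.subspace_0[OF ops_subspace] by blast
next
 case (insert w G)
 then obtain b where b: "b \<in> ops W F" "\<And>u. u \<in> G ==> b \<cdot> u = u" by auto
 define v where "v = w - b \<cdot> w"
 have wW: "w \<in> W" using insert.prems by simp
 have vW: "v \<in> W" unfolding v_def by (rule cv.subspace_diff[OF Wv wW ops_app[OF b(1)]])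
 show ?case
 proof (cases "v = 0")
  case True
  then have "b \<cdot> w = w" unfolding v_def by simp
  then show ?thesis using b by (intro bexI[of _ b]) auto
 next
  case False
  then obtain f where f: "f \<in> F" "f v \<noteq> 0" using sep[OF vW] by blast
  define h where "h = inverse (f v) *\<^sub>C f"
  have h: "h \<in> F" "h v = 1" unfolding h_def using f cv.subspace_scale[OF Fv f(1)] by (auto simp: scC_fun_def)
  have hl: "clinear h" by (rule Fl[OF h(1)])
  define h' where "h' = h - (\<lambda>x. h (b \<cdot> x))"
  have h': "h' \<in> F" unfolding h'_def by (rule cv.subspace_diff[OF Fv h(1) ops_comp[OF b(1) hl]])
  define b' where "b' = b + rk v h'"
  have "b' \<in> ops W F" unfolding b'_def by (rule cv.subspace_add[OF ops_subspace b(1) ops_rk[OF vW h']])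
  moreover have "b' \<cdot> u = u" if "u \<in> G" for u
   unfolding b'_def using Fl[OF h'] b(2)[OF that] by (simp add: h'_def)
  moreover have "h w - h (b \<cdot> w) = 1" using h(2) unfolding v_def by (simp add: clinear_diff[OF hl])
  then have "b' \<cdot> w = w" unfolding b'_def using Fl[OF h'] by (simp add: h'_def v_def)
  ultimately show ?thesis by (intro bexI[of _ b']) auto
 qed
qed

lemma functional_unit: "finite G ==> G \<subseteq> F ==> \<exists>a\<in>ops W F. \<forall>f\<in>G. \<forall>x. f (a \<cdot> x) = f x"
proof (induction rule: finite_induct)
 case empty then show ?case using cv.subspace_0[OF ops_subspace] by blast
next
 case (insert f G)
 then obtain a where a: "a \<in> ops W F" "\<And>h x. h \<in> G ==> h (a \<cdot> x) = h x" by auto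
 have fF: "f \<in> F" and GF: "\<And>h. h \<in> G ==> h \<in> F" using insert.prems by auto
 have fl: "clinear f" by (rule Fl[OF fF])
 define k where "k = f - (\<lambda>x. f (a \<cdot> x))"
 have k: "k \<in> F" unfolding k_def by (rule cv.subspace_diff[OF Fv fF ops_comp[OF a(1) fl]])
 have kx: "k x = f x - f (a \<cdot> x)" for x unfolding k_def by simp
 show ?case
 proof (cases "k = 0")
  case True
  then have "f (a \<cdot> x) = f x" for x using kx[of x] by simp
  then show ?thesis using a by (intro bexI[of _ a]) auto
 next
  case False
  then obtain u where u: "u \<in> W" "k u \<noteq> 0" using cosep[OF k] by blast
  define w where "w = inverse (k u) *\<^sub>C u"
  have w: "w \<in> W" "k w = 1" unfolding w_def using u cv.subspace_scale[OF Wv u(1)] by (auto simp: clinear_scC[OF Fl[OF k]])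
  define a' where "a' = a + rk (w - a \<cdot> w) k"
  have "a' \<in> ops W F" unfolding a'_def
   by (rule cv.subspace_add[OF ops_subspace a(1) ops_rk[OF cv.subspace_diff[OF Wv w(1) ops_app[OF a(1)]] k]])
  moreover have "h (a' \<cdot> x) = h x" if "h \<in> G" for h x
   unfolding a'_def using Fl[OF k] Fl[OF GF[OF that]] a(2)[OF that] by (simp add: clinear_add clinear_scC clinear_diff)
  moreover have "f (a' \<cdot> x) = f x" for x
  proof -
   have "f (a' \<cdot> x) = f (a \<cdot> x) + k x * (f w - f (a \<cdot> w))"
    unfolding a'_def using Fl[OF k] fl by (simp add: clinear_add clinear_scC clinear_diff right_diff_distrib)
   then show ?thesis using w(2) unfolding kx by simp
  qed
  ultimately show ?thesis by (intro bexI[of _ a']) auto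
 qed
qed

lemma left_support: "x \<in> ops W F ==> \<exists>G. finite G \<and> G \<subseteq> W \<and> (\<forall>b. (\<forall>w\<in>G. b \<cdot> w = w) --> b * x = x)"
proof (induction rule: ops_induct)
 case (rk w f) then show ?case by (intro exI[of _ "{w}"]) (simp add: mult_rk Fl)
next
 case zero show ?case by (intro exI[of _ "{}"]) simp
next
 case (add x y)
 then obtain G H where "finite G" "G \<subseteq> W" "\<And>b. (\<forall>w\<in>G. b \<cdot> w = w) ==> b * x = x"
  "finite H" "H \<subseteq> W" "\<And>b. (\<forall>w\<in>H. b \<cdot> w = w) ==> b * y = y" by blast
 then show ?case by (intro exI[of _ "G \<union> H"]) (simp add: distrib_left)
next
 case (scC c x) then show ?case unfolding scC_mult_left scC_mult_right by metis
qed

lemma right_support: "x \<in> ops W F ==> \<exists>G. finite G \<and> G \<subseteq> F \<and> (\<forall>a. (\<forall>f\<in>G. \<forall>x. f (a \<cdot> x) = f x) --> x * a = x)"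
proof (induction rule: ops_induct)
 case (rk w f) then show ?case by (intro exI[of _ "{f}"]) (simp add: rk_mult Fl)
next
 case zero show ?case by (intro exI[of _ "{}"]) simp
next
 case (add x y)
 then obtain G H where "finite G" "G \<subseteq> F" "\<And>a. (\<forall>f\<in>G. \<forall>x. f (a \<cdot> x) = f x) ==> x * a = x"
  "finite H" "H \<subseteq> F" "\<And>a. (\<forall>f\<in>H. \<forall>x. f (a \<cdot> x) = f x) ==> y * a = y" by blast
 then show ?case by (intro exI[of _ "G \<union> H"]) (simp add: distrib_right)
next
 case (scC c x) then show ?case unfolding scC_mult_left scC_mult_right by metis
qed

text \<open>If \<open>b\<close> is a left unit and \<open>a\<close> a right unit, then \<open>1 - (1 - a) * (1 - b)\<close> is a two-sided unit.\<close>
lemma two_sided_unit: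
 assumes P: "finite P" "P \<subseteq> ops W F"
 shows "\<exists>e\<in>ops W F. \<forall>x\<in>P. e * x = x \<and> x * e = x"
proof -
 obtain G where G: "\<And>x. x \<in> P ==> finite (G x) \<and> G x \<subseteq> W \<and> (\<forall>b. (\<forall>w\<in>G x. b \<cdot> w = w) --> b * x = x)"
  using left_support P(2) by (metis subsetD)
 obtain H where H: "\<And>x. x \<in> P ==> finite (H x) \<and> H x \<subseteq> F \<and> (\<forall>a. (\<forall>f\<in>H x. \<forall>y. f (a \<cdot> y) = f y) --> x * a = x)"
  using right_support P(2) by (metis subsetD)
 have "finite (\<Union>x\<in>P. G x)" "(\<Union>x\<in>P. G x) \<subseteq> W" using G P(1) by auto
 then obtain b where b: "b \<in> ops W F" "\<forall>w\<in>(\<Union>x\<in>P. G x). b \<cdot> w = w" using vector_unit by blast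
 have "finite (\<Union>x\<in>P. H x)" "(\<Union>x\<in>P. H x) \<subseteq> F" using H P(1) by auto
 then obtain a where a: "a \<in> ops W F" "\<forall>f\<in>(\<Union>x\<in>P. H x). \<forall>y. f (a \<cdot> y) = f y" using functional_unit by blast
 have bx: "b * x = x" if "x \<in> P" for x using G[OF that] b(2) that by blast
 have xa: "x * a = x" if "x \<in> P" for x using H[OF that] a(2) that by blast
 have "a + b - a * b \<in> ops W F"
  by (rule cv.subspace_diff[OF ops_subspace cv.subspace_add[OF ops_subspace a(1) b(1)] ops_mult[OF a(1) b(1)]])
 moreover have "(a + b - a * b) * x = x" "x * (a + b - a * b) = x" if "x \<in> P" for x
  using bx[OF that] xa[OF that]
  by (simp_all add: distrib_left distrib_right left_diff_distrib right_diff_distrib mult.assoc)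
   (simp_all add: mult.assoc[symmetric])
 ultimately show ?thesis by blast
qed

end

lemma all_pairing: "pairing (UNIV :: 'v::cvec set) {f. clinear f}"
proof (rule pairing.intro)
 show "cv.subspace {f :: 'v => complex. clinear f}"
  by (rule cv.subspaceI) (auto intro!: clinearI simp: clinear_add clinear_scC scC_fun_def algebra_simps)
 show "\<exists>f\<in>{f :: 'v => complex. clinear f}. f w \<noteq> 0" if "w \<noteq> 0" for w :: 'v
 proof -
  obtain p :: "'v endo" where p: "\<And>x. p \<cdot> x \<in> cv.span {w}" "\<And>x. x \<in> cv.span {w} ==> p \<cdot> x = x"
   by (rule proj_onto[OF cv.subspace_span]) (rule that)
  have "p \<in> fr" by (rule fr_range[OF fd_span p(1)]) simp
  have pw: "p \<cdot> w = w" by (rule p(2)) (simp add: cv.span_base)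
  show ?thesis
  proof (rule ccontr)
   assume "\<not> ?thesis"
   then have 0: "f w = 0" if "clinear f" for f :: "'v => complex" using that by blast
   from \<open>p \<in> fr\<close> have "p \<cdot> w = 0"
   proof (induction rule: fr_induct)
    case (rk v f)
    show ?case using 0[OF rk] rk_app[OF rk, of v w] by simp
   qed simp_all
   then show False using pw \<open>w \<noteq> 0\<close> by simp
  qed
 qed
 show "\<exists>w\<in>UNIV. f w \<noteq> 0" if "f \<noteq> 0" for f :: "'v => complex" using that by (auto simp: fun_eq_iff)
qed (simp_all only: mem_Collect_eq cv.subspace_UNIV)

lemma fr_ops: "fr = ops UNIV {f. clinear f}" unfolding fr_def ops_def by simp

lemma finite_rank_unit:
 assumes "finite P" "P \<subseteq> fr" shows "\<exists>e\<in>fr. \<forall>x\<in>P. e * x = x \<and> x * e = x"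
 using pairing.two_sided_unit[OF all_pairing] assms unfolding fr_ops .

lemma separating_functional:
 assumes L: "cv.subspace L" and v: "v \<notin> L"
 obtains f :: "'v::cvec => complex" where "clinear f" "f v = 1" "\<And>x. x \<in> L ==> f x = 0"
proof -
 have "cv.span {v} \<inter> L \<subseteq> {0}"
 proof
  fix x assume x: "x \<in> cv.span {v} \<inter> L"
  then obtain c where c: "x = c *\<^sub>C v" using cv.span_singleton[of v] by auto
  have "c = 0"
  proof (rule ccontr)
   assume "c \<noteq> 0"
   then have "v = inverse c *\<^sub>C x" unfolding c by simp
   then show False using cv.subspace_scale[OF L, of x "inverse c"] x v by simp
  qed
  then show "x \<in> {0}" using c by simp
 qed
 from projection_exists[OF cv.subspace_span L this] obtain p :: "'v endo"
  where p: "p \<cdot> v = v" "\<And>x. x \<in> L ==> p \<cdot> x = 0" by (metis cv.span_base singletonI)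
 have "v \<noteq> 0" using v cv.subspace_0[OF L] by blast
 then obtain f :: "'v => complex" where f: "clinear f" "f v \<noteq> 0" using pairing.sep[OF all_pairing, of v] by auto
 show ?thesis
 proof (rule that)
  show "clinear (\<lambda>x. inverse (f v) * f (p \<cdot> x))" using f(1) by (auto intro!: clinearI simp: clinear_add clinear_scC algebra_simps)
 qed (use p f clinear_0[OF f(1)] in auto)
qed

lemma pe_fixed_left: "e * x = x ==> pe P e * x = poly P 1 *\<^sub>C x"
 by (induction P) (simp_all add: distrib_right mult.assoc cv.scale_left_distrib)

lemma pe_fixed_right: "x * e = x ==> x * pe P e = poly P 1 *\<^sub>C x"
 by (induction P) (simp_all add: distrib_left mult.assoc[symmetric] cv.scale_left_distrib)

text \<open>The spectral projection of \<open>e\<close> for the eigenvalue 1.\<close>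
lemma idempotent_unit:
 fixes e :: "'v::cvec endo"
 assumes e: "e \<in> fr" and A: "cv.subspace A" "e \<in> A" "\<And>a. a \<in> A ==> e * a \<in> A"
 shows "\<exists>b\<in>A. b * b = b \<and> (\<forall>x. e * x = x --> b * x = x) \<and> (\<forall>x. x * e = x --> x * b = x)"
proof -
 obtain p where p: "p \<noteq> 0" "pe p e = 0" by (rule annihilating_poly[OF e]) (rule that)
 obtain q where q: "p = [:-1, 1:] ^ order 1 p * q" "\<not> [:-1, 1:] dvd q"
  using order_decomp[OF p(1), of 1] by auto
 \<comment> \<open>One factor more than the order of the root 1 makes \<open>c\<close> vanish at 1
   even if 1 is not a root of \<open>p\<close>, so that \<open>P\<close> takes the value 1 there.
   The factor \<open>X\<close> in \<open>d\<close> makes \<open>P\<close> a multiple of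
   \<open>X\<close> and keeps \<open>b\<close> inside \<open>A\<close>, which need not contain the
   identity.\<close>
 define c d where "c = [:-1, 1 :: complex:] ^ Suc (order 1 p)" and "d = [:0, 1:] * q"
 have "prime_elem [:-1, 1 :: complex:]" by (rule prime_elem_linear_field_poly) simp
 moreover have "\<not> [:-1, 1:] dvd d" using q(2) unfolding d_def by (simp add: dvd_iff_poly_eq_0)
 ultimately have "coprime [:-1, 1:] d" by (rule prime_elem_imp_coprime)
 then have "coprime c d" unfolding c_def by (rule coprime_power_left_iff[THEN iffD2, OF disjI1])
 then obtain u v where uv: "u * c + v * d = 1"
  using bezout_coefficients_fst_snd[of c d] by (metis coprime_iff_gcd_eq_1)
 define P where "P = [:0, 1:] * (q * v)"
 have Pd: "P = v * d" unfolding P_def d_def by (simp only: ac_simps)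
 define b where "b = pe P e"
 have R: "e * pe R e \<in> A" for R
 proof (induction R)
  case 0 then show ?case using cv.subspace_0[OF A(1)] by simp
 next
  case (pCons a R)
  have "e * pe (pCons a R) e = a *\<^sub>C e + e * (e * pe R e)" by (simp add: distrib_left)
  also have "\<dots> \<in> A" by (intro cv.subspace_add[OF A(1)] cv.subspace_scale[OF A(1)] A(2,3) pCons.IH)
  finally show ?case .
 qed
 have "b \<in> A" using R[of "q * v"] unfolding b_def P_def pe_mult[of "[:0, 1:]"] pe_X .
 moreover have "P * P - P = p * (- ([:-1, 1:] * [:0, 1:] * u * v))"
 proof -
  have "P - 1 = - (u * c)" using uv unfolding Pd by (simp add: algebra_simps)
  moreover have "P * P - P = P * (P - 1)" by (simp only: right_diff_distrib mult_1_right)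
  ultimately have "P * P - P = v * ([:0, 1:] * q) * (- (u * ([:-1, 1:] * [:-1, 1:] ^ order 1 p)))"
   unfolding Pd d_def c_def by simp
  also have "\<dots> = ([:-1, 1:] ^ order 1 p * q) * (- ([:-1, 1:] * [:0, 1:] * u * v))"
   by (simp only: mult_minus_right ac_simps)
  finally show ?thesis unfolding q(1)[symmetric] .
 qed
 then have "pe (P * P - P) e = 0" by (simp only: pe_mult[of p] p(2) mult_zero_left)
 then have "b * b = b" unfolding b_def by simp
 moreover have "poly c 1 = 0" unfolding c_def by simp
 then have "poly P 1 = 1" using arg_cong[OF uv, of "\<lambda>r. poly r 1"] unfolding Pd by simp
 then have "b * x = x" if "e * x = x" for x unfolding b_def using pe_fixed_left[OF that, of P] by simp
 moreover have "x * b = x" if "x * e = x" for x unfolding b_def using pe_fixed_right[OF that, of P] \<open>poly P 1 = 1\<close> by simp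
 ultimately show ?thesis by blast
qed

lemma rank_drop:
 fixes S :: "'v::cvec endo"
 assumes U: "cv.subspace U" "fd U" and e: "e \<in> U" "e \<noteq> 0" "S \<cdot> e = 0"
 shows "cv.dim (app S ` U) < cv.dim U"
proof -
 have "cv.independent {e}" using e(2) by simp
 then obtain B where B: "{e} \<subseteq> B" "B \<subseteq> U" "cv.independent B" "U \<subseteq> cv.span B"
  using cv.maximal_independent_subset_extend[of "{e}" U] e(1) by auto
 obtain C where C: "finite C" "U \<subseteq> cv.span C" using U(2) unfolding fd_def by blast
 have fB: "finite B" using cv.independent_span_bound[OF C(1) B(3)] B(2) C(2) by blast
 have "app S ` U \<subseteq> cv.span (app S ` (B - {e}))"
 proof
  fix y assume "y \<in> app S ` U"
  then obtain x where x: "x \<in> cv.span B" "y = S \<cdot> x" using B(4) by blast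
  from x(1) have "S \<cdot> x \<in> cv.span (app S ` (B - {e}))"
  proof (rule cv.span_induct)
   show "cv.subspace {x. S \<cdot> x \<in> cv.span (app S ` (B - {e}))}"
    by (rule cv.subspaceI) (simp_all add: span_rules)
   show "S \<cdot> x \<in> cv.span (app S ` (B - {e}))" if "x \<in> B" for x
    by (cases "x = e") (use e(3) that in \<open>auto simp: cv.span_zero intro: cv.span_base\<close>)
  qed
  then show "y \<in> cv.span (app S ` (B - {e}))" using x(2) by simp
 qed
 then have "cv.dim (app S ` U) \<le> card (app S ` (B - {e}))" by (rule cv.dim_le_card) (use fB in simp)
 also have "\<dots> \<le> card (B - {e})" by (rule card_image_le) (use fB in simp)
 also have "\<dots> < card B" using fB B(1) by (intro psubset_card_mono) auto
 also have "card B = cv.dim U" by (rule cv.basis_card_eq_dim[OF B(2,4,3)])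
 finally show ?thesis .
qed

text \<open>Pairs \<open>(m, n)\<close> in which \<open>n\<close> is the image of \<open>m\<close> under the formal anti-involution \<open>x \<mapsto> - x\<close>.\<close>
inductive_set prs :: "'v::cvec endo set => ('v endo \<times> 'v endo) set" for g where
 base: "x \<in> g ==> (x, - x) \<in> prs g"
| step: "x \<in> g ==> (m, n) \<in> prs g ==> (x * m, - (n * x)) \<in> prs g"
| add: "(m, n) \<in> prs g ==> (m', n') \<in> prs g ==> (m + m', n + n') \<in> prs g"
| scC: "(m, n) \<in> prs g ==> (c *\<^sub>C m, c *\<^sub>C n) \<in> prs g"

lemma prs_diff: "(m, n) \<in> prs g ==> (m', n') \<in> prs g ==> (m - m', n - n') \<in> prs g"
 using prs.add[of m n g "(-1) *\<^sub>C m'" "(-1) *\<^sub>C n'"] prs.scC[of m' n' g "-1"] by simp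

lemma prs_mult: "(m, n) \<in> prs g ==> (m', n') \<in> prs g ==> (m * m', n' * n) \<in> prs g"
proof (induction rule: prs.induct)
 case (base x) then show ?case using prs.step[of x g m' n'] by simp
next
 case (step x m n) then show ?case using prs.step[of x g "m * m'" "n' * n"] by (simp add: mult.assoc)
next
 case (add m n m2 n2) then show ?case using prs.add[of "m * m'" "n' * n" g "m2 * m'" "n' * n2"] by (simp add: distrib_left distrib_right)
next
 case (scC m n c) then show ?case using prs.scC[of "m * m'" "n' * n" g c] by simp
qed

lemma prs_swap: "(m, n) \<in> prs g ==> (n, m) \<in> prs g"
proof (induction rule: prs.induct)
 case (base x) then show ?case using prs.scC[OF prs.base, of x g "-1"] by simp
next
 case (step x m n)
 have "(- x, x) \<in> prs g" using prs.scC[OF prs.base[OF step(1)], of "-1"] by simp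
 from prs_mult[OF step(3) this] show ?case by simp
qed (auto intro: prs.add prs.scC)

lemma prs_mono: "(m, n) \<in> prs P ==> P \<subseteq> Q ==> (m, n) \<in> prs Q"
 by (induction rule: prs.induct) (auto intro: prs.intros)

lemma prs_support: "(m, n) \<in> prs g ==> \<exists>P. finite P \<and> P \<subseteq> g \<and> (m, n) \<in> prs P"
proof (induction rule: prs.induct)
 case (base x) then show ?case by (intro exI[of _ "{x}"]) (simp add: prs.base)
next
 case (step x m n)
 then obtain P where P: "finite P" "P \<subseteq> g" "(m, n) \<in> prs P" by blast
 have "(x * m, - (n * x)) \<in> prs (insert x P)" by (rule prs.step[OF _ prs_mono[OF P(3)]]) auto
 then show ?case using step(1) P by (intro exI[of _ "insert x P"]) simp
next
 case (add m n m' n')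
 then obtain P Q where P: "finite P" "P \<subseteq> g" "(m, n) \<in> prs P" "finite Q" "Q \<subseteq> g" "(m', n') \<in> prs Q" by blast
 have "(m + m', n + n') \<in> prs (P \<union> Q)" by (rule prs.add[OF prs_mono[OF P(3)] prs_mono[OF P(6)]]) auto
 then show ?case using P by (intro exI[of _ "P \<union> Q"]) simp
next
 case (scC m n c) then show ?case using prs.scC by blast
qed

lemma prs_alg1: "(m, n) \<in> prs P ==> P \<subseteq> h ==> m \<in> alg1 h"
 by (induction rule: prs.induct) (auto intro: alg1_base alg1.intros)

text \<open>The irreducible module is the range of \<open>prj\<close> inside a larger space, which
  is how a subquotient presents itself; the conditions on \<open>prj\<close> place \<open>g\<close>
  in its corner.\<close>

locale irr =
 fixes g :: "'v::cvec endo set" and prj :: "'v endo"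
 assumes g: "subalg g" "g \<subseteq> fr"
  and lf: "\<And>P. finite P ==> P \<subseteq> g ==> \<exists>h. subalg h \<and> fd h \<and> P \<subseteq> h \<and> h \<subseteq> g"
  and prj: "prj * prj = prj" "\<And>x. x \<in> g ==> prj * x = x" "\<And>x. x \<in> g ==> x * prj = x"
  and irr: "\<And>U. cv.subspace U ==> U \<subseteq> range (app prj) ==> (\<And>x u. x \<in> g ==> u \<in> U ==> x \<cdot> u \<in> U) ==>
   U \<subseteq> {0} \<or> range (app prj) \<subseteq> U"
  and nz: "\<not> g \<subseteq> {0}"
begin

definition W where "W = range (app prj)"

lemma gv: "cv.subspace g" by (rule subalg_D(1)[OF g(1)])
lemma Wv: "cv.subspace W" unfolding W_def by (rule subspace_range)
lemma prj_id: "w \<in> W ==> prj \<cdot> w = w" unfolding W_def using arg_cong[OF prj(1), of "\<lambda>x. x \<cdot> _"] by auto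
lemma prj_W: "prj \<cdot> v \<in> W" unfolding W_def by simp

lemma prs_prj: "(m, n) \<in> prs g ==> prj * m = m \<and> m * prj = m \<and> prj * n = n \<and> n * prj = n"
proof (induction rule: prs.induct)
 case (step x m n)
 have "prj * (x * m) = x * m" "n * x * prj = n * x" using prj(2,3)[OF step(1)] by (simp add: mult.assoc[symmetric], simp add: mult.assoc)
 moreover have "x * m * prj = x * m" "prj * (n * x) = n * x" using step.IH by (simp add: mult.assoc, simp add: mult.assoc[symmetric])
 ultimately show ?case by simp
qed (simp_all add: prj distrib_left distrib_right)

lemma prs_fr: "(m, n) \<in> prs g ==> m \<in> fr \<and> n \<in> fr"
proof (induction rule: prs.induct)
 case (base x)
 then have "x \<in> fr" using g(2) by blast
 then show ?case using fr_neg by simp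
next
 case (step x m n)
 then show ?case using fr_mult_left[of m x] fr_mult_right[of n x] fr_neg by simp
qed (simp_all add: fr_add fr_scC)

lemma prs_W: "(m, n) \<in> prs g ==> m \<cdot> v \<in> W"
 using prs_prj[of m n] prj_W[of "m \<cdot> v"] by (metis app_simps(6))

lemma prs_prj_app: "(m, n) \<in> prs g ==> m \<cdot> prj \<cdot> v = m \<cdot> v"
 using prs_prj[of m n] by (metis app_simps(6))

lemma g_W: "x \<in> g ==> x \<cdot> v \<in> W" using prs_W[OF prs.base] .
lemma g_prj: "x \<in> g ==> x \<cdot> prj \<cdot> v = x \<cdot> v" using prs_prj_app[OF prs.base] .

lemma g_eq_0: assumes x: "x \<in> g" and 0: "\<And>w. w \<in> W ==> x \<cdot> w = 0" shows "x = 0"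
 by (rule endo_eqI) (use 0[OF prj_W] g_prj[OF x] in simp)

text \<open>The vectors \<open>m \<cdot> w\<close> form a submodule. As \<open>prs g\<close> is
  built without a unit, this submodule might be zero a priori; but then \<open>w\<close> would span
  the whole module with zero action, against \<open>nz\<close>.\<close>

lemma transitive:
 assumes w: "w \<in> W" "w \<noteq> 0" and w': "w' \<in> W"
 shows "\<exists>m n. (m, n) \<in> prs g \<and> m \<cdot> w = w'"
proof -
 define U where "U = {m \<cdot> w | m n. (m, n) \<in> prs g}"
 obtain x where x: "x \<in> g" "x \<noteq> 0" using nz by blast
 have "(0, 0) \<in> prs g" using prs.scC[OF prs.base[OF x(1)], of 0] by simp
 then have "0 \<cdot> w \<in> U" unfolding U_def by blast
 then have "0 \<in> U" by simp
 moreover have "u + v \<in> U" if "u \<in> U" "v \<in> U" for u v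
  using that prs.add unfolding U_def mem_Collect_eq by (metis app_simps(3))
 moreover have "c *\<^sub>C u \<in> U" if "u \<in> U" for u c
  using that prs.scC unfolding U_def mem_Collect_eq by (metis app_simps(7))
 ultimately have Uv: "cv.subspace U" by (intro cv.subspaceI)
 have "U \<subseteq> W" unfolding U_def using prs_W by blast
 moreover have "y \<cdot> u \<in> U" if "y \<in> g" "u \<in> U" for y u
  using that prs.step unfolding U_def mem_Collect_eq by (metis app_simps(6))
 ultimately have "U \<subseteq> {0} \<or> W \<subseteq> U" using irr[OF Uv] unfolding W_def by blast
 moreover have "\<not> U \<subseteq> {0}"
 proof
  assume "U \<subseteq> {0}"
  then have yw: "y \<cdot> w = 0" if "y \<in> g" for y using prs.base[OF that] unfolding U_def by blast
  have span: "cv.span {w} \<subseteq> W" by (rule cv.span_minimal) (use w Wv in auto)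
  have 0: "y \<cdot> u = 0" if "y \<in> g" "u \<in> cv.span {w}" for y u
   using that(2) cv.span_singleton[of w] yw[OF that(1)] by auto
  have "cv.span {w} \<subseteq> {0} \<or> W \<subseteq> cv.span {w}"
   using irr[OF cv.subspace_span, of "{w}"] span 0 cv.span_zero unfolding W_def by metis
  then have "W \<subseteq> cv.span {w}" using w(2) cv.span_base[of w "{w}"] by auto
  then have "x = 0" using g_eq_0[OF x(1)] 0[OF x(1)] by blast
  then show False using x(2) by simp
 qed
 ultimately have "w' \<in> U" using w' by blast
 then show ?thesis unfolding U_def by blast
qed

text \<open>An eigenvector \<open>e\<close> of \<open>m * b\<close> in the range of \<open>m\<close>
  makes the rank of \<open>m * b * m - l *\<^sub>C m\<close> smaller than that of \<open>m\<close>,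
  so by minimality this operator is zero. The partner \<open>n\<close> is carried along to record
  what the relation means on the other side.\<close>

lemma minimal_rank:
 assumes Q: "Q \<subseteq> prs g" "(m0, n0) \<in> Q" "m0 \<noteq> 0"
  and cl: "\<And>m n b c l. (m, n) \<in> Q ==> (b, c) \<in> prs g ==> (m * b * m - l *\<^sub>C m, n * c * n - l *\<^sub>C n) \<in> Q"
 shows "\<exists>m n. (m, n) \<in> Q \<and> m \<noteq> 0 \<and> (\<forall>b c. (b, c) \<in> prs g --> (\<exists>l. m * b * m = l *\<^sub>C m \<and> (0, n * c * n - l *\<^sub>C n) \<in> Q))"
proof -
 have "(m0, n0) \<in> Q \<and> fst (m0, n0) \<noteq> 0" using Q(2,3) by simp
 from ex_has_least_nat[of "\<lambda>q. q \<in> Q \<and> fst q \<noteq> 0", OF this, of "\<lambda>q. cv.dim (range (app (fst q)))"]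
 obtain q where q: "q \<in> Q \<and> fst q \<noteq> 0"
  and min: "\<And>r. r \<in> Q \<and> fst r \<noteq> 0 ==> cv.dim (range (app (fst q))) \<le> cv.dim (range (app (fst r)))"
  by (elim exE conjE) (rule that, blast+)
 obtain m n where mn: "q = (m, n)" by (cases q)
 have m: "(m, n) \<in> Q" "m \<noteq> 0" using q unfolding mn by auto
 have "m \<in> fr" using prs_fr Q(1) m(1) by blast
 note fdm = fd_range[OF this]
 obtain a where a: "m \<cdot> a \<noteq> 0" using m(2) by (metis endo_eqI app_simps(1))
 have "\<exists>l. m * b * m = l *\<^sub>C m \<and> (0, n * c * n - l *\<^sub>C n) \<in> Q" if bc: "(b, c) \<in> prs g" for b c
 proof -
  obtain l e where e: "e \<in> range (app m)" "e \<noteq> 0" "(m * b) \<cdot> e = l *\<^sub>C e"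
   by (rule eigenvector_exists[OF subspace_range fdm, of "m * b" "m \<cdot> a"]) (use a that in auto)
  define M where "M = m * b * m - l *\<^sub>C m"
  have MQ: "(M, n * c * n - l *\<^sub>C n) \<in> Q" unfolding M_def by (rule cl[OF m(1) bc])
  have "M = 0"
  proof (rule ccontr)
   assume "M \<noteq> 0"
   then have "cv.dim (range (app m)) \<le> cv.dim (range (app M))" using min[of "(M, n * c * n - l *\<^sub>C n)"] MQ unfolding mn by simp
   moreover have "range (app M) = app (m * b - l *\<^sub>C 1) ` range (app m)" unfolding M_def image_image by simp
   moreover have "cv.dim (app (m * b - l *\<^sub>C 1) ` range (app m)) < cv.dim (range (app m))"
    by (rule rank_drop[OF subspace_range fdm e(1,2)]) (use e(3) in simp)
   ultimately show False by simp
  qed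
  then show ?thesis using MQ unfolding M_def by (intro exI[of _ l]) simp
 qed
 then show ?thesis using m by blast
qed

text \<open>By transitivity \<open>prj \<cdot> x\<close> is \<open>b \<cdot> u\<close> with
  \<open>u = m \<cdot> a\<close>, so \<open>m \<cdot> x\<close> is \<open>m * b * m\<close> applied
  to \<open>a\<close>, a multiple of \<open>u\<close>.\<close>

lemma rank_one_form:
 assumes mn: "(m, n) \<in> prs g" "m \<noteq> 0" and l: "\<forall>b c. (b, c) \<in> prs g --> (\<exists>l. m * b * m = l *\<^sub>C m)"
 shows "\<exists>v f. v \<in> W \<and> v \<noteq> 0 \<and> clinear f \<and> f \<noteq> 0 \<and> (\<forall>x. f (prj \<cdot> x) = f x) \<and> m = rk v f"
proof -
 obtain a where a: "m \<cdot> a \<noteq> 0" using mn(2) by (metis endo_eqI app_simps(1))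
 define u where "u = m \<cdot> a"
 have u: "u \<in> W" "u \<noteq> 0" unfolding u_def using prs_W[OF mn(1)] a by auto
 have "\<exists>c. m \<cdot> x = c *\<^sub>C u" for x
 proof -
  obtain b c where b: "(b, c) \<in> prs g" "b \<cdot> u = prj \<cdot> x" using transitive[OF u prj_W] by blast
  obtain k where k: "m * b * m = k *\<^sub>C m" using l b(1) by blast
  have "m \<cdot> x = (m * b * m) \<cdot> a" using b(2) prs_prj_app[OF mn(1)] unfolding u_def by simp
  then show ?thesis unfolding k u_def by auto
 qed
 then obtain f where f: "\<And>x. m \<cdot> x = f x *\<^sub>C u" by metis
 have fl: "clinear f"
 proof (rule clinearI)
  show "f (x + y) = f x + f y" for x y
   using f[of "x + y"] f[of x] f[of y] u(2) by (simp add: cv.scale_left_distrib[symmetric])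
  show "f (c *\<^sub>C x) = c *\<^sub>C f x" for c x using f[of "c *\<^sub>C x"] f[of x] u(2) by simp
 qed
 have "f (prj \<cdot> x) = f x" for x using prs_prj_app[OF mn(1), of x] u(2) unfolding f by simp
 moreover have "m = rk u f" by (rule endo_eqI) (simp add: f fl)
 moreover have "f \<noteq> 0" using f[of a] a by auto
 ultimately show ?thesis using u fl by blast
qed

text \<open>The alternative is whether \<open>x \<mapsto> - x\<close> extends to an anti-involution
  of the associative algebra. If not, a nonzero operator is paired with 0 and can be taken of rank
  one: the special linear type. If it extends, a rank one operator has a partner of rank one, which
  will determine an invariant form: the orthogonal and symplectic types.\<close>

lemma pair_alternative:
 obtains (one) v f where "v \<in> W" "v \<noteq> 0" "clinear f" "f \<noteq> 0" "\<And>x. f (prj \<cdot> x) = f x" "(rk v f, 0) \<in> prs g"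
 | (two) v f w h where "v \<in> W" "v \<noteq> 0" "clinear f" "f \<noteq> 0" "\<And>x. f (prj \<cdot> x) = f x"
   "w \<in> W" "w \<noteq> 0" "clinear h" "h \<noteq> 0" "\<And>x. h (prj \<cdot> x) = h x" "(rk v f, rk w h) \<in> prs g"
   "\<And>m. (m, 0) \<in> prs g ==> m = 0"
proof (cases "\<exists>m. (m, 0) \<in> prs g \<and> m \<noteq> 0")
 case True
 then obtain m0 where m0: "(m0, 0) \<in> prs g" "m0 \<noteq> 0" by blast
 define Q where "Q = {q \<in> prs g. snd q = 0}"
 have cl: "(m * b * m - l *\<^sub>C m, n * c * n - l *\<^sub>C n) \<in> Q" if "(m, n) \<in> Q" "(b, c) \<in> prs g" for m n b c l
 proof -
  have mn: "(m, n) \<in> prs g" "n = 0" using that(1) unfolding Q_def by auto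
  have "(m * b * m - l *\<^sub>C m, n * (c * n) - l *\<^sub>C n) \<in> prs g"
   by (rule prs_diff[OF prs_mult[OF prs_mult[OF mn(1) that(2)] mn(1)] prs.scC[OF mn(1)]])
  then show ?thesis using mn(2) unfolding Q_def by (simp add: mult.assoc)
 qed
 have "Q \<subseteq> prs g" "(m0, 0) \<in> Q" unfolding Q_def using m0 by auto
 then have "\<exists>m n. (m, n) \<in> Q \<and> m \<noteq> 0 \<and> (\<forall>b c. (b, c) \<in> prs g --> (\<exists>l. m * b * m = l *\<^sub>C m \<and> (0, n * c * n - l *\<^sub>C n) \<in> Q))"
  by (rule minimal_rank[OF _ _ m0(2) cl])
 then
 obtain m n where m: "(m, n) \<in> Q" "m \<noteq> 0" "\<forall>b c. (b, c) \<in> prs g --> (\<exists>l. m * b * m = l *\<^sub>C m)"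
  by (elim exE conjE) (rule that, blast+)
 have mn: "(m, 0) \<in> prs g" using m(1) unfolding Q_def by auto
 from rank_one_form[OF mn m(2,3)] obtain v f where v: "v \<in> W" "v \<noteq> 0" "clinear f" "f \<noteq> 0" "\<And>x. f (prj \<cdot> x) = f x" "m = rk v f"
  by (elim exE conjE) (rule that, assumption+, blast, assumption)
 show ?thesis by (rule one[OF v(1-5) mn[unfolded v(6)]])
next
 case False
 then have z: "m = 0" if "(m, 0) \<in> prs g" for m using that by blast
 obtain x where x: "x \<in> g" "x \<noteq> 0" using nz by blast
 have cl: "(m * b * m - l *\<^sub>C m, n * c * n - l *\<^sub>C n) \<in> prs g" if "(m, n) \<in> prs g" "(b, c) \<in> prs g" for m n b c l
  using prs_diff[OF prs_mult[OF prs_mult[OF that] that(1)] prs.scC[OF that(1), of l]] by (simp add: mult.assoc)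
 obtain m n where m: "(m, n) \<in> prs g" "m \<noteq> 0"
  "\<And>b c. (b, c) \<in> prs g ==> \<exists>l. m * b * m = l *\<^sub>C m \<and> (0, n * c * n - l *\<^sub>C n) \<in> prs g"
  using minimal_rank[OF subset_refl prs.base[OF x(1)] x(2), OF cl, simplified] by (elim exE conjE) (rule that, assumption+, blast)
 have n: "n \<noteq> 0" using z m(1,2) by blast
 have nl: "\<forall>b c. (b, c) \<in> prs g --> (\<exists>l. n * b * n = l *\<^sub>C n)"
 proof (intro allI impI)
  fix b c assume bc: "(b, c) \<in> prs g"
  obtain l where "(0, n * b * n - l *\<^sub>C n) \<in> prs g" using m(3)[OF prs_swap[OF bc]] by blast
  from z[OF prs_swap[OF this]] show "\<exists>l. n * b * n = l *\<^sub>C n" by auto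
 qed
 have ml: "\<forall>b c. (b, c) \<in> prs g --> (\<exists>l. m * b * m = l *\<^sub>C m)" using m(3) by blast
 obtain v f where v: "v \<in> W" "v \<noteq> 0" "clinear f" "f \<noteq> 0" "\<And>x. f (prj \<cdot> x) = f x" "m = rk v f"
  using rank_one_form[OF m(1,2) ml] by (elim exE conjE) (rule that, assumption+, blast, assumption)
 obtain w h where w: "w \<in> W" "w \<noteq> 0" "clinear h" "h \<noteq> 0" "\<And>x. h (prj \<cdot> x) = h x" "n = rk w h"
  using rank_one_form[OF prs_swap[OF m(1)] n nl] by (elim exE conjE) (rule that, assumption+, blast, assumption)
 show ?thesis by (rule two[OF v(1-5) w(1-5) m(1)[unfolded v(6) w(6)] z])
qed

lemma rank_one_exists:
 obtains v f n where "v \<in> W" "v \<noteq> 0" "clinear f" "f \<noteq> 0" "\<And>x. f (prj \<cdot> x) = f x" "(rk v f, n) \<in> prs g"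
 by (rule pair_alternative; rule that; assumption)

text \<open>Brackets with \<open>x\<close> lie in \<open>arad h\<close> for suitable
  \<open>h\<close>, so they are orthogonal to the associative algebra, whose rank one operators
  detect every nonzero operator. Hence \<open>x\<close> is central. If \<open>x\<close> is nonzero,
  then \<open>W\<close> is the range of \<open>x\<close>, hence finite-dimensional, and
  \<open>x\<close> is a scalar by Schur's lemma; its trace vanishes as it lies in
  \<open>[g, g]\<close>.\<close>

lemma locally_solvable_ideal_zero:
 assumes K: "ideal_in K g" "K \<subseteq> lbs g g"
  and sol: "\<And>h. subalg h ==> fd h ==> h \<subseteq> g ==> solvable_lie scC lb (K \<inter> h)"
 shows "K \<subseteq> {0}"
proof
 fix x assume xK: "x \<in> K"
 have x: "x \<in> g" by (rule ideal_inD(2)[OF K(1) xK])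
 obtain v f n where v: "v \<in> W" "v \<noteq> 0" "clinear f" "f \<noteq> 0" "\<And>x. f (prj \<cdot> x) = f x" "(rk v f, n) \<in> prs g"
  by (rule rank_one_exists) (rule that)
 obtain u0 where "f u0 \<noteq> 0" using v(4) by (auto simp: fun_eq_iff)
 then have u: "prj \<cdot> u0 \<in> W" "f (prj \<cdot> u0) \<noteq> 0" using prj_W v(5) by auto
 have com: "lb x y = 0" if y: "y \<in> g" for y
 proof (rule g_eq_0)
  show lg: "lb x y \<in> g" by (rule subalg_D(2)[OF g(1) x y])
  fix w assume w: "w \<in> W"
  show "lb x y \<cdot> w = 0"
  proof (rule ccontr)
   assume s: "lb x y \<cdot> w \<noteq> 0"
   obtain b c where b: "(b, c) \<in> prs g" "b \<cdot> v = w" using transitive[OF v(1,2) w] by blast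
   obtain b' c' where b': "(b', c') \<in> prs g" "b' \<cdot> lb x y \<cdot> w = prj \<cdot> u0"
    using transitive[OF g_W[OF lg] s u(1)] by blast
   \<comment> \<open>Chosen such that \<open>tr (lb x y * M)\<close> is \<open>f\<close> at
     \<open>b' \<cdot> lb x y \<cdot> w\<close>, which is nonzero by the choice of
     \<open>b'\<close>.\<close>
   define M where "M = b * rk v f * b'"
   have "(M, c' * (n * c)) \<in> prs g" unfolding M_def by (rule prs_mult[OF prs_mult[OF b(1) v(6)] b'(1)])
   from prs_support[OF this] obtain P where P: "finite P" "P \<subseteq> g" "(M, c' * (n * c)) \<in> prs P"
    by (elim exE conjE) (rule that)
   have "finite (insert x (insert y P))" "insert x (insert y P) \<subseteq> g" using P x y by auto
   then obtain h where h: "subalg h" "fd h" "insert x (insert y P) \<subseteq> h" "h \<subseteq> g" using lf by meson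
   have "ideal_in (K \<inter> h) h"
    unfolding ideal_in_def using cv.subspace_inter[OF ideal_inD(1)[OF K(1)] subalg_D(1)[OF h(1)]]
     ideal_inD(3)[OF K(1)] subalg_D(2)[OF h(1)] h(4) by blast
   from solvable_ideal_arad[OF h(1,2) _ this sol[OF h(1,2,4)], of x y]
   have "lb x y \<in> arad h" using h(3,4) g(2) xK by blast
   then have "tr (lb x y * M) = 0" unfolding arad_def using prs_alg1[OF P(3), of h] h(3) by blast
   moreover have "lb x y * M = rk (lb x y \<cdot> w) f * b'"
    unfolding M_def using mult_rk[OF v(3), of b v] mult_rk[OF v(3), of "lb x y" w] b(2) by (simp add: mult.assoc[symmetric])
   moreover have "tr (rk (lb x y \<cdot> w) f * b') = f (b' \<cdot> lb x y \<cdot> w)"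
    unfolding rk_mult[OF v(3)] by (rule tr_rk) (rule clinear_comp_app[OF v(3)])
   ultimately show False using u(2) b'(2) by simp
  qed
 qed
 have comm: "y \<cdot> x \<cdot> z = x \<cdot> y \<cdot> z" if "y \<in> g" for y z
  using arg_cong[OF com[OF that], of "\<lambda>t. t \<cdot> z"] by (simp add: lb_def)
 show "x \<in> {0}"
 proof (rule ccontr)
  assume "x \<notin> {0}"
  then obtain z where z: "x \<cdot> z \<noteq> 0" by (metis endo_eqI app_simps(1) insertI1)
  have "range (app x) \<subseteq> {0} \<or> W \<subseteq> range (app x)" unfolding W_def
  proof (rule irr[OF subspace_range])
   show "range (app x) \<subseteq> range (app prj)" using g_W[OF x] unfolding W_def by blast
   show "y \<cdot> u \<in> range (app x)" if yu: "y \<in> g" "u \<in> range (app x)" for y u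
    using yu(2) comm[OF yu(1)] by auto
  qed
  then have "W \<subseteq> range (app x)" using z by auto
  moreover have "fd (range (app x))" by (rule fd_range) (use x g(2) in blast)
  ultimately have fW: "fd W" by (rule fd_subset[rotated])
  obtain l e where e: "e \<in> W" "e \<noteq> 0" "x \<cdot> e = l *\<^sub>C e"
   by (rule eigenvector_exists[OF Wv fW, of x "x \<cdot> z"]) (use g_W[OF x] z that in auto)
  define E where "E = {u \<in> W. x \<cdot> u = l *\<^sub>C u}"
  have "cv.subspace E" unfolding E_def
   by (rule cv.subspaceI) (simp_all add: subspace_rules[OF Wv] cv.scale_right_distrib mult.commute)
  then have "E \<subseteq> {0} \<or> W \<subseteq> E" unfolding W_def
  proof (rule irr)
   show "E \<subseteq> range (app prj)" unfolding E_def W_def by blast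
   show "y \<cdot> u \<in> E" if yu: "y \<in> g" "u \<in> E" for y u
    using yu comm[OF yu(1), of u] g_W[OF yu(1), of u] unfolding E_def by simp
  qed
  moreover have "e \<in> E" using e unfolding E_def by simp
  ultimately have xw: "x \<cdot> w = l *\<^sub>C w" if "w \<in> W" for w using e(2) that unfolding E_def by blast
  have xp: "x = l *\<^sub>C prj"
   by (rule endo_eqI) (use xw[OF prj_W] g_prj[OF x] in simp)
  have "prj \<in> fr" by (rule fr_range[OF fW prj_W])
  moreover have "prj \<noteq> 0" using prj_id[OF e(1)] e(2) by auto
  ultimately have "tr prj \<noteq> 0" using tr_idem_nonzero prj(1) by blast
  moreover have "tr x = 0" using subsetD[OF K(2) xK]
   by (induction rule: lbs_induct) (use g(2) in \<open>auto simp: tr_lb\<close>)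
  ultimately have "l = 0" unfolding xp by simp
  then show False using xw[OF g_W[OF x]] z e xp by simp
 qed
qed

end

section \<open>Infinite-dimensional ideals of irreducible Lie algebras\<close>

lemma fcod_refl: "cv.subspace J ==> fcod J J"
 unfolding fcod_def by (intro exI[of _ "{}"]) (simp add: cv.span_empty)

lemma fcod_image:
 assumes H: "fcod H J" and f: "clinear f" and i: "fd (f ` H)" shows "fd (f ` J)"
proof -
 obtain B where B: "finite B" "B \<subseteq> J" "\<And>x. x \<in> J ==> \<exists>b\<in>cv.span B. x - b \<in> H" using H unfolding fcod_def by blast
 have 1: "fd (f ` cv.span B)" by (rule fd_image[OF f fd_span[OF B(1)]])
 have "fd (f ` cv.span B \<union> f ` H)" by (rule fd_Un[OF 1 i])
 then have "fd (cv.span (f ` cv.span B \<union> f ` H))" by simp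
 moreover have "f ` J \<subseteq> cv.span (f ` cv.span B \<union> f ` H)"
 proof
  fix y assume "y \<in> f ` J"
  then obtain x where x: "x \<in> J" "y = f x" by blast
  obtain b where b: "b \<in> cv.span B" "x - b \<in> H" using B(3)[OF x(1)] by blast
  have "y = f b + f (x - b)" unfolding x(2) using clinear_diff[OF f, of x b] by simp
  also have "\<dots> \<in> cv.span (f ` cv.span B \<union> f ` H)"
   by (intro cv.span_add cv.span_base UnI1[OF imageI[OF b(1)]] UnI2[OF imageI[OF b(2)]])
  finally show "y \<in> cv.span (f ` cv.span B \<union> f ` H)" .
 qed
 ultimately show ?thesis by (rule fd_subset)
qed

lemma fd_complex: "fd (S :: complex set)"
proof -
 have "x \<in> cv.span {1}" for x :: complex
  using cv.span_scale[OF cv.span_base[of "1 :: complex" "{1}"], of x] by simp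
 then have "S \<subseteq> cv.span {1}" by blast
 then show ?thesis unfolding fd_def by (intro exI[of _ "{1}"]) simp
qed

lemma fd_app_span:
 assumes "fd ((\<lambda>y. y \<cdot> u) ` g)" "fd ((\<lambda>y. y \<cdot> v) ` g)"
 shows "fd ((\<lambda>y. y \<cdot> (u + v)) ` g)" "fd ((\<lambda>y. y \<cdot> (c *\<^sub>C u)) ` g)"
proof -
 have f: "fd (cv.span ((\<lambda>y. y \<cdot> u) ` g \<union> (\<lambda>y. y \<cdot> v) ` g))" using fd_Un[OF assms] by simp
 have 1: "y \<cdot> (u + v) \<in> cv.span ((\<lambda>y. y \<cdot> u) ` g \<union> (\<lambda>y. y \<cdot> v) ` g)" if "y \<in> g" for y
  unfolding app_lin by (intro cv.span_add cv.span_base UnI1[OF imageI[OF that]] UnI2[OF imageI[OF that]])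
 show "fd ((\<lambda>y. y \<cdot> (u + v)) ` g)" by (rule fd_subset[OF f]) (use 1 in blast)
 have 2: "y \<cdot> (c *\<^sub>C u) \<in> cv.span ((\<lambda>y. y \<cdot> u) ` g \<union> (\<lambda>y. y \<cdot> v) ` g)" if "y \<in> g" for y
  unfolding app_lin by (intro cv.span_scale cv.span_base UnI1[OF imageI[OF that]])
 show "fd ((\<lambda>y. y \<cdot> (c *\<^sub>C u)) ` g)" by (rule fd_subset[OF f]) (use 2 in blast)
qed

lemma clinear_mult_right: "clinear (\<lambda>y. y * (x :: 'v::cvec endo))" by (rule clinearI) (simp_all add: distrib_right)
lemma clinear_eval: "clinear (\<lambda>y. y \<cdot> w)" by (rule clinearI) simp_all
lemma clinear_corner: "clinear (\<lambda>y. a * y * (b :: 'v::cvec endo))"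
 by (rule clinearI) (simp_all add: distrib_right distrib_left)

lemma projection_on_fd:
 assumes "cv.subspace U" "fd U"
 obtains p :: "'v::cvec endo" where "p \<in> fr" "\<And>x. p \<cdot> x \<in> U" "\<And>x. x \<in> U ==> p \<cdot> x = x"
proof -
 obtain p :: "'v endo" where p: "\<And>x. p \<cdot> x \<in> U" "\<And>x. x \<in> U ==> p \<cdot> x = x"
  by (rule proj_onto[OF assms(1)]) (rule that)
 show ?thesis by (rule that[OF fr_range[OF assms(2) p(1)] p])
qed

lemma (in pairing) ops_right: "a \<in> ops W F ==> (\<And>f. f \<in> F ==> (\<lambda>v. f (x \<cdot> v)) \<in> F) ==> a * x \<in> ops W F"
proof (induction rule: ops_induct)
 case (rk w f) then show ?case by (simp add: rk_mult Fl ops_rk)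
qed (simp_all add: distrib_right subspace_rules[OF ops_subspace])

text \<open>The common kernel of \<open>F\<close> in \<open>W\<close> is a proper submodule, hence
  zero, so \<open>F\<close> separates \<open>W\<close>. An element \<open>x\<close> of
  \<open>g\<close> has finite-dimensional range, so \<open>x = b * x\<close> with \<open>b\<close>
  in \<open>ops W F\<close>, and \<open>F\<close> is stable under composition with
  \<open>x\<close>.\<close>

lemma (in irr) pairing_ops:
 assumes F: "cv.subspace F" "\<And>f. f \<in> F ==> clinear f" "\<And>f x. f \<in> F ==> f (prj \<cdot> x) = f x"
  "\<And>f x. f \<in> F ==> x \<in> g ==> (\<lambda>v. f (x \<cdot> v)) \<in> F" "f0 \<in> F" "f0 \<noteq> 0"
 shows "pairing W F" "g \<subseteq> ops W F"
proof -
 show p: "pairing W F"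
 proof (rule pairing.intro)
  define U where "U = {w \<in> W. \<forall>f\<in>F. f w = 0}"
  have "cv.subspace U" unfolding U_def
   by (rule cv.subspaceI) (auto simp: subspace_rules[OF Wv]
     clinear_rules[OF F(2)])
  then have "U \<subseteq> {0} \<or> W \<subseteq> U" unfolding W_def
  proof (rule irr)
   show "U \<subseteq> range (app prj)" unfolding U_def W_def by blast
   show "x \<cdot> u \<in> U" if xu: "x \<in> g" "u \<in> U" for x u
   proof -
    have u0: "\<forall>f\<in>F. f u = 0" using xu(2) unfolding U_def by simp
    have "f (x \<cdot> u) = 0" if f: "f \<in> F" for f using bspec[OF u0 F(4)[OF f xu(1)]] by simp
    then show ?thesis unfolding U_def using g_W[OF xu(1)] by simp
   qed
  qed
  moreover have "\<not> W \<subseteq> U"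
  proof
   assume "W \<subseteq> U"
   then have "f0 (prj \<cdot> x) = 0" for x using prj_W F(5) unfolding U_def by blast
   then have "f0 = 0" using F(3)[OF F(5)] by (simp add: fun_eq_iff)
   then show False using F(6) by simp
  qed
  ultimately have "U \<subseteq> {0}" by blast
  then show "\<exists>f\<in>F. f w \<noteq> 0" if "w \<in> W" "w \<noteq> 0" for w using that unfolding U_def by blast
  show "\<exists>w\<in>W. f w \<noteq> 0" if f: "f \<in> F" "f \<noteq> 0" for f
  proof -
   obtain x where "f x \<noteq> 0" using f(2) by (auto simp: fun_eq_iff)
   then show ?thesis using F(3)[OF f(1), of x] prj_W[of x] by (intro bexI[of _ "prj \<cdot> x"]) simp_all
  qed
 qed (fact Wv F(1,2))+
 interpret pairing W F by (rule p)
 show "g \<subseteq> ops W F"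
 proof
  fix x assume x: "x \<in> g"
  have "fd (range (app x))" by (rule fd_range) (use x g(2) in blast)
  then obtain B where B: "finite B" "B \<subseteq> range (app x)" "cv.span B = range (app x)"
   using fd_basis[OF subspace_range] by metis
  have "B \<subseteq> W" using B(2) g_W[OF x] by blast
  then obtain b where b: "b \<in> ops W F" "\<And>w. w \<in> B ==> b \<cdot> w = w" using vector_unit[OF B(1)] by blast
  have "b \<cdot> u = u" if "u \<in> cv.span B" for u
   using that
  proof (rule cv.span_induct)
   show "cv.subspace {u. b \<cdot> u = u}" by (rule cv.subspaceI) simp_all
  qed (rule b(2))
  then have "b * x = x" unfolding B(3) by (intro endo_eqI) simp
  moreover have "b * x \<in> ops W F" by (rule ops_right[OF b(1) F(4)[OF _ x]])
  ultimately show "x \<in> ops W F" by simp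
 qed
qed

locale irr_ideal = irr g prj for g :: "'v::cvec endo set" and prj +
 fixes J
 assumes J: "ideal_in J g" "J \<subseteq> lbs g g" "\<not> fd J"
begin

lemmas Jv = ideal_inD(1)[OF J(1)] and Jg = ideal_inD(2)[OF J(1)]
lemma J_fr: "x \<in> J ==> x \<in> fr" using Jg g(2) by blast
lemma tr_J: "x \<in> lbs g g ==> tr x = 0"
 by (induction rule: lbs_induct) (use g(2) in \<open>auto simp: tr_lb\<close>)

text \<open>The radical of the form on \<open>J\<close> is an ideal of \<open>g\<close>, and it is
  isotropic, so Cartan's criterion makes it locally solvable.\<close>

lemma J_nondegenerate:
 assumes "x \<in> J" "\<And>y. y \<in> J ==> tr (x * y) = 0" shows "x = 0"
proof -
 define K where "K = {x \<in> J. \<forall>y\<in>J. tr (x * y) = 0}"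
 have K: "ideal_in K g" unfolding K_def by (rule perp_ideal[OF J(1) g(2) ideal_inD(3)[OF J(1)]])
 have "K \<subseteq> {0}"
 proof (rule locally_solvable_ideal_zero[OF K])
  show "K \<subseteq> lbs g g" using J(2) unfolding K_def by blast
  show "solvable_lie scC lb (K \<inter> h)" if h: "subalg h" "fd h" "h \<subseteq> g" for h
  proof (rule Cartan_criterion)
   have "ideal_in (K \<inter> h) h"
    unfolding ideal_in_def using cv.subspace_inter[OF ideal_inD(1)[OF K] subalg_D(1)[OF h(1)]]
     ideal_inD(3)[OF K] subalg_D(2)[OF h(1)] h(3) by blast
   then show "subalg (K \<inter> h)" by (rule ideal_subalg)
   show "fd (K \<inter> h)" by (rule fd_subset[OF h(2)]) blast
   show "K \<inter> h \<subseteq> fr" using h(3) g(2) by blast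
   show "tr (a * b) = 0" if "a \<in> K \<inter> h" "b \<in> K \<inter> h" for a b using that unfolding K_def by blast
  qed
 qed
 then show ?thesis using assms unfolding K_def by blast
qed

lemma W_infinite: "\<not> fd W"
proof
 assume "fd W"
 have p: "prj \<in> fr" by (rule fr_range[OF \<open>fd W\<close> prj_W])
 have "x \<in> {prj * y * prj | y. True}" if "x \<in> J" for x
  using prj(2,3)[OF Jg[OF that]] by (intro CollectI exI[of _ x]) simp
 then have "fd J" by (intro fd_subset[OF fd_corner[OF p p]]) blast
 then show False using J(3) by simp
qed

text \<open>For \<open>x = w \<otimes> f\<close> the trace of \<open>x * c * d\<close> is
  \<open>f (c d w)\<close>. A sum of such operators is handled by intersecting the subspaces of
  finite codimension.\<close>

lemma trace_functional_negligible:
 assumes neg: "\<And>f w. f \<in> F ==> w \<in> W ==> \<exists>H. cv.subspace H \<and> H \<subseteq> J \<and> fcod H J \<and> (\<forall>c\<in>H. \<forall>d\<in>H. f (c \<cdot> d \<cdot> w) = 0)"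
  and Fl: "\<And>f. f \<in> F ==> clinear f" and x: "x \<in> ops W F"
 shows "\<exists>H. cv.subspace H \<and> H \<subseteq> J \<and> fcod H J \<and> (\<forall>c\<in>H. \<forall>d\<in>H. tr (x * c * d) = 0)"
 using x
proof (induction rule: ops_induct)
 case (rk w f)
 have e: "tr (rk w f * c * d) = f (c \<cdot> d \<cdot> w)" for c d
 proof -
  have "rk w f * c * d = rk w (\<lambda>v. f (c \<cdot> d \<cdot> v))"
   unfolding rk_mult[OF Fl[OF rk(2)]] rk_mult[OF clinear_comp_app[OF Fl[OF rk(2)]]] ..
  then show ?thesis using tr_rk[OF clinear_comp_app[OF clinear_comp_app[OF Fl[OF rk(2)], of c], of d], of w] by simp
 qed
 show ?case using neg[OF rk(2,1)] unfolding e .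
next
 case zero
 show ?case using Jv fcod_refl[OF Jv] by (intro exI[of _ J]) simp
next
 case (add x y)
 obtain H1 where H1: "cv.subspace H1" "H1 \<subseteq> J" "fcod H1 J" "\<And>c d. c \<in> H1 ==> d \<in> H1 ==> tr (x * c * d) = 0" using add(1) by blast
 obtain H2 where H2: "cv.subspace H2" "H2 \<subseteq> J" "fcod H2 J" "\<And>c d. c \<in> H2 ==> d \<in> H2 ==> tr (y * c * d) = 0" using add(2) by blast
 have "cv.subspace (H1 \<inter> H2)" by (rule cv.subspace_inter[OF H1(1) H2(1)])
 moreover have "fcod (H1 \<inter> H2) J" by (rule fcod_Int[OF H1(1) H2(1) H1(2) H2(2) H1(3) H2(3)])
 ultimately show ?case using H1(2,4) H2(4) by (intro exI[of _ "H1 \<inter> H2"]) (auto simp: distrib_right)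
next
 case (scC c x)
 then obtain H where "cv.subspace H" "H \<subseteq> J" "fcod H J" "\<And>c d. c \<in> H ==> d \<in> H ==> tr (x * c * d) = 0" by blast
 then show ?case by (intro exI[of _ H]) simp
qed

text \<open>By nondegeneracy an element of \<open>J\<close> orthogonal to \<open>H\<close> is
  determined by its traces against finitely many representatives of \<open>J\<close> modulo
  \<open>H\<close>.\<close>

lemma perp_fd:
 assumes H: "H \<subseteq> J" "fcod H J"
 shows "fd {y \<in> J. \<forall>d\<in>H. tr (y * d) = 0}"
proof -
 define Q where "Q = {y \<in> J. \<forall>d\<in>H. tr (y * d) = 0}"
 have Qv: "cv.subspace Q" unfolding Q_def by (rule perp_subspace[OF Jv])
 obtain B where B: "finite B" "B \<subseteq> J" "\<And>x. x \<in> J ==> \<exists>b\<in>cv.span B. x - b \<in> H" using H(2) unfolding fcod_def by blast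
 define Hb where "Hb b = {y \<in> Q. tr (y * b) = 0}" for b
 have "fcod (Q \<inter> (\<Inter>b\<in>B. Hb b)) Q"
 proof (rule fcod_INT[OF B(1) Qv])
  fix b
  have "cv.subspace (Hb b)" unfolding Hb_def
   by (rule cv.subspaceI) (simp_all add: subspace_rules[OF Qv] distrib_right)
  moreover have "fcod (Hb b) Q" unfolding Hb_def by (rule fcod_ker[OF Qv tr_form_linear(2) fd_complex])
  ultimately show "cv.subspace (Hb b) \<and> Hb b \<subseteq> Q \<and> fcod (Hb b) Q" unfolding Hb_def by blast
 qed
 moreover have "Q \<inter> (\<Inter>b\<in>B. Hb b) \<subseteq> {0}"
 proof
  fix y assume y: "y \<in> Q \<inter> (\<Inter>b\<in>B. Hb b)"
  have yb: "tr (y * b) = 0" if "b \<in> cv.span B" for b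
   using that
  proof (rule cv.span_induct)
   show "cv.subspace {b. tr (y * b) = 0}" by (rule cv.subspaceI) (simp_all add: distrib_left)
   show "tr (y * b) = 0" if "b \<in> B" for b using y that unfolding Hb_def by blast
  qed
  have "y = 0"
  proof (rule J_nondegenerate)
   show "y \<in> J" using y unfolding Q_def by blast
   show "tr (y * z) = 0" if zJ: "z \<in> J" for z
   proof -
    obtain b where b: "b \<in> cv.span B" "z - b \<in> H" using B(3)[OF zJ] by blast
    have "tr (y * (z - b)) = 0" using y b(2) unfolding Q_def by blast
    then show ?thesis using yb[OF b(1)] by (simp add: right_diff_distrib)
   qed
  qed
  then show "y \<in> {0}" by simp
 qed
 ultimately have "fcod {0} Q" by (rule fcod_mono)
 then show ?thesis unfolding Q_def by (rule fcod_zero_fd)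
qed

lemma J_spans_W: "W \<subseteq> cv.span {x \<cdot> w | x w. x \<in> J \<and> w \<in> W}"
proof -
 define S where "S = {x \<cdot> w | x w. x \<in> J \<and> w \<in> W}"
 have SW: "cv.span S \<subseteq> W" by (rule cv.span_minimal[OF _ Wv]) (use g_W Jg in \<open>auto simp: S_def\<close>)
 have "y \<cdot> u \<in> cv.span S" if y: "y \<in> g" and u: "u \<in> cv.span S" for y u
  using u
 proof (rule cv.span_induct)
  show "cv.subspace {u. y \<cdot> u \<in> cv.span S}" by (rule cv.subspaceI) (simp_all add: span_rules)
  show "y \<cdot> u \<in> cv.span S" if uS: "u \<in> S" for u
  proof -
   obtain x w where x: "x \<in> J" "w \<in> W" "u = x \<cdot> w" using uS unfolding S_def by blast
   have "y \<cdot> u = lb y x \<cdot> w + x \<cdot> y \<cdot> w" unfolding x(3) lb_def by simp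
   moreover have "lb y x \<cdot> w \<in> S" unfolding S_def using ideal_inD(3)[OF J(1) y x(1)] x(2) by blast
   moreover have "x \<cdot> y \<cdot> w \<in> S" unfolding S_def using g_W[OF y] x(1) by blast
   ultimately show ?thesis by (simp add: cv.span_add cv.span_base)
  qed
 qed
 then have "cv.span S \<subseteq> {0} \<or> W \<subseteq> cv.span S" using irr[OF cv.subspace_span, of S] SW unfolding W_def by blast
 moreover have "\<not> cv.span S \<subseteq> {0}"
 proof
  assume "cv.span S \<subseteq> {0}"
  then have "x \<cdot> w = 0" if "x \<in> J" "w \<in> W" for x w using cv.span_base[of "x \<cdot> w" S] that unfolding S_def by blast
  then have "J \<subseteq> {0}" using g_eq_0[OF Jg] by blast
  then have "fd J" using fd_finite[of "{0}"] fd_subset by blast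
  then show False using J(3) by simp
 qed
 ultimately show ?thesis unfolding S_def by blast
qed

text \<open>If all \<open>J * x\<close> were finite-dimensional, then so would be all
  \<open>g w\<close> and therefore \<open>g * x\<close> for a nonzero \<open>x\<close>. On the range
  of \<open>x\<close> all of \<open>g\<close> would be represented by a finite-dimensional
  subalgebra \<open>h\<close>, and the module generated by that range would be finite-dimensional,
  although it is all of \<open>W\<close>.\<close>

lemma not_all_negligible:
 assumes fx: "\<And>x. x \<in> J ==> fd ((\<lambda>c. c * x) ` J)" shows False
proof -
 have ind: "P w" if w: "w \<in> W" and base: "\<And>x v. x \<in> J ==> v \<in> W ==> P (x \<cdot> v)"
  and "P 0" "\<And>u v. P u ==> P v ==> P (u + v)" "\<And>c u. P u ==> P (c *\<^sub>C u)" for P and w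
 proof (rule cv.span_induct[OF subsetD[OF J_spans_W w]])
  show "cv.subspace {x. P x}" by (rule cv.subspaceI) (use that in auto)
  show "P u" if "u \<in> {x \<cdot> w | x w. x \<in> J \<and> w \<in> W}" for u using that base by blast
 qed
 have fd0: "fd ((\<lambda>y. y \<cdot> 0) ` A)" for A :: "'v endo set" by (rule fd_subset[OF fd_finite[of "{0}"]]) auto
 have Jw: "fd ((\<lambda>c. c \<cdot> w) ` J)" if "w \<in> W" for w
 proof (rule ind[OF that, of "\<lambda>w. fd ((\<lambda>c. c \<cdot> w) ` J)"])
  show "fd ((\<lambda>c. c \<cdot> x \<cdot> v) ` J)" if "x \<in> J" for x v
  proof -
   have "(\<lambda>c. c \<cdot> x \<cdot> v) ` J = (\<lambda>c. c \<cdot> v) ` ((\<lambda>c. c * x) ` J)" unfolding image_image by simp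
   then show ?thesis using fd_image[OF clinear_eval fx[OF that]] by simp
  qed
  show "fd ((\<lambda>c. c \<cdot> (u + v)) ` J)" if "fd ((\<lambda>c. c \<cdot> u) ` J)" "fd ((\<lambda>c. c \<cdot> v) ` J)" for u v by (rule fd_app_span[OF that])
  show "fd ((\<lambda>c. c \<cdot> (k *\<^sub>C u)) ` J)" if "fd ((\<lambda>c. c \<cdot> u) ` J)" for k u by (rule fd_app_span(2)[OF that that])
 qed (rule fd0)
 have gw: "fd ((\<lambda>y. y \<cdot> w) ` g)" if "w \<in> W" for w
 proof (rule ind[OF that, of "\<lambda>w. fd ((\<lambda>c. c \<cdot> w) ` g)"])
  show "fd ((\<lambda>y. y \<cdot> x \<cdot> v) ` g)" if x: "x \<in> J" and v: "v \<in> W" for x v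
  proof -
   have "fd (cv.span ((\<lambda>c. c \<cdot> v) ` J \<union> range (app x)))"
    using fd_Un[OF Jw[OF v] fd_range[OF J_fr[OF x]]] by simp
   moreover have "y \<cdot> x \<cdot> v \<in> cv.span ((\<lambda>c. c \<cdot> v) ` J \<union> range (app x))" if y: "y \<in> g" for y
   proof -
    have "y \<cdot> x \<cdot> v = lb y x \<cdot> v + x \<cdot> y \<cdot> v" unfolding lb_def by simp
    also have "\<dots> \<in> cv.span ((\<lambda>c. c \<cdot> v) ` J \<union> range (app x))"
     by (intro cv.span_add cv.span_base UnI1[OF imageI[OF ideal_inD(3)[OF J(1) y x]]] UnI2 rangeI)
    finally show ?thesis .
   qed
   then have "(\<lambda>y. y \<cdot> x \<cdot> v) ` g \<subseteq> cv.span ((\<lambda>c. c \<cdot> v) ` J \<union> range (app x))" by blast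
   ultimately show ?thesis by (rule fd_subset)
  qed
  show "fd ((\<lambda>c. c \<cdot> (u + v)) ` g)" if "fd ((\<lambda>c. c \<cdot> u) ` g)" "fd ((\<lambda>c. c \<cdot> v) ` g)" for u v by (rule fd_app_span[OF that])
  show "fd ((\<lambda>c. c \<cdot> (k *\<^sub>C u)) ` g)" if "fd ((\<lambda>c. c \<cdot> u) ` g)" for k u by (rule fd_app_span(2)[OF that that])
 qed (rule fd0)
 have "\<not> J \<subseteq> {0}" using J(3) fd_finite[of "{0}"] fd_subset by blast
 then obtain x where x: "x \<in> J" "x \<noteq> 0" by blast
 have xg: "x \<in> g" by (rule Jg[OF x(1)])
 obtain C where C: "finite C" "C \<subseteq> range (app x)" "cv.span C = range (app x)"
  using fd_basis[OF subspace_range fd_range[OF J_fr[OF x(1)]]] by metis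
 define E where "E = cv.span (\<Union>w\<in>C. (\<lambda>y. y \<cdot> w) ` g)"
 have "fd (\<Union>w\<in>C. (\<lambda>y. y \<cdot> w) ` g)" by (rule fd_UN[OF C(1) gw]) (use C(2) g_W[OF xg] in blast)
 then have Efd: "fd E" unfolding E_def by simp
 obtain q where q: "q \<in> fr" "\<And>v. v \<in> E ==> q \<cdot> v = v"
  by (rule projection_on_fd[OF cv.subspace_span Efd[unfolded E_def]]) (rule that, assumption, simp add: E_def)
 have yE: "y \<cdot> u \<in> E" if y: "y \<in> g" and u: "u \<in> cv.span C" for y u
  using u
 proof (rule cv.span_induct)
  show "cv.subspace {u. y \<cdot> u \<in> E}" unfolding E_def by (rule cv.subspaceI) (simp_all add: span_rules)
  show "y \<cdot> u \<in> E" if "u \<in> C" for u unfolding E_def by (rule cv.span_base) (use that y in blast)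
 qed
 have "y * x = q * y * x" if "y \<in> g" for y
  by (rule endo_eqI) (use q(2)[OF yE[OF that]] C(3) in auto)
 then have "(\<lambda>y. y * x) ` g \<subseteq> {q * y * x | y. True}" by blast
 then have "fd ((\<lambda>y. y * x) ` g)" by (rule fd_subset[OF fd_corner[OF q(1) J_fr[OF x(1)]]])
 then have "fcod {y \<in> g. y * x = 0} g" by (rule fcod_ker[OF gv clinear_mult_right])
 then obtain B where B: "finite B" "B \<subseteq> g" "\<And>y. y \<in> g ==> \<exists>b\<in>cv.span B. y - b \<in> {y \<in> g. y * x = 0}"
  unfolding fcod_def by blast
 obtain h where h: "subalg h" "fd h" "B \<subseteq> h" "h \<subseteq> g" using lf[OF B(1,2)] by blast
 have Bh: "cv.span B \<subseteq> h" by (rule cv.span_minimal[OF h(3) subalg_D(1)[OF h(1)]])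
 \<comment> \<open>Stable under all of \<open>g\<close>: an element of \<open>g\<close> is moved
   through the factors from \<open>h\<close>, and when it reaches \<open>x\<close> it is replaced by
   an element of \<open>h\<close>. Finite-dimensional, since it lies in the sum of the ranges of
   \<open>x\<close> and of a basis of \<open>h\<close>.\<close>
 define S where "S = cv.span {a \<cdot> x \<cdot> v | a v. a \<in> alg1 h}"
 have base: "a \<cdot> x \<cdot> v \<in> S" if "a \<in> alg1 h" for a v unfolding S_def by (rule cv.span_base) (use that in blast)
 have hS: "y \<cdot> s \<in> S" if y: "y \<in> h" and s: "s \<in> S" for y s
  using s unfolding S_def
 proof (rule cv.span_induct)
  show "cv.subspace {u. y \<cdot> u \<in> cv.span {a \<cdot> x \<cdot> v | a v. a \<in> alg1 h}}"
   by (rule cv.subspaceI) (simp_all add: span_rules)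
  fix u assume "u \<in> {a \<cdot> x \<cdot> v | a v. a \<in> alg1 h}"
  then obtain a v where "a \<in> alg1 h" "u = a \<cdot> x \<cdot> v" by blast
  then show "y \<cdot> u \<in> cv.span {a \<cdot> x \<cdot> v | a v. a \<in> alg1 h}" using base[OF alg1.mult[OF y], of a v] unfolding S_def by simp
 qed
 have cS: "c \<cdot> a \<cdot> x \<cdot> v \<in> S" if "a \<in> alg1 h" "c \<in> g" for a c v
  using that
 proof (induction arbitrary: c rule: alg1.induct)
  case one
  obtain b where b: "b \<in> cv.span B" "(c - b) * x = 0" using B(3)[OF one] by blast
  have "c \<cdot> x \<cdot> v = b \<cdot> x \<cdot> v" using arg_cong[OF b(2), of "\<lambda>t. t \<cdot> v"] by simp
  then show ?case using base[OF alg1_base[of b h]] b(1) Bh by auto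
 next
  case (mult y a)
  have yg: "y \<in> g" using mult(1) h(4) by blast
  have "c \<cdot> (y * a) \<cdot> x \<cdot> v = lb c y \<cdot> a \<cdot> x \<cdot> v + y \<cdot> c \<cdot> a \<cdot> x \<cdot> v" unfolding lb_def by simp
  also have "\<dots> \<in> S"
   unfolding S_def by (intro cv.span_add) (fold S_def, rule mult.IH[OF subalg_D(2)[OF g(1) mult.prems yg]], rule hS[OF mult(1) mult.IH[OF mult.prems]])
  finally show ?case .
 next
  case (add a b)
  show ?case using cv.span_add[OF add.IH(1)[OF add.prems, unfolded S_def] add.IH(2)[OF add.prems, unfolded S_def]] unfolding S_def by simp
 next
  case (scC a k)
  show ?case using cv.span_scale[OF scC.IH[OF scC.prems, unfolded S_def], of k] unfolding S_def by simp
 qed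
 have S_stable: "c \<cdot> s \<in> S" if c: "c \<in> g" and s: "s \<in> S" for c s
  using s unfolding S_def
 proof (rule cv.span_induct)
  show "cv.subspace {u. c \<cdot> u \<in> cv.span {a \<cdot> x \<cdot> v | a v. a \<in> alg1 h}}"
   by (rule cv.subspaceI) (simp_all add: span_rules)
  show "c \<cdot> u \<in> cv.span {a \<cdot> x \<cdot> v | a v. a \<in> alg1 h}" if "u \<in> {a \<cdot> x \<cdot> v | a v. a \<in> alg1 h}" for u
   using that cS[OF _ c] unfolding S_def by blast
 qed
 have aW: "a \<cdot> w \<in> W" if "a \<in> alg1 h" "w \<in> W" for a w
  using that
 proof (induction rule: alg1.induct)
  case (mult y a) then show ?case using g_W[of y "a \<cdot> w"] h(4) by auto
 qed (simp_all add: cv.subspace_add[OF Wv] cv.subspace_scale[OF Wv])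
 have "S \<subseteq> W" unfolding S_def by (rule cv.span_minimal[OF _ Wv]) (use aW g_W[OF xg] in blast)
 then have "S \<subseteq> {0} \<or> W \<subseteq> S"
  unfolding W_def by (intro irr S_stable) (simp_all add: S_def cv.subspace_span)
 moreover obtain v where "x \<cdot> v \<noteq> 0" using x(2) by (metis endo_eqI app_simps(1))
 then have "\<not> S \<subseteq> {0}" using base[OF alg1.one, of v] by auto
 moreover have "fd S"
 proof -
  obtain D where D: "finite D" "D \<subseteq> h" "cv.span D = h" using fd_basis[OF subalg_D(1)[OF h(1)] h(2)] by metis
  define R where "R = cv.span (range (app x) \<union> (\<Union>d\<in>D. range (app d)))"
  have "fd (\<Union>d\<in>D. range (app d))" by (rule fd_UN[OF D(1) fd_range]) (use D(2) h(4) g(2) in blast)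
  then have "fd R" unfolding R_def using fd_Un[OF fd_range[OF J_fr[OF x(1)]]] by simp
  have yR: "y \<cdot> u \<in> R" if "y \<in> cv.span D" for y u
   using that
  proof (rule cv.span_induct)
   show "cv.subspace {y. y \<cdot> u \<in> R}" unfolding R_def by (rule cv.subspaceI) (simp_all add: span_rules)
   show "d \<cdot> u \<in> R" if "d \<in> D" for d unfolding R_def by (rule cv.span_base) (use that in blast)
  qed
  have "a \<cdot> x \<cdot> v \<in> R" if "a \<in> alg1 h" for a v
   using that
  proof (induction rule: alg1.induct)
   case one then show ?case unfolding R_def by (simp add: cv.span_base)
  next
   case (mult y a) then show ?case using yR[of y "a \<cdot> x \<cdot> v"] D(3) by simp
  qed (simp_all add: R_def cv.span_add cv.span_scale)
  then have "S \<subseteq> R" unfolding S_def by (intro cv.span_minimal) (auto simp: R_def)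
  with \<open>fd R\<close> show ?thesis by (rule fd_subset)
 qed
 ultimately show False using W_infinite fd_subset by blast
qed

text \<open>Otherwise, for every \<open>x\<close> in \<open>J\<close>,
  \<open>tr (lb x c * d)\<close> vanishes on a subspace of finite codimension, so
  \<open>[x, J]\<close> is finite-dimensional by \<open>perp_fd\<close>. Then elements commuting
  with \<open>x\<close> have finite codimension in \<open>J\<close>; for these
  \<open>c * x = x * c\<close> lies in a corner, and so \<open>J * x\<close> is finite-dimensional
  for all \<open>x\<close>.\<close>

lemma far_functional:
 assumes p: "pairing W F" and gF: "g \<subseteq> ops W F"
 shows "\<exists>f\<in>F. \<exists>w\<in>W. \<forall>H. cv.subspace H --> H \<subseteq> J --> fcod H J --> (\<exists>c\<in>H. \<exists>d\<in>H. f (c \<cdot> d \<cdot> w) \<noteq> 0)"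
proof (rule ccontr)
 interpret pairing W F by (rule p)
 assume neg: "\<not> ?thesis"
 have neg': "\<exists>H. cv.subspace H \<and> H \<subseteq> J \<and> fcod H J \<and> (\<forall>c\<in>H. \<forall>d\<in>H. f (c \<cdot> d \<cdot> w) = 0)" if "f \<in> F" "w \<in> W" for f w
  using neg that by blast
 show False
 proof (rule not_all_negligible)
  fix x assume x: "x \<in> J"
  note xf = J_fr[OF x]
  obtain H where H: "cv.subspace H" "H \<subseteq> J" "fcod H J" "\<And>c d. c \<in> H ==> d \<in> H ==> tr (x * c * d) = 0"
   using trace_functional_negligible[OF neg' Fl subsetD[OF gF Jg[OF x]]] by blast
  have "tr (lb x c * d) = 0" if cd: "c \<in> H" "d \<in> H" for c d
  proof -
   have "tr (c * (x * d)) = tr ((x * d) * c)" using H(2) cd J_fr by (intro tr_comm) auto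
   then show ?thesis using H(4)[OF cd] H(4)[OF cd(2,1)] by (simp add: lb_def left_diff_distrib mult.assoc)
  qed
  moreover have "lb x c \<in> J" if "c \<in> H" for c using ideal_inD(3)[OF J(1) Jg[OF x]] H(2) that by blast
  ultimately have "lb x ` H \<subseteq> {y \<in> J. \<forall>d\<in>H. tr (y * d) = 0}" by blast
  then have "fd (lb x ` H)" by (rule fd_subset[OF perp_fd[OF H(2,3)]])
  then have "fd (lb x ` J)" by (rule fcod_image[OF H(3) clinear_lb])
  then have fc: "fcod {c \<in> J. lb x c = 0} J" by (rule fcod_ker[OF Jv clinear_lb])
  obtain q where q: "q \<in> fr" "\<And>v. v \<in> range (app x) ==> q \<cdot> v = v"
   by (rule projection_on_fd[OF subspace_range fd_range[OF xf]]) (rule that)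
  have qx: "q * x = x" by (rule endo_eqI) (simp add: q(2))
  have "c * x = q * c * x" if "lb x c = 0" for c
  proof -
   have cx: "c * x = x * c" using that unfolding lb_def by simp
   have "q * c * x = q * x * c" by (simp only: mult.assoc cx)
   then show ?thesis unfolding qx cx by simp
  qed
  then have "(\<lambda>c. c * x) ` {c \<in> J. lb x c = 0} \<subseteq> {q * y * x | y. True}" by blast
  then have "fd ((\<lambda>c. c * x) ` {c \<in> J. lb x c = 0})" by (rule fd_subset[OF fd_corner[OF q(1) xf]])
  then show "fd ((\<lambda>c. c * x) ` J)" by (rule fcod_image[OF fc clinear_mult_right])
 qed
qed

end

section \<open>Finite-dimensional perfect subalgebras inside the ideal\<close>

lemma scalar_if_all_eigenvectors:
 assumes b: "b \<in> fr" "b * b = b" and x: "b * x * b = x" "tr x = 0"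
  and ev: "\<And>l. b \<cdot> l = l ==> x \<cdot> l \<in> cv.span {l}"
 shows "(x :: 'v::cvec endo) = 0"
proof (cases "b = 0")
 case True then show ?thesis using x(1) by simp
next
 case False
 have bx: "b * x = x" by (metis b(2) x(1) mult.assoc)
 have xb: "x * b = x" by (metis b(2) x(1) mult.assoc)
 have bb: "b \<cdot> b \<cdot> v = b \<cdot> v" for v using arg_cong[OF b(2), of "\<lambda>t. t \<cdot> v"] by simp
 obtain v where v: "b \<cdot> v \<noteq> 0" using False by (metis endo_eqI app_simps(1))
 define l0 where "l0 = b \<cdot> v"
 have l0: "b \<cdot> l0 = l0" "l0 \<noteq> 0" unfolding l0_def using bb v by auto
 have ev': "\<exists>k. x \<cdot> l = k *\<^sub>C l" if "b \<cdot> l = l" for l using ev[OF that] unfolding cv.span_singleton by blast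
 obtain k where k: "x \<cdot> l0 = k *\<^sub>C l0" using ev'[OF l0(1)] by blast
 have all: "x \<cdot> l = k *\<^sub>C l" if l: "b \<cdot> l = l" for l
 proof -
  obtain a where a: "x \<cdot> l = a *\<^sub>C l" using ev'[OF l] by blast
  have "b \<cdot> (l + l0) = l + l0" using l l0(1) by simp
  then obtain m where m: "x \<cdot> (l + l0) = m *\<^sub>C (l + l0)" using ev' by blast
  have e: "(a - m) *\<^sub>C l = (m - k) *\<^sub>C l0"
   using m unfolding app_lin a k by (simp add: cv.scale_left_diff_distrib cv.scale_right_distrib algebra_simps)
  show ?thesis
  proof (cases "a = m")
   case True
   then have "(m - k) *\<^sub>C l0 = 0" using e by simp
   then show ?thesis using True a l0(2) by simp
  next
   case False
   then have "l = (inverse (a - m) * (m - k)) *\<^sub>C l0"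
    using arg_cong[OF e, of "\<lambda>t. inverse (a - m) *\<^sub>C t"] by simp
   then show ?thesis using k by (simp add: mult.commute)
  qed
 qed
 have "x = k *\<^sub>C b"
 proof (rule endo_eqI)
  fix w
  have "x \<cdot> w = x \<cdot> b \<cdot> w" using arg_cong[OF xb, of "\<lambda>t. t \<cdot> w"] by simp
  then show "x \<cdot> w = (k *\<^sub>C b) \<cdot> w" using all[OF bb] by simp
 qed
 moreover have "tr b \<noteq> 0" by (rule tr_idem_nonzero[OF b False])
 ultimately have "k = 0" using x(2) by simp
 then show ?thesis using \<open>x = k *\<^sub>C b\<close> by simp
qed

text \<open>The condition \<open>e * c * e = 0\<close>, with \<open>e\<close> a unit for a given
  finite set of operators, is the precise sense in which \<open>c\<close> lives far away from that
  set.\<close>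

lemma corner_zero:
 fixes e :: "'w::ring"
 assumes "e * x = x" "x * e = x" "e * c * e = 0"
 shows "e * (x * c) * e = 0" "e * (c * x) * e = 0"
proof -
 have "e * (x * c) * e = (e * x) * c * e" by (simp only: mult.assoc)
 also have "\<dots> = (x * e) * c * e" unfolding assms(1,2) ..
 also have "\<dots> = x * (e * c * e)" by (simp only: mult.assoc)
 finally show "e * (x * c) * e = 0" unfolding assms(3) by simp
 have "e * (c * x) * e = e * c * (x * e)" by (simp only: mult.assoc)
 also have "\<dots> = e * c * (e * x)" unfolding assms(1,2) ..
 also have "\<dots> = (e * c * e) * x" by (simp only: mult.assoc)
 finally show "e * (c * x) * e = 0" unfolding assms(3) by simp
qed

lemma middle_zero:
 fixes e :: "'w::ring"
 assumes "a * e = a" "e * b = b" "e * s * e = 0" shows "a * s * b = 0"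
proof -
 have "a * s * b = (a * e) * s * (e * b)" unfolding assms(1,2) ..
 also have "\<dots> = a * (e * s * e) * b" by (simp only: mult.assoc)
 finally show ?thesis unfolding assms(3) by simp
qed

context irr_ideal
begin

text \<open>For a product \<open>m\<close> of elements of \<open>g\<close> with partner
  \<open>n\<close>, the operator \<open>m * c + c * n\<close> is the iterated bracket of these
  elements with \<open>c\<close>, because the mixed terms \<open>x * c * y\<close> vanish when
  \<open>e * c * e = 0\<close>. In this way the associative algebra acts inside the Lie ideal
  \<open>J\<close>.\<close>

definition adapted :: "'v endo => 'v endo => 'v endo => bool" where
 "adapted e m n \<longleftrightarrow> e * m = m \<and> m * e = m \<and> e * n = n \<and> n * e = n \<and>
  (\<forall>c\<in>J. e * c * e = 0 --> m * c + c * n \<in> J \<and> e * (m * c + c * n) * e = 0)"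

lemma adaptedI:
 assumes mn: "(m, n) \<in> prs P" and P: "P \<subseteq> g" and unit: "\<And>p. p \<in> P ==> e * p = p \<and> p * e = p"
 shows "adapted e m n"
 using mn
proof (induction rule: prs.induct)
 case (base x)
 have e: "e * x = x" "x * e = x" using unit[OF base] by auto
 have "lb x c \<in> J \<and> e * lb x c * e = 0" if c: "c \<in> J" "e * c * e = 0" for c
 proof -
  have "e * lb x c * e = e * (x * c) * e - e * (c * x) * e" unfolding lb_def by (simp only: left_diff_distrib right_diff_distrib)
  then show ?thesis unfolding corner_zero[OF e c(2)] using ideal_inD(3)[OF J(1) _ c(1)] base P by auto
 qed
 then show ?case unfolding adapted_def lb_def using e by simp
next
 case (step x m n)
 have ex: "e * x = x" "x * e = x" using unit[OF step(1)] by auto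
 have em: "e * m = m" "m * e = m" "e * n = n" "n * e = n" using step.IH unfolding adapted_def by auto
 have "x * m * c + c * - (n * x) \<in> J \<and> e * (x * m * c + c * - (n * x)) * e = 0" if c: "c \<in> J" "e * c * e = 0" for c
 proof -
  define y where "y = m * c + c * n"
  have y: "y \<in> J" "e * y * e = 0" using step.IH c unfolding y_def adapted_def by auto
  have 1: "x * c * n = 0" by (rule middle_zero[OF ex(2) em(3) c(2)])
  have 2: "m * c * x = 0" by (rule middle_zero[OF em(2) ex(1) c(2)])
  have l: "x * m * c + c * - (n * x) = lb x y"
   unfolding lb_def y_def using 1 2 by (simp add: distrib_left distrib_right mult.assoc)
  have "e * lb x y * e = e * (x * y) * e - e * (y * x) * e"
   unfolding lb_def by (simp only: left_diff_distrib right_diff_distrib)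
  then show ?thesis unfolding l corner_zero[OF ex y(2)] using ideal_inD(3)[OF J(1) _ y(1)] step(1) P by auto
 qed
 moreover have "e * (x * m) = x * m" "x * m * e = x * m" "e * (n * x) = n * x" "n * x * e = n * x"
  using ex em by (simp_all add: mult.assoc) (simp_all add: mult.assoc[symmetric])
 ultimately show ?case unfolding adapted_def by simp
next
 case (add m n m' n')
 have "(m + m') * c + c * (n + n') \<in> J \<and> e * ((m + m') * c + c * (n + n')) * e = 0" if c: "c \<in> J" "e * c * e = 0" for c
 proof -
  have y: "m * c + c * n \<in> J" "e * (m * c + c * n) * e = 0" "m' * c + c * n' \<in> J" "e * (m' * c + c * n') * e = 0"
   using add.IH c unfolding adapted_def by auto
  have l: "(m + m') * c + c * (n + n') = (m * c + c * n) + (m' * c + c * n')" by (simp add: distrib_left distrib_right)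
  show ?thesis unfolding l distrib_left[of e "m * c + c * n"] distrib_right[of _ _ e] y(2,4)
   using cv.subspace_add[OF Jv y(1,3)] by simp
 qed
 then show ?case using add.IH unfolding adapted_def by (simp add: distrib_left distrib_right)
next
 case (scC m n k)
 have "k *\<^sub>C m * c + c * (k *\<^sub>C n) \<in> J \<and> e * (k *\<^sub>C m * c + c * (k *\<^sub>C n)) * e = 0" if c: "c \<in> J" "e * c * e = 0" for c
 proof -
  have y: "m * c + c * n \<in> J" "e * (m * c + c * n) * e = 0" using scC.IH c unfolding adapted_def by auto
  have l: "k *\<^sub>C m * c + c * (k *\<^sub>C n) = k *\<^sub>C (m * c + c * n)" by (simp add: cv.scale_right_distrib)
  show ?thesis unfolding l unfolding scC_mult_right scC_mult_left y(2) using cv.subspace_scale[OF Jv y(1)] by simp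
 qed
 then show ?case using scC.IH unfolding adapted_def by simp
qed

lemma unit_support:
 assumes "(m, n) \<in> prs g"
 shows "\<exists>P. finite P \<and> P \<subseteq> g \<and> (\<forall>e. (\<forall>p\<in>P. e * p = p \<and> p * e = p) --> e * m = m)"
proof -
 from prs_support[OF assms] obtain P where P: "finite P" "P \<subseteq> g" "(m, n) \<in> prs P"
  by (elim exE conjE) (rule that)
 have "e * m = m" if "\<forall>p\<in>P. e * p = p \<and> p * e = p" for e
  using adaptedI[OF P(3,2), of e] that unfolding adapted_def by blast
 then show ?thesis using P(1,2) by blast
qed

lemma corner_kernel:
 assumes "e \<in> fr"
 shows "cv.subspace {c \<in> J. e * c * e = 0}" "fcod {c \<in> J. e * c * e = 0} J"
proof -
 show "cv.subspace {c \<in> J. e * c * e = 0}"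
  by (rule cv.subspaceI) (simp_all add: subspace_rules[OF Jv] distrib_left distrib_right)
 have "fd ((\<lambda>c. e * c * e) ` J)" by (rule fd_subset[OF fd_corner[OF assms assms]]) blast
 then show "fcod {c \<in> J. e * c * e = 0} J" by (rule fcod_ker[OF Jv clinear_corner])
qed

text \<open>The bracket of the two elements \<open>m * c + c * n\<close> and
  \<open>m' * d + d * n'\<close> of \<open>J\<close>: of its eight terms only two contain no
  vanishing factor.\<close>

lemma bracket_far:
 assumes mn: "(m, n) \<in> prs g" and mn': "(m', n') \<in> prs g" and z: "n * m' = 0" "n' * m = 0"
 shows "\<exists>e\<in>fr. \<forall>c\<in>J. \<forall>d\<in>J. e * c * e = 0 --> e * d * e = 0 --> m * c * d * n' - m' * d * c * n \<in> J"
proof -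
 from prs_support[OF mn] obtain P where P: "finite P" "P \<subseteq> g" "(m, n) \<in> prs P" by (elim exE conjE) (rule that)
 from prs_support[OF mn'] obtain P' where P': "finite P'" "P' \<subseteq> g" "(m', n') \<in> prs P'" by (elim exE conjE) (rule that)
 have "finite (P \<union> P')" "P \<union> P' \<subseteq> fr" using P P' g(2) by auto
 from finite_rank_unit[OF this] obtain e where e: "e \<in> fr" "\<And>p. p \<in> P \<union> P' ==> e * p = p \<and> p * e = p"
  by (elim bexE) (rule that, assumption, blast)
 have f1: "adapted e m n" by (rule adaptedI[OF P(3,2)]) (use e(2) in blast)
 have f2: "adapted e m' n'" by (rule adaptedI[OF P'(3,2)]) (use e(2) in blast)
 have em: "m * e = m" "n * e = n" "e * m' = m'" "e * n' = n'" "m' * e = m'" "n' * e = n'" "e * m = m" "e * n = n" using f1 f2 unfolding adapted_def by auto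
 have "m * c * d * n' - m' * d * c * n \<in> J" if c: "c \<in> J" "e * c * e = 0" and d: "d \<in> J" "e * d * e = 0" for c d
 proof -
  have k: "m * c * m' = 0" "n * d * n' = 0" "m' * d * m = 0" "n' * c * n = 0"
   by (rule middle_zero[OF em(1,3) c(2)], rule middle_zero[OF em(2,4) d(2)],
    rule middle_zero[OF em(5,7) d(2)], rule middle_zero[OF em(6,8) c(2)])
  have e1: "(m * c + c * n) * (m' * d + d * n') = (m * c * m') * d + m * c * d * n' + c * (n * m') * d + c * (n * d * n')"
   by (simp only: distrib_left distrib_right mult.assoc add.assoc) (simp only: ac_simps)
  have e2: "(m' * d + d * n') * (m * c + c * n) = (m' * d * m) * c + m' * d * c * n + d * (n' * m) * c + d * (n' * c * n)"
   by (simp only: distrib_left distrib_right mult.assoc add.assoc) (simp only: ac_simps)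
  have eq: "m * c * d * n' - m' * d * c * n = lb (m * c + c * n) (m' * d + d * n')"
   unfolding lb_def e1 e2 k z by simp
  have "m * c + c * n \<in> J" "m' * d + d * n' \<in> J" using f1 f2 c d unfolding adapted_def by auto
  then show ?thesis unfolding eq by (rule subalg_D(2)[OF ideal_subalg[OF J(1)]])
 qed
 then show ?thesis using e(1) by blast
qed

text \<open>The subalgebra is the part of \<open>J\<close> in the corner of \<open>b\<close>. The
  applications only have to show that certain operators have every vector of the range of
  \<open>b\<close> as an eigenvector; such operators are scalars there, and their trace is zero. For
  operators orthogonal to \<open>u\<close> this gives nondegeneracy (\<open>N\<close>), for the
  centre of \<open>u\<close> it gives perfectness (\<open>C\<close>).\<close>

lemma trim:
 assumes b: "b \<in> fr" "b * b = b" and P: "P \<subseteq> lbs g g" "\<And>x. x \<in> P ==> b * x = x \<and> x * b = x"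
  and N: "\<And>x l. x \<in> g ==> b * x * b = x ==> (\<And>y. y \<in> J ==> b * y * b = y ==> tr (x * y) = 0) ==> b \<cdot> l = l ==> x \<cdot> l \<in> cv.span {l}"
  and C: "\<And>x l. x \<in> J ==> b * x * b = x ==> (\<And>y. y \<in> J ==> b * y * b = y ==> lb x y = 0) ==> b \<cdot> l = l ==> x \<cdot> l \<in> cv.span {l}"
 shows "\<exists>u. u \<subseteq> J \<and> subalg u \<and> fd u \<and> P \<subseteq> u \<and> trad u \<subseteq> {0} \<and> u \<subseteq> lbs u u"
proof -
 define u where "u = {x \<in> J. b * x * b = x}"
 have uJ: "u \<subseteq> J" unfolding u_def by blast
 have uv: "cv.subspace u" unfolding u_def
  by (rule cv.subspaceI) (simp_all add: subspace_rules[OF Jv] distrib_left distrib_right)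
 have ub: "b * x = x" "x * b = x" if "b * x * b = x" for x by (metis b(2) that mult.assoc)+
 have us: "subalg u" unfolding lie_subalgebra_def
 proof (intro conjI ballI)
  show "cv.subspace u" by (rule uv)
  fix x y assume xy: "x \<in> u" "y \<in> u"
  have bx: "b * x = x" "x * b = x" "b * y = y" "y * b = y" using ub xy unfolding u_def by auto
  have "b * (x * y) * b = (b * x) * (y * b)" "b * (y * x) * b = (b * y) * (x * b)" by (simp_all only: mult.assoc)
  then have "b * lb x y * b = lb x y" unfolding lb_def left_diff_distrib right_diff_distrib bx by simp
  moreover have "lb x y \<in> J" using subalg_D(2)[OF ideal_subalg[OF J(1)]] xy uJ by blast
  ultimately show "lb x y \<in> u" unfolding u_def by blast
 qed
 have "x \<in> {b * x * b | x. True}" if "b * x * b = x" for x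
  by (rule CollectI, intro exI[of _ x]) (simp add: that)
 then have "u \<subseteq> {b * x * b | x. True}" unfolding u_def by blast
 then have uf: "fd u" by (rule fd_subset[OF fd_corner[OF b(1) b(1)]])
 have zero: "x = 0" if x: "x \<in> lbs g g" "b * x * b = x" "\<And>y. y \<in> u ==> tr (x * y) = 0" for x
 proof (rule scalar_if_all_eigenvectors[OF b x(2) tr_J[OF x(1)]])
  fix l assume l: "b \<cdot> l = l"
  have "x \<in> g" using x(1) lbs_subalg[OF g(1)] by blast
  then show "x \<cdot> l \<in> cv.span {l}" by (rule N[OF _ x(2) _ l]) (use x(3) in \<open>simp add: u_def\<close>)
 qed
 have ulb: "x \<in> u ==> x \<in> lbs g g" for x using uJ J(2) by blast
 have ubb: "x \<in> u ==> b * x * b = x" for x unfolding u_def by simp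
 have uf': "x \<in> u ==> x \<in> fr" for x using uJ J_fr by blast
 obtain B where B: "finite B" "B \<subseteq> u" "\<And>a c. a \<in> B ==> c \<in> B ==> tr (a * c) = (if a = c then 1 else 0)"
  "\<And>x y. x \<in> u ==> y \<in> u ==> tr ((x - (\<Sum>c\<in>B. tr (x * c) *\<^sub>C c)) * y) = 0"
  using orthonormal_basis[OF uv uf, of "\<lambda>x y. tr (x * y)"] tr_form_linear tr_comm uf' by (smt (verit, best))
 have Bu: "(\<Sum>c\<in>B. k c *\<^sub>C c) \<in> u" for k
  by (intro cv.subspace_sum[OF uv] cv.subspace_scale[OF uv]) (use B(2) in blast)
 have exp: "x = (\<Sum>c\<in>B. tr (x * c) *\<^sub>C c)" if x: "x \<in> u" for x
 proof -
  have d: "x - (\<Sum>c\<in>B. tr (x * c) *\<^sub>C c) \<in> u" by (rule cv.subspace_diff[OF uv x Bu])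
  have "x - (\<Sum>c\<in>B. tr (x * c) *\<^sub>C c) = 0" by (rule zero[OF ulb[OF d] ubb[OF d] B(4)[OF x]])
  then show ?thesis by simp
 qed
 \<comment> \<open>Since \<open>N\<close> covers elements of \<open>g\<close> and not only of
   \<open>J\<close>, the difference between \<open>x\<close> and its projection to \<open>u\<close>
   vanishes; this shows in particular that \<open>x\<close> lies in \<open>J\<close>.\<close>
 have "P \<subseteq> u"
 proof
  fix x assume x: "x \<in> P"
  define z where "z = (\<Sum>c\<in>B. tr (x * c) *\<^sub>C c)"
  have zu: "z \<in> u" unfolding z_def by (rule Bu)
  have "x - z = 0"
  proof (rule zero)
   show "x - z \<in> lbs g g" by (rule cv.subspace_diff[OF lbs_subspace]) (use P(1) x ulb[OF zu] in auto)
   have "b * x * b = x" using P(2)[OF x] by simp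
   then show "b * (x - z) * b = x - z" using ubb[OF zu] by (simp add: left_diff_distrib right_diff_distrib)
   have c0: "tr ((x - z) * c) = 0" if c: "c \<in> B" for c unfolding z_def by (rule orthonormal_residue[OF B(1) _ c]) (use B(3) in blast)
   show "tr ((x - z) * y) = 0" if y: "y \<in> u" for y
   proof -
    have "tr ((x - z) * y) = tr ((x - z) * (\<Sum>c\<in>B. tr (y * c) *\<^sub>C c))" using exp[OF y] by simp
    also have "\<dots> = 0" using c0 by (simp add: sum_distrib_left tr_sum)
    finally show ?thesis .
   qed
  qed
  then show "x \<in> u" using zu by simp
 qed
 moreover have "trad u \<subseteq> {0}" using zero ulb ubb unfolding trad_def by blast
 moreover have "u \<subseteq> lbs u u"
 proof (rule ccontr)
  assume "\<not> u \<subseteq> lbs u u"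
  then obtain x0 where x0: "x0 \<in> u" "x0 \<notin> lbs u u" by blast
  obtain f where f: "clinear f" "f x0 = (1 :: complex)" "\<And>x. x \<in> lbs u u ==> f x = 0"
   by (rule separating_functional[OF lbs_subspace x0(2)]) (rule that)
  \<comment> \<open>By nondegeneracy \<open>y\<close> represents the functional \<open>f\<close>. As
    \<open>f\<close> vanishes on \<open>[u, u]\<close>, invariance of the form makes
    \<open>y\<close> central in \<open>u\<close>.\<close>
  define y where "y = (\<Sum>c\<in>B. f c *\<^sub>C c)"
  have yu: "y \<in> u" unfolding y_def by (rule Bu)
  have yf: "tr (y * z) = f z" if z: "z \<in> u" for z
  proof -
   have "f z = f (\<Sum>c\<in>B. tr (z * c) *\<^sub>C c)" using exp[OF z] by simp
   also have "\<dots> = (\<Sum>c\<in>B. tr (z * c) * f c)" by (simp add: clinear_sum[OF f(1)] clinear_scC[OF f(1)])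
   also have "\<dots> = (\<Sum>c\<in>B. f c * tr (c * z))" by (rule sum.cong) (use tr_comm[OF uf'[OF z]] in \<open>auto simp: mult.commute\<close>)
   also have "\<dots> = tr (y * z)" unfolding y_def by (simp add: sum_distrib_right tr_sum)
   finally show ?thesis ..
  qed
  have com: "lb y a = 0" if a: "a \<in> u" for a
  proof -
   have l: "lb y a \<in> u" by (rule subalg_D(2)[OF us yu a])
   show ?thesis
   proof (rule zero[OF ulb[OF l] ubb[OF l]])
    fix c assume c: "c \<in> u"
    have "tr (lb y a * c) = tr (y * lb a c)" using uf' yu a c by (intro tr_lb_assoc) auto
    also have "\<dots> = 0" using yf[OF subalg_D(2)[OF us a c]] f(3)[OF lbs_mem[OF a c]] by simp
    finally show "tr (lb y a * c) = 0" .
   qed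
  qed
  have "y = 0"
  proof (rule scalar_if_all_eigenvectors[OF b ubb[OF yu] tr_J[OF ulb[OF yu]]])
   fix l assume l: "b \<cdot> l = l"
   show "y \<cdot> l \<in> cv.span {l}"
    by (rule C[OF _ ubb[OF yu] _ l]) (use yu uJ com in \<open>auto simp: u_def\<close>)
  qed
  then show False using yf[OF x0(1)] f(2) by simp
 qed
 ultimately show ?thesis using uJ us uf by blast
qed

text \<open>The case without invariant form. \<open>F\<close> collects the functionals whose rank
  one operators all have partner 0. If \<open>r l = 0\<close>, then \<open>bracket_far\<close>
  applies to the pairs \<open>(l \<otimes> f1, 0)\<close> and \<open>(0, w1 \<otimes> r)\<close> and
  puts \<open>f1 (c d w1)\<close> times \<open>l \<otimes> r\<close> into \<open>J\<close>;
  \<open>far_functional\<close> makes the factor nonzero.\<close>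

lemma claim_one:
 assumes v: "v \<in> W" "v \<noteq> 0" "clinear f" "f \<noteq> 0" "\<And>x. f (prj \<cdot> x) = f x" "(rk v f, 0) \<in> prs g"
  and P: "finite P" "P \<subseteq> lbs g g"
 shows "\<exists>u. u \<subseteq> J \<and> subalg u \<and> fd u \<and> P \<subseteq> u \<and> trad u \<subseteq> {0} \<and> u \<subseteq> lbs u u"
proof -
 define F where "F = {f :: 'v => complex. clinear f \<and> (\<forall>x. f (prj \<cdot> x) = f x) \<and> (\<forall>w\<in>W. (rk w f, 0) \<in> prs g)}"
 have Fl: "clinear r" if "r \<in> F" for r using that unfolding F_def by blast
 have Fp: "r (prj \<cdot> x) = r x" if "r \<in> F" for r x using that unfolding F_def by blast
 have Frk: "(rk w r, 0) \<in> prs g" if "r \<in> F" "w \<in> W" for r w using that unfolding F_def by blast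
 have F1: "f \<in> F" unfolding F_def
 proof (intro CollectI conjI allI ballI)
  fix w assume "w \<in> W"
  then obtain b c where b: "(b, c) \<in> prs g" "b \<cdot> v = w" using transitive[OF v(1,2)] by blast
  show "(rk w f, 0) \<in> prs g" using prs_mult[OF b(1) v(6)] mult_rk[OF v(3), of b v] b(2) by simp
 qed (use v in auto)
 have Fcomp: "(\<lambda>z. r (x \<cdot> z)) \<in> F" if r: "r \<in> F" and x: "x \<in> g" for r x
  unfolding F_def
 proof (intro CollectI conjI allI ballI)
  show "clinear (\<lambda>z. r (x \<cdot> z))" by (rule clinear_comp_app[OF Fl[OF r]])
  show "r (x \<cdot> prj \<cdot> z) = r (x \<cdot> z)" for z unfolding g_prj[OF x] ..
  show "(rk w (\<lambda>z. r (x \<cdot> z)), 0) \<in> prs g" if "w \<in> W" for w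
   using prs_mult[OF Frk[OF r that] prs.base[OF x]] rk_mult[OF Fl[OF r], of w x] by simp
 qed
 have z0: "(0, 0) \<in> prs g" using prs.scC[OF v(6), of 0] by simp
 have Fv: "cv.subspace F"
 proof (rule cv.subspaceI)
  have l0: "clinear (0 :: 'v => complex)" by (rule clinearI) simp_all
  have "rk w 0 = 0" for w :: 'v by (rule endo_eqI) (simp add: l0)
  then show "0 \<in> F" unfolding F_def using l0 z0 by simp
  fix r s assume rs: "r \<in> F" "s \<in> F"
  have "clinear (r + s)" by (rule clinearI) (simp_all add: clinear_add[OF Fl] clinear_scC[OF Fl] rs algebra_simps)
  then show "r + s \<in> F" using Fp rs prs.add[OF Frk Frk, OF rs(1) _ rs(2)]
   unfolding F_def by (simp add: rk_fun_simps(1)[OF Fl[OF rs(1)] Fl[OF rs(2)]])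
 next
  fix k r assume r: "r \<in> F"
  have "clinear (k *\<^sub>C r)" by (rule clinearI) (simp_all add: clinear_add[OF Fl[OF r]] clinear_scC[OF Fl[OF r]] scC_fun_def algebra_simps)
  moreover have "(rk w (k *\<^sub>C r), 0) \<in> prs g" if "w \<in> W" for w
   using prs.scC[OF Frk[OF r that], of k] unfolding rk_fun_simps(3)[OF Fl[OF r] Fl[OF r]] by simp
  moreover have "(k *\<^sub>C r) (prj \<cdot> x) = (k *\<^sub>C r) x" for x using Fp[OF r] by (simp add: scC_fun_def)
  ultimately show "k *\<^sub>C r \<in> F" unfolding F_def by blast
 qed
 have pr: "pairing W F" and gF: "g \<subseteq> ops W F"
  by (rule pairing_ops[OF Fv Fl Fp Fcomp F1 v(4)]; assumption)+
 interpret pairing W F by (rule pr)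
 obtain f1 w1 where fw: "f1 \<in> F" "w1 \<in> W"
  and far: "\<And>H. cv.subspace H ==> H \<subseteq> J ==> fcod H J ==> \<exists>c\<in>H. \<exists>d\<in>H. f1 (c \<cdot> d \<cdot> w1) \<noteq> 0"
  using far_functional[OF pr gF] by blast
 have rkJ: "rk l r \<in> J" if l: "l \<in> W" and r: "r \<in> F" and lr: "r l = 0" for l r
 proof -
  have "rk w1 r * rk l f1 = 0" unfolding rk_rk[OF Fl[OF r] Fl[OF fw(1)]] lr by simp
  then obtain e where e: "e \<in> fr" and eJ: "\<And>c d. c \<in> J ==> d \<in> J ==> e * c * e = 0 ==> e * d * e = 0 ==>
    rk l f1 * c * d * rk w1 r - 0 * d * c * 0 \<in> J"
   using bracket_far[OF Frk[OF fw(1) l] prs_swap[OF Frk[OF r fw(2)]]] by auto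
  obtain c d where cd: "c \<in> J" "d \<in> J" "e * c * e = 0" "e * d * e = 0" "f1 (c \<cdot> d \<cdot> w1) \<noteq> 0"
   using far[OF corner_kernel(1)[OF e] _ corner_kernel(2)[OF e]] by blast
  have "rk l f1 * c * d * rk w1 r = f1 (c \<cdot> d \<cdot> w1) *\<^sub>C rk l r"
   using mult_rk[OF Fl[OF r], of d w1] mult_rk[OF Fl[OF r], of c "d \<cdot> w1"] rk_rk[OF Fl[OF fw(1)] Fl[OF r], of l "c \<cdot> d \<cdot> w1"]
   by (simp add: mult.assoc)
  then have "f1 (c \<cdot> d \<cdot> w1) *\<^sub>C rk l r \<in> J" using eJ[OF cd(1-4)] by simp
  from cv.subspace_scale[OF Jv this, of "inverse (f1 (c \<cdot> d \<cdot> w1))"] show ?thesis using cd(5) by simp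
 qed
 have Pops: "P \<subseteq> ops W F" using P(2) lbs_subalg[OF g(1)] gF by blast
 obtain e where e: "e \<in> ops W F" "\<And>x. x \<in> P ==> e * x = x \<and> x * e = x" using two_sided_unit[OF P(1) Pops] by blast
 obtain b where b: "b \<in> ops W F" "b * b = b" "\<And>x. e * x = x ==> b * x = x" "\<And>x. x * e = x ==> x * b = x"
  using idempotent_unit[OF ops_fr[OF e(1)] ops_subspace e(1) ops_mult[OF e(1)]] by blast
 have bb: "b \<cdot> b \<cdot> v = b \<cdot> v" for v using arg_cong[OF b(2), of "\<lambda>t. t \<cdot> v"] by simp
 have sep1: "\<exists>r. rk l r \<in> J \<and> b * rk l r * b = rk l r \<and> clinear r \<and> r l = 0 \<and> r (x \<cdot> l) = 1"
  if bl: "b \<cdot> l = l" and bx: "b \<cdot> x \<cdot> l = x \<cdot> l" and nl: "x \<cdot> l \<notin> cv.span {l}" for x l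
 proof -
  obtain r0 where r0: "clinear r0" "r0 (x \<cdot> l) = (1 :: complex)" "\<And>z. z \<in> cv.span {l} ==> r0 z = 0"
   by (rule separating_functional[OF cv.subspace_span nl]) (rule that)
  define r where "r = (\<lambda>z. r0 (b \<cdot> z))"
  have rF: "r \<in> F" unfolding r_def by (rule ops_comp[OF b(1) r0(1)])
  have rl: "r l = 0" unfolding r_def bl by (rule r0(3)) (simp add: cv.span_base)
  have lW: "l \<in> W" using ops_app[OF b(1), of l] bl by simp
  have "(\<lambda>z. r (b \<cdot> z)) = r" unfolding r_def bb ..
  then have "b * rk l r * b = rk l r" unfolding mult_rk[OF Fl[OF rF]] rk_mult[OF Fl[OF rF]] bl by simp
  moreover have "r (x \<cdot> l) = 1" unfolding r_def bx by (rule r0(2))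
  ultimately show ?thesis using rkJ[OF lW rF rl] Fl[OF rF] rl by blast
 qed
 have bx: "b \<cdot> x \<cdot> l = x \<cdot> l" if "b * x * b = x" for x l
 proof -
  have "b * x = x" by (metis b(2) that mult.assoc)
  from arg_cong[OF this, of "\<lambda>t. t \<cdot> l"] show ?thesis by simp
 qed
 show ?thesis
 proof (rule trim[OF ops_fr[OF b(1)] b(2) P(2)])
  show "b * x = x \<and> x * b = x" if "x \<in> P" for x using b(3,4) e(2)[OF that] by blast
  fix x l assume xb: "b * x * b = x" and l: "b \<cdot> l = l"
  note s = sep1[OF l bx[OF xb]]
  { assume N: "\<And>y. y \<in> J ==> b * y * b = y ==> tr (x * y) = 0"
   show "x \<cdot> l \<in> cv.span {l}"
   proof (rule ccontr)
    assume "x \<cdot> l \<notin> cv.span {l}"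
    then obtain r where r: "rk l r \<in> J" "b * rk l r * b = rk l r" "clinear r" "r l = 0" "r (x \<cdot> l) = 1" using s by blast
    show False using N[OF r(1,2)] r(5) unfolding mult_rk[OF r(3)] tr_rk[OF r(3)] by simp
   qed }
  { assume C: "\<And>y. y \<in> J ==> b * y * b = y ==> lb x y = 0"
   show "x \<cdot> l \<in> cv.span {l}"
   proof (rule ccontr)
    assume nl: "x \<cdot> l \<notin> cv.span {l}"
    then obtain r where r: "rk l r \<in> J" "b * rk l r * b = rk l r" "clinear r" "r l = 0" "r (x \<cdot> l) = 1" using s by blast
    have "lb x (rk l r) \<cdot> x \<cdot> l = 0" using C[OF r(1,2)] by simp
    then have "x \<cdot> l = r (x \<cdot> x \<cdot> l) *\<^sub>C l" unfolding lb_def using r(3,5) by simp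
    then have "x \<cdot> l \<in> cv.span {l}" unfolding cv.span_singleton by blast
    then show False using nl by simp
   qed }
 qed
qed

text \<open>In the second alternative \<open>\<phi> v w\<close> is the invariant bilinear form on \<open>W\<close>, symmetric or alternating
 according to the sign \<open>\<epsilon>\<close>.\<close>
lemma invariant_form:
 assumes v: "v0 \<in> W" "v0 \<noteq> 0" "clinear f0" "f0 \<noteq> 0" "\<And>x. f0 (prj \<cdot> x) = f0 x"
  and w: "w0 \<in> W" "w0 \<noteq> 0" "clinear h0" "h0 \<noteq> 0" "\<And>x. h0 (prj \<cdot> x) = h0 x"
  and vw: "(rk v0 f0, rk w0 h0) \<in> prs g" and z: "\<forall>m. (m, 0) \<in> prs g --> m = 0"
 shows "\<exists>\<phi> :: 'v => 'v => complex. \<exists>\<epsilon>. \<epsilon> * \<epsilon> = 1 \<and> (\<forall>v\<in>W. clinear (\<phi> v) \<and> (\<forall>x. \<phi> v (prj \<cdot> x) = \<phi> v x)) \<and>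
  (\<forall>u\<in>W. \<forall>v\<in>W. \<phi> (u + v) = \<phi> u + \<phi> v) \<and> (\<forall>u\<in>W. \<forall>k. \<phi> (k *\<^sub>C u) = k *\<^sub>C \<phi> u) \<and>
  (\<forall>v\<in>W. \<forall>w\<in>W. \<phi> v w = \<epsilon> * \<phi> w v \<and> (rk w (\<phi> v), \<epsilon> *\<^sub>C rk v (\<phi> w)) \<in> prs g) \<and>
  (\<forall>m n v. (m, n) \<in> prs g --> v \<in> W --> \<phi> (m \<cdot> v) = (\<lambda>x. \<phi> v (n \<cdot> x))) \<and> (\<exists>v\<in>W. \<phi> v \<noteq> 0)"
proof -
 have uniq: "n = n'" if "(m, n) \<in> prs g" "(m, n') \<in> prs g" for m n n'
  proof -
  have "(0, n - n') \<in> prs g" using prs_diff[OF that] by simp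
  then have "n - n' = 0" using z prs_swap by blast
  then show ?thesis by simp
 qed
 have rk_inj: "h = h'" if "rk u h = rk u h'" "clinear h" "clinear h'" "u \<noteq> 0" for u and h h' :: "'v => complex"
 proof
  fix x
  have "h x *\<^sub>C u = h' x *\<^sub>C u" using arg_cong[OF that(1), of "\<lambda>t. t \<cdot> x"] that(2,3) by simp
  then show "h x = h' x" using that(4) by simp
 qed
 \<comment> \<open>Moving \<open>v0\<close> to \<open>v\<close> by the associative algebra turns the
   partner of \<open>v0 \<otimes> f0\<close> into some \<open>w0 \<otimes> h\<close>. This
   \<open>h\<close> is the value of the form at \<open>v\<close>; it is unique because partners
   are.\<close>
 have "\<exists>h. clinear h \<and> (\<forall>x. h (prj \<cdot> x) = h x) \<and> (rk v f0, rk w0 h) \<in> prs g" if vW: "v \<in> W" for v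
 proof -
  obtain b c where b: "(b, c) \<in> prs g" "b \<cdot> v0 = v" using transitive[OF v(1,2) vW] by blast
  have "(rk v f0, rk w0 (\<lambda>x. h0 (c \<cdot> x))) \<in> prs g"
   using prs_mult[OF b(1) vw] unfolding mult_rk[OF v(3)] rk_mult[OF w(3)] b(2) .
  moreover have "h0 (c \<cdot> prj \<cdot> x) = h0 (c \<cdot> x)" for x using prs_prj_app[OF prs_swap[OF b(1)], of x] by simp
  ultimately show ?thesis using clinear_comp_app[OF w(3)] by blast
 qed
 then obtain \<phi> where \<phi>: "\<And>v. v \<in> W ==> clinear (\<phi> v)" "\<And>v x. v \<in> W ==> \<phi> v (prj \<cdot> x) = \<phi> v x"
  "\<And>v. v \<in> W ==> (rk v f0, rk w0 (\<phi> v)) \<in> prs g" by metis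
 have \<phi>_eq: "\<phi> v = h" if "v \<in> W" "clinear h" "(rk v f0, rk w0 h) \<in> prs g" for v h
  by (rule rk_inj[OF uniq[OF \<phi>(3)[OF that(1)] that(3)] \<phi>(1)[OF that(1)] that(2) w(2)])
 have \<phi>_app: "\<phi> (m \<cdot> v) = (\<lambda>x. \<phi> v (n \<cdot> x))" if "(m, n) \<in> prs g" "v \<in> W" for m n v
  by (rule \<phi>_eq[OF prs_W[OF that(1)] clinear_comp_app[OF \<phi>(1)[OF that(2)]]])
   (use prs_mult[OF that(1) \<phi>(3)[OF that(2)]] in \<open>simp add: mult_rk[OF v(3)] rk_mult[OF \<phi>(1)[OF that(2)]]\<close>)
 have \<phi>_add: "\<phi> (u + v) = \<phi> u + \<phi> v" if uv: "u \<in> W" "v \<in> W" for u v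
 proof (rule \<phi>_eq[OF cv.subspace_add[OF Wv uv]])
  show "clinear (\<phi> u + \<phi> v)"
   by (rule clinearI) (simp_all add: clinear_add[OF \<phi>(1)] clinear_scC[OF \<phi>(1)] uv algebra_simps)
  show "(rk (u + v) f0, rk w0 (\<phi> u + \<phi> v)) \<in> prs g"
   using prs.add[OF \<phi>(3)[OF uv(1)] \<phi>(3)[OF uv(2)]]
   unfolding rk_vec_simps(1)[OF v(3)] rk_fun_simps(1)[OF \<phi>(1)[OF uv(1)] \<phi>(1)[OF uv(2)]] .
 qed
 have \<phi>_scC: "\<phi> (k *\<^sub>C u) = k *\<^sub>C \<phi> u" if u: "u \<in> W" for k u
 proof (rule \<phi>_eq[OF cv.subspace_scale[OF Wv u]])
  show "clinear (k *\<^sub>C \<phi> u)"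
   by (rule clinearI) (simp_all add: clinear_add[OF \<phi>(1)[OF u]] clinear_scC[OF \<phi>(1)[OF u]] scC_fun_def algebra_simps)
  show "(rk (k *\<^sub>C u) f0, rk w0 (k *\<^sub>C \<phi> u)) \<in> prs g"
   using prs.scC[OF \<phi>(3)[OF u]] unfolding rk_vec_simps(3)[OF v(3)] rk_fun_simps(3)[OF \<phi>(1)[OF u] \<phi>(1)[OF u]] .
 qed
 have "\<exists>k. clinear k \<and> (\<forall>v\<in>W. (rk w (\<phi> v), rk v k) \<in> prs g)" if wW: "w \<in> W" for w
 proof -
  obtain b c where b: "(b, c) \<in> prs g" "b \<cdot> w0 = w" using transitive[OF w(1,2) wW] by blast
  have "(rk w (\<phi> v), rk v (\<lambda>x. f0 (c \<cdot> x))) \<in> prs g" if "v \<in> W" for v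
   using prs_mult[OF b(1) prs_swap[OF \<phi>(3)[OF that]]] unfolding mult_rk[OF \<phi>(1)[OF that]] rk_mult[OF v(3)] b(2) .
  then show ?thesis using clinear_comp_app[OF v(3)] by blast
 qed
 then obtain \<psi> where \<psi>: "\<And>w. w \<in> W ==> clinear (\<psi> w)" "\<And>v w. v \<in> W ==> w \<in> W ==> (rk w (\<phi> v), rk v (\<psi> w)) \<in> prs g" by metis
 \<comment> \<open>Invariance of \<open>\<phi>\<close> under the operator
   \<open>w \<otimes> \<phi> v\<close>, evaluated at \<open>y\<close>. For suitable fixed
   \<open>v\<close> and \<open>y\<close> it makes \<open>\<psi>\<close> proportional to
   \<open>\<phi>\<close>; the factor is the sign of the form.\<close>
 have rel: "\<phi> v y *\<^sub>C \<phi> w = \<phi> y v *\<^sub>C \<psi> w" if vwy: "v \<in> W" "w \<in> W" "y \<in> W" for v w y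
  using \<phi>_app[OF \<psi>(2)[OF vwy(1,2)] vwy(3)] unfolding rk_app[OF \<phi>(1)[OF vwy(1)]] rk_app[OF \<psi>(1)[OF vwy(2)]] \<phi>_scC[OF vwy(2)]
  by (simp add: clinear_scC[OF \<phi>(1)[OF vwy(3)]] scC_fun_def mult.commute)
 have "\<phi> v0 = h0" by (rule \<phi>_eq[OF v(1) w(3) vw])
 then obtain y0 where "\<phi> v0 y0 \<noteq> 0" using w(4) by (auto simp: fun_eq_iff)
 then have y1: "\<phi> v0 (prj \<cdot> y0) \<noteq> 0" using \<phi>(2)[OF v(1)] by simp
 define y where "y = prj \<cdot> y0"
 have y: "y \<in> W" "\<phi> v0 y \<noteq> 0" unfolding y_def using y1 prj_W by auto
 define \<epsilon> where "\<epsilon> = \<phi> y v0 / \<phi> v0 y"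
 have \<psi>_eq: "\<psi> w = \<epsilon> *\<^sub>C \<phi> w" if "w \<in> W" for w
 proof -
  have "\<psi> w = inverse (\<phi> v0 y) *\<^sub>C (\<phi> v0 y *\<^sub>C \<psi> w)" using y(2) by simp
  also have "\<dots> = inverse (\<phi> v0 y) *\<^sub>C (\<phi> y v0 *\<^sub>C \<phi> w)" unfolding rel[OF y(1) that v(1)] ..
  finally show ?thesis unfolding \<epsilon>_def by (simp add: field_simps)
 qed
 have sym: "\<phi> v x = \<epsilon> * \<phi> x v" if vx: "v \<in> W" "x \<in> W" for v x
 proof -
  have "(\<phi> v x *\<^sub>C \<phi> v0) y = (\<phi> x v *\<^sub>C \<psi> v0) y" unfolding rel[OF vx(1) v(1) vx(2)] ..
  then show ?thesis unfolding \<psi>_eq[OF v(1)] using y(2) by (simp add: scC_fun_def)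
 qed
 have "\<phi> v0 y = \<epsilon> * (\<epsilon> * \<phi> v0 y)" unfolding sym[OF y(1) v(1), symmetric] by (rule sym[OF v(1) y(1)])
 then have "\<epsilon> * \<epsilon> = 1" using y(2) by simp
 moreover have "(rk w (\<phi> v), \<epsilon> *\<^sub>C rk v (\<phi> w)) \<in> prs g" if "v \<in> W" "w \<in> W" for v w
  using \<psi>(2)[OF that] unfolding \<psi>_eq[OF that(2)] rk_fun_simps(3)[OF \<phi>(1)[OF that(2)] \<phi>(1)[OF that(2)]] .
 moreover have "\<exists>v\<in>W. \<phi> v \<noteq> 0" using y v(1) by (intro bexI[of _ v0]) auto
 ultimately show ?thesis using \<phi>(1,2) \<phi>_add \<phi>_scC sym \<phi>_app
  by (intro exI[of _ \<phi>] exI[of _ \<epsilon>] conjI ballI allI impI) assumption+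
qed

text \<open>The elements \<open>Y l r\<close> replace the operators \<open>l \<otimes> r\<close>;
  both surviving terms of \<open>bracket_far\<close> carry the same factor \<open>k\<close>. The
  idempotent \<open>b\<close> must be self-adjoint, so that functionals on its range are represented
  through \<open>\<phi>\<close> by vectors of its range.\<close>

lemma claim_two:
 assumes v: "v0 \<in> W" "v0 \<noteq> 0" "clinear f0" "f0 \<noteq> 0" "\<And>x. f0 (prj \<cdot> x) = f0 x"
  and w: "w0 \<in> W" "w0 \<noteq> 0" "clinear h0" "h0 \<noteq> 0" "\<And>x. h0 (prj \<cdot> x) = h0 x"
  and vw: "(rk v0 f0, rk w0 h0) \<in> prs g" and z: "\<And>m. (m, 0) \<in> prs g ==> m = 0"
  and P: "finite P" "P \<subseteq> lbs g g"
 shows "\<exists>u. u \<subseteq> J \<and> subalg u \<and> fd u \<and> P \<subseteq> u \<and> trad u \<subseteq> {0} \<and> u \<subseteq> lbs u u"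
proof -
 obtain \<phi> :: "'v => 'v => complex" and \<epsilon> where \<epsilon>: "\<epsilon> * \<epsilon> = 1"
  and \<phi>: "\<And>v. v \<in> W ==> clinear (\<phi> v)" "\<And>v x. v \<in> W ==> \<phi> v (prj \<cdot> x) = \<phi> v x"
  and \<phi>_add: "\<And>u v. u \<in> W ==> v \<in> W ==> \<phi> (u + v) = \<phi> u + \<phi> v"
  and \<phi>_scC: "\<And>u k. u \<in> W ==> \<phi> (k *\<^sub>C u) = k *\<^sub>C \<phi> u"
  and sym: "\<And>v w. v \<in> W ==> w \<in> W ==> \<phi> v w = \<epsilon> * \<phi> w v"
  and pr: "\<And>v w. v \<in> W ==> w \<in> W ==> (rk w (\<phi> v), \<epsilon> *\<^sub>C rk v (\<phi> w)) \<in> prs g"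
  and \<phi>_app: "\<And>m n v. (m, n) \<in> prs g ==> v \<in> W ==> \<phi> (m \<cdot> v) = (\<lambda>x. \<phi> v (n \<cdot> x))"
  and nz: "\<exists>v\<in>W. \<phi> v \<noteq> 0"
 proof -
  have "\<forall>m. (m, 0) \<in> prs g --> m = 0" using z by blast
  from invariant_form[OF v w vw this] show ?thesis by (elim exE conjE) (rule that, assumption, blast+)
 qed
 have inv: "\<phi> (x \<cdot> v) y = - \<phi> v (x \<cdot> y)" if "x \<in> g" "v \<in> W" for x v y
  unfolding \<phi>_app[OF prs.base[OF that(1)] that(2)] by (simp add: clinear_neg[OF \<phi>(1)[OF that(2)]])
 define F where "F = \<phi> ` W"
 have Fv: "cv.subspace F"
 proof (rule cv.subspaceI)
  have "\<phi> 0 = 0" using \<phi>_scC[OF cv.subspace_0[OF Wv], of 0] by simp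
  then show "0 \<in> F" unfolding F_def using cv.subspace_0[OF Wv] by force
  show "r + s \<in> F" if rs: "r \<in> F" "s \<in> F" for r s
  proof -
   obtain a b where "a \<in> W" "b \<in> W" "r = \<phi> a" "s = \<phi> b" using rs unfolding F_def by blast
   then show ?thesis unfolding F_def using \<phi>_add[of a b] cv.subspace_add[OF Wv, of a b] by (metis imageI)
  qed
  show "k *\<^sub>C r \<in> F" if rF: "r \<in> F" for k r
  proof -
   obtain a where "a \<in> W" "r = \<phi> a" using rF unfolding F_def by blast
   then show ?thesis unfolding F_def using \<phi>_scC[of a k] cv.subspace_scale[OF Wv, of a k] by (metis imageI)
  qed
 qed
 have Fl: "clinear r" if "r \<in> F" for r using that \<phi>(1) unfolding F_def by blast
 have Fp: "r (prj \<cdot> x) = r x" if "r \<in> F" for r x using that \<phi>(2) unfolding F_def by auto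
 have Fcomp: "(\<lambda>y. r (x \<cdot> y)) \<in> F" if rx: "r \<in> F" "x \<in> g" for r x
 proof -
  obtain a where a: "a \<in> W" "r = \<phi> a" using rx(1) unfolding F_def by blast
  have "(-1) *\<^sub>C (\<lambda>y. r (x \<cdot> y)) \<in> F"
   using inv[OF rx(2) a(1)] g_W[OF rx(2), of a] unfolding F_def a(2)
   by (intro image_eqI[of _ _ "x \<cdot> a"]) (simp_all add: fun_eq_iff scC_fun_def)
  from cv.subspace_scale[OF Fv this, of "-1"] show ?thesis by simp
 qed
 obtain v1 where v1: "v1 \<in> W" "\<phi> v1 \<noteq> 0" using nz by blast
 have prF: "pairing W F" and gF: "g \<subseteq> ops W F"
  by (rule pairing_ops[OF Fv Fl Fp Fcomp _ v1(2)]; (assumption | simp add: F_def v1(1)))+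
 interpret pairing W F by (rule prF)
 obtain a1 w1 where aw: "a1 \<in> W" "w1 \<in> W"
  and far: "\<And>H. cv.subspace H ==> H \<subseteq> J ==> fcod H J ==> \<exists>c\<in>H. \<exists>d\<in>H. \<phi> a1 (c \<cdot> d \<cdot> w1) \<noteq> 0"
  using far_functional[OF prF gF] unfolding F_def by blast
 define Y where "Y l r = rk l (\<phi> r) - \<epsilon> *\<^sub>C rk r (\<phi> l)" for l r
 have YJ: "Y l r \<in> J" if l: "l \<in> W" and r: "r \<in> W" and lr: "\<phi> r l = 0" for l r
 proof -
  note la = \<phi>(1)[OF aw(1)] and lw = \<phi>(1)[OF aw(2)] and ll = \<phi>(1)[OF l] and lr' = \<phi>(1)[OF r]
  have lr2: "\<phi> l r = 0" using sym[OF l r] lr by simp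
  have 1: "\<epsilon> *\<^sub>C rk a1 (\<phi> l) * (\<epsilon> *\<^sub>C rk r (\<phi> w1)) = 0" by (simp add: rk_rk[OF ll lw] lr2)
  have 2: "rk w1 (\<phi> r) * rk l (\<phi> a1) = 0" by (simp add: rk_rk[OF lr' la] lr)
  obtain e where e: "e \<in> fr" and eJ: "\<And>c d. c \<in> J ==> d \<in> J ==> e * c * e = 0 ==> e * d * e = 0 ==>
    rk l (\<phi> a1) * c * d * rk w1 (\<phi> r) - \<epsilon> *\<^sub>C rk r (\<phi> w1) * d * c * (\<epsilon> *\<^sub>C rk a1 (\<phi> l)) \<in> J"
   using bracket_far[OF pr[OF aw(1) l] prs_swap[OF pr[OF r aw(2)]] 1 2] by blast
  obtain c d where cd: "c \<in> J" "d \<in> J" "e * c * e = 0" "e * d * e = 0" "\<phi> a1 (c \<cdot> d \<cdot> w1) \<noteq> 0"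
   using far[OF corner_kernel(1)[OF e] _ corner_kernel(2)[OF e]] by blast
  define k where "k = \<phi> a1 (c \<cdot> d \<cdot> w1)"
  have cg: "c \<in> g" "d \<in> g" using cd(1,2) Jg by auto
  have "rk l (\<phi> a1) * c * d * rk w1 (\<phi> r) = k *\<^sub>C rk l (\<phi> r)"
   unfolding k_def using mult_rk[OF lr', of d w1] mult_rk[OF lr', of c "d \<cdot> w1"] rk_rk[OF la lr', of l "c \<cdot> d \<cdot> w1"]
   by (simp add: mult.assoc)
  moreover have "\<phi> w1 (d \<cdot> c \<cdot> a1) = \<phi> (c \<cdot> d \<cdot> w1) a1"
   using inv[OF cg(2) aw(2)] inv[OF cg(1) g_W[OF cg(2)]] by simp
  then have "\<phi> w1 (d \<cdot> c \<cdot> a1) = \<epsilon> * k" unfolding k_def using sym[OF g_W[OF cg(1)] aw(1)] by simp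
  then have "\<epsilon> *\<^sub>C rk r (\<phi> w1) * d * c * (\<epsilon> *\<^sub>C rk a1 (\<phi> l)) = k *\<^sub>C (\<epsilon> *\<^sub>C rk r (\<phi> l))"
   using mult_rk[OF ll, of c a1] mult_rk[OF ll, of d "c \<cdot> a1"] rk_rk[OF lw ll, of r "d \<cdot> c \<cdot> a1"] \<epsilon>
   by (simp add: mult.assoc mult.commute mult.left_commute)
  ultimately have "k *\<^sub>C Y l r \<in> J" unfolding Y_def cv.scale_right_diff_distrib using eJ[OF cd(1-4)] by simp
  from cv.subspace_scale[OF Jv this, of "inverse k"] show ?thesis using cd(5) unfolding k_def by simp
 qed
 have "\<not> cv.dependent {}" by (rule cv.independent_empty)
 obtain B where B: "B \<subseteq> W" "\<not> cv.dependent B" "W \<subseteq> cv.span B"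
  using cv.maximal_independent_subset_extend[of "{}" W] cv.independent_empty by auto
 have "infinite B" using W_infinite B(3) unfolding fd_def by blast
 \<comment> \<open>Four independent vectors that \<open>b\<close> will fix: its range must have
   dimension at least 4, because a vector orthogonal to \<open>l\<close> outside the span of
   \<open>l\<close> and \<open>x \<cdot> l\<close> is needed at the end.\<close>
 then obtain B4 where B4: "finite B4" "card B4 = 4" "B4 \<subseteq> B" by (metis infinite_arbitrarily_large)
 have "\<exists>Q. finite Q \<and> Q \<subseteq> g \<and> (\<forall>b. (\<forall>p\<in>Q. b * p = p \<and> p * b = p) --> b \<cdot> x = x)" if x: "x \<in> W" for x
 proof -
  obtain m n where m: "(m, n) \<in> prs g" "m \<cdot> v0 = x" using transitive[OF v(1,2) x] by blast
  obtain Q where Q: "finite Q" "Q \<subseteq> g" "\<And>e. (\<forall>p\<in>Q. e * p = p \<and> p * e = p) ==> e * m = m"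
   using unit_support[OF m(1)] by blast
  have "b \<cdot> x = x" if "\<forall>p\<in>Q. b * p = p \<and> p * b = p" for b
   using arg_cong[OF Q(3)[OF that], of "\<lambda>t. t \<cdot> v0"] m(2) by simp
  then show ?thesis using Q(1,2) by blast
 qed
 then obtain Q where Q: "\<And>x. x \<in> W ==> finite (Q x) \<and> Q x \<subseteq> g \<and> (\<forall>b. (\<forall>p\<in>Q x. b * p = p \<and> p * b = p) --> b \<cdot> x = x)" by metis
 define P' where "P' = P \<union> (\<Union>x\<in>B4. Q x)"
 have B4W: "B4 \<subseteq> W" using B4(3) B(1) by blast
 have P': "finite P'" "P' \<subseteq> g"
 proof -
  have "finite (\<Union>x\<in>B4. Q x)" using Q B4(1) B4W by blast
  then show "finite P'" unfolding P'_def using P(1) by simp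
  have "(\<Union>x\<in>B4. Q x) \<subseteq> g" using Q B4W by blast
  then show "P' \<subseteq> g" unfolding P'_def using P(2) lbs_subalg[OF g(1)] by blast
 qed
 have P'ops: "P' \<subseteq> ops W F" using P'(2) gF by blast
 obtain e where e: "e \<in> ops W F" "\<And>x. x \<in> P' ==> e * x = x \<and> x * e = x" using two_sided_unit[OF P'(1) P'ops] by blast
 have z0: "(0, 0) \<in> prs g" using prs.scC[OF vw, of 0] by simp
 have "\<exists>n. (e, n) \<in> prs g" using e(1)
 proof (induction rule: ops_induct)
  case (rk x f) then show ?case using pr unfolding F_def by blast
 next
  case zero show ?case using z0 by blast
 next
  case (add x y) then show ?case using prs.add by blast
 next
  case (scC c x) then show ?case using prs.scC by blast
 qed
 then obtain e' where e': "(e, e') \<in> prs g" by blast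
 have uniq: "n = n'" if "(m, n) \<in> prs g" "(m, n') \<in> prs g" for m n n'
  using z[OF prs_swap, of "n - n'"] prs_diff[OF that] by simp
 have e'x: "e' * x = x \<and> x * e' = x" if x: "x \<in> P'" for x
 proof -
  have b: "(x, - x) \<in> prs g" using prs.base P'(2) x by blast
  have "(x, - x * e') \<in> prs g" using prs_mult[OF e' b] e(2)[OF x] by simp
  from uniq[OF this b] have 1: "x * e' = x" by simp
  have "(x, e' * - x) \<in> prs g" using prs_mult[OF b e'] e(2)[OF x] by simp
  from uniq[OF this b] have "e' * x = x" by simp
  then show ?thesis using 1 by blast
 qed
 \<comment> \<open>The adjoint \<open>e'\<close> is also a unit for \<open>P'\<close>, so
   \<open>s\<close> is a self-adjoint unit. Its powers stay among the self-adjoint elements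
   commuting with \<open>s\<close>, so \<open>idempotent_unit\<close> yields a self-adjoint
   idempotent.\<close>
 define s where "s = e * e'"
 have ss: "(s, s) \<in> prs g" unfolding s_def by (rule prs_mult[OF e' prs_swap[OF e']])
 have sx: "s * x = x \<and> x * s = x" if x: "x \<in> P'" for x
  unfolding s_def using e(2)[OF x] e'x[OF x] by (metis mult.assoc)
 define A where "A = {m. (m, m) \<in> prs g \<and> m * s = s * m}"
 have "cv.subspace A" unfolding A_def
  by (rule cv.subspaceI) (auto simp: z0 distrib_left distrib_right intro: prs.add prs.scC)
 moreover have "s \<in> A" unfolding A_def using ss by simp
 moreover have "s * m \<in> A" if mA: "m \<in> A" for m
 proof -
  have m: "(m, m) \<in> prs g" "m * s = s * m" using mA unfolding A_def by auto
  have "(s * m, s * m) \<in> prs g" using prs_mult[OF ss m(1)] unfolding m(2) .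
  moreover have "s * m * s = s * (s * m)" unfolding mult.assoc m(2) ..
  ultimately show ?thesis unfolding A_def by blast
 qed
 moreover have "s \<in> fr" using prs_fr[OF ss] by blast
 ultimately obtain b where b: "b \<in> A" "b * b = b" "\<And>x. s * x = x ==> b * x = x" "\<And>x. x * s = x ==> x * b = x"
  using idempotent_unit[of s A] by blast
 have bp: "(b, b) \<in> prs g" using b(1) unfolding A_def by blast
 have bfr: "b \<in> fr" using prs_fr[OF bp] by blast
 have prs_ops: "m \<in> ops W F" if "(m, n) \<in> prs g" for m n
  using that
  by (induction rule: prs.induct)
   (use gF ops_mult in \<open>auto intro: cv.subspace_add[OF ops_subspace] cv.subspace_scale[OF ops_subspace]\<close>)
 have bops: "b \<in> ops W F" by (rule prs_ops[OF bp])
 have bW: "b \<cdot> y \<in> W" for y by (rule prs_W[OF bp])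
 have bb: "b \<cdot> b \<cdot> y = b \<cdot> y" for y using arg_cong[OF b(2), of "\<lambda>t. t \<cdot> y"] by simp
 have bP: "b * x = x \<and> x * b = x" if "x \<in> P'" for x using b(3,4) sx[OF that] by blast
 have b4: "b \<cdot> x = x" if x: "x \<in> B4" for x
 proof -
  have "\<forall>p\<in>Q x. b * p = p \<and> p * b = p" using bP x unfolding P'_def by blast
  then show ?thesis using Q[of x] x B4W by blast
 qed
 have \<phi>b: "\<phi> (b \<cdot> y) = (\<lambda>x. \<phi> y (b \<cdot> x))" if "y \<in> W" for y by (rule \<phi>_app[OF bp that])
 have repr: "\<exists>r. b \<cdot> r = r \<and> \<phi> r = (\<lambda>x. r0 (b \<cdot> x))" if r0: "clinear r0" for r0
 proof -
  obtain r1 where r1: "r1 \<in> W" "(\<lambda>x. r0 (b \<cdot> x)) = \<phi> r1" using ops_comp[OF bops r0] unfolding F_def by blast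
  have "\<phi> (b \<cdot> r1) = (\<lambda>x. r0 (b \<cdot> x))" unfolding \<phi>b[OF r1(1)] r1(2)[symmetric] bb ..
  then show ?thesis using bb by blast
 qed
 have bE: "y \<in> W" if "b \<cdot> y = y" for y using bW[of y] that by simp
 have Yb: "b * Y l r * b = Y l r" if "b \<cdot> l = l" "b \<cdot> r = r" for l r
 proof -
  have "b * rk p (\<phi> q) * b = rk p (\<phi> q)" if pq: "b \<cdot> p = p" "b \<cdot> q = q" for p q
   using \<phi>b[OF bE[OF pq(2)]] unfolding mult_rk[OF \<phi>(1)[OF bE[OF pq(2)]]] rk_mult[OF \<phi>(1)[OF bE[OF pq(2)]]] pq by simp
  then show ?thesis unfolding Y_def using that by (simp add: left_diff_distrib right_diff_distrib)
 qed
 have bx: "b \<cdot> x \<cdot> l = x \<cdot> l" if "b * x * b = x" for x l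
 proof -
  have "b * x = x" by (metis b(2) that mult.assoc)
  from arg_cong[OF this, of "\<lambda>t. t \<cdot> l"] show ?thesis by simp
 qed
 show ?thesis
 proof (rule trim[OF bfr b(2) P(2)])
  show "b * x = x \<and> x * b = x" if "x \<in> P" for x by (rule bP) (simp add: P'_def that)
  fix x l assume xb: "b * x * b = x" and l: "b \<cdot> l = l"
  have lW: "l \<in> W" by (rule bE[OF l])
  { assume xg: "x \<in> g" and N: "\<And>y. y \<in> J ==> b * y * b = y ==> tr (x * y) = 0"
   show "x \<cdot> l \<in> cv.span {l}"
   proof (rule ccontr)
    assume nl: "x \<cdot> l \<notin> cv.span {l}"
    obtain r0 where r0: "clinear r0" "r0 (x \<cdot> l) = (1 :: complex)" "\<And>z. z \<in> cv.span {l} ==> r0 z = 0"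
     by (rule separating_functional[OF cv.subspace_span nl]) (rule that)
    obtain r where r: "b \<cdot> r = r" "\<phi> r = (\<lambda>x. r0 (b \<cdot> x))" using repr[OF r0(1)] by blast
    have rW: "r \<in> W" by (rule bE[OF r(1)])
    have "\<phi> r l = 0" unfolding r(2) l by (rule r0(3)) (simp add: cv.span_base)
    then have "Y l r \<in> J" by (rule YJ[OF lW rW])
    from N[OF this Yb[OF l r(1)]] have "\<phi> r (x \<cdot> l) - \<epsilon> * \<phi> l (x \<cdot> r) = 0"
     unfolding Y_def by (simp add: right_diff_distrib mult_rk[OF \<phi>(1)[OF rW]] mult_rk[OF \<phi>(1)[OF lW]] tr_rk[OF \<phi>(1)[OF rW]] tr_rk[OF \<phi>(1)[OF lW]])
    moreover have "\<phi> l (x \<cdot> r) = - (\<epsilon> * \<phi> r (x \<cdot> l))"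
     using inv[OF xg lW, of r] sym[OF g_W[OF xg] rW, of l] by simp
    ultimately have "\<phi> r (x \<cdot> l) + \<epsilon> * \<epsilon> * \<phi> r (x \<cdot> l) = 0" by (simp add: mult.assoc)
    moreover have "\<phi> r (x \<cdot> l) = 1" unfolding r(2) bx[OF xb] by (rule r0(2))
    ultimately show False unfolding \<epsilon> by simp
   qed }
  { assume xJ: "x \<in> J" and C: "\<And>y. y \<in> J ==> b * y * b = y ==> lb x y = 0"
   have xg: "x \<in> g" by (rule Jg[OF xJ])
   have xlb: "b \<cdot> x \<cdot> l = x \<cdot> l" by (rule bx[OF xb])
   show "x \<cdot> l \<in> cv.span {l}"
   proof (rule ccontr)
    assume nl: "x \<cdot> l \<notin> cv.span {l}"
    have "l \<noteq> 0" using nl cv.span_zero by auto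
    then have "l \<notin> {0}" by simp
    then obtain t0 where t0: "clinear t0" "t0 l = (1 :: complex)"
     by (rule separating_functional[OF cv.subspace_single_0]) (rule that)
    obtain t where t: "b \<cdot> t = t" "\<phi> t = (\<lambda>x. t0 (b \<cdot> x))" using repr[OF t0(1)] by blast
    have tl: "\<phi> t l = 1" unfolding t(2) l by (rule t0(2))
    define L where "L = cv.span {l, x \<cdot> l}"
    \<comment> \<open>A multiple of \<open>t\<close> makes each vector of \<open>B4\<close>
      orthogonal to \<open>l\<close>. If all the results were in \<open>L\<close>, four independent
      vectors would lie in the span of three.\<close>
    have "\<exists>r. b \<cdot> r = r \<and> \<phi> r l = 0 \<and> r \<notin> L"
    proof (rule ccontr)
     assume no: "\<not> ?thesis"
     have "B4 \<subseteq> cv.span {l, x \<cdot> l, t}"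
     proof
      fix y assume y: "y \<in> B4"
      have yW: "y \<in> W" using y B4W by blast
      define k where "k = - \<phi> y l"
      define r where "r = y + k *\<^sub>C t"
      have "b \<cdot> r = r" unfolding r_def using b4[OF y] t(1) by simp
      moreover have "\<phi> r l = 0" unfolding r_def
       using \<phi>_add[OF yW cv.subspace_scale[OF Wv bE[OF t(1)]], of k] \<phi>_scC[OF bE[OF t(1)], of k] tl
       by (simp add: scC_fun_def k_def)
      ultimately have "r \<in> L" using no by blast
      then have "r \<in> cv.span {l, x \<cdot> l, t}" unfolding L_def by (rule subsetD[OF cv.span_mono, rotated]) blast
      moreover have "(- k) *\<^sub>C t \<in> cv.span {l, x \<cdot> l, t}" by (intro cv.span_scale cv.span_base) blast
      ultimately have "r + (- k) *\<^sub>C t \<in> cv.span {l, x \<cdot> l, t}" by (rule cv.span_add)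
      then show "y \<in> cv.span {l, x \<cdot> l, t}" unfolding r_def by simp
     qed
     moreover have "\<not> cv.dependent B4" using cv.independent_mono[OF B(2) B4(3)] .
     ultimately have "card B4 \<le> card {l, x \<cdot> l, t}" using cv.independent_span_bound[of "{l, x \<cdot> l, t}" B4] by blast
     also have "\<dots> \<le> 3" using card_length[of "[l, x \<cdot> l, t]"] by simp
     finally show False using B4(2) by simp
    qed
    then obtain r where r: "b \<cdot> r = r" "\<phi> r l = 0" "r \<notin> L" by blast
    have rW: "r \<in> W" by (rule bE[OF r(1)])
    \<comment> \<open>Evaluating \<open>lb x (Y l r) = 0\<close> at the vector \<open>q\<close>
      obtained from \<open>q0\<close>, dual to \<open>r\<close> and orthogonal to \<open>l\<close>
      and \<open>x \<cdot> l\<close>, leaves only a nonzero multiple of \<open>x \<cdot> l\<close>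
      and a multiple of \<open>l\<close>.\<close>
    obtain q0 where q0: "clinear q0" "q0 r = (1 :: complex)" "\<And>y. y \<in> L ==> q0 y = 0"
     by (rule separating_functional[OF _ r(3)]) (simp add: L_def, rule that)
    obtain q where q: "b \<cdot> q = q" "\<phi> q = (\<lambda>x. q0 (b \<cdot> x))" using repr[OF q0(1)] by blast
    have qW: "q \<in> W" by (rule bE[OF q(1)])
    have lL: "l \<in> L" "x \<cdot> l \<in> L" unfolding L_def by (auto intro: cv.span_base)
    have "\<phi> q l = 0" "\<phi> q (x \<cdot> l) = 0" "\<phi> q r = 1" unfolding q(2) l xlb r(1) using q0 lL by auto
    then have \<phi>q: "\<phi> l q = 0" "\<phi> l (x \<cdot> q) = 0" "\<phi> r q = \<epsilon>"
     using sym[OF lW qW] sym[OF g_W[OF xg] qW, of l] inv[OF xg lW, of q] sym[OF rW qW] by simp_all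
    have "lb x (Y l r) = 0" by (rule C[OF YJ[OF lW rW r(2)] Yb[OF l r(1)]])
    from arg_cong[OF this, of "\<lambda>t. t \<cdot> q"] have "\<epsilon> *\<^sub>C (x \<cdot> l) = \<phi> r (x \<cdot> q) *\<^sub>C l"
     unfolding lb_def Y_def by (simp add: rk_app[OF \<phi>(1)[OF rW]] rk_app[OF \<phi>(1)[OF lW]] \<phi>q)
    then have "\<epsilon> *\<^sub>C (\<epsilon> *\<^sub>C (x \<cdot> l)) = (\<epsilon> * \<phi> r (x \<cdot> q)) *\<^sub>C l" by simp
    then have "x \<cdot> l = (\<epsilon> * \<phi> r (x \<cdot> q)) *\<^sub>C l" using \<epsilon> by simp
    then have "x \<cdot> l \<in> cv.span {l}" unfolding cv.span_singleton by blast
    then show False using nl by simp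
   qed }
 qed
qed

theorem perfect_nondegenerate_subalgebra:
 assumes P: "finite P" "P \<subseteq> lbs g g"
 shows "\<exists>u. u \<subseteq> J \<and> subalg u \<and> fd u \<and> P \<subseteq> u \<and> trad u \<subseteq> {0} \<and> u \<subseteq> lbs u u"
proof (cases rule: pair_alternative)
 case (one v f)
 show ?thesis by (rule claim_one[OF one(1-4) _ one(6) P]) (rule one(5))
next
 case (two v f w h)
 show ?thesis by (rule claim_two[OF two(1-4) _ two(6-9) _ two(11) _ P]) (rule two(5), rule two(10), rule two(12))
qed

end

section \<open>Approximation by subalgebras that are finite-dimensional modulo the radical\<close>

lemma solvable_mono:
 assumes "solvable_lie scC lb B" "A \<subseteq> B" "subalg A" shows "solvable_lie scC lb A"
proof -
 obtain n where "dser B n = {0}" using assms(1) unfolding solvable_lie_def by blast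
 then have "dser A n \<subseteq> {0}" using dser_mono[OF assms(2), of n] by simp
 moreover have "0 \<in> dser A n" by (rule cv.subspace_0[OF subalg_D(1)[OF subalg_dser[OF assms(3)]]])
 ultimately show ?thesis unfolding solvable_lie_def by blast
qed

lemma solvable_lbs:
 assumes "subalg A" "lbs A A \<subseteq> B" "solvable_lie scC lb B" shows "solvable_lie scC lb A"
proof -
 obtain n where "dser B n = {0}" using assms(3) unfolding solvable_lie_def by blast
 then have "dser (lbs A A) n \<subseteq> {0}" using dser_mono[OF assms(2), of n] by simp
 then have "dser A (1 + n) \<subseteq> {0}" unfolding dser_add by simp
 moreover have "0 \<in> dser A (1 + n)" by (rule cv.subspace_0[OF subalg_D(1)[OF subalg_dser[OF assms(1)]]])
 ultimately show ?thesis unfolding solvable_lie_def by blast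
qed

lemma subalg_inter: "subalg A ==> subalg B ==> subalg (A \<inter> B)"
 unfolding lie_subalgebra_def by (simp add: cv.subspace_inter)

lemma hom_lbs:
 assumes T: "clinear T" "\<And>x y. x \<in> A ==> y \<in> A ==> T (lb x y) = lb (T x) (T y)"
 shows "T ` lbs A A = lbs (T ` A) (T ` A)"
proof
 show "lbs (T ` A) (T ` A) \<subseteq> T ` lbs A A"
 proof (rule lbs_subset[OF subspace_image[OF lbs_subspace T(1)]])
  fix a b assume "a \<in> T ` A" "b \<in> T ` A"
  then obtain x y where xy: "x \<in> A" "y \<in> A" "a = T x" "b = T y" by blast
  have "lb a b = T (lb x y)" unfolding xy(3,4) T(2)[OF xy(1,2)] ..
  then show "lb a b \<in> T ` lbs A A" using lbs_mem[OF xy(1,2)] by blast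
 qed
 have "T z \<in> lbs (T ` A) (T ` A)" if "z \<in> lbs A A" for z
  using that
 proof (induction rule: lbs_induct)
  case (lb x y) then show ?case using T(2) lbs_mem[of "T x" "T ` A" "T y" "T ` A"] by simp
 next
  case zero then show ?case unfolding clinear_0[OF T(1)] by (rule cv.subspace_0[OF lbs_subspace])
 next
  case (add x y) then show ?case unfolding clinear_add[OF T(1)] by (rule cv.subspace_add[OF lbs_subspace])
 next
  case (scC c x) then show ?case unfolding clinear_scC[OF T(1)] by (rule cv.subspace_scale[OF lbs_subspace])
 qed
 then show "T ` lbs A A \<subseteq> lbs (T ` A) (T ` A)" by blast
qed

lemma hom_dser:
 assumes A: "subalg A" and T: "clinear T" "\<And>x y. x \<in> A ==> y \<in> A ==> T (lb x y) = lb (T x) (T y)"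
 shows "T ` dser A n = dser (T ` A) n"
proof (induction n)
 case (Suc n)
 have s: "dser A n \<subseteq> A" by (rule dser_subset[OF A])
 have "T ` lbs (dser A n) (dser A n) = lbs (T ` dser A n) (T ` dser A n)"
  by (rule hom_lbs[OF T(1) T(2)]) (use s in blast)+
 then show ?case using Suc by simp
qed simp

lemma hom_solvable:
 assumes A: "subalg A" "solvable_lie scC lb A" and T: "clinear T" "\<And>x y. x \<in> A ==> y \<in> A ==> T (lb x y) = lb (T x) (T y)"
 shows "solvable_lie scC lb (T ` A)"
proof -
 obtain n where "dser A n = {0}" using A(2) unfolding solvable_lie_def by blast
 then have "dser (T ` A) n = {0}" using hom_dser[OF A(1) T, of n] clinear_0[OF T(1)] by simp
 then show ?thesis unfolding solvable_lie_def by blast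
qed

lemma hom_subalg:
 assumes A: "subalg A" and T: "clinear T" "\<And>x y. x \<in> A ==> y \<in> A ==> T (lb x y) = lb (T x) (T y)"
 shows "subalg (T ` A)"
 unfolding lie_subalgebra_def
proof (intro conjI ballI)
 show "cv.subspace (T ` A)" by (rule subspace_image[OF subalg_D(1)[OF A] T(1)])
 fix a b assume "a \<in> T ` A" "b \<in> T ` A"
 then obtain x y where xy: "x \<in> A" "y \<in> A" "a = T x" "b = T y" by blast
 show "lb a b \<in> T ` A" unfolding xy(3,4) T(2)[OF xy(1,2), symmetric] by (rule imageI[OF subalg_D(2)[OF A xy(1,2)]])
qed

text \<open>Compression to the range of \<open>p\<close>. If \<open>irrep p\<close> holds, it is the
  action on the subquotient and is multiplicative on \<open>alg1 g\<close>.\<close>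

definition Tc :: "'v::cvec endo => 'v endo => 'v endo" where "Tc p x = p * x * p"

lemma Tc_linear: "clinear (Tc p)" unfolding Tc_def by (rule clinear_corner)

locale fin_lie =
 fixes g :: "'v::cvec endo set"
 assumes g: "subalg g" "g \<subseteq> fr"
  and lf: "\<And>P. finite P ==> P \<subseteq> g ==> \<exists>h. subalg h \<and> fd h \<and> P \<subseteq> h \<and> h \<subseteq> g"
begin

definition D where "D = lbs g g"
definition N where "N = trad D"

lemma gv: "cv.subspace g" by (rule subalg_D(1)[OF g(1)])
lemma Dg: "D \<subseteq> g" unfolding D_def by (rule lbs_subalg[OF g(1)])
lemma D_subalg: "subalg D" unfolding D_def by (rule subalg_lbs[OF g(1)])
lemma Dv: "cv.subspace D" by (rule subalg_D(1)[OF D_subalg])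
lemma D_fr: "D \<subseteq> fr" using Dg g(2) by blast
lemma lb_D: "x \<in> g ==> y \<in> g ==> lb x y \<in> D" unfolding D_def by (rule lbs_mem)
lemma ND: "N \<subseteq> D" unfolding N_def trad_def by blast
lemma N_orth: "x \<in> N ==> y \<in> D ==> tr (x * y) = 0" unfolding N_def trad_def by blast
lemma N_orth': "x \<in> N ==> y \<in> D ==> tr (y * x) = 0" using N_orth tr_comm[of x y] ND D_fr by auto
lemma Nv: "cv.subspace N" unfolding N_def by (rule trad_subspace[OF D_subalg D_fr])

lemma D_ideal: "ideal_in D g" unfolding ideal_in_def using Dv Dg lb_D by blast

lemma N_ideal: "ideal_in N g"
 unfolding N_def trad_def by (rule perp_ideal[OF D_ideal g(2) ideal_inD(3)[OF D_ideal]])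

lemma int_ideal: assumes "ideal_in K g" "subalg h" "h \<subseteq> g" shows "ideal_in (K \<inter> h) h"
 unfolding ideal_in_def using cv.subspace_inter[OF ideal_inD(1)[OF assms(1)] subalg_D(1)[OF assms(2)]]
  ideal_inD(3)[OF assms(1)] subalg_D(2)[OF assms(2)] assms(3) by blast

text \<open>An element of \<open>D\<close> involves finitely many brackets. This puts it into
  \<open>[h, h]\<close>, the only part of \<open>h\<close> about which
  \<open>solvable_ideal_trace\<close> speaks.\<close>

lemma D_local: "y \<in> D ==> \<exists>P. finite P \<and> P \<subseteq> g \<and> (\<forall>h. subalg h --> P \<subseteq> h --> y \<in> lbs h h)"
 unfolding D_def
proof (induction rule: lbs_induct)
 case (lb a b) then show ?case by (intro exI[of _ "{a, b}"]) (auto intro: lbs_mem)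
next
 case zero show ?case by (intro exI[of _ "{}"]) (auto intro: cv.subspace_0[OF lbs_subspace])
next
 case (add x y)
 then obtain P Q where "finite P" "P \<subseteq> g" "\<forall>h. subalg h --> P \<subseteq> h --> x \<in> lbs h h"
  "finite Q" "Q \<subseteq> g" "\<forall>h. subalg h --> Q \<subseteq> h --> y \<in> lbs h h" by blast
 then show ?case by (intro exI[of _ "P \<union> Q"]) (auto intro: cv.subspace_add[OF lbs_subspace])
next
 case (scC c x) then show ?case by (elim exE conjE, intro exI conjI) (auto intro: cv.subspace_scale[OF lbs_subspace])
qed

text \<open>The orthogonality of solvable ideals to \<open>[h, h]\<close> passes to the limit: any
  \<open>x\<close> in \<open>K\<close> and \<open>y\<close> in \<open>D\<close> fit into some
  \<open>h\<close> with \<open>y\<close> in \<open>[h, h]\<close>.\<close>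

lemma solvable_ideal_N:
 assumes K: "ideal_in K g" "K \<subseteq> D" and sol: "\<And>h. subalg h ==> fd h ==> h \<subseteq> g ==> solvable_lie scC lb (K \<inter> h)"
 shows "K \<subseteq> N"
proof
 fix x assume x: "x \<in> K"
 have "tr (x * y) = 0" if y: "y \<in> D" for y
 proof -
  obtain P where P: "finite P" "P \<subseteq> g" "\<And>h. subalg h ==> P \<subseteq> h ==> y \<in> lbs h h" using D_local[OF y] by blast
  have "finite (insert x P)" "insert x P \<subseteq> g" using P x ideal_inD(2)[OF K(1)] by auto
  from lf[OF this] obtain h where h: "subalg h" "fd h" "insert x P \<subseteq> h" "h \<subseteq> g" by blast
  have hf: "h \<subseteq> fr" using h(4) g(2) by blast
  show ?thesis by (rule solvable_ideal_trace[OF h(1,2) hf int_ideal[OF K(1) h(1,4)] sol[OF h(1,2,4)] _ P(3)[OF h(1)]]) (use x h(3) in auto)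
 qed
 then show "x \<in> N" unfolding N_def trad_def using x K(2) by blast
qed

lemma isotropic_solvable:
 assumes K: "ideal_in K g" and iso: "\<And>a b. a \<in> K ==> b \<in> K ==> tr (a * b) = 0" and h: "subalg h" "fd h" "h \<subseteq> g"
 shows "solvable_lie scC lb (K \<inter> h)"
proof (rule Cartan_criterion[OF ideal_subalg[OF int_ideal[OF K h(1,3)]]])
 show "fd (K \<inter> h)" by (rule fd_subset[OF h(2)]) blast
 show "K \<inter> h \<subseteq> fr" using h(3) g(2) by blast
qed (use iso in blast)

lemma isotropic_N:
 assumes K: "ideal_in K g" "K \<subseteq> D" and iso: "\<And>a b. a \<in> K ==> b \<in> K ==> tr (a * b) = 0"
 shows "K \<subseteq> N"
 by (rule solvable_ideal_N[OF K isotropic_solvable[OF K(1) iso]])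

lemma N_solvable: "subalg h ==> fd h ==> h \<subseteq> g ==> solvable_lie scC lb (N \<inter> h)"
 by (rule isotropic_solvable[OF N_ideal]) (use N_orth ND in blast)+

lemma abelian_mod_N_solvable:
 assumes K: "ideal_in K g" "\<And>a b. a \<in> K ==> b \<in> K ==> lb a b \<in> N" and h: "subalg h" "fd h" "h \<subseteq> g"
 shows "solvable_lie scC lb (K \<inter> h)"
proof (rule solvable_lbs[OF ideal_subalg[OF int_ideal[OF K(1) h(1,3)]] _ N_solvable[OF h]])
 show "lbs (K \<inter> h) (K \<inter> h) \<subseteq> N \<inter> h"
  by (rule lbs_subset[OF cv.subspace_inter[OF Nv subalg_D(1)[OF h(1)]]]) (use K(2) subalg_D(2)[OF h(1)] in blast)
qed

lemma abelian_mod_N: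
 assumes K: "ideal_in K g" "K \<subseteq> D" "\<And>a b. a \<in> K ==> b \<in> K ==> lb a b \<in> N"
 shows "K \<subseteq> N"
 by (rule solvable_ideal_N[OF K(1,2) abelian_mod_N_solvable[OF K(1,3)]])

text \<open>An irreducible subquotient of the module is encoded by a projection \<open>p\<close> onto a complement.\<close>
definition irrep :: "'v endo => bool" where
 "irrep p \<longleftrightarrow> p * p = p \<and> (\<forall>x\<in>g. \<forall>a\<in>alg1 g. p * x * a * p = p * x * p * a * p) \<and>
  (\<forall>U. cv.subspace U --> U \<subseteq> range (app p) --> (\<forall>x\<in>g. \<forall>u\<in>U. p \<cdot> x \<cdot> u \<in> U) --> U \<subseteq> {0} \<or> range (app p) \<subseteq> U) \<and>
  \<not> Tc p ` g \<subseteq> {0}"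

text \<open>The condition in \<open>irrep\<close> inserts \<open>p\<close> after one factor from
  \<open>g\<close>; induction over \<open>a\<close> inserts it after any element of the
  algebra.\<close>

lemma irrep_mult:
 assumes p: "irrep p" and a: "a \<in> alg1 g" and b: "b \<in> alg1 g"
 shows "Tc p (a * b) = Tc p a * Tc p b"
proof -
 have pp: "p * p = p" and st: "\<And>x a. x \<in> g ==> a \<in> alg1 g ==> p * x * a * p = p * x * p * a * p"
  using p unfolding irrep_def by blast+
 have pp': "p * (p * t) = p * t" for t unfolding mult.assoc[symmetric] pp ..
 from a show ?thesis unfolding Tc_def
 proof (induction rule: alg1.induct)
  case one show ?case by (simp add: mult.assoc pp')
 next
  case (mult x a)
  have "p * (x * a * b) * p = p * x * (a * b) * p" by (simp only: mult.assoc)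
  also have "\<dots> = p * x * p * (a * b) * p" by (rule st[OF mult(1) alg1_mult[OF mult(2) b]])
  also have "\<dots> = p * x * (p * (a * b) * p)" by (simp only: mult.assoc)
  also have "\<dots> = p * x * (p * a * p * (p * b * p))" unfolding mult.IH ..
  also have "\<dots> = p * x * p * a * p * (p * b * p)" by (simp only: mult.assoc)
  also have "p * x * p * a * p = p * x * a * p" by (rule st[OF mult(1,2), symmetric])
  finally show ?case by (simp only: mult.assoc)
 qed (simp_all add: distrib_left distrib_right)
qed

lemma irrep_lb: "irrep p ==> x \<in> g ==> y \<in> g ==> Tc p (lb x y) = lb (Tc p x) (Tc p y)"
 unfolding lb_def clinear_diff[OF Tc_linear] by (simp only: irrep_mult alg1_base)

lemma irrep_irr: assumes p: "irrep p" shows "irr (Tc p ` g) p"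
proof (rule irr.intro)
 have pp: "p * p = p" and ir: "\<And>U. cv.subspace U ==> U \<subseteq> range (app p) ==> (\<forall>x\<in>g. \<forall>u\<in>U. p \<cdot> x \<cdot> u \<in> U) ==> U \<subseteq> {0} \<or> range (app p) \<subseteq> U"
  using p unfolding irrep_def by blast+
 show "p * p = p" by (rule pp)
 show "subalg (Tc p ` g)" by (rule hom_subalg[OF g(1) Tc_linear irrep_lb[OF p]])
 show "Tc p ` g \<subseteq> fr" unfolding Tc_def using g(2) fr_mult_left fr_mult_right by blast
 show "\<exists>h. subalg h \<and> fd h \<and> P \<subseteq> h \<and> h \<subseteq> Tc p ` g" if P: "finite P" "P \<subseteq> Tc p ` g" for P
 proof -
  obtain P0 where P0: "P0 \<subseteq> g" "finite P0" "P = Tc p ` P0" using finite_subset_image[OF P] by blast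
  obtain h where h: "subalg h" "fd h" "P0 \<subseteq> h" "h \<subseteq> g" using lf[OF P0(2,1)] by blast
  have "subalg (Tc p ` h)" by (rule hom_subalg[OF h(1) Tc_linear irrep_lb[OF p]]) (use h(4) in blast)+
  then show ?thesis using fd_image[OF Tc_linear h(2)] h(3,4) P0(3) by (intro exI[of _ "Tc p ` h"]) blast
 qed
 show "p * x = x" "x * p = x" if "x \<in> Tc p ` g" for x
  using that pp unfolding Tc_def by (auto simp: mult.assoc) (simp add: mult.assoc[symmetric])
 show "U \<subseteq> {0} \<or> range (app p) \<subseteq> U"
  if U: "cv.subspace U" "U \<subseteq> range (app p)" "\<And>x u. x \<in> Tc p ` g ==> u \<in> U ==> x \<cdot> u \<in> U" for U
 proof (rule ir[OF U(1,2)], intro ballI)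
  fix x u assume xu: "x \<in> g" "u \<in> U"
  have "p \<cdot> u = u" using subsetD[OF U(2) xu(2)] arg_cong[OF pp, of "\<lambda>t. t \<cdot> _"] by auto
  then show "p \<cdot> x \<cdot> u \<in> U" using U(3)[OF imageI[OF xu(1)] xu(2)] unfolding Tc_def by simp
 qed
 show "\<not> Tc p ` g \<subseteq> {0}" using p unfolding irrep_def by blast
qed

lemma lift_finite:
 assumes "cv.subspace A" "fd (T ` A)" "clinear T"
 obtains P where "finite P" "P \<subseteq> A" "T ` A \<subseteq> T ` cv.span P"
proof -
 obtain B where B: "finite B" "B \<subseteq> T ` A" "cv.span B = T ` A" using fd_basis[OF subspace_image[OF assms(1,3)] assms(2)] by metis
 obtain P where P: "P \<subseteq> A" "finite P" "B = T ` P" using finite_subset_image[OF B(1,2)] by blast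
 have "cv.span B \<subseteq> T ` cv.span P"
  by (rule cv.span_minimal[OF _ subspace_image[OF cv.subspace_span assms(3)]]) (use P(3) cv.span_superset in blast)
 then show ?thesis using that[OF P(2,1)] B(3) by simp
qed

text \<open>The image of \<open>N\<close> is a locally solvable ideal of an irreducible algebra,
  contained in its commutator algebra. Local solvability survives because a finite-dimensional piece
  of the image is already covered by finitely many elements of \<open>N\<close>.\<close>

lemma N_acts_trivially: assumes p: "irrep p" and x: "x \<in> N" shows "Tc p x = 0"
proof -
 interpret I: irr "Tc p ` g" p by (rule irrep_irr[OF p])
 have hom: "Tc p (lb x y) = lb (Tc p x) (Tc p y)" if "x \<in> g" "y \<in> g" for x y by (rule irrep_lb[OF p that])
 have "Tc p ` N \<subseteq> {0}"
 proof (rule I.locally_solvable_ideal_zero)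
  have "lb a b \<in> Tc p ` N" if ab: "a \<in> Tc p ` g" "b \<in> Tc p ` N" for a b
  proof -
   obtain x y where xy: "x \<in> g" "y \<in> N" "a = Tc p x" "b = Tc p y" using ab by blast
   show ?thesis unfolding xy(3,4) hom[OF xy(1) ideal_inD(2)[OF N_ideal xy(2)], symmetric]
    by (rule imageI[OF ideal_inD(3)[OF N_ideal xy(1,2)]])
  qed
  moreover have "Tc p ` N \<subseteq> Tc p ` g" using ideal_inD(2)[OF N_ideal] by blast
  ultimately show "ideal_in (Tc p ` N) (Tc p ` g)" unfolding ideal_in_def using subspace_image[OF Nv Tc_linear] by blast
  show "Tc p ` N \<subseteq> lbs (Tc p ` g) (Tc p ` g)"
  proof -
   have "Tc p ` lbs g g = lbs (Tc p ` g) (Tc p ` g)" by (rule hom_lbs[OF Tc_linear hom])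
   then show ?thesis using ND unfolding D_def by blast
  qed
  fix h assume h: "subalg h" "fd h" "h \<subseteq> Tc p ` g"
  define A where "A = {y \<in> N. Tc p y \<in> h}"
  have Av: "cv.subspace A" unfolding A_def
   by (rule cv.subspaceI) (simp_all add: subspace_rules[OF Nv] clinear_rules[OF Tc_linear] subspace_rules[OF subalg_D(1)[OF h(1)]])
  have TA: "Tc p ` A = Tc p ` N \<inter> h" unfolding A_def by blast
  have "fd (Tc p ` A)" unfolding TA by (rule fd_subset[OF h(2)]) blast
  then obtain P where P: "finite P" "P \<subseteq> A" "Tc p ` A \<subseteq> Tc p ` cv.span P" by (rule lift_finite[OF Av _ Tc_linear])
  have PN: "P \<subseteq> N" using P(2) unfolding A_def by blast
  have Pg: "P \<subseteq> g" using PN ideal_inD(2)[OF N_ideal] by blast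
  obtain k where k: "subalg k" "fd k" "P \<subseteq> k" "k \<subseteq> g" using lf[OF P(1) Pg] by blast
  have Nk: "subalg (N \<inter> k)" by (rule ideal_subalg[OF int_ideal[OF N_ideal k(1,4)]])
  have "cv.span P \<subseteq> N \<inter> k" by (rule cv.span_minimal[OF _ subalg_D(1)[OF Nk]]) (use PN k(3) in blast)
  then have "Tc p ` N \<inter> h \<subseteq> Tc p ` (N \<inter> k)" using P(3) unfolding TA by blast
  moreover have "solvable_lie scC lb (Tc p ` (N \<inter> k))"
   by (rule hom_solvable[OF Nk N_solvable[OF k(1,2,4)] Tc_linear hom]) (use k(4) in blast)+
  moreover have "subalg (Tc p ` N)" by (rule hom_subalg[OF ideal_subalg[OF N_ideal] Tc_linear hom]) (use ideal_inD(2)[OF N_ideal] in blast)+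
  then have "subalg (Tc p ` N \<inter> h)" by (rule subalg_inter[OF _ h(1)])
  ultimately show "solvable_lie scC lb (Tc p ` N \<inter> h)" using solvable_mono by blast
 qed
 then show ?thesis using x by blast
qed

section \<open>Irreducible subquotients that detect elements outside the radical of the form\<close>

definition stable :: "'v set => bool" where "stable U \<longleftrightarrow> cv.subspace U \<and> (\<forall>x\<in>g. \<forall>u\<in>U. x \<cdot> u \<in> U)"

lemma stable_alg1: "a \<in> alg1 g ==> stable U ==> u \<in> U ==> a \<cdot> u \<in> U"
proof (induction rule: alg1.induct)
 case (add a b) then show ?case using cv.subspace_add[of U] unfolding stable_def by simp
next
 case (scC a c) then show ?case using cv.subspace_scale[of U] unfolding stable_def by simp
qed (simp_all add: stable_def)

lemma maximal_avoiding:
 assumes v: "v \<noteq> 0"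
 obtains Q where "stable Q" "v \<notin> Q" "\<And>U. stable U ==> Q \<subseteq> U ==> v \<notin> U ==> U = Q"
proof -
 define C where "C = {Q. stable Q \<and> v \<notin> Q}"
 have "{0} \<in> C" unfolding C_def stable_def using v cv.subspace_single_0 by simp
 have "\<exists>Q\<in>C. \<forall>U\<in>C. Q \<subseteq> U --> U = Q"
 proof (rule subset_Zorn_nonempty)
  show "C \<noteq> {}" using \<open>{0} \<in> C\<close> by blast
  fix c assume c: "c \<noteq> {}" "subset.chain C c"
  have cC: "c \<subseteq> C" using c(2) unfolding subset.chain_def by blast
  have ch: "X \<subseteq> Y \<or> Y \<subseteq> X" if "X \<in> c" "Y \<in> c" for X Y using c(2) that unfolding subset_chain_def by blast
  have sv: "cv.subspace X" "\<And>x u. x \<in> g ==> u \<in> X ==> x \<cdot> u \<in> X" if "X \<in> c" for X using cC that unfolding C_def stable_def by blast+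
  have "cv.subspace (\<Union>c)"
  proof (rule cv.subspaceI)
   show "0 \<in> \<Union>c" using c(1) cv.subspace_0[OF sv(1)] by blast
   show "k *\<^sub>C x \<in> \<Union>c" if x: "x \<in> \<Union>c" for k x
   proof -
    obtain X where X: "X \<in> c" "x \<in> X" using x by blast
    show ?thesis by (rule UnionI[OF X(1) cv.subspace_scale[OF sv(1)[OF X(1)] X(2)]])
   qed
   show "x + y \<in> \<Union>c" if xy: "x \<in> \<Union>c" "y \<in> \<Union>c" for x y
   proof -
    obtain X Y where XY: "X \<in> c" "Y \<in> c" "x \<in> X" "y \<in> Y" using xy by blast
    obtain Z where "Z \<in> c" "x \<in> Z" "y \<in> Z" using ch[OF XY(1,2)] XY by blast
    then show ?thesis using cv.subspace_add[OF sv(1)] by blast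
   qed
  qed
  moreover have "\<forall>x\<in>g. \<forall>u\<in>\<Union>c. x \<cdot> u \<in> \<Union>c"
  proof (intro ballI)
   fix x u assume xu: "x \<in> g" "u \<in> \<Union>c"
   obtain X where X: "X \<in> c" "u \<in> X" using xu(2) by blast
   show "x \<cdot> u \<in> \<Union>c" by (rule UnionI[OF X(1) sv(2)[OF X(1) xu(1) X(2)]])
  qed
  moreover have "v \<notin> \<Union>c" using cC unfolding C_def by blast
  ultimately show "\<Union>c \<in> C" unfolding C_def stable_def by blast
 qed
 then obtain Q where Q: "Q \<in> C" "\<forall>U\<in>C. Q \<subseteq> U --> U = Q" by blast
 show ?thesis by (rule that[of Q]) (use Q in \<open>auto simp: C_def\<close>)
qed

text \<open>Since \<open>tr (z * y) \<noteq> 0\<close>, the operator \<open>z * y\<close> has an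
  eigenvector \<open>v\<close> for a nonzero \<open>l\<close>. If \<open>Q\<close> is maximal among
  the submodules avoiding \<open>v\<close> and \<open>P\<close> is generated by \<open>Q\<close> and
  \<open>v\<close>, then \<open>P / Q\<close> is irreducible, and \<open>z * y\<close> multiplies
  the nonzero class of \<open>v\<close> by \<open>l\<close>.\<close>

lemma irrep_separates:
 assumes z: "z \<in> D" "z \<notin> N" shows "\<exists>p. irrep p \<and> Tc p z \<noteq> 0"
proof -
 obtain y where y: "y \<in> D" "tr (z * y) \<noteq> 0" using z unfolding N_def trad_def by blast
 have zg: "z \<in> g" "y \<in> g" using z(1) y(1) Dg by auto
 have "z * y \<in> fr" using z(1) D_fr by (intro fr_mult_right) blast
 then obtain l v where v: "l \<noteq> 0" "v \<noteq> 0" "(z * y) \<cdot> v = l *\<^sub>C v" using y(2) by (rule nonzero_eigenvalue)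
 obtain Q where Q: "stable Q" "v \<notin> Q" "\<And>U. stable U ==> Q \<subseteq> U ==> v \<notin> U ==> U = Q"
  by (rule maximal_avoiding[OF v(2)]) (rule that)
 have Qv: "cv.subspace Q" and Qs: "\<And>x u. x \<in> g ==> u \<in> Q ==> x \<cdot> u \<in> Q" using Q(1) unfolding stable_def by blast+
 define P where "P = \<Inter>{U. stable U \<and> Q \<subseteq> U \<and> v \<in> U}"
 have Ps: "stable P" unfolding stable_def
 proof (intro conjI ballI)
  show "cv.subspace P" unfolding P_def by (rule cv.subspace_Inter) (simp add: stable_def)
  show "x \<cdot> u \<in> P" if xu: "x \<in> g" "u \<in> P" for x u
   unfolding P_def
  proof (rule InterI)
   fix U assume U: "U \<in> {U. stable U \<and> Q \<subseteq> U \<and> v \<in> U}"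
   then have "u \<in> U" using xu(2) unfolding P_def by blast
   then show "x \<cdot> u \<in> U" using U xu(1) unfolding stable_def by blast
  qed
 qed
 have Pv: "cv.subspace P" using Ps unfolding stable_def by blast
 have QP: "Q \<subseteq> P" "v \<in> P" unfolding P_def by auto
 have Pmin: "P \<subseteq> U" if "stable U" "Q \<subseteq> U" "v \<in> U" for U unfolding P_def using that by blast
 obtain q :: "'v endo" where q: "\<And>x. q \<cdot> x \<in> Q" "\<And>x. x \<in> Q ==> q \<cdot> x = x" by (rule proj_onto[OF Qv]) (rule that)
 \<comment> \<open>A complement of \<open>Q\<close> in \<open>P\<close>; the projection
   \<open>p\<close> onto it that kills \<open>Q\<close> represents the quotient
   \<open>P / Q\<close>.\<close>
 define W where "W = {u \<in> P. q \<cdot> u = 0}"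
 have Wv: "cv.subspace W" unfolding W_def
  by (rule cv.subspaceI) (simp_all add: subspace_rules[OF Pv])
 have WQ: "u = 0" if "u \<in> W" "u \<in> Q" for u using q(2)[OF that(2)] that(1) unfolding W_def by simp
 then have "W \<inter> Q \<subseteq> {0}" by blast
 from projection_exists[OF Wv Qv this] obtain p :: "'v endo"
  where p: "\<And>x. p \<cdot> x \<in> W" "\<And>x. x \<in> W ==> p \<cdot> x = x" "\<And>x. x \<in> Q ==> p \<cdot> x = 0" by blast
 have WP: "W \<subseteq> P" unfolding W_def by blast
 have dec: "u - p \<cdot> u \<in> Q" if u: "u \<in> P" for u
 proof -
  have "u - q \<cdot> u \<in> P" by (rule cv.subspace_diff[OF Pv u subsetD[OF QP(1) q(1)]])
  then have "u - q \<cdot> u \<in> W" unfolding W_def using q(2)[OF q(1)] by simp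
  then have "p \<cdot> u = u - q \<cdot> u" using p(2)[of "u - q \<cdot> u"] p(3)[OF q(1), of u] by simp
  then show ?thesis using q(1)[of u] by simp
 qed
 have px: "p \<cdot> x \<cdot> u = p \<cdot> x \<cdot> p \<cdot> u" if "x \<in> g" "u \<in> P" for x u
  using p(3)[OF Qs[OF that(1) dec[OF that(2)]]] by simp
 have pp: "p * p = p" by (rule endo_eqI) (simp add: p(1,2))
 have "\<not> Tc p ` g \<subseteq> {0}" and Tz: "Tc p z \<noteq> 0"
 proof -
  show Tz: "Tc p z \<noteq> 0"
  proof
   assume 0: "Tc p z = 0"
   have yv: "y \<cdot> v \<in> P" using Ps zg(2) QP(2) unfolding stable_def by blast
   have "l *\<^sub>C (p \<cdot> v) = p \<cdot> z \<cdot> y \<cdot> v" using v(3) by (metis app_simps(6) app_lin(5))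
   also have "\<dots> = Tc p z \<cdot> y \<cdot> v" unfolding px[OF zg(1) yv] Tc_def by simp
   finally have "p \<cdot> v = 0" using v(1) unfolding 0 by simp
   then show False using dec[OF QP(2)] Q(2) by simp
  qed
  then show "\<not> Tc p ` g \<subseteq> {0}" using zg(1) by blast
 qed
 moreover have "p * x * a * p = p * x * p * a * p" if xa: "x \<in> g" "a \<in> alg1 g" for x a
 proof (rule endo_eqI)
  fix u
  have "a \<cdot> p \<cdot> u \<in> P" by (rule stable_alg1[OF xa(2) Ps subsetD[OF WP p(1)]])
  from px[OF xa(1) this] show "(p * x * a * p) \<cdot> u = (p * x * p * a * p) \<cdot> u" by simp
 qed
 moreover have "U \<subseteq> {0} \<or> range (app p) \<subseteq> U"
  if U: "cv.subspace U" "U \<subseteq> range (app p)" "\<forall>x\<in>g. \<forall>u\<in>U. p \<cdot> x \<cdot> u \<in> U" for U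
 proof -
  have UW: "U \<subseteq> W" using U(2) p(1) by blast
  define E where "E = {e. \<exists>u\<in>U. e - u \<in> Q}"
  have "stable E" unfolding stable_def
  proof (intro conjI ballI)
   show "cv.subspace E" unfolding E_def by (rule subspace_sum_set[OF U(1) Qv])
   fix x e assume x: "x \<in> g" and "e \<in> E"
   then obtain u where u: "u \<in> U" "e - u \<in> Q" unfolding E_def by blast
   have xu: "x \<cdot> u \<in> P" using Ps x u(1) UW WP unfolding stable_def by blast
   have "x \<cdot> e - p \<cdot> x \<cdot> u = x \<cdot> (e - u) + (x \<cdot> u - p \<cdot> x \<cdot> u)" by simp
   also have "\<dots> \<in> Q" by (rule cv.subspace_add[OF Qv Qs[OF x u(2)] dec[OF xu]])
   finally show "x \<cdot> e \<in> E" unfolding E_def using U(3) x u(1) by blast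
  qed
  moreover have "Q \<subseteq> E" unfolding E_def using cv.subspace_0[OF U(1)] by (auto intro!: bexI[of _ 0])
  moreover have UE: "U \<subseteq> E"
  proof
   fix u assume u: "u \<in> U"
   have "u - u \<in> Q" using cv.subspace_0[OF Qv] by simp
   then show "u \<in> E" unfolding E_def using u by blast
  qed
  ultimately have alt: "P \<subseteq> E \<or> E = Q" using Pmin Q(3) by blast
  show ?thesis
  proof (cases "E = Q")
   case True
   then show ?thesis using UE UW WQ by blast
  next
   case False
   have "w \<in> U" if w: "w \<in> W" for w
   proof -
    obtain u where u: "u \<in> U" "w - u \<in> Q" using alt False w WP unfolding E_def by blast
    have "w - u = 0" by (rule WQ[OF cv.subspace_diff[OF Wv w subsetD[OF UW u(1)]] u(2)])
    then show ?thesis using u(1) by simp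
   qed
   then show ?thesis using p(1) by blast
  qed
 qed
 ultimately have "irrep p" unfolding irrep_def using pp by blast
 then show ?thesis using Tz by blast
qed

end

context fin_lie
begin

text \<open>The subalgebras \<open>h\<close> of the overview; the last two conjuncts yield
  \<open>trad h = N\<close> and \<open>tperfect h\<close>, see \<open>good_trad\<close>.\<close>

definition good :: "'v endo set => bool" where
 "good h \<longleftrightarrow> subalg h \<and> N \<subseteq> h \<and> h \<subseteq> D \<and> fcod N h \<and>
  (\<forall>x\<in>h. (\<forall>y\<in>h. tr (x * y) = 0) --> x \<in> N) \<and> (\<forall>x\<in>h. \<exists>a\<in>lbs h h. x - a \<in> N)"

lemma ker_ideal:
 assumes I: "ideal_in I g" and S: "\<And>p. p \<in> S ==> irrep p"
 shows "ideal_in {x \<in> I. \<forall>p\<in>S. Tc p x = 0} g"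
proof -
 have "cv.subspace {x \<in> I. \<forall>p\<in>S. Tc p x = 0}"
  by (rule cv.subspaceI) (simp_all add: subspace_rules[OF ideal_inD(1)[OF I]]
    clinear_rules[OF Tc_linear])
 moreover have "lb x y \<in> {x \<in> I. \<forall>p\<in>S. Tc p x = 0}" if x: "x \<in> g" and y: "y \<in> {x \<in> I. \<forall>p\<in>S. Tc p x = 0}" for x y
 proof -
  have yI: "y \<in> I" "\<And>p. p \<in> S ==> Tc p y = 0" using y by auto
  have "Tc p (lb x y) = 0" if "p \<in> S" for p
   unfolding irrep_lb[OF S[OF that] x ideal_inD(2)[OF I yI(1)]] yI(2)[OF that] by simp
  then show ?thesis using ideal_inD(3)[OF I x yI(1)] by blast
 qed
 ultimately show ?thesis unfolding ideal_in_def using ideal_inD(2)[OF I] by blast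
qed

lemma prs_lift:
 assumes p: "irrep p" and m: "(m, n) \<in> prs (Tc p ` g)" shows "\<exists>a\<in>alg1 g. m = Tc p a"
 using m
proof (induction rule: prs.induct)
 case (base x) then show ?case using alg1_base by blast
next
 case (step x m n)
 then obtain x0 a where x: "x0 \<in> g" "x = Tc p x0" "a \<in> alg1 g" "m = Tc p a" by blast
 have "x * m = Tc p (x0 * a)" unfolding x(2,4) irrep_mult[OF p alg1_base[OF x(1)] x(3)] ..
 then show ?case using alg1.mult[OF x(1,3)] by blast
next
 case (add m n m' n') then show ?case using alg1.add clinear_add[OF Tc_linear] by metis
next
 case (scC m n c) then show ?case using alg1.scC clinear_scC[OF Tc_linear] by metis
qed

text \<open>By transitivity \<open>b\<close> carries a nonzero vector in the image of
  \<open>f\<close> to one that \<open>z\<close> does not kill, and \<open>a\<close> carries the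
  result to a vector that \<open>f\<close> does not kill.\<close>

lemma irrep_corner_nonzero:
 assumes p: "irrep p" and f: "f \<in> g" "Tc p f \<noteq> 0" and z: "z \<in> g" "Tc p z \<noteq> 0"
 shows "\<exists>a\<in>alg1 g. \<exists>b\<in>alg1 g. Tc p (f * a * z * b * f) \<noteq> 0"
proof -
 interpret I: irr "Tc p ` g" p by (rule irrep_irr[OF p])
 have fz: "Tc p f \<in> Tc p ` g" "Tc p z \<in> Tc p ` g" using f z by auto
 obtain v where v: "v \<in> I.W" "Tc p f \<cdot> v \<noteq> 0" using I.g_eq_0[OF fz(1)] f(2) by blast
 obtain t where t: "t \<in> I.W" "Tc p z \<cdot> t \<noteq> 0" using I.g_eq_0[OF fz(2)] z(2) by blast
 obtain m2 n2 where m2: "(m2, n2) \<in> prs (Tc p ` g)" "m2 \<cdot> Tc p f \<cdot> v = t" using I.transitive[OF I.g_W[OF fz(1)] v(2) t(1)] by blast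
 obtain m1 n1 where m1: "(m1, n1) \<in> prs (Tc p ` g)" "m1 \<cdot> Tc p z \<cdot> t = v" using I.transitive[OF I.g_W[OF fz(2)] t(2) v(1)] by blast
 obtain a where a: "a \<in> alg1 g" "m1 = Tc p a" using prs_lift[OF p m1(1)] by blast
 obtain b where b: "b \<in> alg1 g" "m2 = Tc p b" using prs_lift[OF p m2(1)] by blast
 note A = alg1_base[OF f(1)] alg1_base[OF z(1)]
 have "Tc p (f * a * z * b * f) = Tc p f * m1 * Tc p z * m2 * Tc p f"
  unfolding a(2) b(2) by (simp only: irrep_mult[OF p] A a(1) b(1) alg1_mult)
 then have "Tc p (f * a * z * b * f) \<cdot> v \<noteq> 0" using m1(2) m2(2) v(2) by simp
 then have "Tc p (f * a * z * b * f) \<noteq> 0" by auto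
 then show ?thesis using a(1) b(1) by blast
qed

text \<open>Finitely many irreducible subquotients detect the ideal generated by \<open>F\<close>: each further one that
 is needed lowers the dimension of the finite-dimensional space \<open>M S\<close>.\<close>
lemma finite_irreps:
 assumes F: "finite F" "F \<subseteq> D"
 shows "\<exists>I S. ideal_in I g \<and> N \<subseteq> I \<and> F \<subseteq> I \<and> I \<subseteq> D \<and> finite S \<and> (\<forall>p\<in>S. irrep p) \<and> {x \<in> I. \<forall>p\<in>S. Tc p x = 0} \<subseteq> N"
proof -
 define I where "I = \<Inter>{K. ideal_in K g \<and> N \<union> F \<subseteq> K}"
 have ID: "I \<subseteq> D" unfolding I_def using D_ideal ND F(2) by blast
 have "cv.subspace I" unfolding I_def by (rule cv.subspace_Inter) (simp add: ideal_in_def)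
 moreover have "lb x y \<in> I" if xy: "x \<in> g" "y \<in> I" for x y
  unfolding I_def
 proof (rule InterI)
  fix K assume K: "K \<in> {K. ideal_in K g \<and> N \<union> F \<subseteq> K}"
  then have "y \<in> K" using xy(2) unfolding I_def by blast
  then show "lb x y \<in> K" using K ideal_inD(3)[of K g x y] xy(1) by blast
 qed
 ultimately have Ii: "ideal_in I g" unfolding ideal_in_def using ID Dg by blast
 have NFI: "N \<subseteq> I" "F \<subseteq> I" unfolding I_def by blast+
 define Z where "Z S = {x \<in> I. \<forall>p\<in>S. Tc p x = 0}" for S
 \<comment> \<open>Elements of \<open>Z S\<close> are tested only through corners between elements
   of the finite set \<open>F\<close>; this keeps \<open>M S\<close> finite-dimensional although
   \<open>Z S\<close> need not be.\<close>
 define G where "G S = {f * a * z * b * f' | f a z b f'. f \<in> F \<and> f' \<in> F \<and> z \<in> Z S \<and> a \<in> alg1 g \<and> b \<in> alg1 g}" for S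
 define M where "M S = cv.span (G S)" for S
 have Ffr: "f \<in> fr" if "f \<in> F" for f using that F(2) D_fr by blast
 have Mfd: "fd (M S)" for S
 proof -
  have "fd (\<Union>q\<in>F \<times> F. {fst q * y * snd q | y. True})"
  proof (rule fd_UN)
   show "finite (F \<times> F)" using F(1) by simp
   show "fd {fst q * y * snd q | y. True}" if "q \<in> F \<times> F" for q by (rule fd_corner) (use that Ffr in auto)
  qed
  moreover have "G S \<subseteq> (\<Union>q\<in>F \<times> F. {fst q * y * snd q | y. True})"
  proof
   fix m assume "m \<in> G S"
   then obtain f a z b f' where m: "f \<in> F" "f' \<in> F" "m = f * a * z * b * f'" unfolding G_def by blast
   have "m = f * (a * z * b) * f'" unfolding m(3) by (simp only: mult.assoc)
   then show "m \<in> (\<Union>q\<in>F \<times> F. {fst q * y * snd q | y. True})" using m(1,2) by (intro UN_I[of "(f, f')"]) auto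
  qed
  ultimately have "fd (G S)" by (rule fd_subset)
  then show ?thesis unfolding M_def by simp
 qed
 have "finite ({} :: 'v endo set) \<and> (\<forall>p\<in>{}. irrep p)" by simp
 from ex_has_least_nat[of "\<lambda>S. finite S \<and> (\<forall>p\<in>S. irrep p)", OF this, of "\<lambda>S. cv.dim (M S)"]
 obtain S where S: "finite S" "\<forall>p\<in>S. irrep p" and min: "\<forall>S'. finite S' \<and> (\<forall>p\<in>S'. irrep p) --> cv.dim (M S) \<le> cv.dim (M S')"
  by blast
 have "Z S \<subseteq> N"
 proof (rule ccontr)
  assume "\<not> Z S \<subseteq> N"
  then obtain z where z: "z \<in> Z S" "z \<notin> N" by blast
  have zI: "z \<in> I" using z(1) unfolding Z_def by blast
  have zg: "z \<in> g" by (rule ideal_inD(2)[OF Ii zI])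
  obtain p where p: "irrep p" "Tc p z \<noteq> 0" using irrep_separates[OF _ z(2)] zI ID by blast
  have le: "cv.dim (M S) \<le> cv.dim (M (insert p S))" using min S p(1) by simp
  have "Z (insert p S) \<subseteq> Z S" unfolding Z_def by blast
  then have "G (insert p S) \<subseteq> G S" unfolding G_def by blast
  then have sub: "M (insert p S) \<subseteq> M S" unfolding M_def by (rule cv.span_mono)
  \<comment> \<open>\<open>S\<close> was chosen with \<open>M S\<close> of least dimension, so
    adding \<open>p\<close> changes nothing; hence all of \<open>M S\<close> vanishes under
    \<open>p\<close>, against \<open>irrep_corner_nonzero\<close>.\<close>
  have eq: "M (insert p S) = M S"
   by (rule fd_dim_eq[OF Mfd sub _ _ le]) (simp_all add: M_def cv.subspace_span)
  have "\<exists>f\<in>F. Tc p f \<noteq> 0"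
  proof (rule ccontr)
   assume no: "\<not> ?thesis"
   have "ideal_in {x \<in> D. \<forall>q\<in>{p}. Tc q x = 0} g" by (rule ker_ideal[OF D_ideal]) (use p(1) in simp)
   moreover have "N \<union> F \<subseteq> {x \<in> D. \<forall>q\<in>{p}. Tc q x = 0}" using no N_acts_trivially[OF p(1)] ND F(2) by blast
   ultimately have "I \<subseteq> {x \<in> D. \<forall>q\<in>{p}. Tc q x = 0}" unfolding I_def by blast
   then show False using zI p(2) by blast
  qed
  then obtain f where f: "f \<in> F" "Tc p f \<noteq> 0" by blast
  have fg: "f \<in> g" using f(1) F(2) Dg by blast
  obtain a b where ab: "a \<in> alg1 g" "b \<in> alg1 g" "Tc p (f * a * z * b * f) \<noteq> 0"
   using irrep_corner_nonzero[OF p(1) fg f(2) zg p(2)] by blast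
  have "f * a * z * b * f \<in> M S" unfolding M_def by (rule cv.span_base) (use ab f(1) z(1) in \<open>unfold G_def, blast\<close>)
  then have "f * a * z * b * f \<in> cv.span (G (insert p S))" using eq unfolding M_def by blast
  then have "Tc p (f * a * z * b * f) = 0"
  proof (rule cv.span_induct)
   show "cv.subspace {x. Tc p x = 0}"
    by (rule cv.subspaceI) (simp_all add: clinear_rules[OF Tc_linear])
   fix m assume "m \<in> G (insert p S)"
   then obtain f a z b f' where m: "f \<in> F" "f' \<in> F" "z \<in> Z (insert p S)" "a \<in> alg1 g" "b \<in> alg1 g" "m = f * a * z * b * f'"
    unfolding G_def by blast
   have z0: "Tc p z = 0" "z \<in> I" using m(3) unfolding Z_def by auto
   have A: "f \<in> alg1 g" "f' \<in> alg1 g" "z \<in> alg1 g" using m(1,2) F(2) Dg ideal_inD(2)[OF Ii z0(2)] alg1_base by blast+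
   show "Tc p m = 0" unfolding m(6) by (simp only: irrep_mult[OF p(1)] A m(4,5) alg1_mult z0(1) mult_zero_left mult_zero_right)
  qed
  then show False using ab(3) by simp
 qed
 then show ?thesis unfolding Z_def using Ii NFI ID S by blast
qed

lemma ideal_radical:
 assumes J: "ideal_in J g" "J \<subseteq> D" and x: "x \<in> J" "\<And>y. y \<in> J ==> tr (x * y) = 0" shows "x \<in> N"
proof -
 have "{x \<in> J. \<forall>y\<in>J. tr (x * y) = 0} \<subseteq> N"
  by (rule isotropic_N[OF perp_ideal[OF J(1) g(2) ideal_inD(3)[OF J(1)]]]) (use J(2) in auto)
 then show ?thesis using x by blast
qed

text \<open>An orthonormal family is taken in a finite-dimensional supplement of \<open>N\<close> in
  \<open>J\<close>. The part of that supplement which the family misses is orthogonal to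
  \<open>J\<close>, so it lies in \<open>N\<close> and is orthogonal to all of \<open>D\<close>;
  hence the projection works for elements of \<open>D\<close> too.\<close>

lemma orthogonal_projection:
 assumes J: "ideal_in J g" "J \<subseteq> D" "fcod N J"
 shows "\<exists>O'. finite O' \<and> O' \<subseteq> J \<and> (\<forall>x\<in>D. \<forall>y\<in>J. tr ((x - (\<Sum>c\<in>O'. tr (x * c) *\<^sub>C c)) * y) = 0)"
proof -
 note Jv = ideal_inD(1)[OF J(1)]
 obtain B where B: "finite B" "B \<subseteq> J" "\<And>x. x \<in> J ==> \<exists>b\<in>cv.span B. x - b \<in> N" using J(3) unfolding fcod_def by blast
 have kJ: "cv.span B \<subseteq> J" by (rule cv.span_minimal[OF B(2) Jv])
 have sy: "tr (x * y) = tr (y * x)" if "x \<in> cv.span B" for x y using tr_comm[of x y] that kJ J(2) D_fr by blast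
 have "\<exists>O'. finite O' \<and> O' \<subseteq> cv.span B \<and> (\<forall>a\<in>O'. \<forall>b\<in>O'. tr (a * b) = (if a = b then 1 else 0)) \<and>
  (\<forall>x\<in>cv.span B. \<forall>y\<in>cv.span B. tr ((x - (\<Sum>b\<in>O'. tr (x * b) *\<^sub>C b)) * y) = 0)"
  by (rule orthonormal_basis[OF cv.subspace_span fd_span[OF B(1)], of "\<lambda>x y. tr (x * y)", OF tr_form_linear]) (rule sy)
 then obtain O' where O': "finite O'" "O' \<subseteq> cv.span B" "\<forall>a\<in>O'. \<forall>b\<in>O'. tr (a * b) = (if a = b then 1 else 0)"
  "\<forall>x\<in>cv.span B. \<forall>y\<in>cv.span B. tr ((x - (\<Sum>b\<in>O'. tr (x * b) *\<^sub>C b)) * y) = 0"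
  by (elim exE conjE) (rule that)
 note O = O'(1,2) O'(3)[THEN bspec, THEN bspec] O'(4)[THEN bspec, THEN bspec]
 define s where "s x = (\<Sum>c\<in>O'. tr (x * c) *\<^sub>C c)" for x
 have sk: "s x \<in> cv.span B" for x unfolding s_def by (intro cv.span_sum cv.span_scale) (use O(2) in blast)
 have so: "tr ((x - s x) * c) = 0" if c: "c \<in> O'" for x c unfolding s_def by (rule orthonormal_residue[OF O'(1,3) c])
 have "tr ((x - s x) * y) = 0" if x: "x \<in> D" and y: "y \<in> J" for x y
 proof -
  have d: "x - s x \<in> D" by (rule cv.subspace_diff[OF Dv x]) (use sk kJ J(2) in blast)
  obtain b where b: "b \<in> cv.span B" "y - b \<in> N" using B(3)[OF y] by blast
  define r where "r = b - s b"
  have rk: "r \<in> cv.span B" unfolding r_def by (rule cv.span_diff[OF b(1) sk])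
  have "r \<in> N"
  proof (rule ideal_radical[OF J(1,2)])
   show "r \<in> J" using rk kJ by blast
   show "tr (r * z) = 0" if z: "z \<in> J" for z
   proof -
    obtain c where c: "c \<in> cv.span B" "z - c \<in> N" using B(3)[OF z] by blast
    have "tr (r * (z - c)) = 0" by (rule N_orth'[OF c(2)]) (use rk kJ J(2) in blast)
    moreover have "tr (r * c) = 0" unfolding r_def s_def by (rule O(4)[OF b(1) c(1)])
    ultimately show ?thesis by (simp add: right_diff_distrib)
   qed
  qed
  then have 1: "tr ((x - s x) * r) = 0" by (rule N_orth'[OF _ d])
  have 2: "tr ((x - s x) * (y - b)) = 0" by (rule N_orth'[OF b(2) d])
  have 3: "tr ((x - s x) * s b) = 0" unfolding s_def[of b] sum_distrib_left tr_sum scC_mult_right tr_simps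
   by (rule sum.neutral) (simp add: so)
  have "(x - s x) * y = (x - s x) * (y - b) + (x - s x) * r + (x - s x) * s b"
   unfolding r_def by (simp add: right_diff_distrib)
  then show ?thesis using 1 2 3 by simp
 qed
 moreover have "O' \<subseteq> J" using O(2) kJ by blast
 ultimately show ?thesis using O(1) unfolding s_def by blast
qed

text \<open>Perfectness follows by duality: a functional that vanishes on brackets and on
  \<open>N\<close> is represented by some \<open>y\<close> in \<open>J\<close>, which is central
  modulo \<open>N\<close>. The ideal of such elements is abelian modulo \<open>N\<close>, hence
  contained in \<open>N\<close>.\<close>

lemma good_ideal:
 assumes J: "ideal_in J g" "N \<subseteq> J" "J \<subseteq> D" "fcod N J" shows "good J"
proof -
 note Jv = ideal_inD(1)[OF J(1)]
 have sub: "subalg J" by (rule ideal_subalg[OF J(1)])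
 obtain O' where O: "finite O'" "O' \<subseteq> J" "\<And>x y. x \<in> D ==> y \<in> J ==> tr ((x - (\<Sum>c\<in>O'. tr (x * c) *\<^sub>C c)) * y) = 0"
  using orthogonal_projection[OF J(1,3,4)] by blast
 have OJ: "(\<Sum>c\<in>O'. k c *\<^sub>C c) \<in> J" for k
  by (intro cv.subspace_sum[OF Jv] cv.subspace_scale[OF Jv]) (use O(2) in blast)
 define L where "L = {x. \<exists>a\<in>lbs J J. x - a \<in> N}"
 have Lv: "cv.subspace L" unfolding L_def by (rule subspace_sum_set[OF lbs_subspace Nv])
 have "x0 \<in> L" if x0: "x0 \<in> J" for x0
 proof (rule ccontr)
  assume "x0 \<notin> L"
  then obtain f where f: "clinear f" "f x0 = (1 :: complex)" "\<And>x. x \<in> L ==> f x = 0"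
   by (rule separating_functional[OF Lv]) (rule that)
  have fN: "f n = 0" if "n \<in> N" for n
   by (rule f(3)) (use that cv.subspace_0[OF lbs_subspace, of J J] in \<open>auto simp: L_def intro!: bexI[of _ 0]\<close>)
  have flb: "f n = 0" if "n \<in> lbs J J" for n
   by (rule f(3)) (use that cv.subspace_0[OF Nv] in \<open>auto simp: L_def intro!: bexI[of _ n]\<close>)
  define y where "y = (\<Sum>c\<in>O'. f c *\<^sub>C c)"
  have yJ: "y \<in> J" unfolding y_def by (rule OJ)
  have yf: "tr (y * z) = f z" if z: "z \<in> J" for z
  proof -
   define s where "s = (\<Sum>c\<in>O'. tr (z * c) *\<^sub>C c)"
   have "z - s \<in> N"
   proof (rule ideal_radical[OF J(1,3)])
    show "z - s \<in> J" unfolding s_def by (rule cv.subspace_diff[OF Jv z OJ])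
    show "tr ((z - s) * w) = 0" if "w \<in> J" for w unfolding s_def by (rule O(3)) (use z J(3) that in auto)
   qed
   then have "f z = f s" using fN[of "z - s"] by (simp add: clinear_diff[OF f(1)])
   also have "\<dots> = (\<Sum>c\<in>O'. tr (z * c) * f c)" unfolding s_def by (simp add: clinear_sum[OF f(1)] clinear_scC[OF f(1)])
   also have "\<dots> = (\<Sum>c\<in>O'. f c * tr (c * z))"
    by (rule sum.cong) (use tr_comm[of z] z J(3) D_fr in \<open>auto simp: mult.commute\<close>)
   also have "\<dots> = tr (y * z)" unfolding y_def by (simp add: sum_distrib_right tr_sum)
   finally show ?thesis ..
  qed
  define K where "K = {x \<in> J. \<forall>a\<in>J. lb x a \<in> N}"
  have "cv.subspace K" unfolding K_def
   by (rule cv.subspaceI) (auto simp: subspace_rules[OF Jv]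
    subspace_rules[OF Nv])
  moreover have "lb a x \<in> K" if ax: "a \<in> g" "x \<in> K" for a x
  proof -
   have x: "x \<in> J" "\<And>c. c \<in> J ==> lb x c \<in> N" using ax(2) unfolding K_def by auto
   have "lb (lb a x) c \<in> N" if c: "c \<in> J" for c
   proof -
    have "lb (lb a x) c = lb a (lb x c) - lb x (lb a c)" unfolding lb_jacobi[of a x c] by simp
    also have "\<dots> \<in> N" by (rule cv.subspace_diff[OF Nv ideal_inD(3)[OF N_ideal ax(1) x(2)[OF c]] x(2)[OF ideal_inD(3)[OF J(1) ax(1) c]]])
    finally show ?thesis .
   qed
   then show ?thesis unfolding K_def using ideal_inD(3)[OF J(1) ax(1) x(1)] by blast
  qed
  ultimately have "ideal_in K g" unfolding ideal_in_def using ideal_inD(2)[OF J(1)] unfolding K_def by blast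
  then have "K \<subseteq> N" by (rule abelian_mod_N) (use J(3) in \<open>auto simp: K_def\<close>)
  moreover have "lb y a \<in> N" if a: "a \<in> J" for a
  proof (rule ideal_radical[OF J(1,3)])
   show "lb y a \<in> J" by (rule subalg_D(2)[OF sub yJ a])
   fix c assume c: "c \<in> J"
   have "y \<in> fr" "a \<in> fr" "c \<in> fr" using yJ a c J(3) D_fr by blast+
   then have "tr (lb y a * c) = tr (y * lb a c)" by (intro tr_lb_assoc) auto
   also have "\<dots> = 0" using yf[OF subalg_D(2)[OF sub a c]] flb[OF lbs_mem[OF a c]] by simp
   finally show "tr (lb y a * c) = 0" .
  qed
  ultimately have "y \<in> N" unfolding K_def using yJ by blast
  then have "tr (y * x0) = 0" by (rule N_orth) (use x0 J(3) in blast)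
  then show False using yf[OF x0] f(2) by simp
 qed
 then have "\<forall>x\<in>J. \<exists>a\<in>lbs J J. x - a \<in> N" unfolding L_def by blast
 then show ?thesis unfolding good_def using sub J ideal_radical[OF J(1,3)] by blast
qed

text \<open>Since \<open>h\<close> is perfect modulo \<open>N\<close> and commutes with
  \<open>k\<close> modulo \<open>N\<close>, the two are orthogonal; so the radical of the form on
  the sum can be computed in each summand separately.\<close>

lemma good_sum:
 assumes h: "good h" "good k" and hk: "\<And>a b. a \<in> h ==> b \<in> k ==> lb a b \<in> N"
 shows "good {a + b | a b. a \<in> h \<and> b \<in> k}"
proof -
 have hs: "subalg h" "N \<subseteq> h" "h \<subseteq> D" "fcod N h" "\<And>x. x \<in> h ==> (\<And>y. y \<in> h ==> tr (x * y) = 0) ==> x \<in> N"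
  "\<And>x. x \<in> h ==> \<exists>a\<in>lbs h h. x - a \<in> N" using h(1) unfolding good_def by blast+
 have ks: "subalg k" "N \<subseteq> k" "k \<subseteq> D" "fcod N k" "\<And>x. x \<in> k ==> (\<And>y. y \<in> k ==> tr (x * y) = 0) ==> x \<in> N"
  "\<And>x. x \<in> k ==> \<exists>a\<in>lbs k k. x - a \<in> N" using h(2) unfolding good_def by blast+
 note hv = subalg_D(1)[OF hs(1)] and kv = subalg_D(1)[OF ks(1)]
 define s where "s = {a + b | a b. a \<in> h \<and> b \<in> k}"
 have sv: "cv.subspace s" unfolding s_def by (rule cv.subspace_sums[OF hv kv])
 have hS: "h \<subseteq> s" unfolding s_def using cv.subspace_0[OF kv] by force
 have kS: "k \<subseteq> s" unfolding s_def using cv.subspace_0[OF hv] by force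
 have sI: "a + b \<in> s" if "a \<in> h" "b \<in> k" for a b unfolding s_def using that by blast
 have sD: "s \<subseteq> D" unfolding s_def using hs(3) ks(3) cv.subspace_add[OF Dv] by blast
 have hk': "lb b a \<in> N" if "a \<in> h" "b \<in> k" for a b
  using cv.subspace_neg[OF Nv hk[OF that]] by (simp add: lb_swap[of b a])
 have orth: "tr (a * b) = 0" if a: "a \<in> h" and b: "b \<in> k" for a b
 proof -
  obtain c where c: "c \<in> lbs h h" "a - c \<in> N" using hs(6)[OF a] by blast
  have bD: "b \<in> D" using b ks(3) by blast
  have "tr (c * b) = 0" using c(1)
  proof (induction rule: lbs_induct)
   case (lb x y)
   have "x \<in> fr" "y \<in> fr" "b \<in> fr" using lb bD hs(3) D_fr by blast+
   then have "tr (lb x y * b) = tr (x * lb y b)" by (intro tr_lb_assoc) auto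
   also have "\<dots> = 0" by (rule N_orth'[OF hk[OF lb(2) b]]) (use lb(1) hs(3) in blast)
   finally show ?case .
  qed (simp_all add: distrib_right)
  moreover have "tr ((a - c) * b) = 0" by (rule N_orth[OF c(2) bD])
  ultimately show ?thesis by (simp add: left_diff_distrib)
 qed
 have "subalg s" unfolding lie_subalgebra_def
 proof (intro conjI ballI)
  fix x y assume "x \<in> s" "y \<in> s"
  then obtain a b c d where x: "a \<in> h" "b \<in> k" "x = a + b" "c \<in> h" "d \<in> k" "y = c + d" unfolding s_def by blast
  have "lb x y = (lb a c + lb a d) + (lb b c + lb b d)" unfolding x(3,6) by simp
  also have "\<dots> \<in> s"
   by (intro sI cv.subspace_add[OF hv] cv.subspace_add[OF kv] subalg_D(2)[OF hs(1) x(1,4)] subalg_D(2)[OF ks(1) x(2,5)]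
     subsetD[OF hs(2) hk[OF x(1,5)]] subsetD[OF ks(2) hk'[OF x(4,2)]])
  finally show "lb x y \<in> s" .
 qed (rule sv)
 moreover have "N \<subseteq> s" using hs(2) hS by blast
 moreover have "fcod N s"
 proof -
  obtain B where B: "finite B" "B \<subseteq> h" "\<And>x. x \<in> h ==> \<exists>b\<in>cv.span B. x - b \<in> N" using hs(4) unfolding fcod_def by blast
  obtain C where C: "finite C" "C \<subseteq> k" "\<And>x. x \<in> k ==> \<exists>b\<in>cv.span C. x - b \<in> N" using ks(4) unfolding fcod_def by blast
  show ?thesis unfolding fcod_def
  proof (intro exI[of _ "B \<union> C"] conjI ballI)
   show "finite (B \<union> C)" "B \<union> C \<subseteq> s" using B C hS kS by auto
   fix x assume "x \<in> s"
   then obtain a b where x: "a \<in> h" "b \<in> k" "x = a + b" unfolding s_def by blast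
   obtain a' where a': "a' \<in> cv.span B" "a - a' \<in> N" using B(3)[OF x(1)] by blast
   obtain b' where b': "b' \<in> cv.span C" "b - b' \<in> N" using C(3)[OF x(2)] by blast
   have "x - (a' + b') = (a - a') + (b - b')" unfolding x(3) by simp
   also have "\<dots> \<in> N" by (rule cv.subspace_add[OF Nv a'(2) b'(2)])
   finally have "x - (a' + b') \<in> N" .
   moreover have "a' + b' \<in> cv.span (B \<union> C)"
    by (rule cv.span_add[OF subsetD[OF cv.span_mono a'(1)] subsetD[OF cv.span_mono b'(1)]]) auto
   ultimately show "\<exists>b\<in>cv.span (B \<union> C). x - b \<in> N" by blast
  qed
 qed
 moreover have "x \<in> N" if x: "x \<in> s" "\<And>y. y \<in> s ==> tr (x * y) = 0" for x
 proof -
  obtain a b where ab: "a \<in> h" "b \<in> k" "x = a + b" using x(1) unfolding s_def by blast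
  have afr: "a \<in> fr" "b \<in> fr" using ab hs(3) ks(3) D_fr by blast+
  have "a \<in> N"
  proof (rule hs(5)[OF ab(1)])
   fix y assume y: "y \<in> h"
   have "tr (b * y) = 0" using orth[OF y ab(2)] tr_comm[OF afr(2), of y] by simp
   moreover have "tr (x * y) = 0" by (rule x(2)) (use y hS in blast)
   ultimately show "tr (a * y) = 0" unfolding ab(3) by (simp add: distrib_right)
  qed
  moreover have "b \<in> N"
  proof (rule ks(5)[OF ab(2)])
   fix y assume y: "y \<in> k"
   have "tr (x * y) = 0" by (rule x(2)) (use y kS in blast)
   then show "tr (b * y) = 0" using orth[OF ab(1) y] unfolding ab(3) by (simp add: distrib_right)
  qed
  ultimately show ?thesis unfolding ab(3) by (rule cv.subspace_add[OF Nv])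
 qed
 moreover have "\<exists>c\<in>lbs s s. x - c \<in> N" if x: "x \<in> s" for x
 proof -
  obtain a b where ab: "a \<in> h" "b \<in> k" "x = a + b" using x unfolding s_def by blast
  obtain a' where a': "a' \<in> lbs h h" "a - a' \<in> N" using hs(6)[OF ab(1)] by blast
  obtain b' where b': "b' \<in> lbs k k" "b - b' \<in> N" using ks(6)[OF ab(2)] by blast
  have "x - (a' + b') = (a - a') + (b - b')" unfolding ab(3) by simp
  also have "\<dots> \<in> N" by (rule cv.subspace_add[OF Nv a'(2) b'(2)])
  finally have "x - (a' + b') \<in> N" .
  moreover have "a' + b' \<in> lbs s s"
   by (rule cv.subspace_add[OF lbs_subspace subsetD[OF lbs_mono[OF hS hS] a'(1)] subsetD[OF lbs_mono[OF kS kS] b'(1)]])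
  ultimately show ?thesis by blast
 qed
 ultimately show ?thesis unfolding good_def s_def[symmetric] using sD by blast
qed

text \<open>Modulo \<open>N\<close> the ideal \<open>J\<close> acts faithfully on the single module
  given by \<open>p\<close>, so a finite-dimensional subalgebra \<open>u\<close> of its image can be
  pulled back to \<open>h\<close>. The form on \<open>h\<close> is the trace on the whole space, not
  on the module, so nondegeneracy has to be transferred.\<close>

lemma good_in_large_ideal:
 assumes p: "irrep p" and J: "ideal_in J g" "N \<subseteq> J" "J \<subseteq> D" "{x \<in> J. Tc p x = 0} \<subseteq> N" "\<not> fcod N J"
  and F: "finite F" "F \<subseteq> D"
 shows "\<exists>h. good h \<and> h \<subseteq> J \<and> (\<forall>f\<in>F. \<exists>j\<in>h. Tc p (f - j) = 0)"
proof -
 note Jv = ideal_inD(1)[OF J(1)]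
 have Jg: "J \<subseteq> g" using J(3) Dg by blast
 have hom: "Tc p (lb x y) = lb (Tc p x) (Tc p y)" if "x \<in> g" "y \<in> g" for x y by (rule irrep_lb[OF p that])
 have diff: "x - y \<in> N" if "x \<in> J" "y \<in> J" "Tc p x = Tc p y" for x y
  using J(4) cv.subspace_diff[OF Jv that(1,2)] that(3) by (auto simp: clinear_diff[OF Tc_linear])
 have fcod_lift: "fcod N A" if A: "cv.subspace A" "A \<subseteq> J" "fd (Tc p ` A)" for A
 proof -
  obtain P where P: "finite P" "P \<subseteq> A" "Tc p ` A \<subseteq> Tc p ` cv.span P" by (rule lift_finite[OF A(1,3) Tc_linear])
  have sp: "cv.span P \<subseteq> A" by (rule cv.span_minimal[OF P(2) A(1)])
  show ?thesis unfolding fcod_def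
  proof (intro exI[of _ P] conjI ballI)
   fix x assume x: "x \<in> A"
   obtain b where b: "b \<in> cv.span P" "Tc p x = Tc p b" using P(3) x by blast
   have "x - b \<in> N" by (rule diff[OF _ _ b(2)]) (use x b(1) sp A(2) in blast)+
   then show "\<exists>b\<in>cv.span P. x - b \<in> N" using b(1) by blast
  qed (use P in auto)
 qed
 interpret I: irr "Tc p ` g" p by (rule irrep_irr[OF p])
 have TD: "Tc p ` D = lbs (Tc p ` g) (Tc p ` g)" unfolding D_def by (rule hom_lbs[OF Tc_linear hom])
 interpret C: irr_ideal "Tc p ` g" p "Tc p ` J"
 proof
  have "lb a b \<in> Tc p ` J" if ab: "a \<in> Tc p ` g" "b \<in> Tc p ` J" for a b
  proof -
   obtain x y where xy: "x \<in> g" "y \<in> J" "a = Tc p x" "b = Tc p y" using ab by blast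
   show ?thesis unfolding xy(3,4) hom[OF xy(1) subsetD[OF Jg xy(2)], symmetric]
    by (rule imageI[OF ideal_inD(3)[OF J(1) xy(1,2)]])
  qed
  then show "ideal_in (Tc p ` J) (Tc p ` g)" unfolding ideal_in_def using subspace_image[OF Jv Tc_linear] Jg by blast
  show "Tc p ` J \<subseteq> lbs (Tc p ` g) (Tc p ` g)" unfolding TD[symmetric] using J(3) by blast
  show "\<not> fd (Tc p ` J)" using fcod_lift[OF Jv subset_refl] J(5) by blast
 qed
 have "finite (Tc p ` F)" "Tc p ` F \<subseteq> lbs (Tc p ` g) (Tc p ` g)" unfolding TD[symmetric] using F by auto
 from C.perfect_nondegenerate_subalgebra[OF this] obtain u where u: "u \<subseteq> Tc p ` J" "subalg u" "fd u"
  "Tc p ` F \<subseteq> u" "trad u \<subseteq> {0}" "u \<subseteq> lbs u u" by blast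
 note uv = subalg_D(1)[OF u(2)]
 define h where "h = {x \<in> J. Tc p x \<in> u}"
 have hJ: "h \<subseteq> J" unfolding h_def by blast
 have Th: "Tc p ` h = u" unfolding h_def using u(1) by blast
 have hv: "cv.subspace h" unfolding h_def
  by (rule cv.subspaceI) (simp_all add: subspace_rules[OF Jv] clinear_rules[OF Tc_linear] subspace_rules[OF uv])
 have hs: "subalg h" unfolding lie_subalgebra_def
 proof (intro conjI ballI)
  fix x y assume xy: "x \<in> h" "y \<in> h"
  have xg: "x \<in> g" "y \<in> g" using xy hJ Jg by auto
  have "Tc p (lb x y) \<in> u" unfolding hom[OF xg] by (rule subalg_D(2)[OF u(2)]) (use xy in \<open>auto simp: h_def\<close>)
  moreover have "lb x y \<in> J" by (rule ideal_inD(3)[OF J(1) xg(1)]) (use xy hJ in blast)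
  ultimately show "lb x y \<in> h" unfolding h_def by blast
 qed (rule hv)
 have Nh: "N \<subseteq> h" unfolding h_def using J(2) N_acts_trivially[OF p] cv.subspace_0[OF uv] by auto
 have fdT: "fd (Tc p ` h)" unfolding Th by (rule u(3))
 have "x \<in> N" if x: "x \<in> h" and xo: "\<And>y. y \<in> h ==> tr (x * y) = 0" for x
 proof -
  obtain P where P: "finite P" "P \<subseteq> h" "Tc p ` h \<subseteq> Tc p ` cv.span P" by (rule lift_finite[OF hv fdT Tc_linear])
  have "finite (insert x P)" "insert x P \<subseteq> g" using P x hJ Jg by auto
  from lf[OF this] obtain k0 where k0: "subalg k0" "fd k0" "insert x P \<subseteq> k0" "k0 \<subseteq> g" by blast
  define k where "k = h \<inter> k0"
  have k: "subalg k" "fd k" "insert x P \<subseteq> k" "k \<subseteq> g" "k \<subseteq> h" unfolding k_def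
   using subalg_inter[OF hs k0(1)] fd_subset[OF k0(2), of "h \<inter> k0"] k0(3,4) P(2) x by auto
  have kfr: "k \<subseteq> fr" using k(4) g(2) by blast
  have "cv.span P \<subseteq> k" by (rule cv.span_minimal[OF _ subalg_D(1)[OF k(1)]]) (use k(3) in blast)
  then have Tk: "Tc p ` k = u" using P(3) Th k(5) by blast
  \<comment> \<open>The elements orthogonal to \<open>h\<close>, inside a finite-dimensional
    \<open>k\<close> that maps onto \<open>u\<close>, form a solvable ideal by Cartan's criterion.
    Its image is a solvable ideal of the perfect \<open>u\<close>, hence orthogonal to
    \<open>u\<close> for the form of the module, hence zero.\<close>
  define K where "K = {y \<in> k. \<forall>z\<in>h. tr (y * z) = 0}"
  have Kk: "K \<subseteq> k" unfolding K_def by blast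
  have "ideal_in k k" unfolding ideal_in_def using subalg_D[OF k(1)] by blast
  then have Ki: "ideal_in K k" unfolding K_def by (rule perp_ideal[OF _ kfr]) (use subalg_D(2)[OF hs] k(5) in blast)
  have Ks: "solvable_lie scC lb K"
  proof (rule Cartan_criterion[OF ideal_subalg[OF Ki] fd_subset[OF k(2) Kk]])
   show "K \<subseteq> fr" using Kk kfr by blast
   show "tr (a * b) = 0" if "a \<in> K" "b \<in> K" for a b using that k(5) unfolding K_def by blast
  qed
  have homk: "Tc p (lb a b) = lb (Tc p a) (Tc p b)" if "a \<in> k" "b \<in> k" for a b by (rule hom) (use that k(4) in blast)+
  have "ideal_in (Tc p ` K) u" unfolding ideal_in_def
  proof (intro conjI ballI)
   show "cv.subspace (Tc p ` K)" by (rule subspace_image[OF ideal_inD(1)[OF Ki] Tc_linear])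
   show "Tc p ` K \<subseteq> u" unfolding Tk[symmetric] using Kk by blast
   fix a b assume "a \<in> u" "b \<in> Tc p ` K"
   then obtain c d where cd: "c \<in> k" "d \<in> K" "a = Tc p c" "b = Tc p d" unfolding Tk[symmetric] by blast
   show "lb a b \<in> Tc p ` K" unfolding cd(3,4) homk[OF cd(1) subsetD[OF Kk cd(2)], symmetric]
    by (rule imageI[OF ideal_inD(3)[OF Ki cd(1,2)]])
  qed
  moreover have "solvable_lie scC lb (Tc p ` K)" by (rule hom_solvable[OF ideal_subalg[OF Ki] Ks Tc_linear homk]) (use Kk in blast)+
  moreover have ufr: "u \<subseteq> fr" using u(1) Jg I.g(2) by blast
  moreover have xK: "x \<in> K" unfolding K_def using k(3) xo by blast
  ultimately have "tr (Tc p x * y) = 0" if "y \<in> u" for y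
   using solvable_ideal_trace[OF u(2,3), of "Tc p ` K" "Tc p x" y] that u(6) by blast
  moreover have Txu: "Tc p x \<in> u" using x unfolding h_def by blast
  ultimately have "Tc p x \<in> trad u" unfolding trad_def by blast
  then have "Tc p x = 0" using u(5) by blast
  then show ?thesis using J(4) x hJ by blast
 qed
 moreover have "\<exists>a\<in>lbs h h. x - a \<in> N" if x: "x \<in> h" for x
 proof -
  have "Tc p ` lbs h h = lbs u u" unfolding Th[symmetric] by (rule hom_lbs[OF Tc_linear hom]) (use hJ Jg in blast)+
  moreover have "Tc p x \<in> lbs u u" using x u(6) unfolding h_def by blast
  ultimately obtain a where a: "a \<in> lbs h h" "Tc p x = Tc p a" by (metis imageE)
  have "x - a \<in> N" by (rule diff[OF _ _ a(2)]) (use x a(1) lbs_subalg[OF hs] hJ in blast)+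
  then show ?thesis using a(1) by blast
 qed
 moreover have "fcod N h" by (rule fcod_lift[OF hv hJ fdT])
 moreover have "h \<subseteq> D" using hJ J(3) by blast
 ultimately have "good h" unfolding good_def using hs Nh by blast
 moreover have "\<exists>j\<in>h. Tc p (f - j) = 0" if f: "f \<in> F" for f
 proof -
  have "Tc p f \<in> Tc p ` h" unfolding Th using u(4) f by blast
  then obtain j where j: "j \<in> h" "Tc p f = Tc p j" by blast
  have "Tc p (f - j) = 0" unfolding clinear_diff[OF Tc_linear] j(2) by simp
  then show ?thesis using j(1) by blast
 qed
 ultimately show ?thesis using hJ by blast
qed

text \<open>\<open>J\<close> is the part of \<open>I\<close> that only \<open>p\<close> sees. If it
  is finite-dimensional modulo \<open>N\<close>, it is good itself and is split off by orthogonal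
  projection. If not, \<open>good_in_large_ideal\<close> gives enough of it to change the elements
  of \<open>F\<close> into elements that \<open>p\<close> does not see. Either way the remainder
  lies in an ideal \<open>K\<close> that commutes with \<open>J\<close> modulo \<open>N\<close> and
  is controlled by \<open>S\<close> alone.\<close>

lemma good_in_ideal:
 assumes "finite S" "\<forall>p\<in>S. irrep p" "ideal_in I g" "N \<subseteq> I" "I \<subseteq> D" "{x \<in> I. \<forall>p\<in>S. Tc p x = 0} \<subseteq> N" "finite F" "F \<subseteq> I"
 shows "\<exists>h. good h \<and> h \<subseteq> I \<and> F \<subseteq> h"
 using assms
proof (induction S arbitrary: I F rule: finite_induct)
 case empty
 then have "I = N" by blast
 have "fcod N N" by (rule fcod_refl[OF Nv])
 then have "good N" by (rule good_ideal[OF N_ideal subset_refl ND])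
 then show ?case using empty.prems(7) unfolding \<open>I = N\<close> by (intro exI[of _ N]) simp
next
 case (insert p S)
 have p: "irrep p" and S: "\<forall>q\<in>S. irrep q" using insert.prems(1) by auto
 note I = insert.prems(2,3,4)
 note Iv = ideal_inD(1)[OF I(1)]
 define J where "J = {x \<in> I. \<forall>q\<in>S. Tc q x = 0}"
 have Ji: "ideal_in J g" unfolding J_def by (rule ker_ideal[OF I(1)]) (use S in blast)
 have JI: "J \<subseteq> I" unfolding J_def by blast
 have NJ: "N \<subseteq> J" unfolding J_def using I(2) N_acts_trivially S by blast
 have JD: "J \<subseteq> D" using JI I(3) by blast
 have Jp: "{x \<in> J. Tc p x = 0} \<subseteq> N" unfolding J_def using insert.prems(5) by blast
 have FD: "F \<subseteq> D" using insert.prems(7) I(3) by blast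
 have glue: "\<exists>h. good h \<and> h \<subseteq> I \<and> F \<subseteq> h"
  if h1: "good h1" "h1 \<subseteq> J" and j: "\<And>f. f \<in> F ==> j f \<in> h1 \<and> f - j f \<in> K" and K: "ideal_in K g" "N \<subseteq> K" "K \<subseteq> I"
   and KS: "{x \<in> K. \<forall>q\<in>S. Tc q x = 0} \<subseteq> N" and JK: "\<And>a b. a \<in> J ==> b \<in> K ==> lb a b \<in> N" for h1 j K
 proof -
  have "finite ((\<lambda>f. f - j f) ` F)" "(\<lambda>f. f - j f) ` F \<subseteq> K" "K \<subseteq> D" using insert.prems(6) j K(3) I(3) by auto
  from insert.IH[OF S K(1,2) this(3) KS this(1,2)] obtain h2 where h2: "good h2" "h2 \<subseteq> K" "(\<lambda>f. f - j f) ` F \<subseteq> h2" by blast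
  have "good {a + b | a b. a \<in> h1 \<and> b \<in> h2}" by (rule good_sum[OF h1(1) h2(1) JK]) (use h1(2) h2(2) in blast)+
  moreover have "{a + b | a b. a \<in> h1 \<and> b \<in> h2} \<subseteq> I"
  proof
   fix x assume "x \<in> {a + b | a b. a \<in> h1 \<and> b \<in> h2}"
   then obtain a b where "a \<in> h1" "b \<in> h2" "x = a + b" by blast
   then show "x \<in> I" using cv.subspace_add[OF Iv, of a b] h1(2) JI h2(2) K(3) by blast
  qed
  moreover have "F \<subseteq> {a + b | a b. a \<in> h1 \<and> b \<in> h2}"
  proof
   fix f assume f: "f \<in> F"
   have "f = j f + (f - j f)" "j f \<in> h1" "f - j f \<in> h2" using j[OF f] h2(3) f by auto
   then show "f \<in> {a + b | a b. a \<in> h1 \<and> b \<in> h2}" by blast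
  qed
  ultimately show ?thesis by blast
 qed
 show ?case
 proof (cases "fcod N J")
  case True
  obtain O' where O: "finite O'" "O' \<subseteq> J" "\<And>x y. x \<in> D ==> y \<in> J ==> tr ((x - (\<Sum>c\<in>O'. tr (x * c) *\<^sub>C c)) * y) = 0"
   using orthogonal_projection[OF Ji JD True] by blast
  define K where "K = {x \<in> I. \<forall>y\<in>J. tr (x * y) = 0}"
  have KI: "K \<subseteq> I" unfolding K_def by blast
  have Ki: "ideal_in K g" unfolding K_def by (rule perp_ideal[OF I(1) g(2) ideal_inD(3)[OF Ji]])
  have JKN: "x \<in> N" if "x \<in> J" "x \<in> K" for x by (rule ideal_radical[OF Ji JD that(1)]) (use that(2) in \<open>auto simp: K_def\<close>)
  have NK: "N \<subseteq> K" unfolding K_def using I(2) N_orth JD by blast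
  have KS: "{x \<in> K. \<forall>q\<in>S. Tc q x = 0} \<subseteq> N" using JKN KI unfolding J_def by blast
  have sJ: "(\<Sum>c\<in>O'. tr (f * c) *\<^sub>C c) \<in> J" for f
   by (intro cv.subspace_sum[OF ideal_inD(1)[OF Ji]] cv.subspace_scale[OF ideal_inD(1)[OF Ji]]) (use O(2) in blast)
  show ?thesis
  proof (rule glue[OF good_ideal[OF Ji NJ JD True] subset_refl _ Ki NK KI KS])
   fix f assume f: "f \<in> F"
   have "f - (\<Sum>c\<in>O'. tr (f * c) *\<^sub>C c) \<in> I"
    by (rule cv.subspace_diff[OF Iv _ subsetD[OF JI sJ]]) (use f insert.prems(7) in blast)
   then show "(\<Sum>c\<in>O'. tr (f * c) *\<^sub>C c) \<in> J \<and> f - (\<Sum>c\<in>O'. tr (f * c) *\<^sub>C c) \<in> K"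
    unfolding K_def using sJ O(3) f FD by blast
  next
   fix a b assume ab: "a \<in> J" "b \<in> K"
   show "lb a b \<in> N"
    by (rule JKN[OF ideal_inD(4)[OF Ji ideal_inD(2)[OF Ki ab(2)] ab(1)] ideal_inD(3)[OF Ki ideal_inD(2)[OF Ji ab(1)] ab(2)]])
  qed
 next
  case False
  obtain h1 where h1: "good h1" "h1 \<subseteq> J" "\<And>f. f \<in> F ==> \<exists>j\<in>h1. Tc p (f - j) = 0"
   using good_in_large_ideal[OF p Ji NJ JD Jp False insert.prems(6) FD] by blast
  obtain j where j: "\<And>f. f \<in> F ==> j f \<in> h1 \<and> Tc p (f - j f) = 0" using h1(3) by metis
  define K where "K = {x \<in> I. \<forall>q\<in>{p}. Tc q x = 0}"
  have Ki: "ideal_in K g" unfolding K_def by (rule ker_ideal[OF I(1)]) (use p in simp)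
  have KI: "K \<subseteq> I" unfolding K_def by blast
  have NK: "N \<subseteq> K" unfolding K_def using I(2) N_acts_trivially[OF p] by blast
  have KS: "{x \<in> K. \<forall>q\<in>S. Tc q x = 0} \<subseteq> N" using insert.prems(5) unfolding K_def by blast
  show ?thesis
  proof (rule glue[OF h1(1,2) _ Ki NK KI KS])
   fix f assume f: "f \<in> F"
   have "f - j f \<in> I" by (rule cv.subspace_diff[OF Iv]) (use f j[OF f] insert.prems(7) h1(2) JI in blast)+
   then show "j f \<in> h1 \<and> f - j f \<in> K" unfolding K_def using j[OF f] by blast
  next
   fix a b assume ab: "a \<in> J" "b \<in> K"
   have 1: "lb a b \<in> J" by (rule ideal_inD(4)[OF Ji ideal_inD(2)[OF Ki ab(2)] ab(1)])
   have 2: "lb a b \<in> K" by (rule ideal_inD(3)[OF Ki ideal_inD(2)[OF Ji ab(1)] ab(2)])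
   show "lb a b \<in> N" using 1 2 Jp unfolding K_def by blast
  qed
 qed
qed

theorem good_exists:
 assumes "finite F" "F \<subseteq> D" shows "\<exists>h. good h \<and> F \<subseteq> h"
 using finite_irreps[OF assms] good_in_ideal[OF _ _ _ _ _ _ assms(1)] by meson

end

section \<open>The locally solvable radical and its complement\<close>

lemma subalg_chain_union:
 assumes L: "\<And>n :: nat. subalg (L n)" "\<And>n. L n \<subseteq> L (Suc n)" shows "subalg (\<Union>n. L n)"
proof -
 have mono: "L m \<subseteq> L n" if "m \<le> n" for m n by (rule lift_Suc_mono_le[of L, OF L(2) that])
 have two: "\<exists>n. x \<in> L n \<and> y \<in> L n" if xy: "x \<in> (\<Union>n. L n)" "y \<in> (\<Union>n. L n)" for x y
 proof -
  obtain m n where "x \<in> L m" "y \<in> L n" using xy by blast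
  then show ?thesis using mono[of m "max m n"] mono[of n "max m n"] by auto
 qed
 show ?thesis unfolding lie_subalgebra_def
 proof (intro conjI ballI cv.subspaceI)
  show "0 \<in> (\<Union>n. L n)" using cv.subspace_0[OF subalg_D(1)[OF L(1)]] by blast
  fix x y assume xy: "x \<in> (\<Union>n. L n)" "y \<in> (\<Union>n. L n)"
  obtain n where n: "x \<in> L n" "y \<in> L n" using two[OF xy] by blast
  show "x + y \<in> (\<Union>n. L n)" using cv.subspace_add[OF subalg_D(1)[OF L(1)] n] by blast
  show "lb x y \<in> (\<Union>n. L n)" using subalg_D(2)[OF L(1) n] by blast
 next
  fix c x assume "x \<in> (\<Union>n. L n)"
  then obtain n where n: "x \<in> L n" by blast
  show "c *\<^sub>C x \<in> (\<Union>n. L n)" using cv.subspace_scale[OF subalg_D(1)[OF L(1)] n] by blast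
 qed
qed

context fin_lie
begin

definition rad where "rad = {x \<in> g. \<forall>y\<in>g. lb x y \<in> N}"

lemma rad_ideal: "ideal_in rad g"
proof -
 have "cv.subspace rad" unfolding rad_def
  by (rule cv.subspaceI) (auto simp: subspace_rules[OF gv]
   subspace_rules[OF Nv])
 moreover have "lb a x \<in> rad" if ax: "a \<in> g" "x \<in> rad" for a x
 proof -
  have x: "x \<in> g" "\<And>c. c \<in> g ==> lb x c \<in> N" using ax(2) unfolding rad_def by auto
  have "lb (lb a x) c \<in> N" if c: "c \<in> g" for c
  proof -
   have "lb (lb a x) c = lb a (lb x c) - lb x (lb a c)" unfolding lb_jacobi[of a x c] by simp
   also have "\<dots> \<in> N" by (rule cv.subspace_diff[OF Nv ideal_inD(3)[OF N_ideal ax(1) x(2)[OF c]] x(2)[OF subalg_D(2)[OF g(1) ax(1) c]]])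
   finally show ?thesis .
  qed
  then show ?thesis unfolding rad_def using subalg_D(2)[OF g(1) ax(1) x(1)] by blast
 qed
 ultimately show ?thesis unfolding ideal_in_def rad_def by blast
qed

lemma rad_D: "rad \<inter> D = N"
proof
 show "N \<subseteq> rad \<inter> D" unfolding rad_def using ND ideal_inD(2,4)[OF N_ideal] by blast
 have "ideal_in (rad \<inter> D) g"
  unfolding ideal_in_def using cv.subspace_inter[OF ideal_inD(1)[OF rad_ideal] Dv] Dg
   ideal_inD(3)[OF rad_ideal] ideal_inD(3)[OF D_ideal] by blast
 then show "rad \<inter> D \<subseteq> N" by (rule abelian_mod_N) (use Dg in \<open>auto simp: rad_def\<close>)
qed

lemma rad_locally_solvable:
 assumes F: "finite F" "F \<subseteq> rad"
 shows "\<exists>s. subalg s \<and> s \<subseteq> rad \<and> fd s \<and> solvable_lie scC lb s \<and> F \<subseteq> s"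
proof -
 have "F \<subseteq> g" using F(2) unfolding rad_def by blast
 from lf[OF F(1) this] obtain h where h: "subalg h" "fd h" "F \<subseteq> h" "h \<subseteq> g" by blast
 have "solvable_lie scC lb (rad \<inter> h)"
  by (rule abelian_mod_N_solvable[OF rad_ideal _ h(1,2,4)]) (auto simp: rad_def)
 moreover have "fd (rad \<inter> h)" by (rule fd_subset[OF h(2)]) blast
 ultimately show ?thesis using ideal_subalg[OF int_ideal[OF rad_ideal h(1,4)]] F(2) h(3)
  by (intro exI[of _ "rad \<inter> h"]) blast
qed

text \<open>Brackets of \<open>I\<close> with \<open>g\<close> lie in \<open>I \<inter> D\<close>,
  whose finite-dimensional pieces are solvable, so that it is contained in \<open>N\<close>.\<close>

lemma rad_maximal:
 assumes I: "ideal_in I g"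
  and s: "\<And>F. finite F ==> F \<subseteq> I ==> \<exists>s. subalg s \<and> s \<subseteq> I \<and> fd s \<and> solvable_lie scC lb s \<and> F \<subseteq> s"
 shows "I \<subseteq> rad"
proof -
 have K: "ideal_in (I \<inter> D) g"
  unfolding ideal_in_def using cv.subspace_inter[OF ideal_inD(1)[OF I] Dv] Dg
   ideal_inD(3)[OF I] ideal_inD(3)[OF D_ideal] by blast
 have "I \<inter> D \<subseteq> N"
 proof (rule solvable_ideal_N[OF K])
  fix h assume h: "subalg h" "fd h" "h \<subseteq> g"
  have sub: "subalg (I \<inter> D \<inter> h)" by (rule ideal_subalg[OF int_ideal[OF K h(1,3)]])
  have "fd (I \<inter> D \<inter> h)" by (rule fd_subset[OF h(2)]) blast
  then obtain B where B: "finite B" "B \<subseteq> I \<inter> D \<inter> h" "cv.span B = I \<inter> D \<inter> h" using fd_basis[OF subalg_D(1)[OF sub]] by metis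
  obtain k where k: "subalg k" "solvable_lie scC lb k" "B \<subseteq> k" using s[OF B(1)] B(2) by blast
  have "I \<inter> D \<inter> h \<subseteq> k" unfolding B(3)[symmetric] by (rule cv.span_minimal[OF k(3) subalg_D(1)[OF k(1)]])
  then show "solvable_lie scC lb (I \<inter> D \<inter> h)" by (rule solvable_mono[OF k(2) _ sub])
 qed blast
 then show ?thesis unfolding rad_def using ideal_inD(2)[OF I] ideal_inD(4)[OF I] lb_D by blast
qed

definition levi_pair :: "'v endo set => 'v endo set => bool" where
 "levi_pair l h \<longleftrightarrow> good h \<and> subalg l \<and> fd l \<and> l \<subseteq> h \<and> (\<forall>x\<in>h. \<exists>p\<in>N. x + p \<in> l) \<and> N \<inter> l \<subseteq> {0}"

lemma good_trad: assumes "good h" shows "subalg h" "h \<subseteq> fr" "trad h = N" "tperfect h"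
proof -
 show "subalg h" using assms unfolding good_def by blast
 show "h \<subseteq> fr" using assms D_fr unfolding good_def by blast
 show t: "trad h = N"
 proof
  show "trad h \<subseteq> N" using assms unfolding good_def trad_def by blast
  show "N \<subseteq> trad h" using assms N_orth unfolding good_def trad_def by blast
 qed
 show "tperfect h" unfolding tperfect_def t using assms unfolding good_def by blast
qed

text \<open>Levi's theorem needs finite dimension, which \<open>h'\<close> may lack because of
  \<open>N\<close>. It is applied to \<open>H = h' \<inter> k\<close>, which contains
  \<open>l\<close>, supplements \<open>N\<close> in \<open>h'\<close> and has
  \<open>trad H = N \<inter> H\<close>; its Levi subalgebra is then a complement of \<open>N\<close>
  in \<open>h'\<close>.\<close>

lemma levi_pair_extend:
 assumes lh: "levi_pair l h" and d: "d \<in> D"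
 shows "\<exists>l' h'. levi_pair l' h' \<and> l \<subseteq> l' \<and> h \<subseteq> h' \<and> d \<in> h'"
proof -
 have h: "good h" and l: "subalg l" "fd l" "l \<subseteq> h" "\<And>x. x \<in> h ==> \<exists>p\<in>N. x + p \<in> l" "N \<inter> l \<subseteq> {0}"
  using lh unfolding levi_pair_def by blast+
 have hD: "h \<subseteq> D" "fcod N h" using h unfolding good_def by blast+
 obtain B where B: "finite B" "B \<subseteq> h" "\<And>x. x \<in> h ==> \<exists>b\<in>cv.span B. x - b \<in> N" using hD(2) unfolding fcod_def by blast
 \<comment> \<open>Representatives \<open>B\<close> of \<open>h\<close> modulo \<open>N\<close> are
   included so that the new subalgebra contains \<open>h\<close>.\<close>
 have "finite (insert d B)" "insert d B \<subseteq> D" using B d hD by auto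
 from good_exists[OF this] obtain h' where h': "good h'" "insert d B \<subseteq> h'" by blast
 have h'D: "N \<subseteq> h'" "h' \<subseteq> D" "fcod N h'" using h'(1) unfolding good_def by blast+
 note gh' = good_trad[OF h'(1)]
 note h'v = subalg_D(1)[OF gh'(1)]
 have hh': "h \<subseteq> h'"
 proof
  fix x assume "x \<in> h"
  then obtain b where b: "b \<in> cv.span B" "x - b \<in> N" using B(3) by blast
  have "b \<in> h'" using b(1) cv.span_minimal[OF _ h'v, of B] h'(2) by blast
  from cv.subspace_add[OF h'v subsetD[OF h'D(1) b(2)] this] show "x \<in> h'" by simp
 qed
 obtain B' where B': "finite B'" "B' \<subseteq> h'" "\<And>x. x \<in> h' ==> \<exists>b\<in>cv.span B'. x - b \<in> N" using h'D(3) unfolding fcod_def by blast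
 obtain C where C: "finite C" "C \<subseteq> l" "cv.span C = l" using fd_basis[OF subalg_D(1)[OF l(1)] l(2)] by metis
 have "finite (B' \<union> C)" "B' \<union> C \<subseteq> g" using B'(1,2) C(1,2) h'D(2) Dg l(3) hD(1) by blast+
 from lf[OF this] obtain k where k: "subalg k" "fd k" "B' \<union> C \<subseteq> k" "k \<subseteq> g" by blast
 define H where "H = h' \<inter> k"
 have H: "subalg H" "fd H" "H \<subseteq> h'" unfolding H_def by (rule subalg_inter[OF gh'(1) k(1)], rule fd_subset[OF k(2)], blast, blast)
 have Hfr: "H \<subseteq> fr" using H(3) gh'(2) by blast
 have "cv.span C \<subseteq> k" by (rule cv.span_minimal[OF _ subalg_D(1)[OF k(1)]]) (use k(3) in blast)
 then have lH: "l \<subseteq> H" unfolding H_def using C(3) l(3) hh' by blast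
 have B'H: "cv.span B' \<subseteq> H" by (rule cv.span_minimal[OF _ subalg_D(1)[OF H(1)]]) (use B'(2) k(3) in \<open>auto simp: H_def\<close>)
 have sup: "\<exists>p\<in>trad h'. x + p \<in> H" if x: "x \<in> h'" for x
 proof -
  obtain b where b: "b \<in> cv.span B'" "x - b \<in> N" using B'(3)[OF x] by blast
  have "- (x - b) \<in> N" by (rule cv.subspace_neg[OF Nv b(2)])
  moreover have "x + - (x - b) \<in> H" using b(1) B'H by auto
  ultimately show ?thesis unfolding gh'(3) by blast
 qed
 have tH: "trad H = N \<inter> H" using supplement_trad[OF gh'(1,2) H(1,3) sup] unfolding gh'(3) .
 have pH: "tperfect H" by (rule supplement_tperfect[OF gh'(1,2,4) H(1,3) sup])
 note gh = good_trad[OF h]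
 have lsup: "\<exists>p\<in>trad h. x + p \<in> l" if "x \<in> h" for x unfolding gh(3) by (rule l(4)[OF that])
 have tl: "trad l \<subseteq> {0}" using supplement_trad[OF gh(1,2) l(1,3) lsup] l(5) unfolding gh(3) by blast
 have pl: "tperfect l" by (rule supplement_tperfect[OF gh(1,2,4) l(1,3) lsup])
 obtain l' where l': "subalg l'" "l' \<subseteq> H" "l \<subseteq> l'" "\<forall>x\<in>H. \<exists>p\<in>trad H. x + p \<in> l'" "trad H \<inter> l' \<subseteq> {0}"
  using levi_finite_dimensional[OF H(1,2) Hfr pH l(1) lH pl tl] by (elim exE conjE) (rule that)
 have "levi_pair l' h'" unfolding levi_pair_def
 proof (intro conjI ballI)
  show "fd l'" by (rule fd_subset[OF H(2) l'(2)])
  show "l' \<subseteq> h'" using l'(2) H(3) by blast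
  show "N \<inter> l' \<subseteq> {0}" using l'(2,5) unfolding tH by blast
  fix x assume "x \<in> h'"
  then obtain p where p: "p \<in> N" "x + p \<in> H" using sup unfolding gh'(3) by blast
  obtain q where q: "q \<in> N" "x + p + q \<in> l'" using l'(4) p(2) unfolding tH by blast
  show "\<exists>p\<in>N. x + p \<in> l'" using cv.subspace_add[OF Nv p(1) q(1)] q(2) by (auto simp: add.assoc)
 qed (fact h'(1) l'(1))+
 then show ?thesis using l'(3) hh' h'(2) by blast
qed

text \<open>Countable dimension enters through the sequence \<open>d\<close>: it lets an increasing
  sequence of pairs, started at \<open>({0}, N)\<close>, exhaust \<open>D\<close>.\<close>

theorem levi_complement:
 fixes d :: "nat => 'v endo"
 assumes d: "range d \<subseteq> D" "D \<subseteq> cv.span (range d)"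
 shows "\<exists>l. subalg l \<and> l \<subseteq> D \<and> (\<forall>x\<in>D. \<exists>p\<in>N. x + p \<in> l) \<and> N \<inter> l \<subseteq> {0}"
proof -
 have s0: "subalg {0}" unfolding lie_subalgebra_def using cv.subspace_single_0 by simp
 have "good N" by (rule good_ideal[OF N_ideal subset_refl ND fcod_refl[OF Nv]])
 moreover have "\<exists>p\<in>N. x + p \<in> {0}" if "x \<in> N" for x using cv.subspace_neg[OF Nv that] by (intro bexI[of _ "- x"]) auto
 ultimately have "levi_pair {0} N"
  unfolding levi_pair_def using s0 fd_finite[of "{0}"] cv.subspace_0[OF Nv] by simp
 then have base: "\<exists>x. levi_pair (fst x) (snd x)" by (intro exI[of _ "({0}, N)"]) simp
 have "\<exists>f. \<forall>n. levi_pair (fst (f n)) (snd (f n)) \<and>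
  (fst (f n) \<subseteq> fst (f (Suc n)) \<and> snd (f n) \<subseteq> snd (f (Suc n)) \<and> d n \<in> snd (f (Suc n)))"
 proof (rule dependent_nat_choice[OF base])
  fix x n assume x: "levi_pair (fst x) (snd x)"
  have "d n \<in> D" using d(1) by blast
  from levi_pair_extend[OF x this] obtain l' h' where "levi_pair l' h'" "fst x \<subseteq> l'" "snd x \<subseteq> h'" "d n \<in> h'"
   by (elim exE conjE) (rule that)
  then show "\<exists>y. levi_pair (fst y) (snd y) \<and> (fst x \<subseteq> fst y \<and> snd x \<subseteq> snd y \<and> d n \<in> snd y)"
   by (intro exI[of _ "(l', h')"]) simp
 qed
 then obtain f where f: "\<And>n. levi_pair (fst (f n)) (snd (f n))" "\<And>n. fst (f n) \<subseteq> fst (f (Suc n))"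
  "\<And>n. snd (f n) \<subseteq> snd (f (Suc n))" "\<And>n. d n \<in> snd (f (Suc n))" by blast
 define L H where "L n = fst (f n)" and "H n = snd (f n)" for n
 have LH: "good (H n)" "subalg (L n)" "L n \<subseteq> H n" "\<forall>x\<in>H n. \<exists>p\<in>N. x + p \<in> L n" "N \<inter> L n \<subseteq> {0}" for n
  using f(1)[of n] unfolding levi_pair_def L_def H_def by blast+
 have l: "subalg (\<Union>n. L n)" by (rule subalg_chain_union[OF LH(2)]) (use f(2) in \<open>simp add: L_def\<close>)
 have h: "subalg (\<Union>n. H n)" by (rule subalg_chain_union[OF good_trad(1)[OF LH(1)]]) (use f(3) in \<open>simp add: H_def\<close>)
 have "range d \<subseteq> (\<Union>n. H n)" using f(4) unfolding H_def by blast
 then have "cv.span (range d) \<subseteq> (\<Union>n. H n)" by (rule cv.span_minimal[OF _ subalg_D(1)[OF h]])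
 then have DH: "D \<subseteq> (\<Union>n. H n)" using d(2) by blast
 have "H n \<subseteq> D" for n using LH(1)[of n] unfolding good_def by blast
 then have "(\<Union>n. L n) \<subseteq> D" using LH(3) by blast
 moreover have "\<exists>p\<in>N. x + p \<in> (\<Union>n. L n)" if xD: "x \<in> D" for x
 proof -
  obtain n where "x \<in> H n" using DH xD by blast
  then show ?thesis using LH(4)[of n] by blast
 qed
 moreover have "N \<inter> (\<Union>n. L n) \<subseteq> {0}" using LH(5) by blast
 ultimately show ?thesis using l by blast
qed

end

section \<open>Transfer to abstract finitary Lie algebras\<close>

text \<open>The type \<open>'g\<close> carries its scalar multiplication as a parameter, whereas the
  theory above lives in the class \<open>cvec\<close>; so every notion is transported along an
  injective homomorphism \<open>R\<close> into operators.\<close>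

locale lie_embedding = V: vector_space sc
 for sc :: "complex => 'g::ab_group_add => 'g" +
 fixes br :: "'g => 'g => 'g" and R :: "'g => 'v::cvec endo"
 assumes lin: "Vector_Spaces.linear sc scC R" and inj: "inj R" and hom: "\<And>x y. R (br x y) = lb (R x) (R y)"
begin

sublocale L: Vector_Spaces.linear sc scC R by (rule lin)

lemma R_subspace: "V.subspace S \<longleftrightarrow> cv.subspace (R ` S)"
proof
 show "V.subspace S ==> cv.subspace (R ` S)" by (rule L.subspace_image)
 assume "cv.subspace (R ` S)"
 then have "V.subspace (R -` (R ` S))" by (rule L.subspace_vimage)
 then show "V.subspace S" unfolding inj_vimage_image_eq[OF inj] .
qed

lemma R_span: "R ` V.span S = cv.span (R ` S)"
 by (rule L.span_image[symmetric])

lemma R_subalgebra: "lie_subalgebra sc br S \<longleftrightarrow> subalg (R ` S)"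
 unfolding lie_subalgebra_def R_subspace by (auto simp: hom[symmetric] inj_image_mem_iff[OF inj])

lemma R_bracket: "R ` bracket_span sc br A B = lbs (R ` A) (R ` B)"
proof -
 have "R ` {br a b | a b. a \<in> A \<and> b \<in> B} = {lb a b | a b. a \<in> R ` A \<and> b \<in> R ` B}"
 proof
  show "R ` {br a b | a b. a \<in> A \<and> b \<in> B} \<subseteq> {lb a b | a b. a \<in> R ` A \<and> b \<in> R ` B}" using hom by blast
  show "{lb a b | a b. a \<in> R ` A \<and> b \<in> R ` B} \<subseteq> R ` {br a b | a b. a \<in> A \<and> b \<in> B}"
  proof
   fix z assume "z \<in> {lb a b | a b. a \<in> R ` A \<and> b \<in> R ` B}"
   then obtain a b where ab: "a \<in> A" "b \<in> B" "z = lb (R a) (R b)" by blast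
   show "z \<in> R ` {br a b | a b. a \<in> A \<and> b \<in> B}" unfolding ab(3) hom[symmetric] using ab(1,2) by blast
  qed
 qed
 then show ?thesis unfolding bracket_span_def R_span by simp
qed

lemma R_derived: "R ` derived_series sc br S n = dser (R ` S) n"
 by (induction n) (simp_all add: R_bracket)

lemma R_zero: "R ` X = {0} \<longleftrightarrow> X = {0}"
proof -
 have "{0} = R ` {0}" by (simp add: L.zero)
 then show ?thesis by (metis inj inj_image_eq_iff)
qed

lemma R_solvable: "solvable_lie sc br S \<longleftrightarrow> solvable_lie scC lb (R ` S)"
 unfolding solvable_lie_def R_derived[symmetric] R_zero ..

lemma R_fin_dim:
 assumes "V.subspace S" shows "fin_dim sc S \<longleftrightarrow> fd (R ` S)"
proof
 assume "fin_dim sc S"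
 then obtain B where B: "finite B" "V.span B = S" unfolding fin_dim_def by blast
 have "R ` S = cv.span (R ` B)" unfolding B(2)[symmetric] by (rule R_span)
 then show "fd (R ` S)" using fd_span[of "R ` B"] B(1) by simp
next
 assume "fd (R ` S)"
 then obtain C where C: "finite C" "C \<subseteq> R ` S" "cv.span C = R ` S"
  using fd_basis assms unfolding R_subspace by metis
 obtain B where B: "finite B" "C = R ` B" using finite_subset_image[OF C(1,2)] by blast
 have "R ` V.span B = R ` S" unfolding R_span B(2)[symmetric] by (rule C(3))
 then show "fin_dim sc S" unfolding fin_dim_def using B(1) inj_image_eq_iff[OF inj] by blast
qed

lemma R_ideal: "lie_ideal sc br I \<longleftrightarrow> ideal_in (R ` I) (range R)"
 unfolding lie_ideal_def ideal_in_def R_subspace by (auto simp: hom[symmetric] inj_image_mem_iff[OF inj])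

lemma R_locally_solvable:
 "locally_solvable sc br A \<longleftrightarrow> (\<forall>F. finite F \<and> F \<subseteq> R ` A -->
  (\<exists>s. subalg s \<and> s \<subseteq> R ` A \<and> fd s \<and> solvable_lie scC lb s \<and> F \<subseteq> s))"
proof
 assume ls: "locally_solvable sc br A"
 show "\<forall>F. finite F \<and> F \<subseteq> R ` A --> (\<exists>s. subalg s \<and> s \<subseteq> R ` A \<and> fd s \<and> solvable_lie scC lb s \<and> F \<subseteq> s)"
 proof (intro allI impI)
  fix F assume "finite F \<and> F \<subseteq> R ` A"
  then obtain F0 where F0: "F0 \<subseteq> A" "finite F0" "F = R ` F0" using finite_subset_image by metis
  then obtain S where S: "lie_subalgebra sc br S" "S \<subseteq> A" "fin_dim sc S" "solvable_lie sc br S" "F0 \<subseteq> S"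
   using ls unfolding locally_solvable_def by blast
  have "V.subspace S" using S(1) unfolding lie_subalgebra_def by blast
  then have "fd (R ` S)" using S(3) R_fin_dim by blast
  then show "\<exists>s. subalg s \<and> s \<subseteq> R ` A \<and> fd s \<and> solvable_lie scC lb s \<and> F \<subseteq> s"
   using S(1,2,4,5) F0(3) unfolding R_subalgebra R_solvable by (intro exI[of _ "R ` S"]) blast
 qed
next
 assume ls: "\<forall>F. finite F \<and> F \<subseteq> R ` A --> (\<exists>s. subalg s \<and> s \<subseteq> R ` A \<and> fd s \<and> solvable_lie scC lb s \<and> F \<subseteq> s)"
 show "locally_solvable sc br A" unfolding locally_solvable_def
 proof (intro allI impI)
  fix F assume F: "finite F \<and> F \<subseteq> A"
  then have "finite (R ` F) \<and> R ` F \<subseteq> R ` A" by blast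
  from ls[rule_format, OF this] obtain s where s: "subalg s" "s \<subseteq> R ` A" "fd s" "solvable_lie scC lb s" "R ` F \<subseteq> s"
   by (elim exE conjE) (rule that)
  obtain S where S: "S \<subseteq> A" "s = R ` S" using s(2) by (auto simp: subset_image_iff)
  have a: "lie_subalgebra sc br S" using s(1) unfolding S(2) R_subalgebra .
  then have "V.subspace S" unfolding lie_subalgebra_def by blast
  then have "fin_dim sc S" using s(3) R_fin_dim unfolding S(2) by blast
  moreover have "F \<subseteq> S" using s(5) unfolding S(2) inj_image_subset_iff[OF inj] .
  ultimately show "\<exists>S. lie_subalgebra sc br S \<and> S \<subseteq> A \<and> fin_dim sc S \<and> solvable_lie sc br S \<and> F \<subseteq> S"
   using a S(1) s(4) unfolding S(2) R_solvable by blast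
 qed
qed

lemma levi_component_exists:
 assumes fr: "range R \<subseteq> fr" and lf: "locally_finite_lie sc br" and cd: "countable_dim sc"
 shows "\<exists>l. levi_component sc br l"
proof -
 interpret G: fin_lie "range R"
 proof
  have "lie_subalgebra sc br UNIV" unfolding lie_subalgebra_def by simp
  then show "subalg (range R)" unfolding R_subalgebra .
  show "range R \<subseteq> fr" by (rule fr)
  show "\<exists>h. subalg h \<and> fd h \<and> P \<subseteq> h \<and> h \<subseteq> range R" if P: "finite P" "P \<subseteq> range R" for P
  proof -
   obtain F where F: "finite F" "P = R ` F" using finite_subset_image[OF P] by blast
   obtain S where S: "lie_subalgebra sc br S" "fin_dim sc S" "F \<subseteq> S" using lf F(1) unfolding locally_finite_lie_def by blast
   have "V.subspace S" using S(1) unfolding lie_subalgebra_def by blast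
   then have "fd (R ` S)" using S(2) R_fin_dim by blast
   then show ?thesis using S(1,3) F(2) unfolding R_subalgebra by (intro exI[of _ "R ` S"]) blast
  qed
 qed
 obtain B where B: "countable B" "V.span B = UNIV" using cd unfolding countable_dim_def by blast
 \<comment> \<open>Inserting 0 makes \<open>C\<close> nonempty, so that \<open>from_nat_into\<close>
   enumerates exactly \<open>C\<close>.\<close>
 define C where "C = insert 0 {lb x y | x y. x \<in> R ` B \<and> y \<in> R ` B}"
 have "{lb x y | x y. x \<in> R ` B \<and> y \<in> R ` B} = (\<lambda>(x, y). lb x y) ` (R ` B \<times> R ` B)" by auto
 then have cC: "countable C" unfolding C_def using B(1) by auto
 have CD: "C \<subseteq> G.D" unfolding C_def using G.lb_D cv.subspace_0[OF G.Dv] by blast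
 have gB: "x \<in> cv.span (R ` B)" if "x \<in> range R" for x using that R_span[of B] unfolding B(2) by blast
 have lbC: "lb x y \<in> cv.span C" if x: "x \<in> cv.span (R ` B)" and y: "y \<in> cv.span (R ` B)" for x y
  using x
 proof (rule cv.span_induct)
  show "cv.subspace {x. lb x y \<in> cv.span C}" by (rule cv.subspaceI) (simp_all add: span_rules)
  fix a assume a: "a \<in> R ` B"
  show "lb a y \<in> cv.span C" using y
  proof (rule cv.span_induct)
   show "cv.subspace {y. lb a y \<in> cv.span C}" by (rule cv.subspaceI) (simp_all add: span_rules)
   show "lb a b \<in> cv.span C" if "b \<in> R ` B" for b by (rule cv.span_base) (use a that in \<open>unfold C_def, blast\<close>)
  qed
 qed
 have "G.D \<subseteq> cv.span C" unfolding G.D_def by (rule lbs_subset[OF cv.subspace_span lbC]) (rule gB, assumption)+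
 moreover have rC: "range (from_nat_into C) = C" by (rule range_from_nat_into[OF _ cC]) (simp add: C_def)
 ultimately have "\<exists>l. subalg l \<and> l \<subseteq> G.D \<and> (\<forall>x\<in>G.D. \<exists>p\<in>G.N. x + p \<in> l) \<and> G.N \<inter> l \<subseteq> {0}"
  using CD by (intro G.levi_complement[of "from_nat_into C"]) (simp_all only: rC)
 then obtain l where l: "subalg l" "l \<subseteq> G.D" "\<And>x. x \<in> G.D ==> \<exists>p\<in>G.N. x + p \<in> l" "G.N \<inter> l \<subseteq> {0}"
  by blast
 define l' r where "l' = R -` l" and "r = R -` G.rad"
 have Rl: "R ` l' = l" unfolding l'_def using l(2) G.Dg by (intro image_vimage_eq[THEN trans]) blast
 have Rr: "R ` r = G.rad" unfolding r_def using ideal_inD(2)[OF G.rad_ideal] by (intro image_vimage_eq[THEN trans]) blast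
 define D where "D = bracket_span sc br UNIV UNIV"
 have RD: "R ` D = G.D" unfolding D_def G.D_def by (rule R_bracket)
 have Dm: "x \<in> D \<longleftrightarrow> R x \<in> G.D" for x unfolding RD[symmetric] inj_image_mem_iff[OF inj] ..
 have lm: "x \<in> l' \<longleftrightarrow> R x \<in> l" and rm: "x \<in> r \<longleftrightarrow> R x \<in> G.rad" for x unfolding l'_def r_def by auto
 have rN: "x \<in> r \<inter> D \<longleftrightarrow> R x \<in> G.N" for x using G.rad_D Dm rm by blast
 have rad: "locally_solvable_radical sc br r" unfolding locally_solvable_radical_def
 proof (intro conjI allI impI)
  show "lie_ideal sc br r" unfolding R_ideal Rr by (rule G.rad_ideal)
  show "locally_solvable sc br r" unfolding R_locally_solvable Rr using G.rad_locally_solvable by blast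
  fix I assume I: "lie_ideal sc br I \<and> locally_solvable sc br I"
  have "R ` I \<subseteq> G.rad" by (rule G.rad_maximal) (use I in \<open>auto simp: R_ideal R_locally_solvable\<close>)
  then show "I \<subseteq> r" using rm by blast
 qed
 have "D = {a + b | a b. a \<in> r \<inter> D \<and> b \<in> l'}"
 proof
  show "D \<subseteq> {a + b | a b. a \<in> r \<inter> D \<and> b \<in> l'}"
  proof
   fix x assume "x \<in> D"
   then obtain p where p: "p \<in> G.N" "R x + p \<in> l" using l(3) Dm by blast
   obtain q where q: "p = R q" using p(1) ideal_inD(2)[OF G.N_ideal] by blast
   have "R (- q) \<in> G.N" using cv.subspace_neg[OF G.Nv p(1)] unfolding q by (simp add: L.neg)
   moreover have "R (x + q) \<in> l" using p(2) unfolding q by (simp add: L.add)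
   moreover have "x = - q + (x + q)" by simp
   ultimately show "x \<in> {a + b | a b. a \<in> r \<inter> D \<and> b \<in> l'}" using rN lm by blast
  qed
  show "{a + b | a b. a \<in> r \<inter> D \<and> b \<in> l'} \<subseteq> D"
  proof
   fix x assume "x \<in> {a + b | a b. a \<in> r \<inter> D \<and> b \<in> l'}"
   then obtain a b where ab: "a \<in> r \<inter> D" "b \<in> l'" "x = a + b" by blast
   have "R a \<in> G.D" "R b \<in> G.D" using ab(1,2) rN lm G.ND l(2) by blast+
   then show "x \<in> D" unfolding Dm ab(3) L.add by (rule cv.subspace_add[OF G.Dv])
  qed
 qed
 moreover have "r \<inter> D \<inter> l' = {0}"
 proof
  show "r \<inter> D \<inter> l' \<subseteq> {0}"
  proof
   fix x assume "x \<in> r \<inter> D \<inter> l'"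
   then have "R x = 0" using rN lm l(4) by blast
   then have "R x = R 0" by (simp add: L.zero)
   then show "x \<in> {0}" using injD[OF inj] by blast
  qed
  show "{0} \<subseteq> r \<inter> D \<inter> l'" using rN lm cv.subspace_0[OF G.Nv] cv.subspace_0[OF subalg_D(1)[OF l(1)]] L.zero by auto
 qed
 moreover have "l' \<subseteq> D" using lm Dm l(2) by blast
 moreover have "lie_subalgebra sc br l'" unfolding R_subalgebra Rl by (rule l(1))
 ultimately have "levi_component sc br l'" unfolding levi_component_def Let_def D_def[symmetric] using rad by blast
 then show ?thesis by blast
qed

end

text \<open>Row-finite matrices act on all sequences, so that the space of finite sequences need not be constructed.\<close>
definition mv :: "(nat => nat => complex) => (nat => complex) => nat => complex" where
 "mv A v i = (\<Sum>j | A i j \<noteq> 0. A i j * v j)"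

definition row_finite :: "(nat => nat => complex) => bool" where
 "row_finite A \<longleftrightarrow> (\<forall>i. finite {j. A i j \<noteq> 0})"

lemma mv_superset: "finite J ==> {j. A i j \<noteq> 0} \<subseteq> J ==> mv A v i = (\<Sum>j\<in>J. A i j * v j)"
 unfolding mv_def by (rule sum.mono_neutral_left) auto

lemma mv_linear: "clinear (mv A)"
 by (rule clinearI; rule ext) (simp_all add: mv_def scC_fun_def distrib_left sum.distrib sum_distrib_left mult.left_commute)

lemma finite_matrix_rows: "finite_matrix A ==> finite {i. \<exists>j. A i j \<noteq> 0}"
proof -
 assume "finite_matrix A"
 then have "finite (fst ` {(i, j). A i j \<noteq> 0})" unfolding finite_matrix_def by simp
 moreover have "{i. \<exists>j. A i j \<noteq> 0} = fst ` {(i, j). A i j \<noteq> 0}" by force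
 ultimately show ?thesis by simp
qed

lemma finite_matrix_row_finite: "finite_matrix A ==> row_finite A"
proof -
 assume "finite_matrix A"
 then have f: "finite (snd ` {(i, j). A i j \<noteq> 0})" unfolding finite_matrix_def by simp
 show ?thesis unfolding row_finite_def
 proof
  fix i
  have "{j. A i j \<noteq> 0} \<subseteq> snd ` {(i, j). A i j \<noteq> 0}" by force
  then show "finite {j. A i j \<noteq> 0}" using f by (rule finite_subset)
 qed
qed

text \<open>Entries may cancel, so the three rows have different supports; all sums are extended to
  one common finite index set.\<close>

lemma mv_combination:
 assumes "row_finite A" "row_finite B"
 shows "mv (\<lambda>i j. a * A i j + b * B i j) v i = a * mv A v i + b * mv B v i"
proof -
 define J where "J = {j. A i j \<noteq> 0} \<union> {j. B i j \<noteq> 0}"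
 have J: "finite J" unfolding J_def using assms unfolding row_finite_def by simp
 have "mv (\<lambda>i j. a * A i j + b * B i j) v i = (\<Sum>j\<in>J. (a * A i j + b * B i j) * v j)"
  by (rule mv_superset[OF J]) (auto simp: J_def)
 also have "\<dots> = a * (\<Sum>j\<in>J. A i j * v j) + b * (\<Sum>j\<in>J. B i j * v j)"
  by (simp add: distrib_right sum.distrib sum_distrib_left mult.assoc)
 also have "(\<Sum>j\<in>J. A i j * v j) = mv A v i" by (rule mv_superset[OF J, symmetric]) (auto simp: J_def)
 also have "(\<Sum>j\<in>J. B i j * v j) = mv B v i" by (rule mv_superset[OF J, symmetric]) (auto simp: J_def)
 finally show ?thesis .
qed

lemma mat_mult_support: "{k. mat_mult A B i k \<noteq> 0} \<subseteq> (\<Union>j\<in>{j. A i j \<noteq> 0}. {k. B j k \<noteq> 0})"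
proof
 fix k assume "k \<in> {k. mat_mult A B i k \<noteq> 0}"
 then have "(\<Sum>j | A i j \<noteq> 0. A i j * B j k) \<noteq> 0" unfolding mat_mult_def by simp
 then obtain j where "A i j \<noteq> 0" "A i j * B j k \<noteq> 0" by (metis (mono_tags, lifting) mem_Collect_eq sum.neutral)
 then show "k \<in> (\<Union>j\<in>{j. A i j \<noteq> 0}. {k. B j k \<noteq> 0})" by auto
qed

lemma mat_mult_finite:
 assumes "row_finite A" "row_finite B" shows "finite (\<Union>j\<in>{j. A i j \<noteq> 0}. {k. B j k \<noteq> 0})"
 using assms unfolding row_finite_def by simp

lemma row_finite_mat_mult: "row_finite A ==> row_finite B ==> row_finite (mat_mult A B)"
 unfolding row_finite_def[of "mat_mult A B"] by (intro allI finite_subset[OF mat_mult_support]) (rule mat_mult_finite)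

lemma mv_mat_mult:
 assumes "row_finite A" "row_finite B" shows "mv (mat_mult A B) v i = mv A (mv B v) i"
proof -
 define K where "K = (\<Union>j\<in>{j. A i j \<noteq> 0}. {k. B j k \<noteq> 0})"
 have K: "finite K" unfolding K_def by (rule mat_mult_finite[OF assms])
 have "mv (mat_mult A B) v i = (\<Sum>k\<in>K. mat_mult A B i k * v k)"
  by (rule mv_superset[OF K]) (unfold K_def, rule mat_mult_support)
 also have "\<dots> = (\<Sum>k\<in>K. \<Sum>j | A i j \<noteq> 0. A i j * (B j k * v k))"
  unfolding mat_mult_def by (simp add: sum_distrib_right mult.assoc)
 also have "\<dots> = (\<Sum>j | A i j \<noteq> 0. \<Sum>k\<in>K. A i j * (B j k * v k))" by (rule sum.swap)
 also have "\<dots> = (\<Sum>j | A i j \<noteq> 0. A i j * mv B v j)"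
 proof (rule sum.cong[OF refl])
  fix j assume "j \<in> {j. A i j \<noteq> 0}"
  then have "{k. B j k \<noteq> 0} \<subseteq> K" unfolding K_def by blast
  from mv_superset[of K B j, OF K this, of v] show "(\<Sum>k\<in>K. A i j * (B j k * v k)) = A i j * mv B v j"
   by (simp add: sum_distrib_left)
 qed
 finally show ?thesis unfolding mv_def[of A] .
qed

definition unit_vector :: "nat => nat => complex" where "unit_vector j k = (if k = j then 1 else 0)"

lemma mv_unit_vector: "row_finite A ==> mv A (unit_vector j) i = A i j"
proof -
 assume "row_finite A"
 then have f: "finite (insert j {j. A i j \<noteq> 0})" unfolding row_finite_def by simp
 have "mv A (unit_vector j) i = (\<Sum>k\<in>insert j {j. A i j \<noteq> 0}. A i k * unit_vector j k)"
  by (rule mv_superset[OF f]) blast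
 also have "\<dots> = (\<Sum>k\<in>insert j {j. A i j \<noteq> 0}. if k = j then A i j else 0)"
  by (rule sum.cong) (auto simp: unit_vector_def)
 also have "\<dots> = A i j" using f by simp
 finally show ?thesis .
qed

text \<open>Only finitely many rows are nonzero, so all values lie in the span of the unit vectors
  for these rows, even though the operator acts on arbitrary sequences.\<close>

lemma mv_finite_rank: "finite_matrix A ==> endo_of (mv A) \<in> fr"
proof -
 assume A: "finite_matrix A"
 define I where "I = {i. \<exists>j. A i j \<noteq> 0}"
 have I: "finite I" unfolding I_def by (rule finite_matrix_rows[OF A])
 have "mv A v = (\<Sum>i\<in>I. mv A v i *\<^sub>C unit_vector i)" for v
 proof
  fix k
  have "(\<Sum>i\<in>I. mv A v i *\<^sub>C unit_vector i) k = (\<Sum>i\<in>I. mv A v i * unit_vector i k)"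
   using I by (induction rule: finite_induct) (simp_all add: scC_fun_def)
  also have "\<dots> = (\<Sum>i\<in>I. if i = k then mv A v k else 0)" by (rule sum.cong) (auto simp: unit_vector_def)
  also have "\<dots> = mv A v k" using I by (auto simp: I_def mv_def)
  finally show "mv A v k = (\<Sum>i\<in>I. mv A v i *\<^sub>C unit_vector i) k" ..
 qed
 moreover have "(\<Sum>i\<in>I. mv A v i *\<^sub>C unit_vector i) \<in> cv.span (unit_vector ` I)" for v
  by (intro cv.span_sum cv.span_scale cv.span_base) blast
 ultimately have "endo_of (mv A) \<cdot> v \<in> cv.span (unit_vector ` I)" for v unfolding app_endo_of[OF mv_linear] by metis
 then show ?thesis by (rule fr_range[OF fd_span[OF finite_imageI[OF I]]])
qed

theorem theorem4p2:
  fixes sc :: "complex \<Rightarrow> 'g::ab_group_add \<Rightarrow> 'g" and br :: "'g \<Rightarrow> 'g \<Rightarrow> 'g"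
  assumes "lie_algebra sc br"
    and "countable_dim sc"
    and "locally_finite_lie sc br"
    and "finitary_lie sc br"
  shows "\<exists>l. levi_component sc br l"
proof -
 interpret V: vector_space sc using assms(1) unfolding lie_algebra_def by blast
 obtain \<rho> :: "'g => nat => nat => complex" where fin: "\<And>x. finite_matrix (\<rho> x)" and inj: "inj \<rho>"
  and lin: "\<And>a x y. \<rho> (sc a x + y) = (\<lambda>i j. a * \<rho> x i j + \<rho> y i j)"
  and hom: "\<And>x y. \<rho> (br x y) = (\<lambda>i j. mat_mult (\<rho> x) (\<rho> y) i j - mat_mult (\<rho> y) (\<rho> x) i j)"
  using assms(4) unfolding finitary_lie_def by blast
 note rf = finite_matrix_row_finite[OF fin]
 define R where "R x = endo_of (mv (\<rho> x))" for x
 have R: "(R x \<cdot> v) i = mv (\<rho> x) v i" for x v i unfolding R_def app_endo_of[OF mv_linear] ..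
 have Rlin: "R (sc a x + y) = a *\<^sub>C R x + R y" for a x y
 proof (rule endo_eqI, rule ext)
  fix v i
  show "(R (sc a x + y) \<cdot> v) i = ((a *\<^sub>C R x + R y) \<cdot> v) i"
   using mv_combination[OF rf[of x] rf[of y], of a 1 v i] unfolding R lin by (simp add: R scC_fun_def)
 qed
 have R0: "R 0 = 0" using Rlin[of 1 0 0] by simp
 interpret lie_embedding sc br R
 proof
  show "R (x + y) = R x + R y" for x y using Rlin[of 1 x y] by simp
  show "R (sc a x) = a *\<^sub>C R x" for a x using Rlin[of a x 0] R0 by simp
  show "inj R"
  proof (rule injI)
   fix x y assume "R x = R y"
   then have "mv (\<rho> x) v i = mv (\<rho> y) v i" for v i unfolding R[symmetric] by simp
   \<comment> \<open>Unit vectors recover the columns, so a row-finite matrix is determined by its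
     operator.\<close>
   from this[of "unit_vector _"] have "\<rho> x = \<rho> y" unfolding mv_unit_vector[OF rf] by (intro ext)
   then show "x = y" by (rule injD[OF inj])
  qed
  show "R (br x y) = lb (R x) (R y)" for x y
  proof (rule endo_eqI, rule ext)
   fix v i
   have RR: "(R x \<cdot> R y \<cdot> v) i = mv (mat_mult (\<rho> x) (\<rho> y)) v i" for x y
    unfolding R mv_mat_mult[OF rf rf] by (simp add: R[abs_def] R_def app_endo_of[OF mv_linear])
   show "(R (br x y) \<cdot> v) i = (lb (R x) (R y) \<cdot> v) i"
    using mv_combination[OF row_finite_mat_mult[OF rf[of x] rf[of y]] row_finite_mat_mult[OF rf[of y] rf[of x]], of 1 "-1" v i]
    unfolding R hom by (simp add: lb_def RR)
  qed
 qed
 have "range R \<subseteq> fr" unfolding R_def using mv_finite_rank[OF fin] by blast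
 then show ?thesis by (rule levi_component_exists[OF _ assms(3,2)])
qed

end
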